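(* Let $$\mathcal X=\{\rho(A)-BC=K,\ \varkappa_j(A)=\mathrm{const}_j\ (j=1,\dots,k-1)\},\qquad K<\min\rho,$$ let $a_0$ be a point with $\varkappa_j(a_0)=\mathrm{const}_j$, and let $\gamma^t,\lambda^\hbar,M$ be as in the context. Assume that the trajectory $\{\gamma^t(a_0)\}$ is not periodic, so that the surface $\mathcal X$ is homeomorphic to the cylinder. Then: (a) In the space $\mathcal L$ of antiholomorphic $2\pi i$-periodic functions with the Hilbert norm $$\|u\|=\Big(\frac1{4\pi\sqrt{\pi\hbar}}\int_{0<\operatorname{Im}z<2\pi}|u(\bar z)|^2e^{-(\bar z+z-\hbar)^2/4\hbar}\,d\bar z\,dz\Big)^{1/2},$$ the irreducible representation of the algebra with generators $\mathbf A,\mathbf B,\mathbf C$ and relations $$[\mathbf C,\mathbf B]=\lambda^\hbar(\mathbf A),\quad\mathbf C\mathbf A=\gamma^\hbar(\mathbf A)\mathbf C,\quad[\mathbf A_\mu,\mathbf A_\nu]=0,\quad\mathbf C=\mathbf B^*,\quad\mathbf A=\mathbf A^*$$ acts by the operators $$\widehat A=\gamma^{\hbar\bar\partial+\hbar}(a_0),\qquad\widehat B=e^{\bar z-\hbar\bar\partial-\hbar/2}M(\widehat A),\qquad\widehat C=\overline M(\widehat A)\,e^{\hbar\bar\partial-\bar z+\hbar/2}.$$ This representation, up to equivalence, does not depend on the choice of the point $a_0$, but is parametrized by the values of the Casimir functions $K,\varkappa_j$ defining $\mathcal X$. (b) The space $\mathcal L$ is identified with the space $\mathcal L(\mathcal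 X)$ of antiholomorphic sections over the symplectic leaf $\mathcal X$ supplied with the complex structure $e^z=Ce^{t(A)}/\overline{M(A)}$ and with the Kähler form $$\omega=i\hbar\,\bar\partial\partial\ln\mathcal K,\qquad\mathcal K(\bar z|z)=\theta(\bar z+z-\hbar,e^{-\hbar}).$$ (c) The reproducing measure on $\mathcal X$ corresponding to this Kähler form is $$dm=\frac12\,\theta\Big(\frac{i\pi}\hbar(\bar z+z-\hbar),\,e^{-\pi^2/\hbar}\Big)\,d\bar z\,dz .$$
   Context: Let $\hbar>0$. On $\mathbb R^{k+2}$ with coordinates $S_1,S_2,A=(A_1,\dots,A_k)$ put $C=\overline B=S_1+iS_2$, so $BC=S_1^2+S_2^2$. Let $\rho,\varkappa_1,\dots,\varkappa_{k-1}$ be real polynomials on $\mathbb R^k$ ($\varkappa_j$ independent), $v=v_\mu\partial/\partial A_\mu$ a polynomial vector field on $\mathbb R^k$ annulling all $\varkappa_j$, with flow $\gamma^t$ ($\frac d{dt}\gamma^t=v(\gamma^t)$, $\gamma^0=\mathrm{id}$) such that $\gamma^t(A)$ is polynomial in $A$ and $t$. Put $\lambda^\hbar(A)=\rho(A)-\rho(\gamma^{-\hbar}(A))$ and $\lambda=v(\rho)$. The Poisson structure on $\mathbb R^{k+2}$ is $\{C,B\}=i\lambda(A)$, $\{C,A_\mu\}=iv_\mu(A)C$, $\{A_\mu,A_\nu\}=0$, and $\mathcal X$ is a symplectic leaf; the axis of revolution of $\mathcal X$ is the trajectory $\{\gamma^t(a_0)\}$, and $t(A)$ denotes the time along trajectories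 of the flow with $t(a_0)=0$. A real polynomial $g(A)$ is taken such that $g(\gamma^t(a_0))=g(a_0)=K$ for all $t$ and $\rho(A)>g(A)$ in a neighborhood of $\mathcal X$, and it is assumed that there is a complex polynomial $M(A)$ with $\rho(A)-g(A)=|M(A)|^2$ (for real $A$); $\overline M$ is the polynomial with complex conjugate coefficients. The theta-function is $\theta(\alpha,q)=\sum_{n\in\mathbb Z}q^{n^2}e^{n\alpha}$, $q<1$. Here $\bar\partial=\partial/\partial\bar z$ and $d\bar z\,dz=|d\bar z\wedge dz|$ (i.e. $2\,dx\,dy$ for $z=x+iy$). $\mathcal L(\mathcal X)$ consists of antiholomorphic sections over $\mathcal X$ with norm $\|u\|=\big(\frac1{2\pi\hbar}\int_{\mathcal X}\frac{|u|^2}{\mathcal K}dm\big)^{1/2}$; the measure $dm$ is the reproducing measure corresponding to $\omega=i\hbar\bar\partial\partial\ln\mathcal K$ when $\mathcal K$ is the reproducing kernel $\sum_j|u_j|^2$ ($\{u_j\}$ an orthonormal basis) of this Hilbert space.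
   Formalization: Independence of a₀ up to equivalence fails as stated (Â has spectrum γ^{nħ}(a₀), n∈ℤ); proved instead: equivalent iff the Casimir values agree and a₀' = γ^{nħ}(a₀) for some n∈ℤ; for other a₀' = γ^s(a₀), equivalent after twisting 𝓛 by monodromy e^{2πis/ħ}. *)

theory Defs
  imports "HOL-Complex_Analysis.Complex_Analysis"
begin

section \<open>The Poisson structure and the leaf\<close>

text \<open>Points of the phase space are triples (S1, S2, A).\<close>

type_synonym 'k pt = "real \<times> real \<times> (real^'k)"

definition coordA :: "'k::finite pt \<Rightarrow> real^'k" where
  "coordA p = snd (snd p)"

definition coordC :: "'k::finite pt \<Rightarrow> complex" where
  "coordC p = Complex (fst p) (fst (snd p))"

definition coordB :: "'k::finite pt \<Rightarrow> complex" where
  "coordB p = cnj (coordC p)"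

text \<open>\<open>vec_apply v f\<close> is the derivative of \<open>f\<close> along the vector field \<open>v\<close>; in particular
  the function \<lambda> of the Poisson structure is \<open>vec_apply v \<rho>\<close>.\<close>

definition vec_apply :: "(real^'k::finite \<Rightarrow> real^'k) \<Rightarrow> (real^'k \<Rightarrow> real) \<Rightarrow> real^'k \<Rightarrow> real" where
  "vec_apply v f A = frechet_derivative f (at A) (v A)"

text \<open>In real coordinates the brackets {C,B} = i\<lambda>, {C,A_\<mu>} = i v_\<mu> C, {A_\<mu>,A_\<nu>} = 0 read
  {S1,S2} = -\<lambda>/2, {S1,A_\<mu>} = -v_\<mu> S2, {S2,A_\<mu>} = v_\<mu> S1 (see the three lemmas below).\<close>

definition poisson ::
  "(real^'k::finite \<Rightarrow> real) \<Rightarrow> (real^'k \<Rightarrow> real^'k) \<Rightarrow>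
   ('k pt \<Rightarrow> 'a::real_normed_field) \<Rightarrow> ('k pt \<Rightarrow> 'a) \<Rightarrow> 'k pt \<Rightarrow> 'a" where
  "poisson \<rho> v F G p =
    (let S1 = fst p; S2 = fst (snd p); A = coordA p;
         dF = frechet_derivative F (at p); dG = frechet_derivative G (at p);
         F1 = dF (1, 0, 0); F2 = dF (0, 1, 0); Fv = dF (0, 0, v A);
         G1 = dG (1, 0, 0); G2 = dG (0, 1, 0); Gv = dG (0, 0, v A)
     in of_real (- vec_apply v \<rho> A / 2) * (F1 * G2 - F2 * G1)
        - of_real S2 * (F1 * Gv - Fv * G1) + of_real S1 * (F2 * Gv - Fv * G2))"

lemma bounded_linear_coordC: "bounded_linear (coordC :: 'k::finite pt \<Rightarrow> complex)"
  unfolding coordC_def Complex_eq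
  by (intro bounded_linear_add bounded_linear_compose[OF bounded_linear_of_real]
      bounded_linear_compose[OF bounded_linear_mult_right]
      bounded_linear_fst bounded_linear_compose[OF bounded_linear_fst bounded_linear_snd])

lemma coordC_derivative:
  "frechet_derivative coordC (at p) = (\<lambda>q. coordC (q :: 'k::finite pt))"
  using frechet_derivative_at[OF bounded_linear_imp_has_derivative[OF bounded_linear_coordC, of "at p"]]
  by simp

lemma coordB_derivative:
  "frechet_derivative coordB (at p) = (\<lambda>q. coordB (q :: 'k::finite pt))"
proof -
  have "bounded_linear (coordB :: 'k pt \<Rightarrow> complex)"
    unfolding coordB_def by (rule bounded_linear_compose[OF bounded_linear_cnj bounded_linear_coordC])
  from frechet_derivative_at[OF bounded_linear_imp_has_derivative[OF this, of "at p"]]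
  show ?thesis by simp
qed

lemma coordA_derivative:
  "frechet_derivative (\<lambda>q. complex_of_real (coordA q $ \<mu>)) (at p) =
   (\<lambda>q. complex_of_real (coordA (q :: 'k::finite pt) $ \<mu>))"
proof -
  have "bounded_linear (\<lambda>q. complex_of_real (coordA (q :: 'k pt) $ \<mu>))"
    unfolding coordA_def
    by (intro bounded_linear_compose[OF bounded_linear_of_real]
        bounded_linear_compose[OF bounded_linear_vec_nth]
        bounded_linear_compose[OF bounded_linear_snd bounded_linear_snd])
  from frechet_derivative_at[OF bounded_linear_imp_has_derivative[OF this, of "at p"]]
  show ?thesis by simp
qed

lemma poisson_C_B: "poisson \<rho> v coordC coordB p = \<i> * of_real (vec_apply v \<rho> (coordA p))"
  by (simp add: poisson_def Let_def coordC_derivative coordB_derivative coordB_def coordC_def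
      complex_eq_iff)

lemma poisson_C_A:
  "poisson \<rho> v coordC (\<lambda>q. complex_of_real (coordA q $ \<mu>)) p =
   \<i> * of_real (v (coordA p) $ \<mu>) * coordC p"
  unfolding poisson_def coordC_derivative coordA_derivative
  by (simp add: Let_def coordC_def coordA_def complex_eq_iff)

lemma poisson_A_A:
  "poisson \<rho> v (\<lambda>q. complex_of_real (coordA q $ \<mu>)) (\<lambda>q. complex_of_real (coordA q $ \<nu>)) p = 0"
  unfolding poisson_def coordA_derivative
  by (simp add: Let_def coordA_def)

definition hamiltonian_field ::
  "(real^'k::finite \<Rightarrow> real) \<Rightarrow> (real^'k \<Rightarrow> real^'k) \<Rightarrow> ('k pt \<Rightarrow> real) \<Rightarrow> 'k pt \<Rightarrow> 'k pt" where
  "hamiltonian_field \<rho> v F p =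
    (poisson \<rho> v F fst p, poisson \<rho> v F (\<lambda>q. fst (snd q)) p,
     (\<chi> \<mu>. poisson \<rho> v F (\<lambda>q. coordA q $ \<mu>) p))"

text \<open>Two points lie on the same symplectic leaf iff they are joined by finitely many segments of
  integral curves of Hamiltonian vector fields. Polynomial Hamiltonians suffice, since the
  fields of the coordinate functions already span all Hamiltonian directions; durations and
  directions of time are absorbed by rescaling the Hamiltonian.\<close>

definition hamiltonian_segment ::
  "(real^'k::finite \<Rightarrow> real) \<Rightarrow> (real^'k \<Rightarrow> real^'k) \<Rightarrow> 'k pt \<Rightarrow> 'k pt \<Rightarrow> bool" where
  "hamiltonian_segment \<rho> v p q \<longleftrightarrow>
    (\<exists>F c. real_polynomial_function F \<and> c 0 = p \<and> c 1 = q \<and>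
      (\<forall>t\<in>{0..1::real}. (c has_vector_derivative hamiltonian_field \<rho> v F (c t)) (at t within {0..1})))"

definition symplectic_leaf ::
  "(real^'k::finite \<Rightarrow> real) \<Rightarrow> (real^'k \<Rightarrow> real^'k) \<Rightarrow> 'k pt set \<Rightarrow> bool" where
  "symplectic_leaf \<rho> v X \<longleftrightarrow> (\<exists>p. X = {q. (hamiltonian_segment \<rho> v)\<^sup>*\<^sup>* p q})"

text \<open>Functional independence: the differentials are linearly independent on a dense set.\<close>

definition functionally_independent ::
  "nat set \<Rightarrow> (nat \<Rightarrow> real^'k::finite \<Rightarrow> real) \<Rightarrow> bool" where
  "functionally_independent J \<kappa> \<longleftrightarrow>
    closure {A. \<forall>w. (\<forall>h. (\<Sum>j\<in>J. w j * frechet_derivative (\<kappa> j) (at A) h) = 0)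
                  \<longrightarrow> (\<forall>j\<in>J. w j = (0::real))} = UNIV"

definition algebra_data ::
  "(real^'k::finite \<Rightarrow> real) \<Rightarrow> (nat \<Rightarrow> real^'k \<Rightarrow> real) \<Rightarrow> (real^'k \<Rightarrow> real^'k) \<Rightarrow>
   (real \<Rightarrow> real^'k \<Rightarrow> real^'k) \<Rightarrow> bool" where
  "algebra_data \<rho> \<kappa> v \<gamma> \<longleftrightarrow>
    real_polynomial_function \<rho> \<and>
    (\<forall>j\<in>{1..<CARD('k)}. real_polynomial_function (\<kappa> j)) \<and>
    functionally_independent {1..<CARD('k)} \<kappa> \<and>
    polynomial_function v \<and>
    (\<forall>j\<in>{1..<CARD('k)}. \<forall>A. vec_apply v (\<kappa> j) A = 0) \<and>
    (\<forall>A t. ((\<lambda>s. \<gamma> s A) has_vector_derivative v (\<gamma> t A)) (at t)) \<and>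
    (\<forall>A. \<gamma> 0 A = A) \<and>
    polynomial_function (\<lambda>(t, A). \<gamma> t A)"

definition leaf_surface ::
  "(real^'k::finite \<Rightarrow> real) \<Rightarrow> (nat \<Rightarrow> real^'k \<Rightarrow> real) \<Rightarrow> real \<Rightarrow> (nat \<Rightarrow> real) \<Rightarrow> 'k pt set" where
  "leaf_surface \<rho> \<kappa> K c =
    {p. of_real (\<rho> (coordA p)) - coordB p * coordC p = of_real K \<and>
        (\<forall>j\<in>{1..<CARD('k)}. \<kappa> j (coordA p) = c j)}"

text \<open>\<open>K < min \<rho>\<close> is the minimum over the level set of the \<open>\<kappa>\<^sub>j\<close>, i.e. along the axis of the
  surface; the axis of revolution is the projection of the surface to the A-space.\<close>

definition leaf_data ::
  "(real^'k::finite \<Rightarrow> real) \<Rightarrow> (nat \<Rightarrow> real^'k \<Rightarrow> real) \<Rightarrow> (real^'k \<Rightarrow> real^'k) \<Rightarrow>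
   (real \<Rightarrow> real^'k \<Rightarrow> real^'k) \<Rightarrow> real \<Rightarrow> (nat \<Rightarrow> real) \<Rightarrow> real^'k \<Rightarrow>
   (real^'k \<Rightarrow> real) \<Rightarrow> (real^'k \<Rightarrow> complex) \<Rightarrow> bool" where
  "leaf_data \<rho> \<kappa> v \<gamma> K c a0 g M \<longleftrightarrow>
    (\<forall>A. (\<forall>j\<in>{1..<CARD('k)}. \<kappa> j A = c j) \<longrightarrow> K < \<rho> A) \<and>
    symplectic_leaf \<rho> v (leaf_surface \<rho> \<kappa> K c) \<and>
    (\<forall>j\<in>{1..<CARD('k)}. \<kappa> j a0 = c j) \<and>
    coordA ` leaf_surface \<rho> \<kappa> K c = range (\<lambda>t. \<gamma> t a0) \<and>
    real_polynomial_function g \<and>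
    (\<forall>t. g (\<gamma> t a0) = K) \<and>
    (\<exists>U. open U \<and> leaf_surface \<rho> \<kappa> K c \<subseteq> U \<and> (\<forall>p\<in>U. g (coordA p) < \<rho> (coordA p))) \<and>
    polynomial_function M \<and>
    (\<forall>A. \<rho> A - g A = (cmod (M A))\<^sup>2)"

definition nonperiodic :: "(real \<Rightarrow> real^'k::finite \<Rightarrow> real^'k) \<Rightarrow> real^'k \<Rightarrow> bool" where
  "nonperiodic \<gamma> a0 \<longleftrightarrow> (\<forall>T>0. \<gamma> T a0 \<noteq> a0)"

definition lambda_h ::
  "real \<Rightarrow> (real^'k::finite \<Rightarrow> real) \<Rightarrow> (real \<Rightarrow> real^'k \<Rightarrow> real^'k) \<Rightarrow> real^'k \<Rightarrow> real" where
  "lambda_h hbar \<rho> \<gamma> A = \<rho> A - \<rho> (\<gamma> (- hbar) A)"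


section \<open>Hilbert spaces of functions and unbounded operators\<close>

type_synonym 'x fn = "'x \<Rightarrow> complex"

definition ip :: "'x measure \<Rightarrow> 'x fn \<Rightarrow> 'x fn \<Rightarrow> complex" where
  "ip \<mu> u v = (\<integral>x. u x * cnj (v x) \<partial>\<mu>)"

definition nrm :: "'x measure \<Rightarrow> 'x fn \<Rightarrow> real" where
  "nrm \<mu> u = sqrt (\<integral>x. (cmod (u x))\<^sup>2 \<partial>\<mu>)"

definition sq_integrable :: "'x measure \<Rightarrow> 'x fn \<Rightarrow> bool" where
  "sq_integrable \<mu> u \<longleftrightarrow> u \<in> borel_measurable \<mu> \<and> integrable \<mu> (\<lambda>x. (cmod (u x))\<^sup>2)"

definition lin_subspace :: "'x fn set \<Rightarrow> bool" where
  "lin_subspace V \<longleftrightarrow> (\<lambda>x. 0) \<in> V \<and> (\<forall>u\<in>V. \<forall>v\<in>V. (\<lambda>x. u x + v x) \<in> V) \<and>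
    (\<forall>a. \<forall>u\<in>V. (\<lambda>x. a * u x) \<in> V)"

definition linear_on :: "'x fn set \<Rightarrow> ('x fn \<Rightarrow> 'y fn) \<Rightarrow> bool" where
  "linear_on V T \<longleftrightarrow> (\<forall>u\<in>V. \<forall>v\<in>V. T (\<lambda>x. u x + v x) = (\<lambda>y. T u y + T v y)) \<and>
    (\<forall>a. \<forall>u\<in>V. T (\<lambda>x. a * u x) = (\<lambda>y. a * T u y))"

definition hilbert :: "'x measure \<Rightarrow> 'x fn set \<Rightarrow> bool" where
  "hilbert \<mu> H \<longleftrightarrow> lin_subspace H \<and> (\<forall>u\<in>H. sq_integrable \<mu> u) \<and>
    (\<forall>u\<in>H. nrm \<mu> u = 0 \<longrightarrow> u = (\<lambda>x. 0)) \<and>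
    (\<forall>s. (\<forall>n. s n \<in> H) \<and>
         (\<forall>e>0. \<exists>N. \<forall>m\<ge>N. \<forall>n\<ge>N. nrm \<mu> (\<lambda>x. s m x - s n x) < e)
       \<longrightarrow> (\<exists>l\<in>H. (\<lambda>n. nrm \<mu> (\<lambda>x. s n x - l x)) \<longlonglongrightarrow> 0))"

definition orthonormal_basis :: "'x measure \<Rightarrow> 'x fn set \<Rightarrow> 'x fn set \<Rightarrow> bool" where
  "orthonormal_basis \<mu> H E \<longleftrightarrow> E \<subseteq> H \<and>
    (\<forall>u\<in>E. \<forall>v\<in>E. ip \<mu> u v = (if u = v then 1 else 0)) \<and>
    (\<forall>f\<in>H. \<forall>e>0. \<exists>F a. finite F \<and> F \<subseteq> E \<and> nrm \<mu> (\<lambda>x. f x - (\<Sum>u\<in>F. a u * u x)) < e)"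

text \<open>An operator is a domain together with a map.\<close>

type_synonym 'x oper = "'x fn set \<times> ('x fn \<Rightarrow> 'x fn)"

definition densely_defined :: "'x measure \<Rightarrow> 'x fn set \<Rightarrow> 'x oper \<Rightarrow> bool" where
  "densely_defined \<mu> H T \<longleftrightarrow> fst T \<subseteq> H \<and> snd T ` fst T \<subseteq> H \<and> lin_subspace (fst T) \<and>
    linear_on (fst T) (snd T) \<and>
    (\<forall>u\<in>H. \<forall>e>0. \<exists>w\<in>fst T. nrm \<mu> (\<lambda>x. u x - w x) < e)"

text \<open>\<open>S = T\<^sup>*\<close> in the sense of unbounded operators, equality of domains included.\<close>

definition is_adjoint :: "'x measure \<Rightarrow> 'x fn set \<Rightarrow> 'x oper \<Rightarrow> 'x oper \<Rightarrow> bool" where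
  "is_adjoint \<mu> H T S \<longleftrightarrow>
    fst S = {v\<in>H. \<exists>w\<in>H. \<forall>u\<in>fst T. ip \<mu> (snd T u) v = ip \<mu> u w} \<and>
    (\<forall>v\<in>fst S. snd S v \<in> H \<and> (\<forall>u\<in>fst T. ip \<mu> (snd T u) v = ip \<mu> u (snd S v)))"

definition is_core :: "'x measure \<Rightarrow> 'x oper \<Rightarrow> 'x fn set \<Rightarrow> bool" where
  "is_core \<mu> T D \<longleftrightarrow> D \<subseteq> fst T \<and>
    (\<forall>u\<in>fst T. \<forall>e>0. \<exists>w\<in>D. nrm \<mu> (\<lambda>x. u x - w x) < e \<and>
        nrm \<mu> (\<lambda>x. snd T u x - snd T w x) < e)"

definition closed_subspace :: "'x measure \<Rightarrow> 'x fn set \<Rightarrow> 'x fn set \<Rightarrow> bool" where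
  "closed_subspace \<mu> H V \<longleftrightarrow> V \<subseteq> H \<and> lin_subspace V \<and>
    (\<forall>u\<in>H. (\<forall>e>0. \<exists>w\<in>V. nrm \<mu> (\<lambda>x. u x - w x) < e) \<longrightarrow> u \<in> V)"

text \<open>\<open>V\<close> reduces \<open>T\<close>: the orthogonal splitting of \<open>H\<close> by \<open>V\<close> splits \<open>T\<close> as well.\<close>

definition reduces :: "'x measure \<Rightarrow> 'x fn set \<Rightarrow> 'x oper \<Rightarrow> 'x fn set \<Rightarrow> bool" where
  "reduces \<mu> H T V \<longleftrightarrow>
    (\<forall>v\<in>V. \<forall>w\<in>H. (\<forall>y\<in>V. ip \<mu> w y = 0) \<and> (\<lambda>x. v x + w x) \<in> fst T \<longrightarrow>
      v \<in> fst T \<and> w \<in> fst T \<and> snd T v \<in> V \<and> (\<forall>y\<in>V. ip \<mu> (snd T w) y = 0))"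


section \<open>Polynomials of operators\<close>

text \<open>Substitution of an operator for the variable of a real polynomial function of one variable.\<close>

definition poly_op1 :: "(real \<Rightarrow> real) \<Rightarrow> ('x fn \<Rightarrow> 'x fn) \<Rightarrow> 'x fn \<Rightarrow> 'x fn" where
  "poly_op1 f T u =
    (let p = (THE p. \<forall>t. poly p t = f t)
     in (\<lambda>x. \<Sum>i\<le>degree p. of_real (coeff p i) * (T ^^ i) u x))"

text \<open>The coefficients, indexed by multi-indices, of a complex polynomial in k real variables.\<close>

definition mpoly_coeffs :: "(real^'k::finite \<Rightarrow> complex) \<Rightarrow> ('k \<Rightarrow> nat) \<Rightarrow> complex" where
  "mpoly_coeffs f = (SOME a. finite {m. a m \<noteq> 0} \<and>
    (\<forall>A. f A = (\<Sum>m | a m \<noteq> 0. a m * (\<Prod>\<mu>\<in>UNIV. of_real (A $ \<mu>) ^ m \<mu>))))"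

text \<open>Ordered product of powers of operators. The operators substituted below commute, so the
  chosen enumeration of the indices is irrelevant.\<close>

definition monomial_op :: "('k::finite \<Rightarrow> 'x fn \<Rightarrow> 'x fn) \<Rightarrow> ('k \<Rightarrow> nat) \<Rightarrow> 'x fn \<Rightarrow> 'x fn" where
  "monomial_op T m =
    foldr (\<lambda>\<mu> S. (T \<mu> ^^ m \<mu>) \<circ> S) (SOME xs. distinct xs \<and> set xs = UNIV) id"

definition poly_op ::
  "(real^'k::finite \<Rightarrow> complex) \<Rightarrow> ('k \<Rightarrow> 'x fn \<Rightarrow> 'x fn) \<Rightarrow> 'x fn \<Rightarrow> 'x fn" where
  "poly_op f T u =
    (\<lambda>x. \<Sum>m | mpoly_coeffs f m \<noteq> 0. mpoly_coeffs f m * monomial_op T m u x)"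


section \<open>Representations of the algebra\<close>

record ('k, 'x) alg_rep =
  rep_measure :: "'x measure"
  rep_space :: "'x fn set"
  rep_A :: "'k \<Rightarrow> 'x oper"
  rep_B :: "'x oper"
  rep_C :: "'x oper"

definition generators :: "('k::finite, 'x) alg_rep \<Rightarrow> 'x oper set" where
  "generators R = range (rep_A R) \<union> {rep_B R, rep_C R}"

text \<open>The adjointness relations hold for the unbounded operators themselves; the permutation
  relations hold on an invariant domain that is a core of every generator.\<close>

definition star_representation ::
  "real \<Rightarrow> (real^'k::finite \<Rightarrow> real) \<Rightarrow> (real \<Rightarrow> real^'k \<Rightarrow> real^'k) \<Rightarrow> ('k, 'x) alg_rep \<Rightarrow> bool" where
  "star_representation hbar \<rho> \<gamma> R \<longleftrightarrow>
    (let \<mu> = rep_measure R; H = rep_space R;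
         A = (\<lambda>i. snd (rep_A R i)); B = snd (rep_B R); C = snd (rep_C R)
     in hilbert \<mu> H \<and>
        (\<forall>T\<in>generators R. densely_defined \<mu> H T) \<and>
        is_adjoint \<mu> H (rep_B R) (rep_C R) \<and>
        (\<forall>i. is_adjoint \<mu> H (rep_A R i) (rep_A R i)) \<and>
        (\<exists>D. lin_subspace D \<and>
          (\<forall>T\<in>generators R. is_core \<mu> T D \<and> snd T ` D \<subseteq> D) \<and>
          (\<forall>u\<in>D.
            (\<lambda>x. C (B u) x - B (C u) x) = poly_op (\<lambda>a. of_real (lambda_h hbar \<rho> \<gamma> a)) A u \<and>
            (\<forall>i. C (A i u) = poly_op (\<lambda>a. of_real (\<gamma> hbar a $ i)) A (C u)) \<and>
            (\<forall>i j. A i (A j u) = A j (A i u)))))"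

definition irreducible_rep :: "('k::finite, 'x) alg_rep \<Rightarrow> bool" where
  "irreducible_rep R \<longleftrightarrow> rep_space R \<noteq> {\<lambda>x. 0} \<and>
    (\<forall>V. closed_subspace (rep_measure R) (rep_space R) V \<and>
         (\<forall>T\<in>generators R. reduces (rep_measure R) (rep_space R) T V)
       \<longrightarrow> V = {\<lambda>x. 0} \<or> V = rep_space R)"

definition intertwines :: "'x fn set \<Rightarrow> ('x fn \<Rightarrow> 'y fn) \<Rightarrow> 'x oper \<Rightarrow> 'y oper \<Rightarrow> bool" where
  "intertwines H U T T' \<longleftrightarrow>
    (\<forall>u\<in>H. (u \<in> fst T \<longleftrightarrow> U u \<in> fst T') \<and> (u \<in> fst T \<longrightarrow> U (snd T u) = snd T' (U u)))"

definition unitary ::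
  "'x measure \<Rightarrow> 'x fn set \<Rightarrow> 'y measure \<Rightarrow> 'y fn set \<Rightarrow> ('x fn \<Rightarrow> 'y fn) \<Rightarrow> bool" where
  "unitary \<mu> H \<mu>' H' U \<longleftrightarrow> linear_on H U \<and> bij_betw U H H' \<and> (\<forall>u\<in>H. nrm \<mu>' (U u) = nrm \<mu> u)"

definition equivalent_reps :: "('k::finite, 'x) alg_rep \<Rightarrow> ('k, 'y) alg_rep \<Rightarrow> bool" where
  "equivalent_reps R R' \<longleftrightarrow>
    (\<exists>U. unitary (rep_measure R) (rep_space R) (rep_measure R') (rep_space R') U \<and>
      (\<forall>i. intertwines (rep_space R) U (rep_A R i) (rep_A R' i)) \<and>
      intertwines (rep_space R) U (rep_B R) (rep_B R') \<and>
      intertwines (rep_space R) U (rep_C R) (rep_C R'))"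


section \<open>Antiholomorphic functions on the covering plane\<close>

text \<open>The value at \<open>z\<close> of an element of the following spaces is what is usually written
  \<open>u(\<close>conjugate of \<open>z)\<close>.\<close>

definition antiholomorphic_on :: "complex fn \<Rightarrow> complex set \<Rightarrow> bool" where
  "antiholomorphic_on u S \<longleftrightarrow> (\<lambda>z. cnj (u z)) holomorphic_on S"

definition wirtinger :: "complex fn \<Rightarrow> complex fn" where
  "wirtinger f z =
    (frechet_derivative f (at z) 1 - \<i> * frechet_derivative f (at z) \<i>) / 2"

definition wirtinger_bar :: "complex fn \<Rightarrow> complex fn" where
  "wirtinger_bar f z =
    (frechet_derivative f (at z) 1 + \<i> * frechet_derivative f (at z) \<i>) / 2"

text \<open>The measure written \<open>|d zbar \<and> dz| = 2 dx dy\<close>, restricted to one period strip.\<close>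

definition strip_measure :: "complex measure" where
  "strip_measure = density lborel (\<lambda>z. 2 * indicator {z. 0 < Im z \<and> Im z < 2 * pi} z)"

definition L_measure :: "real \<Rightarrow> complex measure" where
  "L_measure hbar = density strip_measure
    (\<lambda>z. ennreal (exp (- (2 * Re z - hbar)\<^sup>2 / (4 * hbar)) / (4 * pi * sqrt (pi * hbar))))"

text \<open>For \<open>\<tau> = 1\<close> this is the space of \<open>2\<pi>i\<close>-periodic functions; the spaces with \<open>|\<tau>| = 1\<close> are its
  twists by a flat line bundle over the cylinder.\<close>

definition L_space :: "real \<Rightarrow> complex \<Rightarrow> complex fn set" where
  "L_space hbar \<tau> =
    {u. antiholomorphic_on u UNIV \<and> (\<forall>z. u (z + 2 * of_real pi * \<i>) = \<tau> * u z) \<and>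
        sq_integrable (L_measure hbar) u}"

definition exp_op :: "('x fn \<Rightarrow> 'x fn) \<Rightarrow> 'x fn \<Rightarrow> 'x fn" where
  "exp_op T u = (\<lambda>x. \<Sum>n. (T ^^ n) u x / fact n)"

definition A_hat ::
  "real \<Rightarrow> (real \<Rightarrow> real^'k::finite \<Rightarrow> real^'k) \<Rightarrow> real^'k \<Rightarrow> 'k \<Rightarrow> complex fn \<Rightarrow> complex fn" where
  "A_hat hbar \<gamma> a0 i =
    poly_op1 (\<lambda>t. \<gamma> t a0 $ i) (\<lambda>u z. of_real hbar * wirtinger_bar u z + of_real hbar * u z)"

definition B_hat ::
  "real \<Rightarrow> (real \<Rightarrow> real^'k::finite \<Rightarrow> real^'k) \<Rightarrow> real^'k \<Rightarrow> (real^'k \<Rightarrow> complex) \<Rightarrow>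
   complex fn \<Rightarrow> complex fn" where
  "B_hat hbar \<gamma> a0 M u =
    exp_op (\<lambda>u z. cnj z * u z - of_real hbar * wirtinger_bar u z - of_real hbar / 2 * u z)
      (poly_op M (A_hat hbar \<gamma> a0) u)"

definition C_hat ::
  "real \<Rightarrow> (real \<Rightarrow> real^'k::finite \<Rightarrow> real^'k) \<Rightarrow> real^'k \<Rightarrow> (real^'k \<Rightarrow> complex) \<Rightarrow>
   complex fn \<Rightarrow> complex fn" where
  "C_hat hbar \<gamma> a0 M u =
    poly_op (\<lambda>A. cnj (M A)) (A_hat hbar \<gamma> a0)
      (exp_op (\<lambda>u z. of_real hbar * wirtinger_bar u z - cnj z * u z + of_real hbar / 2 * u z) u)"

definition max_oper :: "'x fn set \<Rightarrow> ('x fn \<Rightarrow> 'x fn) \<Rightarrow> 'x oper" where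
  "max_oper H T = ({u\<in>H. T u \<in> H}, T)"

definition L_rep ::
  "real \<Rightarrow> complex \<Rightarrow> (real \<Rightarrow> real^'k::finite \<Rightarrow> real^'k) \<Rightarrow> real^'k \<Rightarrow> (real^'k \<Rightarrow> complex) \<Rightarrow>
   ('k, complex) alg_rep" where
  "L_rep hbar \<tau> \<gamma> a0 M =
    \<lparr> rep_measure = L_measure hbar,
      rep_space = L_space hbar \<tau>,
      rep_A = (\<lambda>i. max_oper (L_space hbar \<tau>) (A_hat hbar \<gamma> a0 i)),
      rep_B = max_oper (L_space hbar \<tau>) (B_hat hbar \<gamma> a0 M),
      rep_C = max_oper (L_space hbar \<tau>) (C_hat hbar \<gamma> a0 M) \<rparr>"


section \<open>The leaf as a complex curve\<close>

definition leaf_time :: "(real \<Rightarrow> real^'k::finite \<Rightarrow> real^'k) \<Rightarrow> real^'k \<Rightarrow> real^'k \<Rightarrow> real" where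
  "leaf_time \<gamma> a0 A = (THE t. \<gamma> t a0 = A)"

text \<open>The function \<open>e\<^sup>z\<close> on the leaf.\<close>

definition leaf_chart ::
  "(real \<Rightarrow> real^'k::finite \<Rightarrow> real^'k) \<Rightarrow> real^'k \<Rightarrow> (real^'k \<Rightarrow> complex) \<Rightarrow> 'k pt \<Rightarrow> complex" where
  "leaf_chart \<gamma> a0 M p =
    coordC p * of_real (exp (leaf_time \<gamma> a0 (coordA p))) / cnj (M (coordA p))"

text \<open>\<open>w\<close> is a global chart identifying the surface \<open>X\<close> with the open set \<open>W\<close>: a homeomorphism
  whose inverse is a \<open>C\<^sup>1\<close> immersion.\<close>

definition global_chart :: "'k::finite pt set \<Rightarrow> ('k pt \<Rightarrow> complex) \<Rightarrow> complex set \<Rightarrow> bool" where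
  "global_chart X w W \<longleftrightarrow> open W \<and>
    (\<exists>\<psi>. homeomorphism X W w \<psi> \<and>
      (\<forall>\<zeta>\<in>W. \<psi> differentiable (at \<zeta>) \<and> inj (frechet_derivative \<psi> (at \<zeta>))) \<and>
      (\<forall>h. continuous_on W (\<lambda>\<zeta>. frechet_derivative \<psi> (at \<zeta>) h)))"

definition point_of :: "'k::finite pt set \<Rightarrow> ('k pt \<Rightarrow> complex) \<Rightarrow> complex \<Rightarrow> 'k pt" where
  "point_of X w z = inv_into X w (exp z)"

text \<open>The measure on \<open>X\<close> with density \<open>f\<close> with respect to \<open>|d zbar \<and> dz|\<close>, where \<open>w = e\<^sup>z\<close>.\<close>

definition measure_on_leaf ::
  "'k::finite pt set \<Rightarrow> ('k pt \<Rightarrow> complex) \<Rightarrow> (complex \<Rightarrow> real) \<Rightarrow> 'k pt measure" where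
  "measure_on_leaf X w f = distr (density strip_measure (\<lambda>z. ennreal (f z))) borel (point_of X w)"

text \<open>Sections over \<open>X\<close> are represented by functions, the Hermitian metric being the factor
  \<open>1/\<K>\<close> of the norm. The functions are set to 0 outside \<open>X\<close>.\<close>

definition section_measure :: "real \<Rightarrow> ('k::finite pt \<Rightarrow> real) \<Rightarrow> 'k pt measure \<Rightarrow> 'k pt measure" where
  "section_measure hbar \<K> dm = density dm (\<lambda>p. ennreal (1 / (2 * pi * hbar * \<K> p)))"

definition section_space ::
  "real \<Rightarrow> 'k::finite pt set \<Rightarrow> ('k pt \<Rightarrow> complex) \<Rightarrow> ('k pt \<Rightarrow> real) \<Rightarrow> 'k pt measure \<Rightarrow> 'k pt fn set" where
  "section_space hbar X w \<K> dm =
    {u. (\<exists>f. antiholomorphic_on f (w ` X) \<and> (\<forall>p\<in>X. u p = f (w p))) \<and>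
        (\<forall>p. p \<notin> X \<longrightarrow> u p = 0) \<and>
        sq_integrable (section_measure hbar \<K> dm) u}"

text \<open>The 2-form \<open>i \<hbar> (\<partial>bar \<partial> ln \<K>) d zbar \<and> dz\<close> in the coordinate \<open>z\<close>, evaluated on the tangent
  vectors \<open>\<xi>\<close>, \<open>\<eta>\<close> at \<open>z\<close>.\<close>

definition kaehler_potential_form ::
  "real \<Rightarrow> (complex \<Rightarrow> real) \<Rightarrow> complex \<Rightarrow> complex \<Rightarrow> complex \<Rightarrow> complex" where
  "kaehler_potential_form hbar \<K> z \<xi> \<eta> =
    \<i> * of_real hbar * wirtinger_bar (wirtinger (\<lambda>z. of_real (ln (\<K> z)))) z
      * (cnj \<xi> * \<eta> - cnj \<eta> * \<xi>)"

text \<open>A form on the quotient of the plane by \<open>2\<pi>i\<close>: real, invariant under the complex structure,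
  and with positive metric \<open>(\<xi>,\<eta>) \<mapsto> \<omega>(i\<xi>, \<eta>)\<close>. In complex dimension one it is closed for trivial
  reasons. With the factor order \<open>d zbar \<and> dz\<close> above the metric is \<open>\<omega>(i\<xi>, \<eta>)\<close> rather than
  \<open>\<omega>(\<xi>, i\<eta>)\<close>.\<close>

definition kaehler_on_cylinder :: "(complex \<Rightarrow> complex \<Rightarrow> complex \<Rightarrow> complex) \<Rightarrow> bool" where
  "kaehler_on_cylinder \<omega> \<longleftrightarrow>
    (\<forall>z \<xi> \<eta>. \<omega> (z + 2 * of_real pi * \<i>) \<xi> \<eta> = \<omega> z \<xi> \<eta> \<and>
      \<omega> z \<xi> \<eta> \<in> \<real> \<and> \<omega> z \<eta> \<xi> = - \<omega> z \<xi> \<eta> \<and> \<omega> z (\<i> * \<xi>) (\<i> * \<eta>) = \<omega> z \<xi> \<eta> \<and>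
      (\<xi> \<noteq> 0 \<longrightarrow> 0 < Re (\<omega> z (\<i> * \<xi>) \<xi>)))"

definition reproducing_measure ::
  "real \<Rightarrow> 'k::finite pt set \<Rightarrow> ('k pt \<Rightarrow> complex) \<Rightarrow> (complex \<Rightarrow> complex \<Rightarrow> complex \<Rightarrow> complex) \<Rightarrow>
   ('k pt \<Rightarrow> real) \<Rightarrow> 'k pt measure \<Rightarrow> bool" where
  "reproducing_measure hbar X w \<omega> \<K> dm \<longleftrightarrow>
    \<omega> = kaehler_potential_form hbar (\<lambda>z. \<K> (point_of X w z)) \<and>
    (let \<mu> = section_measure hbar \<K> dm; H = section_space hbar X w \<K> dm
     in hilbert \<mu> H \<and> (\<exists>E. orthonormal_basis \<mu> H E) \<and>
        (\<forall>E. orthonormal_basis \<mu> H E \<longrightarrow>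
          (\<forall>p\<in>X. ((\<lambda>u. (cmod (u p))\<^sup>2) has_sum \<K> p) E)))"

definition theta :: "complex \<Rightarrow> real \<Rightarrow> complex" where
  "theta \<alpha> q = (\<Sum>\<^sub>\<infinity>n\<in>(UNIV :: int set). of_real (q powi (n\<^sup>2)) * exp (of_int n * \<alpha>))"

definition theta_kernel :: "real \<Rightarrow> complex \<Rightarrow> complex" where
  "theta_kernel hbar z = theta (cnj z + z - of_real hbar) (exp (- hbar))"

definition theta_density :: "real \<Rightarrow> complex \<Rightarrow> complex" where
  "theta_density hbar z =
    1 / 2 * theta (\<i> * of_real (pi / hbar) * (cnj z + z - of_real hbar)) (exp (- pi\<^sup>2 / hbar))"

end

theory Submission
  imports Defs "HOL-Probability.Probability"
begin

text \<open>The proof consists of reading everything in Fourier coefficients. A quasi-periodic antiholomorphic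
  function is a series \<open>u(z) = \<Sum>\<^sub>n c\<^sub>n exp (\<nu> cnj z)\<close> with \<open>\<nu> = n + \<sigma>\<close>: this is the Laurent
  expansion in \<open>e\<^sup>\<zeta>\<close> (\<open>quasi_periodic_expansion\<close>). Parseval on vertical lines and a Gaussian
  integral in the real direction give \<open>\<parallel>u\<parallel>\<^sup>2 = \<Sum>\<^sub>n |c\<^sub>n|\<^sup>2 exp (\<hbar> (\<nu>\<^sup>2 + \<nu>))\<close>, so the coefficients with respect
  to the normalized exponentials identify the space \<open>L\<close> with the square-summable families over the
  integers (\<open>L_space_model\<close>). Hilbert space arguments are therefore made for an abstract space with
  such coefficients, the locale \<open>l2_model\<close>.

  In these coordinates \<open>\<hbar> \<partial>bar + \<hbar>\<close> multiplies the \<open>n\<close>-th coefficient by \<open>\<hbar> (\<nu> + 1)\<close>, so the operators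
  \<open>A\<close> are diagonal, with joint eigenvalues \<open>\<alpha>\<^sub>n\<close> that follow the trajectory in steps of time \<open>\<hbar>\<close>. The
  exponential in \<open>B\<close> is defined by its power series; it is the Taylor series, at time 1, of an explicit
  one-parameter group (\<open>ladder_exp_sums\<close>), and turns out to be the bilateral shift with all weights 1.
  So \<open>B\<close> and \<open>C\<close> are weighted shifts, in opposite directions, with weights \<open>M(\<alpha>\<^sub>n)\<close> and their
  conjugates. For such operators on their maximal domains finitely supported families are a core, and
  adjoints can be read off (\<open>weighted_shift_core\<close>, \<open>weighted_shift_adjoint\<close>). The relations of the
  algebra then say that the flow over time \<open>\<hbar>\<close> maps \<open>\<alpha>\<^sub>n\<close> to the next \<open>\<alpha>\<close>, and that
  \<open>|M(\<alpha>\<^sub>n)|\<^sup>2 = \<rho>(\<alpha>\<^sub>n) - K\<close>, which holds because \<open>g = K\<close> on the trajectory. A nonperiodic trajectory has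
  pairwise distinct \<open>\<alpha>\<^sub>n\<close>, and \<open>K < \<rho>\<close> makes all weights nonzero; hence a reducing subspace is spanned by
  basis vectors and closed under shifting both ways (\<open>no_reducing_subspace\<close>). Equivalent
  representations share the eigenvalues of \<open>A\<close> and of \<open>C B\<close>, which gives \<open>K\<close> and the position of the
  base point up to multiples of \<open>\<hbar>\<close>; conversely, the weights of two representations with the same
  spectrum differ by phases, and a family of phases intertwines them. Moving the base point by a time
  \<open>s\<close> that is no multiple of \<open>\<hbar>\<close> is compensated by \<open>\<sigma> = - s/\<hbar>\<close>, that is, by a flat twist of \<open>L\<close>.

  On the leaf \<open>|C| = |M(A)|\<close>, so \<open>|w| = e\<^sup>t\<close> and both \<open>t\<close> and \<open>C\<close> can be recovered from \<open>w\<close>. The inverse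
  is smooth, and \<open>w\<close> is continuous because a nonperiodic polynomial trajectory runs to infinity and is
  properly embedded (\<open>w_homeomorphism\<close>). Jacobi's transformation of the theta-function shows that the
  density of \<open>dm\<close> is the Gaussian weight of \<open>L\<close> times \<open>2\<pi>\<hbar>\<K>\<close> (\<open>theta_density_eq\<close>), so composition with
  \<open>z = ln w\<close> is unitary from \<open>L\<close> to the sections over the leaf. Evaluation at a point has the
  coefficients \<open>exp (n cnj z) / \<parallel>e\<^sub>n\<parallel>\<close>, whose squares sum up to \<open>\<K>\<close>; Parseval turns this into the
  reproducing property for every orthonormal basis (\<open>reproducing_sum\<close>). Finally, \<open>\<omega>\<close> is positive since
  \<open>\<K>\<close> is a sum of exponentials in \<open>Re z\<close> with positive coefficients and hence strictly
  logarithmically convex (\<open>theta_log_convex\<close>).\<close>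

section \<open>Square-summable families and polarization\<close>

definition square_summable :: "('i \<Rightarrow> complex) \<Rightarrow> bool" where
  "square_summable x \<longleftrightarrow> (\<lambda>n. (cmod (x n))\<^sup>2) summable_on UNIV"

lemma cmod_add_sq_le: "(cmod (a + b))\<^sup>2 \<le> 2 * (cmod a)\<^sup>2 + 2 * (cmod b)\<^sup>2"
proof -
  have "(cmod (a + b))\<^sup>2 \<le> (cmod a + cmod b)\<^sup>2"
    by (intro power_mono norm_triangle_ineq) auto
  moreover have "0 \<le> (cmod a - cmod b)\<^sup>2" by simp
  ultimately show ?thesis by (simp add: power2_eq_square algebra_simps)
qed

lemma square_summable_add:
  assumes "square_summable x" "square_summable y"
  shows "square_summable (\<lambda>n. x n + y n)"
  unfolding square_summable_def
proof (rule summable_on_comparison_test)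
  show "(\<lambda>n. 2 * (cmod (x n))\<^sup>2 + 2 * (cmod (y n))\<^sup>2) summable_on UNIV"
    using assms unfolding square_summable_def by (intro summable_on_add summable_on_cmult_right)
qed (simp_all add: cmod_add_sq_le)

lemma square_summable_scale:
  assumes "square_summable x"
  shows "square_summable (\<lambda>n. a * x n)"
  using assms unfolding square_summable_def
  by (simp add: norm_mult power_mult_distrib summable_on_cmult_right)

lemma square_summable_finite: "finite {n. x n \<noteq> 0} \<Longrightarrow> square_summable x"
  unfolding square_summable_def
  by (rule finite_nonzero_values_imp_summable_on) simp

lemma polarization:
  fixes a b :: complex
  shows "4 * (a * cnj b) = of_real ((cmod (a + b))\<^sup>2) - of_real ((cmod (a + (-1) * b))\<^sup>2)
     + \<i> * of_real ((cmod (a + \<i> * b))\<^sup>2) - \<i> * of_real ((cmod (a + (-\<i>) * b))\<^sup>2)"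
  by (simp only: complex_norm_square)
     (simp add: complex_eq_iff algebra_simps)

lemma nrm_sq: "(nrm \<mu> u)\<^sup>2 = (\<integral>x. (cmod (u x))\<^sup>2 \<partial>\<mu>)"
  by (simp add: nrm_def)

lemma nrm_nonneg: "0 \<le> nrm \<mu> u"
  by (simp add: nrm_def)

lemma ip_same: "ip \<mu> u u = of_real ((nrm \<mu> u)\<^sup>2)"
  unfolding nrm_sq ip_def by (simp only: complex_norm_square[symmetric] integral_complex_of_real)

lemma ip_swap: "ip \<mu> v u = cnj (ip \<mu> u v)"
  unfolding ip_def by (simp only: Bochner_Integration.integral_cnj[symmetric]) (simp add: mult.commute)

lemma ip_polarization:
  assumes "sq_integrable \<mu> (\<lambda>x. u x + v x)" "sq_integrable \<mu> (\<lambda>x. u x + (-1) * v x)"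
    "sq_integrable \<mu> (\<lambda>x. u x + \<i> * v x)" "sq_integrable \<mu> (\<lambda>x. u x + (-\<i>) * v x)"
  shows "4 * ip \<mu> u v = of_real ((nrm \<mu> (\<lambda>x. u x + v x))\<^sup>2) - of_real ((nrm \<mu> (\<lambda>x. u x + (-1) * v x))\<^sup>2)
     + \<i> * of_real ((nrm \<mu> (\<lambda>x. u x + \<i> * v x))\<^sup>2) - \<i> * of_real ((nrm \<mu> (\<lambda>x. u x + (-\<i>) * v x))\<^sup>2)"
proof -
  have int: "integrable \<mu> (\<lambda>x. complex_of_real ((cmod (u x + a * v x))\<^sup>2))"
    if "sq_integrable \<mu> (\<lambda>x. u x + a * v x)" for a
    using that unfolding sq_integrable_def by (intro integrable_of_real) auto
  note I = int[of 1, unfolded mult_1, OF assms(1)] int[OF assms(2)] int[OF assms(3)] int[OF assms(4)]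
  have "4 * ip \<mu> u v = (\<integral>x. 4 * (u x * cnj (v x)) \<partial>\<mu>)"
    unfolding ip_def by simp
  also have "\<dots> = (\<integral>x. of_real ((cmod (u x + v x))\<^sup>2) - of_real ((cmod (u x + (-1) * v x))\<^sup>2)
     + \<i> * of_real ((cmod (u x + \<i> * v x))\<^sup>2) - \<i> * of_real ((cmod (u x + (-\<i>) * v x))\<^sup>2) \<partial>\<mu>)"
    by (subst polarization) (rule refl)
  also have "\<dots> = of_real (\<integral>x. (cmod (u x + v x))\<^sup>2 \<partial>\<mu>) - of_real (\<integral>x. (cmod (u x + (-1) * v x))\<^sup>2 \<partial>\<mu>)
     + \<i> * of_real (\<integral>x. (cmod (u x + \<i> * v x))\<^sup>2 \<partial>\<mu>) - \<i> * of_real (\<integral>x. (cmod (u x + (-\<i>) * v x))\<^sup>2 \<partial>\<mu>)"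
    using I by (simp only: Bochner_Integration.integral_diff Bochner_Integration.integral_add
        Bochner_Integration.integrable_diff Bochner_Integration.integrable_add
        integrable_mult_right integral_mult_right_zero integral_complex_of_real)
  finally show ?thesis unfolding nrm_sq .
qed

lemma has_sum_diff_complex:
  fixes f g :: "'a \<Rightarrow> complex"
  assumes "(f has_sum a) A" "(g has_sum b) A"
  shows "((\<lambda>x. f x - g x) has_sum (a - b)) A"
  using has_sum_add[OF assms(1) has_sum_cmult_right[OF assms(2), of "-1"]] by simp

lemma small_tail:
  fixes f :: "'i \<Rightarrow> real"
  assumes "f summable_on UNIV" "e > 0"
  shows "\<forall>\<^sub>F F in finite_subsets_at_top UNIV. infsum (\<lambda>n. if n \<in> F then 0 else f n) UNIV < e"
proof -
  have "(sum f \<longlongrightarrow> infsum f UNIV) (finite_subsets_at_top UNIV)"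
    using assms(1) infsum_tendsto by blast
  then have "\<forall>\<^sub>F F in finite_subsets_at_top UNIV. infsum f UNIV - e < sum f F"
    using assms(2) by (intro order_tendstoD) auto
  then show ?thesis
  proof (rule eventually_mp[rotated], intro eventually_finite_subsets_at_top_weakI impI)
    fix F :: "'i set" assume F: "finite F" "infsum f UNIV - e < sum f F"
    have "((\<lambda>n. if n \<in> F then f n else 0) has_sum sum f F) UNIV"
      using F by (intro has_sum_finite_neutralI[of F]) auto
    from has_sum_add[OF has_sum_infsum[OF assms(1)] has_sum_cmult_right[OF this, of "-1"]]
    moreover have "(\<lambda>n. f n + - 1 * (if n \<in> F then f n else 0)) = (\<lambda>n. if n \<in> F then 0 else f n)"
      by auto
    ultimately have "((\<lambda>n. if n \<in> F then 0 else f n) has_sum (infsum f UNIV - sum f F)) UNIV"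
      by simp
    then show "infsum (\<lambda>n. if n \<in> F then 0 else f n) UNIV < e"
      using F(2) by (simp add: infsumI)
  qed
qed

section \<open>Hilbert spaces given by coefficients\<close>

text \<open>The space \<open>H\<close> is a copy of the square-summable families over \<open>'i\<close>. The larger space \<open>P\<close> consists of
  functions whose coefficients need not be square-summable. Unbounded operators are defined on all of
  \<open>P\<close>, which makes square-summability of the image the only condition on a vector of their maximal
  domain.\<close>

locale l2_model =
  fixes \<mu> :: "'x measure" and P H :: "'x fn set" and N :: "'x fn \<Rightarrow> 'i \<Rightarrow> complex"
  assumes P_subspace: "lin_subspace P"
    and H_iff: "u \<in> H \<longleftrightarrow> u \<in> P \<and> square_summable (N u)"
    and N_add: "u \<in> P \<Longrightarrow> v \<in> P \<Longrightarrow> N (\<lambda>x. u x + v x) = (\<lambda>n. N u n + N v n)"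
    and N_scale: "u \<in> P \<Longrightarrow> N (\<lambda>x. a * u x) = (\<lambda>n. a * N u n)"
    and N_inj: "u \<in> P \<Longrightarrow> (\<And>n. N u n = 0) \<Longrightarrow> u = (\<lambda>x. 0)"
    and N_surj: "square_summable x \<Longrightarrow> \<exists>u\<in>P. N u = x"
    and H_sq: "u \<in> H \<Longrightarrow> sq_integrable \<mu> u"
    and parseval: "u \<in> H \<Longrightarrow> ((\<lambda>n. (cmod (N u n))\<^sup>2) has_sum (nrm \<mu> u)\<^sup>2) UNIV"
begin

lemma P_zero: "(\<lambda>x. 0) \<in> P"
  and P_add: "u \<in> P \<Longrightarrow> v \<in> P \<Longrightarrow> (\<lambda>x. u x + v x) \<in> P"
  and P_scale: "u \<in> P \<Longrightarrow> (\<lambda>x. a * u x) \<in> P"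
  using P_subspace unfolding lin_subspace_def by auto

lemma N_zero: "N (\<lambda>x. 0) = (\<lambda>n. 0)"
  using N_scale[OF P_zero, of 0] by simp

lemma P_diff: "u \<in> P \<Longrightarrow> v \<in> P \<Longrightarrow> (\<lambda>x. u x - v x) \<in> P"
  using P_add[OF _ P_scale[of v "-1"], of u] by simp

lemma N_diff: "u \<in> P \<Longrightarrow> v \<in> P \<Longrightarrow> N (\<lambda>x. u x - v x) = (\<lambda>n. N u n - N v n)"
  using N_add[OF _ P_scale[of v "-1"], of u] N_scale[of v "-1"] by simp

lemma P_eqI: "u \<in> P \<Longrightarrow> v \<in> P \<Longrightarrow> (\<And>n. N u n = N v n) \<Longrightarrow> u = v"
  using N_inj[OF P_diff[of u v]] N_diff[of u v] by (auto simp: fun_eq_iff)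

lemma P_sum: "finite F \<Longrightarrow> (\<And>i. i \<in> F \<Longrightarrow> f i \<in> P) \<Longrightarrow> (\<lambda>x. \<Sum>i\<in>F. a i * f i x) \<in> P"
  by (induction F rule: finite_induct) (simp_all add: P_zero P_add P_scale)

lemma N_sum: "finite F \<Longrightarrow> (\<And>i. i \<in> F \<Longrightarrow> f i \<in> P) \<Longrightarrow>
    N (\<lambda>x. \<Sum>i\<in>F. a i * f i x) = (\<lambda>n. \<Sum>i\<in>F. a i * N (f i) n)"
  by (induction F rule: finite_induct) (simp_all add: N_zero N_add N_scale P_scale P_sum)

lemma H_P: "u \<in> H \<Longrightarrow> u \<in> P" and H_l2: "u \<in> H \<Longrightarrow> square_summable (N u)"
  and H_I: "u \<in> P \<Longrightarrow> square_summable (N u) \<Longrightarrow> u \<in> H"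
  by (auto simp: H_iff)

lemma H_zero: "(\<lambda>x. 0) \<in> H"
  by (intro H_I P_zero) (simp add: N_zero square_summable_finite)

lemma H_add: "u \<in> H \<Longrightarrow> v \<in> H \<Longrightarrow> (\<lambda>x. u x + v x) \<in> H"
  by (simp add: H_iff P_add N_add square_summable_add)

lemma H_scale: "u \<in> H \<Longrightarrow> (\<lambda>x. a * u x) \<in> H"
  by (simp add: H_iff P_scale N_scale square_summable_scale)

lemma H_subspace: "lin_subspace H"
  unfolding lin_subspace_def using H_zero H_add H_scale by auto

lemma H_diff: "u \<in> H \<Longrightarrow> v \<in> H \<Longrightarrow> (\<lambda>x. u x - v x) \<in> H"
  using H_add[OF _ H_scale[of v "-1"], of u] by simp

lemma H_sum:
  assumes "finite F" "\<And>i. i \<in> F \<Longrightarrow> f i \<in> H"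
  shows "(\<lambda>x. \<Sum>i\<in>F. a i * f i x) \<in> H"
  using assms
proof (induction F rule: finite_induct)
  case empty
  show ?case using H_zero by simp
next
  case (insert i F)
  have 1: "(\<lambda>x. a i * f i x) \<in> H" by (rule H_scale[OF insert.prems[OF insertI1]])
  have 2: "(\<lambda>x. \<Sum>i\<in>F. a i * f i x) \<in> H" by (rule insert.IH[OF insert.prems[OF insertI2]])
  show ?case using H_add[OF 1 2] unfolding sum.insert[OF insert.hyps] .
qed

lemma N_onto_H: "square_summable x \<Longrightarrow> \<exists>u\<in>H. N u = x"
  using N_surj H_iff by metis

text \<open>The assumption \<open>parseval\<close> is about norms; polarization carries it over to inner products.\<close>

lemma ip_has_sum:
  assumes u: "u \<in> H" and v: "v \<in> H"
  shows "((\<lambda>n. N u n * cnj (N v n)) has_sum ip \<mu> u v) UNIV"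
proof -
  have P: "((\<lambda>n. complex_of_real ((cmod (N u n + a * N v n))\<^sup>2)) has_sum
       complex_of_real ((nrm \<mu> (\<lambda>x. u x + a * v x))\<^sup>2)) UNIV" for a
    using has_sum_of_real[OF parseval[OF H_add[OF u H_scale[OF v, of a]]]]
    unfolding N_add[OF H_P[OF u] P_scale[OF H_P[OF v]]] N_scale[OF H_P[OF v]] .
  have eq: "4 * ip \<mu> u v = of_real ((nrm \<mu> (\<lambda>x. u x + v x))\<^sup>2) - of_real ((nrm \<mu> (\<lambda>x. u x + (-1) * v x))\<^sup>2)
     + \<i> * of_real ((nrm \<mu> (\<lambda>x. u x + \<i> * v x))\<^sup>2) - \<i> * of_real ((nrm \<mu> (\<lambda>x. u x + (-\<i>) * v x))\<^sup>2)"
    by (rule ip_polarization; rule H_sq; rule H_add[OF u]; (rule H_scale)?; rule v)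
  have "((\<lambda>n. 4 * (N u n * cnj (N v n))) has_sum (4 * ip \<mu> u v)) UNIV"
    unfolding polarization eq
    by (intro has_sum_add has_sum_diff_complex has_sum_cmult_right P P[of 1, unfolded mult_1])
  from has_sum_cmult_right[OF this, of "1/4"] show ?thesis by simp
qed

text \<open>Completeness is inherited from the coefficients. They converge one by one along a Cauchy sequence,
  and the bounds on finite partial sums pass to the limit; so the limit family is square-summable and
  its distance from the sequence tends to 0.\<close>

lemma hilbert: "hilbert \<mu> H"
proof -
  have nrm0: "u = (\<lambda>x. 0)" if u: "u \<in> H" and "nrm \<mu> u = 0" for u
  proof (rule N_inj[OF H_P[OF u]])
    fix n
    have "((\<lambda>n. (cmod (N u n))\<^sup>2) has_sum 0) UNIV" using parseval[OF u] that(2) by simp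
    then have "(cmod (N u n))\<^sup>2 = 0"
      using nonneg_has_sum_le_0D[where f = "\<lambda>n. (cmod (N u n))\<^sup>2" and A = UNIV and x = n] by simp
    then show "N u n = 0" by simp
  qed
  have complete: "\<exists>l\<in>H. (\<lambda>n. nrm \<mu> (\<lambda>x. s n x - l x)) \<longlonglongrightarrow> 0"
    if s: "\<And>n. s n \<in> H"
      and cau: "\<forall>e>0. \<exists>K. \<forall>m\<ge>K. \<forall>n\<ge>K. nrm \<mu> (\<lambda>x. s m x - s n x) < e" for s
  proof -
    have bd: "(\<Sum>k\<in>F. (cmod (N (s m) k - N (s n) k))\<^sup>2) \<le> (nrm \<mu> (\<lambda>x. s m x - s n x))\<^sup>2"
      if "finite F" for F m n
      using finite_sum_le_has_sum[OF parseval[OF H_diff[OF s s, of m n]] that]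
      by (simp add: N_diff s H_P)
    have "Cauchy (\<lambda>n. N (s n) k)" for k
    proof (rule metric_CauchyI)
      fix e :: real assume "e > 0"
      then obtain K where K: "\<forall>m\<ge>K. \<forall>n\<ge>K. nrm \<mu> (\<lambda>x. s m x - s n x) < e" using cau by blast
      have "dist (N (s m) k) (N (s n) k) < e" if "m \<ge> K" "n \<ge> K" for m n
      proof -
        have "cmod (N (s m) k - N (s n) k) \<le> nrm \<mu> (\<lambda>x. s m x - s n x)"
          using bd[of "{k}" m n] by (intro power2_le_imp_le[OF _ nrm_nonneg]) simp
        then show ?thesis using K that by (fastforce simp: dist_norm)
      qed
      then show "\<exists>M. \<forall>m\<ge>M. \<forall>n\<ge>M. dist (N (s m) k) (N (s n) k) < e" by blast
    qed
    then have lim: "(\<lambda>n. N (s n) k) \<longlonglongrightarrow> lim (\<lambda>n. N (s n) k)" for k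
      by (simp add: Cauchy_convergent_iff convergent_LIMSEQ_iff)
    define l where "l k = lim (\<lambda>n. N (s n) k)" for k
    note l = lim[folded l_def]
    have fin: "(\<Sum>k\<in>F. (cmod (N (s m) k - l k))\<^sup>2) \<le> e\<^sup>2"
      if "finite F" "\<forall>n\<ge>K. nrm \<mu> (\<lambda>x. s m x - s n x) < e" for F m K e
    proof (rule tendsto_upperbound)
      show "(\<lambda>n. \<Sum>k\<in>F. (cmod (N (s m) k - N (s n) k))\<^sup>2) \<longlonglongrightarrow> (\<Sum>k\<in>F. (cmod (N (s m) k - l k))\<^sup>2)"
        by (intro tendsto_intros l)
      show "\<forall>\<^sub>F n in sequentially. (\<Sum>k\<in>F. (cmod (N (s m) k - N (s n) k))\<^sup>2) \<le> e\<^sup>2"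
        unfolding eventually_sequentially
        using that by (intro exI[of _ K] allI impI order_trans[OF bd] power_mono nrm_nonneg)
            (auto simp: less_imp_le)
    qed simp
    have sum_bd: "square_summable (\<lambda>k. N (s m) k - l k)"
      if "\<forall>n\<ge>K. nrm \<mu> (\<lambda>x. s m x - s n x) < e" for m K e
      unfolding square_summable_def
      by (rule nonneg_bounded_partial_sums_imp_summable_on[where C = "e\<^sup>2"])
         (use fin[OF _ that] in \<open>auto intro!: eventually_finite_subsets_at_top_weakI\<close>)
    obtain K1 where K1: "\<forall>m\<ge>K1. \<forall>n\<ge>K1. nrm \<mu> (\<lambda>x. s m x - s n x) < 1" using cau zero_less_one by blast
    have "square_summable (\<lambda>k. N (s K1) k + (-1) * (N (s K1) k - l k))"
      by (intro square_summable_add square_summable_scale sum_bd[of K1 K1 1] H_l2 s) (use K1 in auto)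
    then have "square_summable l" by simp
    then obtain L where L: "L \<in> H" "N L = l" using N_onto_H by blast
    have "(\<lambda>n. nrm \<mu> (\<lambda>x. s n x - L x)) \<longlonglongrightarrow> 0"
    proof (rule metric_LIMSEQ_I)
      fix e :: real assume e: "e > 0"
      then obtain K where K: "\<forall>m\<ge>K. \<forall>n\<ge>K. nrm \<mu> (\<lambda>x. s m x - s n x) < e/2"
        using cau half_gt_zero by blast
      have "nrm \<mu> (\<lambda>x. s m x - L x) < e" if "m \<ge> K" for m
      proof -
        have "((\<lambda>n. (cmod (N (s m) n - l n))\<^sup>2) has_sum (nrm \<mu> (\<lambda>x. s m x - L x))\<^sup>2) UNIV"
          using parseval[OF H_diff[OF s L(1), of m]] by (simp add: N_diff s H_P L)
        then have "(nrm \<mu> (\<lambda>x. s m x - L x))\<^sup>2 \<le> (e/2)\<^sup>2"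
          by (rule has_sum_le_finite_sums) (rule fin[where K = K], use K that in auto)
        then have "nrm \<mu> (\<lambda>x. s m x - L x) \<le> e/2" using power2_le_imp_le[of _ "e/2"] e by simp
        then show ?thesis using e by simp
      qed
      then show "\<exists>no. \<forall>n\<ge>no. dist (nrm \<mu> (\<lambda>x. s n x - L x)) 0 < e"
        by (auto simp: dist_norm nrm_nonneg)
    qed
    then show ?thesis using L by blast
  qed
  show ?thesis unfolding hilbert_def
    using H_subspace H_sq nrm0 complete by blast
qed

definition basis_vector :: "'i \<Rightarrow> 'x fn" where
  "basis_vector n = (SOME u. u \<in> H \<and> N u = (\<lambda>m. if m = n then 1 else 0))"

lemma basis_vector: "basis_vector n \<in> H" "N (basis_vector n) = (\<lambda>m. if m = n then 1 else 0)"
proof -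
  have "square_summable (\<lambda>m. if m = n then 1 else 0)"
    by (rule square_summable_finite) simp
  from N_onto_H[OF this] have "\<exists>u. u \<in> H \<and> N u = (\<lambda>m. if m = n then 1 else 0)" by (simp add: Bex_def)
  from someI_ex[OF this] show "basis_vector n \<in> H" "N (basis_vector n) = (\<lambda>m. if m = n then 1 else 0)"
    unfolding basis_vector_def by (rule conjunct1, rule conjunct2)
qed

definition truncate :: "'i set \<Rightarrow> 'x fn \<Rightarrow> 'x fn" where
  "truncate F u = (\<lambda>x. \<Sum>n\<in>F. N u n * basis_vector n x)"

lemma truncate:
  assumes "finite F"
  shows "truncate F u \<in> H" "N (truncate F u) = (\<lambda>n. if n \<in> F then N u n else 0)"
proof -
  show "truncate F u \<in> H"
    unfolding truncate_def by (rule H_sum[where f = basis_vector, OF assms]) (rule basis_vector)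
  have "N (truncate F u) = (\<lambda>m. \<Sum>n\<in>F. N u n * (if m = n then 1 else 0))"
    unfolding truncate_def
    using N_sum[where f = basis_vector and F = F and a = "N u", OF assms] H_P basis_vector
    by (simp only: basis_vector(2))
  then show "N (truncate F u) = (\<lambda>n. if n \<in> F then N u n else 0)"
    using assms by (simp add: if_distrib[of "\<lambda>x. _ * x"] cong: if_cong)
qed

lemma ip_basis:
  assumes "u \<in> H" shows "ip \<mu> u (basis_vector n) = N u n" "ip \<mu> (basis_vector n) u = cnj (N u n)"
proof -
  have "((\<lambda>m. N u m * cnj (N (basis_vector n) m)) has_sum ip \<mu> u (basis_vector n)) UNIV"
    using assms basis_vector by (intro ip_has_sum)
  then have "((\<lambda>m. if m = n then N u n else 0) has_sum ip \<mu> u (basis_vector n)) UNIV"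
    by (rule has_sum_cong[THEN iffD1, rotated]) (simp add: basis_vector)
  moreover have "((\<lambda>m. if m = n then N u n else 0) has_sum N u n) UNIV"
    by (rule has_sum_finite_neutralI[of "{n}"]) auto
  ultimately show 1: "ip \<mu> u (basis_vector n) = N u n" by (rule has_sum_unique)
  show "ip \<mu> (basis_vector n) u = cnj (N u n)" by (subst ip_swap) (simp add: 1)
qed

section \<open>Weighted shifts: cores and adjoints\<close>

lemma nrm_sq_eq: "u \<in> H \<Longrightarrow> (nrm \<mu> u)\<^sup>2 = infsum (\<lambda>n. (cmod (N u n))\<^sup>2) UNIV"
  using parseval infsumI by metis

lemma nrm_lessI: "u \<in> H \<Longrightarrow> infsum (\<lambda>n. (cmod (N u n))\<^sup>2) UNIV < e\<^sup>2 \<Longrightarrow> 0 < e \<Longrightarrow> nrm \<mu> u < e"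
  using nrm_sq_eq power2_less_imp_less[of "nrm \<mu> u" e] by simp

definition finite_vectors :: "'x fn set" where
  "finite_vectors = {u \<in> P. finite {n. N u n \<noteq> 0}}"

lemma finite_vectors_H: "u \<in> finite_vectors \<Longrightarrow> u \<in> H"
  by (simp add: finite_vectors_def H_iff square_summable_finite)

lemma finite_vectors_subspace: "lin_subspace finite_vectors"
  unfolding lin_subspace_def finite_vectors_def
proof (safe)
  fix u v assume a: "u \<in> P" "v \<in> P" "finite {n. N u n \<noteq> 0}" "finite {n. N v n \<noteq> 0}"
  show "finite {n. N (\<lambda>x. u x + v x) n \<noteq> 0}"
    by (rule finite_subset[OF _ finite_UnI[OF a(3,4)]]) (auto simp: N_add a)
  show "(\<lambda>x. u x + v x) \<in> P" by (rule P_add[OF a(1,2)])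
next
  fix a u assume a: "u \<in> P" "finite {n. N u n \<noteq> 0}"
  show "finite {n. N (\<lambda>x. a * u x) n \<noteq> 0}"
    by (rule finite_subset[OF _ a(2)]) (auto simp: N_scale a)
  show "(\<lambda>x. a * u x) \<in> P" by (rule P_scale[OF a(1)])
qed (simp_all add: P_zero N_zero)

lemma truncate_finite_vectors: "finite F \<Longrightarrow> truncate F u \<in> finite_vectors"
  unfolding finite_vectors_def using truncate[of F u] H_P[of "truncate F u"]
  by (auto intro: finite_subset)

text \<open>Diagonal operators (\<open>\<pi>\<close> the identity) and weighted bilateral shifts are treated together, so that
  cores, adjoints, compositions and intertwiners need one argument each.\<close>

definition weighted_shift :: "('x fn \<Rightarrow> 'x fn) \<Rightarrow> ('i \<Rightarrow> 'i) \<Rightarrow> ('i \<Rightarrow> complex) \<Rightarrow> bool" where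
  "weighted_shift T \<pi> t \<longleftrightarrow> bij \<pi> \<and> (\<forall>u\<in>P. T u \<in> P \<and> (\<forall>n. N (T u) (\<pi> n) = t n * N u n))"

lemma weighted_shiftD:
  assumes "weighted_shift T \<pi> t"
  shows "bij \<pi>" "u \<in> P \<Longrightarrow> T u \<in> P" "u \<in> P \<Longrightarrow> N (T u) (\<pi> n) = t n * N u n"
  using assms unfolding weighted_shift_def by auto

lemma weighted_shift_summable:
  assumes "weighted_shift T \<pi> t" "u \<in> P"
  shows "T u \<in> H \<longleftrightarrow> (\<lambda>n. (cmod (t n * N u n))\<^sup>2) summable_on UNIV"
  using summable_on_reindex_bij_betw[of \<pi> UNIV UNIV "\<lambda>n. (cmod (N (T u) n))\<^sup>2"]
    weighted_shiftD[OF assms(1)] assms(2)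
  by (simp add: H_iff square_summable_def)

lemma weighted_shift_nrm:
  assumes "weighted_shift T \<pi> t" "u \<in> P" "T u \<in> H"
  shows "(nrm \<mu> (T u))\<^sup>2 = infsum (\<lambda>n. (cmod (t n * N u n))\<^sup>2) UNIV"
  using infsum_reindex_bij_betw[of \<pi> UNIV UNIV "\<lambda>n. (cmod (N (T u) n))\<^sup>2"]
    weighted_shiftD[OF assms(1)] assms(2)
  by (simp add: nrm_sq_eq[OF assms(3)])

lemma weighted_shift_eqI:
  assumes "weighted_shift T \<pi> t" "u \<in> P" "v \<in> P" "\<And>n. N v (\<pi> n) = t n * N u n"
  shows "T u = v"
proof (rule P_eqI[OF weighted_shiftD(2)[OF assms(1,2)] assms(3)])
  fix m obtain n where "m = \<pi> n" using weighted_shiftD(1)[OF assms(1)] bij_pointE by metis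
  then show "N (T u) m = N v m" using weighted_shiftD(3)[OF assms(1,2)] assms(4) by simp
qed

lemma weighted_shift_add:
  assumes "weighted_shift T \<pi> t" "u \<in> P" "v \<in> P"
  shows "T (\<lambda>x. u x + v x) = (\<lambda>x. T u x + T v x)"
  using weighted_shiftD[OF assms(1)] assms(2,3)
  by (intro weighted_shift_eqI[OF assms(1)]) (simp_all add: P_add N_add distrib_left)

lemma weighted_shift_scale:
  assumes "weighted_shift T \<pi> t" "u \<in> P"
  shows "T (\<lambda>x. a * u x) = (\<lambda>x. a * T u x)"
  using weighted_shiftD[OF assms(1)] assms(2)
  by (intro weighted_shift_eqI[OF assms(1)]) (simp_all add: P_scale N_scale)

lemma weighted_shift_diff:
  assumes "weighted_shift T \<pi> t" "u \<in> P" "v \<in> P"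
  shows "T (\<lambda>x. u x - v x) = (\<lambda>x. T u x - T v x)"
  using weighted_shiftD[OF assms(1)] assms(2,3)
  by (intro weighted_shift_eqI[OF assms(1)]) (simp_all add: P_diff N_diff right_diff_distrib)

lemma weighted_shift_finite_vectors:
  assumes "weighted_shift T \<pi> t" "u \<in> finite_vectors"
  shows "T u \<in> finite_vectors"
proof -
  have u: "u \<in> P" "finite {n. N u n \<noteq> 0}" using assms(2) by (auto simp: finite_vectors_def)
  have "{m. N (T u) m \<noteq> 0} \<subseteq> \<pi> ` {n. N u n \<noteq> 0}"
  proof
    fix m assume m: "m \<in> {m. N (T u) m \<noteq> 0}"
    obtain n where "m = \<pi> n" using weighted_shiftD(1)[OF assms(1)] bij_pointE by metis
    then show "m \<in> \<pi> ` {n. N u n \<noteq> 0}"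
      using m weighted_shiftD(3)[OF assms(1) u(1), of n] by auto
  qed
  then show ?thesis
    using u weighted_shiftD(2)[OF assms(1) u(1)] by (auto simp: finite_vectors_def intro: finite_subset)
qed

lemma weighted_shift_id: "weighted_shift (\<lambda>u. u) (\<lambda>n. n) (\<lambda>n. 1)"
  by (simp add: weighted_shift_def bij_def)

lemma weighted_shift_comp:
  assumes "weighted_shift S \<rho> s" "weighted_shift T \<pi> t"
  shows "weighted_shift (\<lambda>u. S (T u)) (\<lambda>n. \<rho> (\<pi> n)) (\<lambda>n. s (\<pi> n) * t n)"
  unfolding weighted_shift_def
  using weighted_shiftD[OF assms(1)] weighted_shiftD[OF assms(2)] bij_comp[of \<pi> \<rho>]
  by (simp add: o_def)

text \<open>The operator maps truncations of \<open>u\<close> to truncations of its image, so one finite set of indices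
  makes the tails of both small. With \<open>T\<close> the identity this is the density of the finite vectors.\<close>

lemma approximation:
  assumes T: "weighted_shift T \<pi> t" and u: "u \<in> H" and Tu: "T u \<in> H" and e: "e > 0"
  shows "\<exists>w\<in>finite_vectors. nrm \<mu> (\<lambda>x. u x - w x) < e \<and> nrm \<mu> (\<lambda>x. T u x - T w x) < e"
proof -
  have s1: "(\<lambda>n. (cmod (N u n))\<^sup>2) summable_on UNIV" using u by (simp add: H_iff square_summable_def)
  have s2: "(\<lambda>n. (cmod (t n * N u n))\<^sup>2) summable_on UNIV"
    using Tu weighted_shift_summable[OF T H_P[OF u]] by simp
  have "\<forall>\<^sub>F F in finite_subsets_at_top UNIV. finite F \<and>
      infsum (\<lambda>n. if n \<in> F then 0 else (cmod (N u n))\<^sup>2) UNIV < e\<^sup>2 \<and>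
      infsum (\<lambda>n. if n \<in> F then 0 else (cmod (t n * N u n))\<^sup>2) UNIV < e\<^sup>2"
    using e by (intro eventually_conj small_tail s1 s2 eventually_finite_subsets_at_top_weakI) auto
  then obtain F where F: "finite F"
      "infsum (\<lambda>n. if n \<in> F then 0 else (cmod (N u n))\<^sup>2) UNIV < e\<^sup>2"
      "infsum (\<lambda>n. if n \<in> F then 0 else (cmod (t n * N u n))\<^sup>2) UNIV < e\<^sup>2"
    using eventually_happens'[OF finite_subsets_at_top_neq_bot] by blast
  let ?w = "truncate F u"
  have w: "?w \<in> finite_vectors" by (rule truncate_finite_vectors[OF F(1)])
  have wH: "?w \<in> H" "?w \<in> P" "T ?w \<in> H"
    using w finite_vectors_H H_P weighted_shift_finite_vectors[OF T] by auto
  let ?d = "\<lambda>x. u x - ?w x"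
  have d: "?d \<in> H" by (rule H_diff[OF u wH(1)])
  have Nd: "N ?d = (\<lambda>n. if n \<in> F then 0 else N u n)"
    by (auto simp: N_diff[OF H_P[OF u] wH(2)] truncate[OF F(1)])
  have "nrm \<mu> ?d < e"
    using F(2) by (intro nrm_lessI[OF d _ e]) (simp add: Nd if_distrib[of cmod] if_distrib[of "\<lambda>x. x\<^sup>2"] cong: if_cong)
  have Td: "T ?d = (\<lambda>x. T u x - T ?w x)" by (rule weighted_shift_diff[OF T H_P[OF u] wH(2)])
  then have "T ?d \<in> H" using H_diff[OF Tu wH(3)] by simp
  from weighted_shift_nrm[OF T H_P[OF d] this] have "(nrm \<mu> (T ?d))\<^sup>2 < e\<^sup>2"
    using F(3) by (simp add: Nd if_distrib[of cmod] if_distrib[of "\<lambda>x. x\<^sup>2"] if_distrib[of "\<lambda>x. _ * x"] cong: if_cong)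
  then have "nrm \<mu> (T ?d) < e" using e power2_less_imp_less[of "nrm \<mu> (T ?d)" e] by simp
  then show ?thesis using \<open>nrm \<mu> ?d < e\<close> w Td by auto
qed

lemma weighted_shift_core:
  assumes "weighted_shift T \<pi> t"
  shows "is_core \<mu> (max_oper H T) finite_vectors"
  unfolding is_core_def max_oper_def
  using approximation[OF assms] finite_vectors_H weighted_shift_finite_vectors[OF assms] by auto

lemma weighted_shift_densely_defined:
  assumes "weighted_shift T \<pi> t"
  shows "densely_defined \<mu> H (max_oper H T)"
proof -
  have "lin_subspace {u \<in> H. T u \<in> H}"
    unfolding lin_subspace_def
    using H_zero H_add H_scale weighted_shift_add[OF assms] weighted_shift_scale[OF assms] H_P
      weighted_shift_scale[OF assms P_zero, of 0]
    by auto
  moreover have "linear_on {u \<in> H. T u \<in> H} T"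
    unfolding linear_on_def
    using weighted_shift_add[OF assms] weighted_shift_scale[OF assms] H_P by auto
  moreover have "\<exists>w\<in>{u \<in> H. T u \<in> H}. nrm \<mu> (\<lambda>x. u x - w x) < e" if "u \<in> H" "e > 0" for u e
    using approximation[OF weighted_shift_id that(1) that(1) that(2)]
      finite_vectors_H weighted_shift_finite_vectors[OF assms] by blast
  ultimately show ?thesis
    unfolding densely_defined_def max_oper_def by auto
qed

lemma basis_vector_finite: "basis_vector n \<in> finite_vectors"
  by (simp add: finite_vectors_def basis_vector H_P)

text \<open>The maximal operators are adjoint to each other with equality of domains: the defining relation,
  tested on the basis vectors, determines all coefficients of the adjoint vector \<open>w\<close>, and these are
  the coefficients of \<open>T' v\<close>.\<close>

lemma weighted_shift_adjoint:
  assumes T: "weighted_shift T \<pi> t" and T': "weighted_shift T' \<pi>' t'"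
    and \<pi>': "\<And>n. \<pi>' (\<pi> n) = n" and t': "\<And>n. t' (\<pi> n) = cnj (t n)"
  shows "is_adjoint \<mu> H (max_oper H T) (max_oper H T')"
proof -
  have NT': "N (T' v) n = cnj (t n) * N v (\<pi> n)" if "v \<in> P" for v n
    using weighted_shiftD(3)[OF T' that, of "\<pi> n"] by (simp add: \<pi>' t')
  have adj: "ip \<mu> (T u) v = ip \<mu> u (T' v)" if "u \<in> H" "T u \<in> H" "v \<in> H" "T' v \<in> H" for u v
  proof -
    have "((\<lambda>m. N (T u) m * cnj (N v m)) has_sum ip \<mu> (T u) v) UNIV"
      using that by (intro ip_has_sum)
    then have "((\<lambda>n. N (T u) (\<pi> n) * cnj (N v (\<pi> n))) has_sum ip \<mu> (T u) v) UNIV"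
      using has_sum_reindex_bij_betw[OF weighted_shiftD(1)[OF T], of "\<lambda>m. N (T u) m * cnj (N v m)"] by simp
    moreover have "((\<lambda>n. N u n * cnj (N (T' v) n)) has_sum ip \<mu> u (T' v)) UNIV"
      using that by (intro ip_has_sum)
    ultimately show ?thesis
      using weighted_shiftD(3)[OF T H_P[OF that(1)]]
      by (simp add: NT'[OF H_P[OF that(3)]] mult_ac has_sum_unique)
  qed
  have dom: "T' v \<in> H" if v: "v \<in> H" and w: "w \<in> H"
      and eq: "\<forall>u\<in>{u\<in>H. T u \<in> H}. ip \<mu> (T u) v = ip \<mu> u w" for v w
  proof -
    have "T' v = w"
    proof (rule P_eqI[OF weighted_shiftD(2)[OF T' H_P[OF v]] H_P[OF w]])
      fix n
      let ?b = "basis_vector n"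
      have bP: "?b \<in> P" using basis_vector(1) H_P by auto
      have TbH: "T ?b \<in> H"
        using weighted_shift_finite_vectors[OF T basis_vector_finite] finite_vectors_H by auto
      have bp: "basis_vector (\<pi> n) \<in> P" using basis_vector(1) H_P by auto
      have Tb: "T ?b = (\<lambda>x. t n * basis_vector (\<pi> n) x)"
        using weighted_shiftD(1)[OF T]
        by (intro weighted_shift_eqI[OF T bP P_scale[OF bp]])
           (auto simp: N_scale[OF bp] basis_vector bij_def inj_eq)
      have "ip \<mu> ?b w = ip \<mu> (T ?b) v" using eq basis_vector(1) TbH by auto
      also have "\<dots> = t n * ip \<mu> (basis_vector (\<pi> n)) v"
        unfolding Tb ip_def by (simp only: mult.assoc integral_mult_right_zero)
      finally have "cnj (N w n) = t n * cnj (N v (\<pi> n))" by (simp add: ip_basis v w)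
      then have "cnj (cnj (N w n)) = cnj (t n * cnj (N v (\<pi> n)))" by (rule arg_cong)
      then show "N (T' v) n = N w n" by (simp add: NT' H_P v)
    qed
    then show ?thesis using w by simp
  qed
  show ?thesis
    unfolding is_adjoint_def max_oper_def fst_conv snd_conv
    using adj dom by blast
qed

section \<open>Closed subspaces and irreducibility\<close>

lemma ip_add_left: "u \<in> H \<Longrightarrow> v \<in> H \<Longrightarrow> y \<in> H \<Longrightarrow> ip \<mu> (\<lambda>x. u x + v x) y = ip \<mu> u y + ip \<mu> v y"
  using has_sum_add[OF ip_has_sum[of u y] ip_has_sum[of v y]] ip_has_sum[OF H_add[of u v], of y]
  by (simp add: N_add H_P ring_distribs has_sum_unique)

lemma ip_scale_left: "ip \<mu> (\<lambda>x. a * u x) y = a * ip \<mu> u y"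
  unfolding ip_def by (simp only: mult.assoc integral_mult_right_zero)

lemma ip_sum_left:
  assumes "finite F" "\<And>i. i \<in> F \<Longrightarrow> f i \<in> H" "y \<in> H"
  shows "ip \<mu> (\<lambda>x. \<Sum>i\<in>F. a i * f i x) y = (\<Sum>i\<in>F. a i * ip \<mu> (f i) y)"
  using assms(1,2)
proof (induction F rule: finite_induct)
  case empty show ?case by (simp add: ip_def)
next
  case (insert i F)
  have "(\<lambda>x. a i * f i x) \<in> H" by (rule H_scale[OF insert.prems[OF insertI1]])
  moreover have "(\<lambda>x. \<Sum>i\<in>F. a i * f i x) \<in> H"
    by (rule H_sum[OF insert.hyps(1) insert.prems[OF insertI2]])
  ultimately show ?case
    using insert.IH[OF insert.prems[OF insertI2]]
    unfolding sum.insert[OF insert.hyps] by (simp only: ip_add_left[OF _ _ assms(3)] ip_scale_left)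
qed

lemma nrm_expand:
  assumes u: "u \<in> H" and v: "v \<in> H"
  shows "(nrm \<mu> (\<lambda>x. u x + a * v x))\<^sup>2
    = (nrm \<mu> u)\<^sup>2 + 2 * Re (cnj a * ip \<mu> u v) + (cmod a)\<^sup>2 * (nrm \<mu> v)\<^sup>2"
proof -
  have id: "(cmod (p + a * q))\<^sup>2 = (cmod p)\<^sup>2 + 2 * Re (cnj a * (p * cnj q)) + (cmod a)\<^sup>2 * (cmod q)\<^sup>2" for p q
    by (simp add: cmod_power2) (simp add: power2_eq_square algebra_simps)
  have "((\<lambda>n. (cmod (N u n + a * N v n))\<^sup>2) has_sum (nrm \<mu> (\<lambda>x. u x + a * v x))\<^sup>2) UNIV"
    using parseval[OF H_add[OF u H_scale[OF v, of a]]]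
    unfolding N_add[OF H_P[OF u] P_scale[OF H_P[OF v]]] N_scale[OF H_P[OF v]] .
  moreover have "((\<lambda>n. (cmod (N u n + a * N v n))\<^sup>2) has_sum
      ((nrm \<mu> u)\<^sup>2 + 2 * Re (cnj a * ip \<mu> u v) + (cmod a)\<^sup>2 * (nrm \<mu> v)\<^sup>2)) UNIV"
    unfolding id
  proof (intro has_sum_add)
    have "((\<lambda>n. cnj a * (N u n * cnj (N v n))) has_sum cnj a * ip \<mu> u v) UNIV"
      by (rule has_sum_cmult_right[OF ip_has_sum[OF u v]])
    from has_sum_cmult_right[OF has_sum_Re[OF this], of 2]
    show "((\<lambda>n. 2 * Re (cnj a * (N u n * cnj (N v n)))) has_sum 2 * Re (cnj a * ip \<mu> u v)) UNIV" .
  qed (intro parseval u has_sum_cmult_right v)+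
  ultimately show ?thesis by (rule has_sum_unique)
qed

lemma nrm_zero_iff: "u \<in> H \<Longrightarrow> nrm \<mu> u = 0 \<longleftrightarrow> u = (\<lambda>x. 0)"
proof
  assume u: "u \<in> H" "nrm \<mu> u = 0"
  have "\<forall>u\<in>H. nrm \<mu> u = 0 \<longrightarrow> u = (\<lambda>x. 0)" using hilbert unfolding hilbert_def by (elim conjE)
  then show "u = (\<lambda>x. 0)" using u by blast
qed (simp add: nrm_def)

lemma cauchy_schwarz:
  assumes u: "u \<in> H" and v: "v \<in> H"
  shows "cmod (ip \<mu> u v) \<le> nrm \<mu> u * nrm \<mu> v"
proof (cases "v = (\<lambda>x. 0)")
  case True
  then show ?thesis by (simp add: ip_def nrm_def)
next
  case False
  then have pos: "0 < nrm \<mu> v" using nrm_zero_iff[OF v] nrm_nonneg[of \<mu> v] by (simp add: less_le)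
  define a where "a = - (ip \<mu> u v / of_real ((nrm \<mu> v)\<^sup>2))"
  have "cnj a * ip \<mu> u v = - of_real ((cmod (ip \<mu> u v))\<^sup>2 / (nrm \<mu> v)\<^sup>2)"
    by (simp add: a_def complex_norm_square mult.commute del: of_real_power)
  moreover have "(cmod a)\<^sup>2 * (nrm \<mu> v)\<^sup>2 = (cmod (ip \<mu> u v))\<^sup>2 / (nrm \<mu> v)\<^sup>2"
    using pos by (simp add: a_def norm_divide power_divide norm_mult power2_eq_square field_simps)
  ultimately have "(nrm \<mu> (\<lambda>x. u x + a * v x))\<^sup>2 = (nrm \<mu> u)\<^sup>2 - (cmod (ip \<mu> u v))\<^sup>2 / (nrm \<mu> v)\<^sup>2"
    using nrm_expand[OF u v, of a] by simp
  then have "(cmod (ip \<mu> u v))\<^sup>2 / (nrm \<mu> v)\<^sup>2 \<le> (nrm \<mu> u)\<^sup>2"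
    using zero_le_power2[of "nrm \<mu> (\<lambda>x. u x + a * v x)"] by linarith
  then have "(cmod (ip \<mu> u v))\<^sup>2 \<le> (nrm \<mu> u * nrm \<mu> v)\<^sup>2"
    using pos by (simp add: divide_le_eq power_mult_distrib)
  then show ?thesis by (rule power2_le_imp_le) (simp add: nrm_nonneg)
qed

lemma nrm_triangle:
  assumes u: "u \<in> H" and v: "v \<in> H"
  shows "nrm \<mu> (\<lambda>x. u x + v x) \<le> nrm \<mu> u + nrm \<mu> v"
proof (rule power2_le_imp_le)
  have "Re (ip \<mu> u v) \<le> nrm \<mu> u * nrm \<mu> v"
    using cauchy_schwarz[OF u v] complex_Re_le_cmod order_trans by blast
  then show "(nrm \<mu> (\<lambda>x. u x + v x))\<^sup>2 \<le> (nrm \<mu> u + nrm \<mu> v)\<^sup>2"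
    using nrm_expand[OF u v, of 1] by (simp add: power2_sum)
qed (simp add: nrm_nonneg)

lemma nrm_parallelogram:
  assumes u: "u \<in> H" and v: "v \<in> H"
  shows "(nrm \<mu> (\<lambda>x. u x + v x))\<^sup>2 + (nrm \<mu> (\<lambda>x. u x - v x))\<^sup>2 = 2 * (nrm \<mu> u)\<^sup>2 + 2 * (nrm \<mu> v)\<^sup>2"
  using nrm_expand[OF u v, of 1] nrm_expand[OF u v, of "-1"] by simp

lemma nrm_scale: "nrm \<mu> (\<lambda>x. a * u x) = cmod a * nrm \<mu> u"
  by (simp add: nrm_def norm_mult power_mult_distrib real_sqrt_mult)

text \<open>A minimizing sequence for the distance from \<open>f\<close> to \<open>V\<close> is a Cauchy sequence by the parallelogram
  law; at the minimum, moving by a small multiple of \<open>y \<in> V\<close> cannot decrease the distance, which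
  forces orthogonality.\<close>

lemma orthogonal_projection:
  assumes V: "closed_subspace \<mu> H V" and f: "f \<in> H"
  shows "\<exists>v\<in>V. \<exists>w\<in>H. (\<forall>y\<in>V. ip \<mu> w y = 0) \<and> f = (\<lambda>x. v x + w x)"
proof -
  have VH: "\<And>v. v \<in> V \<Longrightarrow> v \<in> H" and V0: "(\<lambda>x. 0) \<in> V"
    and Vadd: "\<And>u v. u \<in> V \<Longrightarrow> v \<in> V \<Longrightarrow> (\<lambda>x. u x + v x) \<in> V"
    and Vscale: "\<And>a u. u \<in> V \<Longrightarrow> (\<lambda>x. a * u x) \<in> V"
    and Vcl: "\<And>u. u \<in> H \<Longrightarrow> (\<forall>e>0. \<exists>w\<in>V. nrm \<mu> (\<lambda>x. u x - w x) < e) \<Longrightarrow> u \<in> V"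
    using V unfolding closed_subspace_def lin_subspace_def by auto
  define D where "D = (\<lambda>v. (nrm \<mu> (\<lambda>x. f x - v x))\<^sup>2) ` V"
  define d where "d = Inf D"
  have D: "D \<noteq> {}" "bdd_below D" using V0 by (auto simp: D_def intro!: bdd_belowI[of _ 0])
  have dle: "d \<le> (nrm \<mu> (\<lambda>x. f x - v x))\<^sup>2" if "v \<in> V" for v
    unfolding d_def using that D by (intro cInf_lower) (auto simp: D_def)
  have "\<exists>v\<in>V. (nrm \<mu> (\<lambda>x. f x - v x))\<^sup>2 < d + 1 / real (Suc n)" for n
    using cInf_less_iff[OF D, of "d + 1 / real (Suc n)"] by (auto simp: d_def D_def)
  then obtain s where s: "\<And>n. s n \<in> V" "\<And>n. (nrm \<mu> (\<lambda>x. f x - s n x))\<^sup>2 < d + 1 / real (Suc n)"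
    by metis
  have sd: "(nrm \<mu> (\<lambda>x. s m x - s n x))\<^sup>2 \<le> 2 / real (Suc m) + 2 / real (Suc n)" for m n
  proof -
    let ?p = "\<lambda>x. f x - s m x" and ?q = "\<lambda>x. f x - s n x"
    have pq: "?p \<in> H" "?q \<in> H" by (rule H_diff[OF f VH[OF s(1)]])+
    define c where "c = (\<lambda>x. (1/2) * (s m x + s n x))"
    have c: "c \<in> V" unfolding c_def by (rule Vscale[OF Vadd[OF s(1) s(1)]])
    have "(\<lambda>x. ?p x + ?q x) = (\<lambda>x. 2 * (f x - c x))" by (auto simp: c_def algebra_simps)
    then have "nrm \<mu> (\<lambda>x. ?p x + ?q x) = 2 * nrm \<mu> (\<lambda>x. f x - c x)" by (simp only: nrm_scale) simp
    then have "4 * d \<le> (nrm \<mu> (\<lambda>x. ?p x + ?q x))\<^sup>2"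
      using dle[OF c] by (simp only: power_mult_distrib) simp
    moreover have "(\<lambda>x. ?p x - ?q x) = (\<lambda>x. (-1) * (s m x - s n x))" by auto
    then have "nrm \<mu> (\<lambda>x. ?p x - ?q x) = nrm \<mu> (\<lambda>x. s m x - s n x)" by (simp only: nrm_scale) simp
    ultimately show ?thesis using nrm_parallelogram[OF pq] s(2)[of m] s(2)[of n] by simp
  qed
  have "\<forall>e>0. \<exists>K. \<forall>m\<ge>K. \<forall>n\<ge>K. nrm \<mu> (\<lambda>x. s m x - s n x) < e"
  proof (intro allI impI)
    fix e :: real assume e: "e > 0"
    obtain K where K: "4 / real (Suc K) < e\<^sup>2"
      using reals_Archimedean[of "e\<^sup>2 / 4"] e by (auto simp: inverse_eq_divide field_simps)
    have "nrm \<mu> (\<lambda>x. s m x - s n x) < e" if "m \<ge> K" "n \<ge> K" for m n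
    proof (rule power2_less_imp_less)
      have "2 / real (Suc m) \<le> 2 / real (Suc K)" "2 / real (Suc n) \<le> 2 / real (Suc K)"
        using that by (auto intro!: divide_left_mono)
      then show "(nrm \<mu> (\<lambda>x. s m x - s n x))\<^sup>2 < e\<^sup>2" using sd[of m n] K by simp
    qed (use e in simp)
    then show "\<exists>K. \<forall>m\<ge>K. \<forall>n\<ge>K. nrm \<mu> (\<lambda>x. s m x - s n x) < e" by blast
  qed
  moreover have "\<forall>s. (\<forall>n. s n \<in> H) \<and> (\<forall>e>0. \<exists>K. \<forall>m\<ge>K. \<forall>n\<ge>K. nrm \<mu> (\<lambda>x. s m x - s n x) < e)
      \<longrightarrow> (\<exists>l\<in>H. (\<lambda>n. nrm \<mu> (\<lambda>x. s n x - l x)) \<longlonglongrightarrow> 0)"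
    using hilbert unfolding hilbert_def by (elim conjE)
  moreover have "\<forall>n. s n \<in> H" using s(1) VH by simp
  ultimately obtain l where l: "l \<in> H" "(\<lambda>n. nrm \<mu> (\<lambda>x. s n x - l x)) \<longlonglongrightarrow> 0"
    by (elim allE[of _ s]) blast
  have neg: "nrm \<mu> (\<lambda>x. l x - s n x) = nrm \<mu> (\<lambda>x. s n x - l x)" for n
    by (simp add: nrm_def norm_minus_commute)
  have "l \<in> V"
  proof (rule Vcl[OF l(1)], intro allI impI)
    fix e :: real assume "e > 0"
    then have "\<forall>\<^sub>F n in sequentially. nrm \<mu> (\<lambda>x. s n x - l x) < e"
      using order_tendstoD(2)[OF l(2)] by blast
    then obtain n where "nrm \<mu> (\<lambda>x. s n x - l x) < e"
      using eventually_happens'[OF sequentially_bot] by blast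
    then show "\<exists>w\<in>V. nrm \<mu> (\<lambda>x. l x - w x) < e" using neg[of n] by (intro bexI[OF _ s(1)[of n]]) simp
  qed
  let ?w = "\<lambda>x. f x - l x"
  have w: "?w \<in> H" by (rule H_diff[OF f l(1)])
  have bound: "nrm \<mu> ?w \<le> sqrt (d + 1 / real (Suc n)) + nrm \<mu> (\<lambda>x. s n x - l x)" for n
  proof -
    have "nrm \<mu> ?w = nrm \<mu> (\<lambda>x. (f x - s n x) + (s n x - l x))" by simp
    also have "\<dots> \<le> nrm \<mu> (\<lambda>x. f x - s n x) + nrm \<mu> (\<lambda>x. s n x - l x)"
      using f VH[OF s(1)] l(1) by (intro nrm_triangle H_diff)
    also have "nrm \<mu> (\<lambda>x. f x - s n x) \<le> sqrt (d + 1 / real (Suc n))"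
      using s(2)[of n] by (intro real_le_rsqrt) simp
    finally show ?thesis by simp
  qed
  have "(\<lambda>n. sqrt (d + 1 / real (Suc n)) + nrm \<mu> (\<lambda>x. s n x - l x)) \<longlonglongrightarrow> sqrt (d + 0) + 0"
    by (intro tendsto_intros l(2) LIMSEQ_inverse_real_of_nat[unfolded inverse_eq_divide])
  then have "nrm \<mu> ?w \<le> sqrt (d + 0) + 0"
    by (rule LIMSEQ_le_const) (use bound in auto)
  moreover have "0 \<le> d" unfolding d_def by (rule cInf_greatest) (use D in \<open>auto simp: D_def\<close>)
  ultimately have wd: "(nrm \<mu> ?w)\<^sup>2 \<le> d"
    using power_mono[OF _ nrm_nonneg, of \<mu> ?w "sqrt d" 2] by simp
  have "ip \<mu> ?w y = 0" if y: "y \<in> V" for y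
  proof (rule ccontr)
    assume ne: "ip \<mu> ?w y \<noteq> 0"
    define r where "r = (cmod (ip \<mu> ?w y))\<^sup>2"
    have r: "r > 0" using ne by (simp add: r_def)
    have ge: "2 * t * r \<le> t\<^sup>2 * r * (nrm \<mu> y)\<^sup>2" for t :: real
    proof -
      define a where "a = - (of_real t * ip \<mu> ?w y)"
      have "(\<lambda>x. l x + (-a) * y x) \<in> V" by (rule Vadd[OF \<open>l \<in> V\<close> Vscale[OF y]])
      from dle[OF this] have "d \<le> (nrm \<mu> (\<lambda>x. ?w x + a * y x))\<^sup>2" by (simp add: algebra_simps)
      moreover have "Re (cnj a * ip \<mu> ?w y) = - (t * r)"
        unfolding a_def r_def cmod_power2 by (simp add: power2_eq_square algebra_simps)
      moreover have "(cmod a)\<^sup>2 = t\<^sup>2 * r"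
        by (simp add: a_def r_def norm_mult power_mult_distrib)
      ultimately show ?thesis using nrm_expand[OF w VH[OF y], of a] wd by simp
    qed
    \<comment> \<open>every \<open>t > 0\<close> with \<open>t \<parallel>y\<parallel>\<^sup>2 < 2\<close> contradicts the previous inequality\<close>
    define t where "t = 1 / ((nrm \<mu> y)\<^sup>2 + 1)"
    have t: "t > 0" "t * (nrm \<mu> y)\<^sup>2 < 1" by (auto simp: t_def field_simps add_pos_nonneg add_nonneg_pos)
    have "2 * (t * r) \<le> (t * (nrm \<mu> y)\<^sup>2) * (t * r)" using ge[of t] by (simp add: power2_eq_square mult_ac)
    moreover have "(t * (nrm \<mu> y)\<^sup>2) * (t * r) < 1 * (t * r)"
      using t r by (intro mult_strict_right_mono) auto
    moreover have "t * r > 0" using t r by simp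
    ultimately show False by linarith
  qed
  then show ?thesis using \<open>l \<in> V\<close> w by (intro bexI[of _ l] bexI[of _ ?w]) auto
qed

lemma reduces_full:
  assumes "reduces \<mu> H T V" "v \<in> V" "v \<in> fst T"
  shows "snd T v \<in> V"
proof -
  have "v \<in> V \<longrightarrow> (\<lambda>x. 0) \<in> H \<longrightarrow> (\<forall>y\<in>V. ip \<mu> (\<lambda>x. 0) y = 0) \<and> (\<lambda>x. v x + 0) \<in> fst T \<longrightarrow> snd T v \<in> V"
    using assms(1) unfolding reduces_def by blast
  then show ?thesis using assms H_zero by (simp add: ip_def)
qed

text \<open>The operators \<open>A i\<close> separate the indices, so the component in \<open>V\<close> of a basis vector, being a joint
  eigenvector with the same eigenvalues, is a multiple of that basis vector. Hence each basis vector
  lies in \<open>V\<close> or is orthogonal to \<open>V\<close>. The shifts \<open>B\<close> and \<open>C\<close> have nonzero weights and move basis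
  vectors of \<open>V\<close> along \<open>\<pi>\<close> in both directions, so by transitivity the same alternative holds for all
  of them.\<close>

lemma no_reducing_subspace:
  assumes V: "closed_subspace \<mu> H V"
    and A: "\<And>i. weighted_shift (A i) (\<lambda>n. n) (a i)" "\<And>i. reduces \<mu> H (max_oper H (A i)) V"
    and sep: "\<And>m n. (\<And>i. a i m = a i n) \<Longrightarrow> m = n"
    and B: "weighted_shift B \<pi> b" "reduces \<mu> H (max_oper H B) V" "\<And>n. b n \<noteq> 0"
    and C: "weighted_shift C \<pi>' c" "reduces \<mu> H (max_oper H C) V" "\<And>n. c n \<noteq> 0"
    and \<pi>': "\<And>n. \<pi>' (\<pi> n) = n"
    and trans: "\<And>S. (\<And>n. n \<in> S \<longleftrightarrow> \<pi> n \<in> S) \<Longrightarrow> S = {} \<or> S = UNIV"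
  shows "V = {\<lambda>x. 0} \<or> V = H"
proof -
  have VH: "\<And>v. v \<in> V \<Longrightarrow> v \<in> H" and V0: "(\<lambda>x. 0) \<in> V"
    and Vadd: "\<And>u v. u \<in> V \<Longrightarrow> v \<in> V \<Longrightarrow> (\<lambda>x. u x + v x) \<in> V"
    and Vscale: "\<And>a u. u \<in> V \<Longrightarrow> (\<lambda>x. a * u x) \<in> V"
    and Vcl: "\<And>u. u \<in> H \<Longrightarrow> (\<forall>e>0. \<exists>w\<in>V. nrm \<mu> (\<lambda>x. u x - w x) < e) \<Longrightarrow> u \<in> V"
    using V unfolding closed_subspace_def lin_subspace_def by auto
  have bP: "basis_vector n \<in> P" for n using basis_vector(1) H_P by auto
  have shift_basis: "T (basis_vector n) = (\<lambda>x. t n * basis_vector (\<sigma> n) x)"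
    if "weighted_shift T \<sigma> t" for T \<sigma> t n
    using weighted_shiftD(1)[OF that]
    by (intro weighted_shift_eqI[OF that bP P_scale[OF bP]])
       (auto simp: N_scale[OF bP] basis_vector bij_def inj_eq)
  have basis_dom: "basis_vector n \<in> fst (max_oper H T)" if "weighted_shift T \<sigma> t" for T \<sigma> t n
    using weighted_shift_finite_vectors[OF that basis_vector_finite] finite_vectors_H basis_vector(1)
    by (auto simp: max_oper_def)
  have dich: "basis_vector n \<in> V \<or> (\<forall>y\<in>V. N y n = 0)" for n
  proof -
    obtain v w where vw: "v \<in> V" "w \<in> H" "\<And>y. y \<in> V \<Longrightarrow> ip \<mu> w y = 0"
        "basis_vector n = (\<lambda>x. v x + w x)"
      using orthogonal_projection[OF V basis_vector(1)] by blast
    have vP: "v \<in> P" "w \<in> P" using vw VH H_P by auto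
    have sum1: "N v m + N w m = (if m = n then 1 else 0)" for m
      using N_add[OF vP] basis_vector(2)[of n] vw(4) by metis
    have Av: "A i v = (\<lambda>x. a i n * v x)" for i
    proof -
      have dom: "(\<lambda>x. v x + w x) \<in> fst (max_oper H (A i))" using basis_dom[OF A(1)] vw(4) by metis
      have "v \<in> fst (max_oper H (A i)) \<and> w \<in> fst (max_oper H (A i)) \<and>
          A i v \<in> V \<and> (\<forall>y\<in>V. ip \<mu> (A i w) y = 0)"
        using A(2)[of i] vw(1-3) dom unfolding reduces_def by (auto simp: max_oper_def)
      then have AV: "A i v \<in> V" and AwH: "A i w \<in> H" and Aw: "\<And>y. y \<in> V \<Longrightarrow> ip \<mu> (A i w) y = 0"
        by (auto simp: max_oper_def)
      \<comment> \<open>this vector lies in \<open>V\<close>; by the eigenvalue equation of \<open>v + w\<close> it also lies in the orthogonal complement\<close>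
      define y where "y = (\<lambda>x. A i v x + (- a i n) * v x)"
      have yV: "y \<in> V" unfolding y_def by (rule Vadd[OF AV Vscale[OF vw(1)]])
      have "A i (\<lambda>x. v x + w x) = (\<lambda>x. a i n * (v x + w x))"
        using shift_basis[OF A(1)[of i], of n] vw(4) by simp
      then have "(\<lambda>x. A i v x + A i w x) = (\<lambda>x. a i n * v x + a i n * w x)"
        using weighted_shift_add[OF A(1) vP, of i] by (simp add: distrib_left)
      then have "A i v x + A i w x = a i n * v x + a i n * w x" for x by (rule fun_cong)
      moreover have swap: "p + q = r + s \<Longrightarrow> p - r = s - q" for p q r s :: complex by algebra
      ultimately have "A i v x - a i n * v x = a i n * w x - A i w x" for x
        by blast
      then have y_eq: "y = (\<lambda>x. a i n * w x + (-1) * A i w x)" by (simp add: y_def)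
      have "ip \<mu> y y = ip \<mu> (\<lambda>x. a i n * w x + (-1) * A i w x) y" using y_eq by simp
      also have "\<dots> = 0"
        using vw(3)[OF yV] Aw[OF yV]
        by (subst ip_add_left[OF H_scale[OF vw(2)] H_scale[OF AwH] VH[OF yV]])
           (simp only: ip_scale_left mult_zero_right add_0)
      finally have "y = (\<lambda>x. 0)" using nrm_zero_iff[OF VH[OF yV]] by (simp add: ip_same)
      then show ?thesis by (simp add: y_def fun_eq_iff)
    qed
    have "N v m = 0" if "m \<noteq> n" for m
    proof -
      obtain i where i: "a i m \<noteq> a i n" using sep[of m n] \<open>m \<noteq> n\<close> by blast
      have "a i n * N v m = a i m * N v m"
        using weighted_shiftD(3)[OF A(1) vP(1), of i m] unfolding Av[of i] N_scale[OF vP(1)] .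
      then show ?thesis using i by (metis mult_right_cancel)
    qed
    then have Nv: "N v = (\<lambda>m. N v n * (if m = n then 1 else 0))" by auto
    have v_eq: "v = (\<lambda>x. N v n * basis_vector n x)"
      using vP(1) bP[of n] Nv by (intro P_eqI P_scale) (auto simp: N_scale basis_vector)
    show ?thesis
    proof (cases "N v n = 0")
      case True
      then have "v = (\<lambda>x. 0)" using v_eq by simp
      then have "w = basis_vector n" using vw(4) by simp
      then have "N y n = 0" if "y \<in> V" for y using vw(3)[OF that] ip_basis(2)[OF VH[OF that]] by simp
      then show ?thesis by blast
    next
      case False
      have "basis_vector n = (\<lambda>x. (1 / N v n) * v x)" using False by (subst v_eq) simp
      then show ?thesis using Vscale[OF vw(1), of "1 / N v n"] by simp
    qed
  qed
  have step: "basis_vector (\<sigma> n) \<in> V"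
    if "weighted_shift T \<sigma> t" "reduces \<mu> H (max_oper H T) V" "t n \<noteq> 0" "basis_vector n \<in> V" for T \<sigma> t n
  proof -
    have "(\<lambda>x. t n * basis_vector (\<sigma> n) x) \<in> V"
      using reduces_full[OF that(2,4) basis_dom[OF that(1)]] shift_basis[OF that(1)]
      by (simp add: max_oper_def)
    from Vscale[OF this, of "1 / t n"] show ?thesis using that(3) by simp
  qed
  define S where "S = {n. basis_vector n \<in> V}"
  have "n \<in> S \<longleftrightarrow> \<pi> n \<in> S" for n
    using step[OF B(1,2,3), of n] step[OF C(1,2,3), of "\<pi> n"] by (auto simp: S_def \<pi>')
  then consider "S = {}" | "S = UNIV" using trans by blast
  then show ?thesis
  proof cases
    case 1
    then have "y = (\<lambda>x. 0)" if "y \<in> V" for y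
      using dich that H_P[OF VH[OF that]] by (intro N_inj) (auto simp: S_def)
    then show ?thesis using V0 by blast
  next
    case 2
    have tr: "truncate F u \<in> V" if "finite F" for F u
      using that
    proof (induction F rule: finite_induct)
      case empty then show ?case using V0 by (simp add: truncate_def)
    next
      case (insert n F)
      have "(\<lambda>x. N u n * basis_vector n x) \<in> V" using 2 by (intro Vscale) (auto simp: S_def)
      from Vadd[OF this insert.IH] show ?case by (simp add: truncate_def sum.insert[OF insert.hyps])
    qed
    have fin: "w \<in> V" if w: "w \<in> finite_vectors" for w
    proof -
      have F: "finite {n. N w n \<noteq> 0}" and wP: "w \<in> P" using w by (auto simp: finite_vectors_def)
      have "w = truncate {n. N w n \<noteq> 0} w"
        using truncate(1)[OF F] by (intro P_eqI[OF wP]) (auto simp: truncate[OF F] H_P)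
      then show ?thesis using tr[OF F] by metis
    qed
    have "u \<in> V" if u: "u \<in> H" for u
      using approximation[OF weighted_shift_id u u] fin by (intro Vcl[OF u]) blast
    then show ?thesis using VH by blast
  qed
qed

section \<open>Orthonormal bases and reproducing kernels\<close>

lemma bessel_identity:
  assumes E: "\<forall>u\<in>E. \<forall>v\<in>E. ip \<mu> u v = (if u = v then 1 else 0)" and EH: "E \<subseteq> H"
    and k: "k \<in> H" and F: "finite F" "F \<subseteq> E"
  shows "(nrm \<mu> (\<lambda>x. k x - (\<Sum>u\<in>F. a u * u x)))\<^sup>2
    = (nrm \<mu> k)\<^sup>2 - (\<Sum>u\<in>F. (cmod (ip \<mu> k u))\<^sup>2) + (\<Sum>u\<in>F. (cmod (a u - ip \<mu> k u))\<^sup>2)"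
  using F
proof (induction F rule: finite_induct)
  case empty
  then show ?case by simp
next
  case (insert u F)
  have uE: "u \<in> E" and uH: "u \<in> H" and FE: "F \<subseteq> E" and FH: "\<And>v. v \<in> F \<Longrightarrow> v \<in> H"
    using insert.prems EH by auto
  let ?s = "\<lambda>x. \<Sum>v\<in>F. a v * v x"
  let ?f = "\<lambda>x. k x - ?s x"
  have s: "?s \<in> H" using H_sum[of F "\<lambda>v. v" a] insert.hyps(1) FH by simp
  have f: "?f \<in> H" by (rule H_diff[OF k s])
  have "ip \<mu> ?s u = (\<Sum>v\<in>F. a v * ip \<mu> v u)"
    using ip_sum_left[of F "\<lambda>v. v" u a] insert.hyps(1) FH uH by simp
  also have "\<dots> = 0"
    using E uE FE insert.hyps(2) by (intro sum.neutral) fastforce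
  finally have ipf: "ip \<mu> ?f u = ip \<mu> k u"
    using ip_add_left[OF k H_scale[OF s, of "-1"] uH] ip_scale_left[of "-1" ?s u] by simp
  have "complex_of_real ((nrm \<mu> u)\<^sup>2) = 1" using E uE ip_same[of \<mu> u] by simp
  then have n1: "(nrm \<mu> u)\<^sup>2 = 1" unfolding of_real_eq_1_iff .
  have "2 * Re (cnj (- b) * q) + (cmod (- b))\<^sup>2 * 1 = (cmod (b - q))\<^sup>2 - (cmod q)\<^sup>2" for b q
    by (simp add: cmod_power2) (simp add: power2_eq_square algebra_simps)
  from this[of "a u" "ip \<mu> k u"] have "(nrm \<mu> (\<lambda>x. ?f x + (- a u) * u x))\<^sup>2
      = (nrm \<mu> ?f)\<^sup>2 + (cmod (a u - ip \<mu> k u))\<^sup>2 - (cmod (ip \<mu> k u))\<^sup>2"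
    using nrm_expand[OF f uH, of "- a u"] unfolding ipf n1 by linarith
  moreover have "(\<lambda>x. ?f x + (- a u) * u x) = (\<lambda>x. k x - (\<Sum>v\<in>insert u F. a v * v x))"
    using insert.hyps by (simp add: algebra_simps)
  ultimately show ?case using insert.IH[OF FE] insert.hyps by simp
qed

text \<open>Some linear combination over a finite \<open>F \<subseteq> E\<close> is close to \<open>k\<close>. By Bessel's identity replacing its
  coefficients by inner products only improves the approximation, so the partial sums come
  arbitrarily close to the squared norm, and they never exceed it.\<close>

lemma orthonormal_basis_parseval:
  assumes E: "orthonormal_basis \<mu> H E" and k: "k \<in> H"
  shows "((\<lambda>u. (cmod (ip \<mu> k u))\<^sup>2) has_sum (nrm \<mu> k)\<^sup>2) E"
proof -
  have E': "E \<subseteq> H" "\<forall>u\<in>E. \<forall>v\<in>E. ip \<mu> u v = (if u = v then 1 else 0)"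
    "\<And>e. e > 0 \<Longrightarrow> \<exists>F a. finite F \<and> F \<subseteq> E \<and> nrm \<mu> (\<lambda>x. k x - (\<Sum>u\<in>F. a u * u x)) < e"
    using E k unfolding orthonormal_basis_def by auto
  note B = bessel_identity[OF E'(2,1) k]
  let ?S = "\<lambda>F. \<Sum>u\<in>F. (cmod (ip \<mu> k u))\<^sup>2"
  have le: "?S F \<le> (nrm \<mu> k)\<^sup>2" if "finite F" "F \<subseteq> E" for F
    using B[OF that, of "\<lambda>u. ip \<mu> k u"]
      zero_le_power2[of "nrm \<mu> (\<lambda>x. k x - (\<Sum>u\<in>F. ip \<mu> k u * u x))"] by simp
  have ev: "\<forall>\<^sub>F F in finite_subsets_at_top E. finite F \<and> F \<subseteq> E"
    by (rule eventually_finite_subsets_at_top_weakI) auto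
  show ?thesis unfolding has_sum_def
  proof (rule order_tendstoI)
    fix y assume y: "y < (nrm \<mu> k)\<^sup>2"
    define e where "e = sqrt ((nrm \<mu> k)\<^sup>2 - y)"
    have e: "e > 0" "e\<^sup>2 = (nrm \<mu> k)\<^sup>2 - y" using y by (auto simp: e_def)
    obtain F a where F: "finite F" "F \<subseteq> E" "nrm \<mu> (\<lambda>x. k x - (\<Sum>u\<in>F. a u * u x)) < e"
      using E'(3)[OF e(1)] by blast
    have "(nrm \<mu> (\<lambda>x. k x - (\<Sum>u\<in>F. a u * u x)))\<^sup>2 < e\<^sup>2"
      using F(3) by (intro power_strict_mono nrm_nonneg) auto
    moreover have "0 \<le> (\<Sum>u\<in>F. (cmod (a u - ip \<mu> k u))\<^sup>2)" by (intro sum_nonneg) simp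
    ultimately have yF: "y < ?S F" using B[OF F(1,2), of a] e(2) by linarith
    show "\<forall>\<^sub>F G in finite_subsets_at_top E. y < ?S G"
      unfolding eventually_finite_subsets_at_top
    proof (intro exI[of _ F] conjI allI impI F(1,2))
      fix G assume "finite G \<and> F \<subseteq> G \<and> G \<subseteq> E"
      then have "?S F \<le> ?S G" by (intro sum_mono2) auto
      then show "y < ?S G" using yF by simp
    qed
  next
    fix y assume "y > (nrm \<mu> k)\<^sup>2"
    then show "\<forall>\<^sub>F G in finite_subsets_at_top E. ?S G < y"
      using eventually_mono[OF ev] le by (metis (mono_tags, lifting) order_le_less_trans)
  qed
qed

lemma orthonormal_basis_exists: "orthonormal_basis \<mu> H (range basis_vector)"
proof -
  have inj: "inj basis_vector"
  proof (rule injI)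
    fix m n assume "basis_vector m = basis_vector n"
    then have "(if m = m then 1 else 0) = (if m = n then 1 else (0::complex))"
      using basis_vector(2)[of m] basis_vector(2)[of n] by metis
    then show "m = n" by (simp split: if_splits)
  qed
  have dense: "\<exists>F a. finite F \<and> F \<subseteq> range basis_vector \<and> nrm \<mu> (\<lambda>x. f x - (\<Sum>u\<in>F. a u * u x)) < e"
    if f: "f \<in> H" and e: "e > 0" for f e
  proof -
    obtain w where w: "w \<in> finite_vectors" "nrm \<mu> (\<lambda>x. f x - w x) < e"
      using approximation[OF weighted_shift_id f f e] by blast
    have F: "finite {n. N w n \<noteq> 0}" and wP: "w \<in> P" using w by (auto simp: finite_vectors_def)
    have "w = truncate {n. N w n \<noteq> 0} w"
      using truncate(1)[OF F] by (intro P_eqI[OF wP]) (auto simp: truncate[OF F] H_P)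
    also have "\<dots> = (\<lambda>x. \<Sum>u\<in>basis_vector ` {n. N w n \<noteq> 0}. N w (inv basis_vector u) * u x)"
      unfolding truncate_def by (simp add: sum.reindex[OF inj_on_subset[OF inj]] inv_f_f[OF inj])
    finally have w_eq: "w = (\<lambda>x. \<Sum>u\<in>basis_vector ` {n. N w n \<noteq> 0}. N w (inv basis_vector u) * u x)" .
    define G where "G = basis_vector ` {n. N w n \<noteq> 0}"
    define a where "a = (\<lambda>u. N w (inv basis_vector u))"
    have "w x = (\<Sum>u\<in>G. a u * u x)" for x
      using fun_cong[OF w_eq, of x] by (simp only: G_def a_def)
    then have "nrm \<mu> (\<lambda>x. f x - (\<Sum>u\<in>G. a u * u x)) < e" using w(2) by simp
    then show ?thesis using F by (intro exI[of _ G] exI[of _ a]) (auto simp: G_def)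
  qed
  show ?thesis
    unfolding orthonormal_basis_def using dense
    by (auto simp: basis_vector ip_basis inj_eq[OF inj])
qed

text \<open>If evaluation at \<open>p\<close> is given by the square-summable family \<open>k\<close>, it is the inner product with a
  vector \<open>f\<close> of squared norm \<open>s\<close>; Parseval for \<open>E\<close> computes this norm from the values \<open>u p\<close>.\<close>

lemma reproducing_sum:
  assumes E: "orthonormal_basis \<mu> H E"
    and k: "square_summable k" and ev: "\<And>u. u \<in> H \<Longrightarrow> ((\<lambda>n. N u n * k n) has_sum u p) UNIV"
    and s: "((\<lambda>n. (cmod (k n))\<^sup>2) has_sum s) UNIV"
  shows "((\<lambda>u. (cmod (u p))\<^sup>2) has_sum s) E"
proof -
  have "square_summable (\<lambda>n. cnj (k n))" using k by (simp add: square_summable_def)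
  then obtain f where f: "f \<in> H" "N f = (\<lambda>n. cnj (k n))" using N_onto_H by blast
  have up: "u p = cnj (ip \<mu> f u)" if "u \<in> H" for u
    using ev[OF that] ip_has_sum[OF that f(1)] by (simp add: f(2) has_sum_unique ip_swap[of \<mu> f u])
  have "(nrm \<mu> f)\<^sup>2 = s" using parseval[OF f(1)] s by (simp add: f(2) has_sum_unique)
  then have "((\<lambda>u. (cmod (ip \<mu> f u))\<^sup>2) has_sum s) E"
    using orthonormal_basis_parseval[OF E f(1)] by simp
  moreover have "(cmod (ip \<mu> f u))\<^sup>2 = (cmod (u p))\<^sup>2" if "u \<in> E" for u
    using up[of u] E that by (auto simp: orthonormal_basis_def)
  ultimately show ?thesis using has_sum_cong[of E "\<lambda>u. (cmod (ip \<mu> f u))\<^sup>2" "\<lambda>u. (cmod (u p))\<^sup>2"] by simp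
qed

end

section \<open>Unitary transport between two coefficient models\<close>

locale l2_model_pair = M1: l2_model \<mu> P H N + M2: l2_model \<mu>' P' H' N'
  for \<mu> :: "'x measure" and P H and N :: "'x fn \<Rightarrow> 'i \<Rightarrow> complex"
    and \<mu>' :: "'y measure" and P' H' and N' :: "'y fn \<Rightarrow> 'i \<Rightarrow> complex" +
  fixes phase :: "'i \<Rightarrow> complex"
  assumes phase: "cmod (phase n) = 1"
begin

definition transport :: "'x fn \<Rightarrow> 'y fn" where
  "transport u = (SOME v. v \<in> H' \<and> N' v = (\<lambda>n. phase n * N u n))"

lemma transport:
  assumes "u \<in> H"
  shows "transport u \<in> H'" "N' (transport u) = (\<lambda>n. phase n * N u n)"
proof -
  have "square_summable (\<lambda>n. phase n * N u n)"
    using M1.H_l2[OF assms] by (simp add: square_summable_def norm_mult phase)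
  from M2.N_onto_H[OF this] have "\<exists>v. v \<in> H' \<and> N' v = (\<lambda>n. phase n * N u n)" by (simp add: Bex_def)
  from someI_ex[OF this] show "transport u \<in> H'" "N' (transport u) = (\<lambda>n. phase n * N u n)"
    unfolding transport_def by (rule conjunct1, rule conjunct2)
qed

lemma phase_nz: "phase n \<noteq> 0"
  using phase[of n] by auto

lemma transport_eqI: "u \<in> H \<Longrightarrow> v \<in> P' \<Longrightarrow> (\<And>n. N' v n = phase n * N u n) \<Longrightarrow> transport u = v"
  using transport[of u] by (intro M2.P_eqI) (auto simp: M2.H_P)

lemma unitary_transport: "unitary \<mu> H \<mu>' H' transport"
  unfolding unitary_def
proof (intro conjI ballI)
  show "linear_on H transport"
    unfolding linear_on_def
  proof (intro conjI ballI allI)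
    fix u v assume u: "u \<in> H" and v: "v \<in> H"
    note t = transport(1)[OF u, THEN M2.H_P] transport(1)[OF v, THEN M2.H_P]
    show "transport (\<lambda>x. u x + v x) = (\<lambda>y. transport u y + transport v y)"
      by (rule transport_eqI[OF M1.H_add[OF u v] M2.P_add[OF t]])
         (simp only: M2.N_add[OF t] transport(2)[OF u] transport(2)[OF v]
            M1.N_add[OF M1.H_P[OF u] M1.H_P[OF v]] distrib_left)
  next
    fix a u assume u: "u \<in> H"
    note t = transport(1)[OF u, THEN M2.H_P]
    show "transport (\<lambda>x. a * u x) = (\<lambda>y. a * transport u y)"
      by (rule transport_eqI[OF M1.H_scale[OF u] M2.P_scale[OF t]])
         (simp only: M2.N_scale[OF t] transport(2)[OF u] M1.N_scale[OF M1.H_P[OF u]] mult.left_commute)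
  qed
  show "bij_betw transport H H'"
    unfolding bij_betw_def
  proof
    show "inj_on transport H"
    proof (rule inj_onI)
      fix u v assume uv: "u \<in> H" "v \<in> H" "transport u = transport v"
      then have "phase n * N u n = phase n * N v n" for n
        using transport(2)[OF uv(1)] transport(2)[OF uv(2)] by metis
      then show "u = v" using uv phase_nz by (intro M1.P_eqI M1.H_P) auto
    qed
    show "transport ` H = H'"
    proof (intro equalityI subsetI)
      fix v assume v: "v \<in> H'"
      have "square_summable (\<lambda>n. N' v n / phase n)"
        using M2.H_l2[OF v] by (simp add: square_summable_def norm_divide phase)
      then obtain u where u: "u \<in> H" "N u = (\<lambda>n. N' v n / phase n)" using M1.N_onto_H by blast
      then have "transport u = v" using v phase_nz by (intro transport_eqI M2.H_P) auto
      then show "v \<in> transport ` H" using u by blast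
    qed (use transport in auto)
  qed
  show "nrm \<mu>' (transport u) = nrm \<mu> u" if "u \<in> H" for u
  proof -
    have "(nrm \<mu>' (transport u))\<^sup>2 = (nrm \<mu> u)\<^sup>2"
      using M2.parseval[OF transport(1)[OF that]] M1.parseval[OF that]
      by (simp add: transport[OF that] norm_mult phase has_sum_unique)
    then show ?thesis using power2_eq_iff_nonneg[OF nrm_nonneg nrm_nonneg] by blast
  qed
qed

text \<open>The condition on the weights forces their moduli to agree, which makes the maximal domains
  correspond to each other.\<close>

lemma transport_intertwines:
  assumes T: "M1.weighted_shift T \<pi> t" and T': "M2.weighted_shift T' \<pi> t'"
    and comm: "\<And>n. t' n * phase n = phase (\<pi> n) * t n"
  shows "intertwines H transport (max_oper H T) (max_oper H' T')"
proof -
  have tt: "cmod (t' n) = cmod (t n)" for n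
    using arg_cong[OF comm[of n], of cmod] by (simp add: norm_mult phase)
  have dom: "T u \<in> H \<longleftrightarrow> T' (transport u) \<in> H'" if "u \<in> H" for u
    using M1.weighted_shift_summable[OF T M1.H_P[OF that]]
      M2.weighted_shift_summable[OF T' M2.H_P[OF transport(1)[OF that]]]
    by (simp add: transport(2)[OF that] norm_mult phase tt)
  have "transport (T u) = T' (transport u)" if u: "u \<in> H" and Tu: "T u \<in> H" for u
  proof -
    have "N' (transport (T u)) (\<pi> n) = t' n * N' (transport u) n" for n
      using comm[of n] by (simp add: transport(2)[OF u] transport(2)[OF Tu]
          M1.weighted_shiftD(3)[OF T M1.H_P[OF u]] mult.assoc[symmetric])
    from M2.weighted_shift_eqI[OF T' transport(1)[OF u, THEN M2.H_P] transport(1)[OF Tu, THEN M2.H_P] this]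
    show ?thesis by simp
  qed
  then show ?thesis
    unfolding intertwines_def max_oper_def using dom transport(1) by auto
qed

end

section \<open>Exponential series with rapidly decreasing coefficients\<close>

lemma has_sum_int:
  fixes f :: "int \<Rightarrow> 'a::{topological_ab_group_add, t2_space}"
  assumes "((\<lambda>n. f (int n)) has_sum a) UNIV" "((\<lambda>n. f (- int (Suc n))) has_sum b) UNIV"
  shows "(f has_sum (a + b)) UNIV"
proof -
  have bij1: "bij_betw int UNIV {0..}"
    by (rule bij_betw_byWitness[of _ nat]) auto
  have bij2: "bij_betw (\<lambda>n. - int (Suc n)) UNIV {..<0}"
    by (rule bij_betw_byWitness[of _ "\<lambda>n. nat (- n - 1)"]) auto
  have "(f has_sum a) {0..}"
    using has_sum_reindex_bij_betw[OF bij1, of f a] assms(1) by simp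
  moreover have "(f has_sum b) {..<0}"
    using has_sum_reindex_bij_betw[OF bij2, of f b] assms(2) by simp
  ultimately have "(f has_sum (a + b)) ({0..} \<union> {..<0})"
    by (intro has_sum_Un_disjoint) auto
  moreover have "{0..} \<union> {..<0} = (UNIV :: int set)" by auto
  ultimately show ?thesis by simp
qed

lemma summable_on_int_exp: "(\<lambda>n::int. exp (- real_of_int \<bar>n\<bar>)) summable_on UNIV"
proof -
  have "summable (\<lambda>n. exp (-1) ^ n :: real)" by (rule summable_geometric) simp
  then have s: "summable (\<lambda>n. exp (- real n))" by (simp add: exp_of_nat_mult[symmetric])
  have 1: "(\<lambda>n. exp (- real n)) summable_on UNIV"
    by (rule summable_nonneg_imp_summable_on[OF s]) simp
  have 2: "(\<lambda>n. exp (- real (Suc n))) summable_on UNIV"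
    by (rule summable_nonneg_imp_summable_on) (use s summable_Suc_iff[of "\<lambda>n. exp (- real n)"] in auto)
  show ?thesis
    by (rule has_sum_imp_summable, rule has_sum_int[OF has_sum_infsum has_sum_infsum])
       (use 1 2 in \<open>simp_all add: abs_if algebra_simps\<close>)
qed

text \<open>These are the coefficient families of the Laurent series that converge absolutely on the whole
  punctured plane.\<close>

definition rapid :: "(int \<Rightarrow> complex) \<Rightarrow> bool" where
  "rapid c \<longleftrightarrow> (\<forall>R. (\<lambda>n. cmod (c n) * exp (R * real_of_int \<bar>n\<bar>)) summable_on UNIV)"

lemma rapidI:
  assumes "\<And>R. \<exists>B. \<forall>n. cmod (c n) \<le> B * exp (- R * real_of_int \<bar>n\<bar>)"
  shows "rapid c"
  unfolding rapid_def
proof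
  fix R
  obtain B where B: "\<And>n. cmod (c n) \<le> B * exp (- (R + 1) * real_of_int \<bar>n\<bar>)" using assms by blast
  show "(\<lambda>n. cmod (c n) * exp (R * real_of_int \<bar>n\<bar>)) summable_on UNIV"
  proof (rule summable_on_comparison_test)
    show "(\<lambda>n. B * exp (- real_of_int \<bar>n\<bar>)) summable_on UNIV"
      by (rule summable_on_cmult_right[OF summable_on_int_exp])
    fix n
    have "cmod (c n) * exp (R * real_of_int \<bar>n\<bar>) \<le> B * exp (- (R + 1) * real_of_int \<bar>n\<bar>) * exp (R * real_of_int \<bar>n\<bar>)"
      using B[of n] by (rule mult_right_mono) simp
    also have "\<dots> = B * exp (- real_of_int \<bar>n\<bar>)"
      by (simp add: mult.assoc mult_exp_exp[symmetric] exp_add[symmetric] algebra_simps)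
    finally show "cmod (c n) * exp (R * real_of_int \<bar>n\<bar>) \<le> B * exp (- real_of_int \<bar>n\<bar>)" .
  qed simp
qed

lemma rapid_mono:
  assumes "rapid c" "\<And>n. cmod (d n) \<le> B * exp (S * real_of_int \<bar>n\<bar>) * cmod (c n)"
  shows "rapid d"
  unfolding rapid_def
proof
  fix R
  show "(\<lambda>n. cmod (d n) * exp (R * real_of_int \<bar>n\<bar>)) summable_on UNIV"
  proof (rule summable_on_comparison_test)
    show "(\<lambda>n. B * (cmod (c n) * exp ((S + R) * real_of_int \<bar>n\<bar>))) summable_on UNIV"
      using assms(1) unfolding rapid_def by (intro summable_on_cmult_right) blast
    fix n
    have "cmod (d n) * exp (R * real_of_int \<bar>n\<bar>) \<le> B * exp (S * real_of_int \<bar>n\<bar>) * cmod (c n) * exp (R * real_of_int \<bar>n\<bar>)"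
      using assms(2)[of n] by (rule mult_right_mono) simp
    also have "\<dots> = B * (cmod (c n) * exp ((S + R) * real_of_int \<bar>n\<bar>))"
      by (simp add: exp_add distrib_right)
    finally show "cmod (d n) * exp (R * real_of_int \<bar>n\<bar>) \<le> B * (cmod (c n) * exp ((S + R) * real_of_int \<bar>n\<bar>))" .
  qed simp
qed

lemma rapid_add: "rapid c \<Longrightarrow> rapid d \<Longrightarrow> rapid (\<lambda>n. c n + d n)"
  unfolding rapid_def
proof
  fix R assume a: "\<forall>R. (\<lambda>n. cmod (c n) * exp (R * real_of_int \<bar>n\<bar>)) summable_on UNIV"
     "\<forall>R. (\<lambda>n. cmod (d n) * exp (R * real_of_int \<bar>n\<bar>)) summable_on UNIV"
  show "(\<lambda>n. cmod (c n + d n) * exp (R * real_of_int \<bar>n\<bar>)) summable_on UNIV"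
    by (rule summable_on_comparison_test[OF summable_on_add[OF a[THEN spec, of R]]])
       (auto simp: distrib_right[symmetric] intro!: mult_right_mono norm_triangle_ineq)
qed

lemma rapid_scale: "rapid c \<Longrightarrow> rapid (\<lambda>n. a * c n)"
  by (rule rapid_mono[of c _ "cmod a" 0]) (simp_all add: norm_mult)

lemma rapid_zero: "rapid (\<lambda>n. 0)"
  by (simp add: rapid_def)

lemma rapid_shift:
  assumes "rapid c" shows "rapid (\<lambda>n. c (n + k))"
proof -
  have "rapid (\<lambda>n. c (n + k))" unfolding rapid_def
  proof
    fix R
    have bij: "bij_betw (\<lambda>n. n + k) UNIV UNIV"
      by (rule bij_betw_byWitness[of _ "\<lambda>n. n - k"]) auto
    have "(\<lambda>m. cmod (c m) * exp (\<bar>R\<bar> * real_of_int \<bar>m\<bar>)) summable_on UNIV"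
      using assms by (simp add: rapid_def)
    then have s: "(\<lambda>n. cmod (c (n + k)) * exp (\<bar>R\<bar> * real_of_int \<bar>n + k\<bar>)) summable_on UNIV"
      using summable_on_reindex_bij_betw[OF bij, of "\<lambda>m. cmod (c m) * exp (\<bar>R\<bar> * real_of_int \<bar>m\<bar>)"] by simp
    show "(\<lambda>n. cmod (c (n + k)) * exp (R * real_of_int \<bar>n\<bar>)) summable_on UNIV"
    proof (rule summable_on_comparison_test)
      show "(\<lambda>n. exp (\<bar>R\<bar> * real_of_int \<bar>k\<bar>) * (cmod (c (n + k)) * exp (\<bar>R\<bar> * real_of_int \<bar>n + k\<bar>))) summable_on UNIV"
        by (rule summable_on_cmult_right[OF s])
      fix n
      have "R * real_of_int \<bar>n\<bar> \<le> \<bar>R\<bar> * real_of_int \<bar>n\<bar>" by (rule mult_right_mono) auto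
      also have "\<dots> \<le> \<bar>R\<bar> * (real_of_int \<bar>k\<bar> + real_of_int \<bar>n + k\<bar>)"
        by (rule mult_left_mono) auto
      finally have "exp (R * real_of_int \<bar>n\<bar>) \<le> exp (\<bar>R\<bar> * real_of_int \<bar>k\<bar>) * exp (\<bar>R\<bar> * real_of_int \<bar>n + k\<bar>)"
        by (simp only: exp_add[symmetric] exp_le_cancel_iff distrib_left)
      from mult_left_mono[OF this, of "cmod (c (n + k))"]
      show "cmod (c (n + k)) * exp (R * real_of_int \<bar>n\<bar>) \<le>
          exp (\<bar>R\<bar> * real_of_int \<bar>k\<bar>) * (cmod (c (n + k)) * exp (\<bar>R\<bar> * real_of_int \<bar>n + k\<bar>))"
        by (simp add: mult_ac)
    qed simp
  qed
  then show ?thesis .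
qed

text \<open>A Laurent series in \<open>e\<^sup>\<zeta>\<close>, multiplied by \<open>exp (\<sigma> \<zeta>)\<close>.\<close>

definition exp_series :: "real \<Rightarrow> (int \<Rightarrow> complex) \<Rightarrow> complex \<Rightarrow> complex" where
  "exp_series \<sigma> c \<zeta> = (\<Sum>\<^sub>\<infinity>n. c n * exp (of_real (of_int n + \<sigma>) * \<zeta>))"

lemma exp_term_bound:
  assumes "\<bar>Re \<zeta>\<bar> \<le> R"
  shows "cmod (c n * exp (of_real (of_int n + \<sigma>) * \<zeta>)) \<le> exp (\<bar>\<sigma>\<bar> * R) * (cmod (c n) * exp (R * real_of_int \<bar>n\<bar>))"
proof -
  have R: "0 \<le> R" using assms by linarith
  have "(of_int n + \<sigma>) * Re \<zeta> \<le> \<bar>of_int n + \<sigma>\<bar> * \<bar>Re \<zeta>\<bar>" by (metis abs_ge_self abs_mult)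
  also have "\<dots> \<le> (\<bar>real_of_int n\<bar> + \<bar>\<sigma>\<bar>) * R"
    using assms by (intro mult_mono abs_triangle_ineq) auto
  finally have "exp ((of_int n + \<sigma>) * Re \<zeta>) \<le> exp (\<bar>\<sigma>\<bar> * R) * exp (R * real_of_int \<bar>n\<bar>)"
    by (simp only: exp_add[symmetric] exp_le_cancel_iff) (simp add: algebra_simps)
  from mult_left_mono[OF this, of "cmod (c n)"] show ?thesis
    by (simp add: norm_mult mult_ac)
qed

lemma rapid_bound_summable:
  assumes "rapid c"
  shows "(\<lambda>n. exp (\<bar>\<sigma>\<bar> * R) * (cmod (c n) * exp (R * real_of_int \<bar>n\<bar>))) summable_on UNIV"
  using assms unfolding rapid_def by (intro summable_on_cmult_right) blast

lemma exp_series_abs_summable: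
  assumes "rapid c"
  shows "(\<lambda>n. cmod (c n * exp (of_real (of_int n + \<sigma>) * \<zeta>))) summable_on UNIV"
proof (rule summable_on_comparison_test[OF rapid_bound_summable[OF assms, of \<sigma> "\<bar>Re \<zeta>\<bar>"]])
  show "cmod (c n * exp (of_real (of_int n + \<sigma>) * \<zeta>))
      \<le> exp (\<bar>\<sigma>\<bar> * \<bar>Re \<zeta>\<bar>) * (cmod (c n) * exp (\<bar>Re \<zeta>\<bar> * real_of_int \<bar>n\<bar>))" for n
    by (rule exp_term_bound) simp
qed simp

lemma exp_series_has_sum:
  assumes "rapid c"
  shows "((\<lambda>n. c n * exp (of_real (of_int n + \<sigma>) * \<zeta>)) has_sum exp_series \<sigma> c \<zeta>) UNIV"
  unfolding exp_series_def
  by (rule has_sum_infsum[OF abs_summable_summable[OF exp_series_abs_summable[OF assms]]])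

lemma exp_series_uniform:
  assumes "rapid c" "\<And>\<zeta>. \<zeta> \<in> Y \<Longrightarrow> \<bar>Re \<zeta>\<bar> \<le> R"
  shows "uniform_limit Y (\<lambda>X \<zeta>. \<Sum>n\<in>X. c n * exp (of_real (of_int n + \<sigma>) * \<zeta>)) (exp_series \<sigma> c)
    (finite_subsets_at_top UNIV)"
  unfolding exp_series_def
proof (rule Weierstrass_m_test_general[OF _ rapid_bound_summable[OF assms(1), of \<sigma> R]])
  show "cmod (c n * exp (of_real (of_int n + \<sigma>) * \<zeta>))
      \<le> exp (\<bar>\<sigma>\<bar> * R) * (cmod (c n) * exp (R * real_of_int \<bar>n\<bar>))" if "\<zeta> \<in> Y" for n \<zeta>
    by (rule exp_term_bound[OF assms(2)[OF that]])
qed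

lemma rapid_deriv:
  assumes "rapid c" shows "rapid (\<lambda>n. of_real (of_int n + \<sigma>) * c n)"
proof (rule rapid_mono[OF assms, of _ "1 + \<bar>\<sigma>\<bar>" 1])
  fix n
  have "\<bar>real_of_int n + \<sigma>\<bar> \<le> \<bar>real_of_int n\<bar> + \<bar>\<sigma>\<bar>" by (rule abs_triangle_ineq)
  also have "\<dots> \<le> exp \<bar>real_of_int n\<bar> + \<bar>\<sigma>\<bar> * exp \<bar>real_of_int n\<bar>"
  proof (rule add_mono)
    show "\<bar>real_of_int n\<bar> \<le> exp \<bar>real_of_int n\<bar>" using exp_ge_add_one_self[of "\<bar>real_of_int n\<bar>"] by linarith
    show "\<bar>\<sigma>\<bar> \<le> \<bar>\<sigma>\<bar> * exp \<bar>real_of_int n\<bar>" using mult_left_mono[of 1 "exp \<bar>real_of_int n\<bar>" "\<bar>\<sigma>\<bar>"] by simp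
  qed
  finally have "\<bar>real_of_int n + \<sigma>\<bar> \<le> (1 + \<bar>\<sigma>\<bar>) * exp (1 * real_of_int \<bar>n\<bar>)" by (simp add: distrib_right)
  from mult_right_mono[OF this, of "cmod (c n)"]
  show "cmod (of_real (of_int n + \<sigma>) * c n) \<le> (1 + \<bar>\<sigma>\<bar>) * exp (1 * real_of_int \<bar>n\<bar>) * cmod (c n)"
    unfolding norm_mult norm_of_real by simp
qed

text \<open>Termwise differentiation, justified by the uniform convergence of the finite partial sums on the
  unit disc around \<open>\<zeta>\<close>.\<close>

lemma exp_series_deriv:
  assumes c: "rapid c"
  shows "(exp_series \<sigma> c has_field_derivative exp_series \<sigma> (\<lambda>n. of_real (of_int n + \<sigma>) * c n) \<zeta>) (at \<zeta>)"
proof -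
  let ?d = "\<lambda>n. of_real (of_int n + \<sigma>) * c n"
  have ul: "uniform_limit (cball \<zeta> 1) (\<lambda>X \<zeta>. \<Sum>n\<in>X. c n * exp (of_real (of_int n + \<sigma>) * \<zeta>)) (exp_series \<sigma> c)
    (finite_subsets_at_top UNIV)"
  proof (rule exp_series_uniform[OF c, of _ "\<bar>Re \<zeta>\<bar> + 1"])
    fix z assume "z \<in> cball \<zeta> 1"
    then have "\<bar>Re \<zeta> - Re z\<bar> \<le> 1" using abs_Re_le_cmod[of "\<zeta> - z"] by (simp add: dist_norm)
    then show "\<bar>Re z\<bar> \<le> \<bar>Re \<zeta>\<bar> + 1" by linarith
  qed
  obtain g' where g': "\<And>w. w \<in> ball \<zeta> 1 \<Longrightarrow> (exp_series \<sigma> c has_field_derivative (g' w)) (at w) \<and>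
      ((\<lambda>X. \<Sum>n\<in>X. ?d n * exp (of_real (of_int n + \<sigma>) * w)) \<longlongrightarrow> g' w) (finite_subsets_at_top UNIV)"
  proof (rule has_complex_derivative_uniform_limit[OF _ ul])
    show "\<forall>\<^sub>F X in finite_subsets_at_top UNIV.
        continuous_on (cball \<zeta> 1) (\<lambda>\<zeta>. \<Sum>n\<in>X. c n * exp (of_real (of_int n + \<sigma>) * \<zeta>)) \<and>
        (\<forall>w\<in>ball \<zeta> 1. ((\<lambda>\<zeta>. \<Sum>n\<in>X. c n * exp (of_real (of_int n + \<sigma>) * \<zeta>)) has_field_derivative
             (\<Sum>n\<in>X. ?d n * exp (of_real (of_int n + \<sigma>) * w))) (at w))"
      by (intro always_eventually allI conjI ballI continuous_intros)
         (auto intro!: derivative_eq_intros sum.cong simp: mult_ac)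
  qed auto
  have "((\<lambda>n. ?d n * exp (of_real (of_int n + \<sigma>) * \<zeta>)) has_sum g' \<zeta>) UNIV"
    using g'[of \<zeta>] by (simp add: has_sum_def)
  then have "g' \<zeta> = exp_series \<sigma> ?d \<zeta>"
    by (rule has_sum_unique[OF _ exp_series_has_sum[OF rapid_deriv[OF c]]])
  then show ?thesis using g'[of \<zeta>] by simp
qed

lemma exp_series_holomorphic: "rapid c \<Longrightarrow> exp_series \<sigma> c holomorphic_on S"
  using exp_series_deriv[of c \<sigma>] by (auto simp: holomorphic_on_def field_differentiable_def intro: has_field_derivative_at_within)

lemma exp_series_continuous: "rapid c \<Longrightarrow> continuous_on S (exp_series \<sigma> c)"
  by (rule holomorphic_on_imp_continuous_on[OF exp_series_holomorphic])

lemma exp_series_period: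
  "exp_series \<sigma> c (\<zeta> + 2 * of_real pi * \<i>) = exp (2 * of_real pi * \<i> * of_real \<sigma>) * exp_series \<sigma> c \<zeta>"
proof -
  have "exp (of_real (of_int n + \<sigma>) * (\<zeta> + 2 * of_real pi * \<i>))
      = exp (2 * of_real pi * \<i> * of_real \<sigma>) * exp (of_real (of_int n + \<sigma>) * \<zeta>)" for n
  proof -
    have "exp (of_real (of_int n + \<sigma>) * (\<zeta> + 2 * of_real pi * \<i>))
      = exp (2 * of_real pi * \<i> * of_real \<sigma> + of_real (of_int n + \<sigma>) * \<zeta>) * exp (2 * of_int n * pi * \<i>)"
      unfolding exp_add[symmetric] by (rule arg_cong[of _ _ exp]) (simp add: algebra_simps)
    then show ?thesis using exp_integer_2pi[of "of_int n"] by (simp add: exp_add)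
  qed
  then show ?thesis
    unfolding exp_series_def by (simp add: infsum_cmult_right'[symmetric] mult.left_commute)
qed

lemma exp_orthogonal:
  assumes "m \<noteq> n"
  shows "((\<lambda>y. cis (real_of_int (m - n) * y)) has_integral 0) {0..2 * pi}"
proof -
  define k where "k = real_of_int (m - n)"
  have k: "k \<noteq> 0" using assms by (simp add: k_def)
  have "((\<lambda>y. cis (k * y)) has_integral cis (k * (2 * pi)) / (\<i> * of_real k) - cis (k * 0) / (\<i> * of_real k)) {0..2 * pi}"
  proof (rule fundamental_theorem_of_calculus)
    fix y
    have "((\<lambda>y. exp (\<i> * of_real k * y) / (\<i> * of_real k)) has_field_derivative exp (\<i> * of_real k * of_real y)) (at (of_real y))"
      using k by (auto intro!: derivative_eq_intros)
    from has_vector_derivative_real_field[OF this, of "{0..2*pi}"]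
    show "((\<lambda>y. cis (k * y) / (\<i> * of_real k)) has_vector_derivative cis (k * y)) (at y within {0..2*pi})"
      by (simp add: cis_conv_exp mult.assoc)
  qed simp
  moreover have "cis (k * (2 * pi)) = 1" using cis_multiple_2pi[of k] by (simp add: mult_ac k_def)
  ultimately show ?thesis by (simp add: k_def)
qed

section \<open>Parseval on vertical lines\<close>

lemma norm_sum_cis_integral:
  fixes a :: "int \<Rightarrow> complex"
  assumes "finite X"
  shows "((\<lambda>y. (cmod (\<Sum>n\<in>X. a n * cis (real_of_int n * y)))\<^sup>2) has_integral 2 * pi * (\<Sum>n\<in>X. (cmod (a n))\<^sup>2)) {0..2 * pi}"
proof -
  have eq: "complex_of_real ((cmod (\<Sum>n\<in>X. a n * cis (real_of_int n * y)))\<^sup>2)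
      = (\<Sum>m\<in>X. \<Sum>n\<in>X. a m * cnj (a n) * cis (real_of_int (m - n) * y))" for y
    unfolding complex_norm_square cnj_sum sum_product
    by (intro sum.cong refl) (simp add: cis_cnj cis_mult left_diff_distrib right_diff_distrib mult_ac)
  have one: "((\<lambda>y. a m * cnj (a n) * cis (real_of_int (m - n) * y)) has_integral
      (if m = n then complex_of_real (2 * pi * (cmod (a m))\<^sup>2) else 0)) {0..2 * pi}" for m n
  proof (cases "m = n")
    case True
    have "((\<lambda>y. a m * cnj (a m)) has_integral (2 * pi - 0) *\<^sub>R (a m * cnj (a m))) {0..2 * pi}"
      using has_integral_const_real[of "a m * cnj (a m)" 0 "2 * pi"] by simp
    then show ?thesis using True by (simp add: complex_norm_square[symmetric] scaleR_conv_of_real)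
  next
    case False
    then show ?thesis using has_integral_mult_right[OF exp_orthogonal[OF False], of "a m * cnj (a n)"] by simp
  qed
  have "((\<lambda>y. complex_of_real ((cmod (\<Sum>n\<in>X. a n * cis (real_of_int n * y)))\<^sup>2)) has_integral
      (\<Sum>m\<in>X. \<Sum>n\<in>X. if m = n then complex_of_real (2 * pi * (cmod (a m))\<^sup>2) else 0)) {0..2 * pi}"
    unfolding eq using assms by (intro has_integral_sum one) auto
  also have "(\<Sum>m\<in>X. \<Sum>n\<in>X. if m = n then complex_of_real (2 * pi * (cmod (a m))\<^sup>2) else 0)
      = complex_of_real (2 * pi * (\<Sum>n\<in>X. (cmod (a n))\<^sup>2))"
    using assms by (simp add: sum_distrib_left)
  finally have "((\<lambda>y. complex_of_real ((cmod (\<Sum>n\<in>X. a n * cis (real_of_int n * y)))\<^sup>2)) has_integral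
      complex_of_real (2 * pi * (\<Sum>n\<in>X. (cmod (a n))\<^sup>2))) {0..2 * pi}" .
  from has_integral_Re[OF this] show ?thesis by (simp only: Re_complex_of_real)
qed

text \<open>For finite sums the integral is computed by orthogonality; absolutely summable coefficients make
  the convergence uniform, so that the integrals converge along with the sums of squares.\<close>

lemma parseval_cis:
  fixes a :: "int \<Rightarrow> complex"
  assumes "(\<lambda>n. cmod (a n)) summable_on UNIV"
    and f: "\<And>y. ((\<lambda>n. a n * cis (real_of_int n * y)) has_sum f y) UNIV"
  shows "\<exists>s. ((\<lambda>n. (cmod (a n))\<^sup>2) has_sum s) UNIV \<and>
    ((\<lambda>y. (cmod (f y))\<^sup>2) has_integral 2 * pi * s) {0..2 * pi}"
proof -
  let ?F = "finite_subsets_at_top (UNIV :: int set)"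
  let ?p = "\<lambda>X y. \<Sum>n\<in>X. a n * cis (real_of_int n * y)"
  have ul: "uniform_limit {0..2*pi} ?p f ?F"
    by (rule Weierstrass_m_test_general'[OF _ f assms(1)]) (simp add: norm_mult)
  have cf: "continuous_on {0..2*pi} f"
    by (rule uniform_limit_theorem[OF _ ul])
       (auto intro!: always_eventually continuous_intros)
  then have bf: "bounded (f ` {0..2*pi})"
    by (intro compact_imp_bounded compact_continuous_image) auto
  have ul2: "uniform_limit {0..2*pi} (\<lambda>X y. cnj (?p X y)) (\<lambda>y. cnj (f y)) ?F"
    by (rule bounded_linear.uniform_limit[OF bounded_linear_cnj ul])
  have bf2: "bounded ((\<lambda>y. cnj (f y)) ` {0..2*pi})"
    using bf unfolding bounded_iff by auto
  have "uniform_limit {0..2*pi} (\<lambda>X y. ?p X y * cnj (?p X y)) (\<lambda>y. f y * cnj (f y)) ?F"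
    by (rule uniform_lim_mult[OF ul ul2 bf bf2])
  then obtain I J where I: "\<And>X. ((\<lambda>y. ?p X y * cnj (?p X y)) has_integral I X) {0..2*pi}"
      and J: "((\<lambda>y. f y * cnj (f y)) has_integral J) {0..2*pi}" and IJ: "(I \<longlongrightarrow> J) ?F"
    by (rule uniform_limit_integral) (auto intro!: continuous_intros)
  have Ieq: "Re (I X) = 2 * pi * (\<Sum>n\<in>X. (cmod (a n))\<^sup>2)" if "finite X" for X
    using has_integral_unique[OF has_integral_Re[OF I[of X]]] norm_sum_cis_integral[OF that, of a]
    by (simp only: complex_norm_square[symmetric] Re_complex_of_real)
  have "((\<lambda>X. Re (I X)) \<longlongrightarrow> Re J) ?F" by (rule tendsto_Re[OF IJ])
  then have "((\<lambda>X. 2 * pi * (\<Sum>n\<in>X. (cmod (a n))\<^sup>2)) \<longlongrightarrow> Re J) ?F"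
    by (rule Lim_transform_eventually)
       (auto intro!: eventually_finite_subsets_at_top_weakI simp: Ieq)
  from tendsto_mult[OF tendsto_const[of "1 / (2 * pi)"] this]
  have "((\<lambda>n. (cmod (a n))\<^sup>2) has_sum (Re J / (2 * pi))) UNIV"
    by (simp add: has_sum_def)
  moreover have "((\<lambda>y. (cmod (f y))\<^sup>2) has_integral 2 * pi * (Re J / (2 * pi))) {0..2 * pi}"
    using has_integral_Re[OF J] by (simp add: complex_norm_square[symmetric] del: of_real_power)
  ultimately show ?thesis by blast
qed

text \<open>On the line \<open>Re \<zeta> = x\<close> the series is, up to the unimodular factor \<open>exp (i \<sigma> y)\<close>, the Fourier series
  with coefficients \<open>c\<^sub>n exp ((n + \<sigma>) x)\<close>.\<close>

lemma exp_series_parseval: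
  assumes "rapid c"
  shows "\<exists>s. ((\<lambda>n. (cmod (c n) * exp ((of_int n + \<sigma>) * x))\<^sup>2) has_sum s) UNIV \<and>
    ((\<lambda>y. (cmod (exp_series \<sigma> c (Complex x y)))\<^sup>2) has_integral 2 * pi * s) {0..2 * pi}"
proof -
  define a where "a = (\<lambda>n. c n * of_real (exp ((of_int n + \<sigma>) * x)))"
  have summand: "c n * exp (of_real (of_int n + \<sigma>) * Complex x y) = cis (\<sigma> * y) * (a n * cis (real_of_int n * y))" for n y
  proof -
    have "of_real (of_int n + \<sigma>) * Complex x y = Complex ((of_int n + \<sigma>) * x) ((of_int n + \<sigma>) * y)"
      by (simp add: complex_eq_iff)
    then show ?thesis
      by (simp add: a_def exp_eq_polar cis_mult distrib_left mult_ac add_ac)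
  qed
  have ca: "cmod (a n) = cmod (c n) * exp ((of_int n + \<sigma>) * x)" for n
    by (simp add: a_def norm_mult)
  have "((\<lambda>n. a n * cis (real_of_int n * y)) has_sum (cis (- \<sigma> * y) * exp_series \<sigma> c (Complex x y))) UNIV" for y
    using has_sum_cmult_right[OF exp_series_has_sum[OF assms, of \<sigma> "Complex x y"], of "cis (- \<sigma> * y)"]
    unfolding summand by (simp add: mult.assoc[symmetric] cis_mult)
  moreover have "(\<lambda>n. cmod (a n)) summable_on UNIV"
    using exp_series_abs_summable[OF assms, of \<sigma> "Complex x 0"] unfolding summand
    by (simp add: norm_mult)
  ultimately obtain s where "((\<lambda>n. (cmod (a n))\<^sup>2) has_sum s) UNIV"
    "((\<lambda>y. (cmod (cis (- \<sigma> * y) * exp_series \<sigma> c (Complex x y)))\<^sup>2) has_integral 2 * pi * s) {0..2 * pi}"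
    using parseval_cis[of a "\<lambda>y. cis (- \<sigma> * y) * exp_series \<sigma> c (Complex x y)"] by blast
  then show ?thesis by (auto simp: ca norm_mult)
qed

lemma exp_series_add: "rapid c \<Longrightarrow> rapid d \<Longrightarrow> exp_series \<sigma> (\<lambda>n. c n + d n) \<zeta> = exp_series \<sigma> c \<zeta> + exp_series \<sigma> d \<zeta>"
  using has_sum_add[OF exp_series_has_sum[of c \<sigma> \<zeta>] exp_series_has_sum[of d \<sigma> \<zeta>]]
    exp_series_has_sum[OF rapid_add[of c d], of \<sigma> \<zeta>]
  by (simp add: distrib_right has_sum_unique)

lemma exp_series_scale: "exp_series \<sigma> (\<lambda>n. a * c n) \<zeta> = a * exp_series \<sigma> c \<zeta>"
  unfolding exp_series_def by (simp add: mult.assoc infsum_cmult_right')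

lemma exp_series_zero_imp:
  assumes "rapid c" "\<And>\<zeta>. exp_series \<sigma> c \<zeta> = 0"
  shows "c n = 0"
proof -
  obtain s where s: "((\<lambda>n. (cmod (c n) * exp ((of_int n + \<sigma>) * 0))\<^sup>2) has_sum s) UNIV"
    "((\<lambda>y. (cmod (exp_series \<sigma> c (Complex 0 y)))\<^sup>2) has_integral 2 * pi * s) {0..2 * pi}"
    using exp_series_parseval[OF assms(1), of \<sigma> 0] by blast
  have "((\<lambda>y. 0 :: real) has_integral 2 * pi * s) {0..2 * pi}" using s(2) by (simp add: assms(2))
  then have "s = 0" using has_integral_unique[OF _ has_integral_0] by fastforce
  then have "((\<lambda>n. (cmod (c n))\<^sup>2) has_sum 0) UNIV" using s(1) by simp
  then have "(cmod (c n))\<^sup>2 = 0"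
    using nonneg_has_sum_le_0D[where f = "\<lambda>n. (cmod (c n))\<^sup>2" and A = UNIV and x = n] by simp
  then show ?thesis by simp
qed

lemma exp_series_inject:
  assumes "rapid c" "rapid d" "exp_series \<sigma> c = exp_series \<sigma> d"
  shows "c = d"
proof
  fix n
  have "exp_series \<sigma> (\<lambda>n. c n + (-1) * d n) \<zeta> = 0" for \<zeta>
    using assms(3) by (subst exp_series_add[OF assms(1) rapid_scale[OF assms(2)]]) (simp only: exp_series_scale, simp)
  from exp_series_zero_imp[OF rapid_add[OF assms(1) rapid_scale[OF assms(2)]] this, of n]
  show "c n = d n" by simp
qed

section \<open>Laurent series and quasi-periodic entire functions\<close>

definition laurent_coeff :: "(complex \<Rightarrow> complex) \<Rightarrow> int \<Rightarrow> complex" where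
  "laurent_coeff G n = residue (\<lambda>\<xi>. G \<xi> * \<xi> powi (- n - 1)) 0"

lemma laurent_coeff_integral:
  assumes G: "G holomorphic_on - {0}" and "r > 0"
  shows "((\<lambda>\<xi>. G \<xi> * \<xi> powi (- n - 1)) has_contour_integral 2 * pi * \<i> * laurent_coeff G n) (circlepath 0 r)"
  unfolding laurent_coeff_def
  by (rule base_residue[of UNIV]) (use assms in \<open>auto intro!: holomorphic_intros simp: Compl_eq_Diff_UNIV[symmetric]\<close>)

lemma circle_bound:
  assumes G: "G holomorphic_on - {0}" and r: "r > 0"
  shows "\<exists>B\<ge>0. \<forall>\<xi>. cmod \<xi> = r \<longrightarrow> cmod (G \<xi>) \<le> B"
proof -
  have "continuous_on (sphere 0 r) G"
    using r by (intro continuous_on_subset[OF holomorphic_on_imp_continuous_on[OF G]]) auto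
  then have "compact (G ` sphere 0 r)" by (intro compact_continuous_image) auto
  then have "bounded (G ` sphere 0 r)" by (rule compact_imp_bounded)
  then obtain B where "\<forall>x\<in>sphere 0 r. cmod (G x) \<le> B" by (auto simp: bounded_iff)
  then show ?thesis by (intro exI[of _ "\<bar>B\<bar>"]) (auto intro: order_trans[OF _ abs_ge_self])
qed

lemma laurent_coeff_bound:
  assumes G: "G holomorphic_on - {0}" and r: "r > 0"
  shows "\<exists>B\<ge>0. \<forall>n. cmod (laurent_coeff G n) \<le> B * r powi (- n)"
proof -
  obtain B where B: "B \<ge> 0" "\<And>\<xi>. cmod \<xi> = r \<Longrightarrow> cmod (G \<xi>) \<le> B" using circle_bound[OF G r] by blast
  have "cmod (laurent_coeff G n) \<le> B * r powi (- n)" for n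
  proof -
    have "cmod (2 * pi * \<i> * laurent_coeff G n) \<le> (B * r powi (- n - 1)) * (2 * pi * r)"
      by (rule has_contour_integral_bound_circlepath[OF laurent_coeff_integral[OF G r]])
         (use B r in \<open>auto simp: norm_mult norm_power_int intro!: mult_right_mono mult_nonneg_nonneg\<close>)
    also have "\<dots> = 2 * pi * (B * r powi (- n))"
      using r by (simp add: power_int_diff)
    finally show ?thesis by (simp add: norm_mult)
  qed
  then show ?thesis using B(1) by blast
qed

text \<open>The larger circle encloses the singularities 0 and \<open>w\<close> of the integrand, the smaller one only 0; so
  the difference is the residue at \<open>w\<close>.\<close>

lemma annulus_cauchy:
  assumes G: "G holomorphic_on - {0}" and r: "0 < r" "r < cmod w" "cmod w < R"
  obtains I J where "((\<lambda>\<xi>. G \<xi> / (\<xi> - w)) has_contour_integral I) (circlepath 0 R)"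
    "((\<lambda>\<xi>. G \<xi> / (\<xi> - w)) has_contour_integral J) (circlepath 0 r)" "I - J = 2 * pi * \<i> * G w"
proof -
  let ?f = "\<lambda>\<xi>. G \<xi> / (\<xi> - w)"
  have w: "w \<noteq> 0" using r by auto
  have hol: "?f holomorphic_on UNIV - {0, w}"
    by (intro holomorphic_intros holomorphic_on_subset[OF G]) auto
  have "contour_integral (circlepath 0 R) ?f = 2 * pi * \<i> *
      (\<Sum>p\<in>{0, w}. winding_number (circlepath 0 R) p * residue ?f p)"
    by (rule Residue_theorem[OF _ _ _ hol]) (use r in auto)
  also have "\<dots> = 2 * pi * \<i> * (residue ?f 0 + residue ?f w)"
    using r w by (simp add: winding_number_circlepath)
  also have "residue ?f w = G w"
    by (rule residue_simple[of "- {0}"]) (use w G in auto)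
  finally have 1: "contour_integral (circlepath 0 R) ?f = 2 * pi * \<i> * (residue ?f 0 + G w)" .
  have 2: "(?f has_contour_integral contour_integral (circlepath 0 R) ?f) (circlepath 0 R)"
    by (intro has_contour_integral_integral contour_integrable_continuous_circlepath
        continuous_on_subset[OF holomorphic_on_imp_continuous_on[OF hol]]) (use r in auto)
  have 3: "(?f has_contour_integral 2 * pi * \<i> * residue ?f 0) (circlepath 0 r)"
    by (rule base_residue[of "ball 0 (cmod w)"])
       (use r in \<open>auto intro!: holomorphic_on_subset[OF hol]\<close>)
  show ?thesis by (rule that[OF 2 3]) (simp add: 1 algebra_simps)
qed

lemma geometric_tail:
  fixes q :: complex
  assumes "q \<noteq> 1"
  shows "1 / (1 - q) = (\<Sum>n<K. q ^ n) + q ^ K / (1 - q)"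
  using sum_gp_strict[of q K] assms by (simp add: field_simps)

lemma cmod_tendsto_geometric:
  fixes X :: "nat \<Rightarrow> complex"
  assumes "\<And>K. cmod (X K - L) \<le> q ^ K * C" "0 \<le> q" "q < 1"
  shows "X \<longlonglongrightarrow> L"
proof (rule LIM_zero_cancel, rule Lim_null_comparison)
  show "\<forall>\<^sub>F K in sequentially. cmod (X K - L) \<le> q ^ K * C" using assms(1) by simp
  have "(\<lambda>K. q ^ K * C) \<longlonglongrightarrow> 0 * C"
    using assms by (intro tendsto_mult tendsto_const LIMSEQ_power_zero) auto
  then show "(\<lambda>K. q ^ K * C) \<longlonglongrightarrow> 0" by simp
qed

text \<open>On a circle outside \<open>w\<close> the Cauchy kernel is a geometric series in \<open>w / \<xi>\<close>. After \<open>K\<close> terms the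
  remainder is \<open>(w / \<xi>)^K\<close> times the integrand and decays geometrically in \<open>K\<close>.\<close>

lemma laurent_regular_part:
  assumes G: "G holomorphic_on - {0}" and R: "w \<noteq> 0" "cmod w < R"
    and I: "((\<lambda>\<xi>. G \<xi> / (\<xi> - w)) has_contour_integral I) (circlepath 0 R)"
  shows "(\<lambda>n. 2 * pi * \<i> * (laurent_coeff G (int n) * w ^ n)) sums I"
proof -
  have R0: "R > 0" using R by (smt (verit) norm_ge_zero)
  obtain B where B: "B \<ge> 0" "\<And>\<xi>. cmod \<xi> = R \<Longrightarrow> cmod (G \<xi>) \<le> B" using circle_bound[OF G R0] by blast
  let ?q = "cmod w / R" and ?C = "B / (R - cmod w) * (2 * pi * R)"
  let ?S = "\<lambda>K. \<Sum>n<K. 2 * pi * \<i> * (laurent_coeff G (int n) * w ^ n)"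
  have "cmod (?S K - I) \<le> ?q ^ K * ?C" for K
  proof -
    have "((\<lambda>\<xi>. \<Sum>n<K. w ^ n * (G \<xi> * \<xi> powi (- int n - 1))) has_contour_integral
        (\<Sum>n<K. w ^ n * (2 * pi * \<i> * laurent_coeff G (int n)))) (circlepath 0 R)"
      by (intro has_contour_integral_sum has_contour_integral_lmul laurent_coeff_integral[OF G R0]) auto
    from has_contour_integral_diff[OF I this]
    have "((\<lambda>\<xi>. G \<xi> / (\<xi> - w) - (\<Sum>n<K. w ^ n * (G \<xi> * \<xi> powi (- int n - 1)))) has_contour_integral
        (I - ?S K)) (circlepath 0 R)" by (simp add: mult_ac)
    moreover have "cmod (G \<xi> / (\<xi> - w) - (\<Sum>n<K. w ^ n * (G \<xi> * \<xi> powi (- int n - 1)))) \<le> ?q ^ K * (B / (R - cmod w))"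
      if \<xi>: "cmod (\<xi> - 0) = R" for \<xi>
    proof -
      have \<xi>0: "\<xi> \<noteq> 0" "\<xi> \<noteq> w" using \<xi> R R0 by auto
      have t: "w ^ n * (G \<xi> * \<xi> powi (- int n - 1)) = G \<xi> / \<xi> * (w / \<xi>) ^ n" for n
        using \<xi>0 by (simp add: power_int_diff power_int_minus power_divide field_simps)
      have a: "G \<xi> / (\<xi> - w) = G \<xi> / \<xi> * (1 / (1 - w / \<xi>))" using \<xi>0 by (simp add: field_simps)
      have b: "G \<xi> / \<xi> / (1 - w / \<xi>) = G \<xi> / (\<xi> - w)" using \<xi>0 by (simp add: field_simps)
      have "G \<xi> / \<xi> * (1 / (1 - w / \<xi>)) = G \<xi> / \<xi> * (\<Sum>n<K. (w / \<xi>) ^ n) + (w / \<xi>) ^ K * (G \<xi> / \<xi> / (1 - w / \<xi>))"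
        using \<xi>0 by (subst geometric_tail[of _ K]) (auto simp: algebra_simps)
      from trans[OF a this[unfolded b]]
      have "G \<xi> / (\<xi> - w) - (\<Sum>n<K. w ^ n * (G \<xi> * \<xi> powi (- int n - 1))) = (w / \<xi>) ^ K * (G \<xi> / (\<xi> - w))"
        unfolding t sum_distrib_left by (metis add_diff_cancel_left')
      moreover have "cmod (G \<xi> / (\<xi> - w)) \<le> B / (R - cmod w)"
        unfolding norm_divide using B \<xi> R norm_triangle_ineq2[of \<xi> w] by (intro frac_le) auto
      moreover have "cmod ((w / \<xi>) ^ K) = ?q ^ K" using \<xi> by (simp add: norm_power norm_divide)
      ultimately show ?thesis using R0
        by (simp only: norm_mult) (intro mult_left_mono, auto)
    qed
    ultimately have "cmod (I - ?S K) \<le> ?q ^ K * (B / (R - cmod w)) * (2 * pi * R)"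
      using B R R0 by (intro has_contour_integral_bound_circlepath) auto
    then show ?thesis by (simp only: norm_minus_commute mult.assoc)
  qed
  then have "?S \<longlonglongrightarrow> I" by (rule cmod_tendsto_geometric) (use R R0 in auto)
  then show ?thesis by (simp add: sums_def)
qed

text \<open>The same on a circle inside \<open>w\<close>, with a geometric series in \<open>\<xi> / w\<close>.\<close>

lemma laurent_principal_part:
  assumes G: "G holomorphic_on - {0}" and r: "0 < r" "r < cmod w"
    and J: "((\<lambda>\<xi>. G \<xi> / (\<xi> - w)) has_contour_integral J) (circlepath 0 r)"
  shows "(\<lambda>n. 2 * pi * \<i> * (laurent_coeff G (- int (Suc n)) * w powi (- int (Suc n)))) sums (- J)"
proof -
  have w: "w \<noteq> 0" using r by auto
  obtain B where B: "B \<ge> 0" "\<And>\<xi>. cmod \<xi> = r \<Longrightarrow> cmod (G \<xi>) \<le> B" using circle_bound[OF G r(1)] by blast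
  let ?q = "r / cmod w" and ?C = "B / (cmod w - r) * (2 * pi * r)"
  let ?S = "\<lambda>K. \<Sum>n<K. 2 * pi * \<i> * (laurent_coeff G (- int (Suc n)) * w powi (- int (Suc n)))"
  have "cmod (?S K - - J) \<le> ?q ^ K * ?C" for K
  proof -
    have "((\<lambda>\<xi>. \<Sum>n<K. w powi (- int (Suc n)) * (G \<xi> * \<xi> powi (- (- int (Suc n)) - 1))) has_contour_integral
        (\<Sum>n<K. w powi (- int (Suc n)) * (2 * pi * \<i> * laurent_coeff G (- int (Suc n))))) (circlepath 0 r)"
      by (intro has_contour_integral_sum has_contour_integral_lmul laurent_coeff_integral[OF G r(1)]) auto
    from has_contour_integral_add[OF this J]
    have "((\<lambda>\<xi>. (\<Sum>n<K. w powi (- int (Suc n)) * (G \<xi> * \<xi> powi (- (- int (Suc n)) - 1))) + G \<xi> / (\<xi> - w))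
        has_contour_integral (?S K - - J)) (circlepath 0 r)" by (simp add: mult_ac)
    moreover have "cmod ((\<Sum>n<K. w powi (- int (Suc n)) * (G \<xi> * \<xi> powi (- (- int (Suc n)) - 1))) + G \<xi> / (\<xi> - w))
        \<le> ?q ^ K * (B / (cmod w - r))"
      if \<xi>: "cmod (\<xi> - 0) = r" for \<xi>
    proof -
      have \<xi>0: "\<xi> \<noteq> w" using \<xi> r by auto
      have t: "w powi (- int (Suc n)) * (G \<xi> * \<xi> powi (- (- int (Suc n)) - 1)) = G \<xi> / w * (\<xi> / w) ^ n" for n
        using w by (simp add: power_int_minus power_int_diff power_int_add power_divide field_simps)
      have b: "G \<xi> / w / (1 - \<xi> / w) = - (G \<xi> / (\<xi> - w))" using \<xi>0 w by (simp add: divide_simps) (simp add: algebra_simps)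
      then have a: "- (G \<xi> / (\<xi> - w)) = G \<xi> / w * (1 / (1 - \<xi> / w))" by simp
      have "G \<xi> / w * (1 / (1 - \<xi> / w)) = G \<xi> / w * (\<Sum>n<K. (\<xi> / w) ^ n) + (\<xi> / w) ^ K * (G \<xi> / w / (1 - \<xi> / w))"
        using \<xi>0 w by (subst geometric_tail[of _ K]) (auto simp: algebra_simps)
      moreover have "- x = s + q * - x \<Longrightarrow> s + x = q * x" for x s q :: complex
        by algebra
      ultimately have "G \<xi> / w * (\<Sum>n<K. (\<xi> / w) ^ n) + G \<xi> / (\<xi> - w) = (\<xi> / w) ^ K * (G \<xi> / (\<xi> - w))"
        using a unfolding b by metis
      then have "(\<Sum>n<K. w powi (- int (Suc n)) * (G \<xi> * \<xi> powi (- (- int (Suc n)) - 1))) + G \<xi> / (\<xi> - w)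
          = (\<xi> / w) ^ K * (G \<xi> / (\<xi> - w))"
        unfolding t sum_distrib_left .
      moreover have "cmod (G \<xi> / (\<xi> - w)) \<le> B / (cmod w - r)"
        unfolding norm_divide using B \<xi> r norm_triangle_ineq2[of w \<xi>]
        by (intro frac_le) (auto simp: norm_minus_commute)
      moreover have "cmod ((\<xi> / w) ^ K) = ?q ^ K" using \<xi> by (simp add: norm_power norm_divide)
      ultimately show ?thesis using r
        by (simp only: norm_mult) (intro mult_left_mono, auto)
    qed
    ultimately have "cmod (?S K - - J) \<le> ?q ^ K * (B / (cmod w - r)) * (2 * pi * r)"
      using B r by (intro has_contour_integral_bound_circlepath) auto
    then show ?thesis by (simp only: mult.assoc)
  qed
  then have "?S \<longlonglongrightarrow> - J" by (rule cmod_tendsto_geometric) (use r w in auto)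
  then show ?thesis by (simp add: sums_def)
qed

text \<open>Cauchy's estimate is available on all circles: the radius \<open>e\<^sup>R\<close> controls the coefficients of positive
  index, the radius \<open>exp (- R)\<close> those of negative index.\<close>

lemma laurent_coeff_rapid:
  assumes G: "G holomorphic_on - {0}"
  shows "rapid (laurent_coeff G)"
proof (rule rapidI)
  fix R :: real
  obtain B1 where B1: "B1 \<ge> 0" "\<And>n. cmod (laurent_coeff G n) \<le> B1 * exp R powi (- n)"
    using laurent_coeff_bound[OF G, of "exp R"] by auto
  obtain B2 where B2: "B2 \<ge> 0" "\<And>n. cmod (laurent_coeff G n) \<le> B2 * exp (- R) powi (- n)"
    using laurent_coeff_bound[OF G, of "exp (- R)"] by auto
  have pw: "exp x powi n = exp (of_int n * x)" for x :: real and n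
    by (simp add: exp_power_int mult.commute)
  have "cmod (laurent_coeff G n) \<le> (B1 + B2) * exp (- R * real_of_int \<bar>n\<bar>)" for n
  proof (cases "n \<ge> 0")
    case True
    have "cmod (laurent_coeff G n) \<le> B1 * exp (- R * real_of_int \<bar>n\<bar>)"
      using B1(2)[of n] True unfolding pw by (simp add: mult.commute)
    also have "\<dots> \<le> (B1 + B2) * exp (- R * real_of_int \<bar>n\<bar>)"
      using B2(1) by (intro mult_right_mono) auto
    finally show ?thesis .
  next
    case False
    have "cmod (laurent_coeff G n) \<le> B2 * exp (- R * real_of_int \<bar>n\<bar>)"
      using B2(2)[of n] False unfolding pw by (simp add: mult.commute abs_if)
    also have "\<dots> \<le> (B1 + B2) * exp (- R * real_of_int \<bar>n\<bar>)"
      using B1(1) by (intro mult_right_mono) auto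
    finally show ?thesis .
  qed
  then show "\<exists>B. \<forall>n. cmod (laurent_coeff G n) \<le> B * exp (- R * real_of_int \<bar>n\<bar>)" by blast
qed

lemma laurent_expansion_exp:
  assumes G: "G holomorphic_on - {0}"
  shows "G (exp \<zeta>) = exp_series 0 (laurent_coeff G) \<zeta>"
proof -
  let ?w = "exp \<zeta>" and ?c = "laurent_coeff G"
  have w: "cmod ?w > 0" by simp
  obtain I J where IJ: "((\<lambda>\<xi>. G \<xi> / (\<xi> - ?w)) has_contour_integral I) (circlepath 0 (cmod ?w + 1))"
    "((\<lambda>\<xi>. G \<xi> / (\<xi> - ?w)) has_contour_integral J) (circlepath 0 (cmod ?w / 2))" "I - J = 2 * pi * \<i> * G ?w"
    by (rule annulus_cauchy[OF G, of "cmod ?w / 2" ?w "cmod ?w + 1"]) (use w in auto)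
  have pw: "?w powi n = exp (of_real (of_int n + 0) * \<zeta>)" for n
    by (simp add: exp_power_int)
  have abs: "(\<lambda>n. cmod (?c n * ?w powi n)) summable_on UNIV"
    unfolding pw by (rule exp_series_abs_summable[OF laurent_coeff_rapid[OF G]])
  have p: "(\<lambda>n. cmod (?c (int n) * ?w powi (int n))) summable_on UNIV"
    using summable_on_reindex_bij_betw[of int UNIV "range int" "\<lambda>n. cmod (?c n * ?w powi n)"]
      summable_on_subset_banach[OF abs] by (simp add: inj_on_imp_bij_betw)
  have m: "(\<lambda>n. cmod (?c (- int (Suc n)) * ?w powi (- int (Suc n)))) summable_on UNIV"
    using summable_on_reindex_bij_betw[of "\<lambda>n. - int (Suc n)" UNIV "range (\<lambda>n. - int (Suc n))" "\<lambda>n. cmod (?c n * ?w powi n)"]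
      summable_on_subset_banach[OF abs] by (simp add: inj_on_imp_bij_betw inj_on_def)
  have "(\<lambda>n. 2 * pi * \<i> * (?c (int n) * ?w ^ n)) sums I"
    by (rule laurent_regular_part[OF G _ _ IJ(1)]) auto
  from sums_mult[OF this, of "1 / (2 * pi * \<i>)"]
  have "(\<lambda>n. ?c (int n) * ?w powi (int n)) sums (I / (2 * pi * \<i>))" by simp
  then have hp: "((\<lambda>n. ?c (int n) * ?w powi (int n)) has_sum (I / (2 * pi * \<i>))) UNIV"
    by (rule norm_summable_imp_has_sum[OF summable_on_imp_summable[OF p]])
  have "(\<lambda>n. 2 * pi * \<i> * (?c (- int (Suc n)) * ?w powi (- int (Suc n)))) sums (- J)"
    by (rule laurent_principal_part[OF G _ _ IJ(2)]) auto
  from sums_mult[OF this, of "1 / (2 * pi * \<i>)"]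
  have "(\<lambda>n. ?c (- int (Suc n)) * ?w powi (- int (Suc n))) sums (- J / (2 * pi * \<i>))" by simp
  then have hm: "((\<lambda>n. ?c (- int (Suc n)) * ?w powi (- int (Suc n))) has_sum (- J / (2 * pi * \<i>))) UNIV"
    by (rule norm_summable_imp_has_sum[OF summable_on_imp_summable[OF m]])
  have "((\<lambda>n. ?c n * ?w powi n) has_sum (I / (2 * pi * \<i>) + - J / (2 * pi * \<i>))) UNIV"
    by (rule has_sum_int[OF hp hm])
  moreover have "I / (2 * pi * \<i>) + - J / (2 * pi * \<i>) = (I - J) / (2 * pi * \<i>)"
    by (simp add: diff_divide_distrib)
  then have "I / (2 * pi * \<i>) + - J / (2 * pi * \<i>) = G ?w" using IJ(3) by simp
  ultimately have "((\<lambda>n. ?c n * ?w powi n) has_sum G ?w) UNIV" by simp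
  from has_sum_unique[OF this[unfolded pw] exp_series_has_sum[OF laurent_coeff_rapid[OF G]]]
  show ?thesis .
qed

lemma periodic_int:
  assumes "\<And>\<zeta>. F (\<zeta> + 2 * of_real pi * \<i>) = F (\<zeta> :: complex)"
  shows "F (\<zeta> + of_int n * (2 * of_real pi * \<i>)) = F \<zeta>"
proof (induction n arbitrary: \<zeta> rule: int_induct[where k = 0])
  case (step1 i)
  show ?case using step1(2)[of "\<zeta> + 2 * of_real pi * \<i>"] assms[of \<zeta>] by (simp add: algebra_simps)
next
  case (step2 i)
  show ?case using step2(2)[of "\<zeta> - 2 * of_real pi * \<i>"] assms[of "\<zeta> - 2 * of_real pi * \<i>"] by (simp add: algebra_simps)
qed simp

lemma periodic_exp_eq:
  assumes "\<And>\<zeta>. F (\<zeta> + 2 * of_real pi * \<i>) = F (\<zeta> :: complex)" "exp a = exp b"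
  shows "F a = F b"
proof -
  obtain n :: int where "a = b + of_int (2 * n) * pi * \<i>" using assms(2) by (auto simp: exp_eq)
  then have "a = b + of_int n * (2 * of_real pi * \<i>)" by simp
  then show ?thesis using periodic_int[of F, OF assms(1)] by simp
qed

text \<open>Periodicity makes the choice of the logarithm immaterial: near the branch cut of \<open>Ln\<close> the branch
  \<open>Ln (- w) + i\<pi>\<close>, which is holomorphic on the left half-plane, gives the same function.\<close>

lemma holomorphic_periodic_Ln:
  assumes F: "F holomorphic_on UNIV" and per: "\<And>\<zeta>. F (\<zeta> + 2 * of_real pi * \<i>) = F \<zeta>"
  shows "(\<lambda>w. F (Ln w)) holomorphic_on - {0}"
proof -
  have "(\<lambda>w. F (Ln w)) holomorphic_on {w. w \<notin> \<real>\<^sub>\<le>\<^sub>0}"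
    by (rule holomorphic_on_compose_gen[OF _ F, unfolded o_def]) (auto intro!: holomorphic_intros)
  moreover have "(\<lambda>w. F (Ln w)) holomorphic_on {w. Re w < 0}"
  proof (rule holomorphic_transform)
    show "(\<lambda>w. F (Ln (- w) + \<i> * of_real pi)) holomorphic_on {w. Re w < 0}"
      by (rule holomorphic_on_compose_gen[OF _ F, unfolded o_def])
         (auto intro!: holomorphic_intros simp: complex_nonpos_Reals_iff)
    fix w assume "w \<in> {w. Re w < 0}"
    then have "w \<noteq> 0" by auto
    then show "F (Ln (- w) + \<i> * of_real pi) = F (Ln w)"
      by (intro periodic_exp_eq[of F, OF per]) (simp add: exp_add)
  qed
  ultimately have "(\<lambda>w. F (Ln w)) holomorphic_on {w. w \<notin> \<real>\<^sub>\<le>\<^sub>0} \<union> {w. Re w < 0}"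
    by (intro holomorphic_on_Un) (auto simp: open_halfspace_Re_lt Compl_eq[symmetric])
  then show ?thesis
    by (rule holomorphic_on_subset) (auto simp: complex_nonpos_Reals_iff complex_eq_iff)
qed

text \<open>Dividing by \<open>exp (\<sigma> \<zeta>)\<close> leaves a periodic function, that is, a holomorphic function on the punctured
  plane composed with the exponential function.\<close>

lemma quasi_periodic_expansion:
  assumes F: "F holomorphic_on UNIV"
    and per: "\<And>\<zeta>. F (\<zeta> + 2 * of_real pi * \<i>) = exp (2 * of_real pi * \<i> * of_real \<sigma>) * F \<zeta>"
  shows "\<exists>c. rapid c \<and> F = exp_series \<sigma> c"
proof -
  define F0 where "F0 = (\<lambda>\<zeta>. F \<zeta> * exp (- of_real \<sigma> * \<zeta>))"
  have F0: "F0 holomorphic_on UNIV" unfolding F0_def by (intro holomorphic_intros F)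
  have per0: "F0 (\<zeta> + 2 * of_real pi * \<i>) = F0 \<zeta>" for \<zeta>
    unfolding F0_def per by (simp add: exp_add[symmetric] exp_minus field_simps ring_distribs)

  define G where "G = (\<lambda>w. F0 (Ln w))"
  have G: "G holomorphic_on - {0}" unfolding G_def by (rule holomorphic_periodic_Ln[OF F0 per0])
  have "F \<zeta> = exp_series \<sigma> (laurent_coeff G) \<zeta>" for \<zeta>
  proof -
    have "F0 \<zeta> = G (exp \<zeta>)" unfolding G_def by (rule periodic_exp_eq[of F0, OF per0]) simp
    also have "\<dots> = exp_series 0 (laurent_coeff G) \<zeta>" by (rule laurent_expansion_exp[OF G])
    finally have "F0 \<zeta> * exp (of_real \<sigma> * \<zeta>) = exp_series 0 (laurent_coeff G) \<zeta> * exp (of_real \<sigma> * \<zeta>)" by simp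
    also have "\<dots> = exp_series \<sigma> (laurent_coeff G) \<zeta>"
      unfolding exp_series_def by (simp add: infsum_cmult_left'[symmetric] exp_add distrib_right mult.assoc)
    finally show ?thesis by (simp add: F0_def mult.assoc flip: exp_add)
  qed
  then show ?thesis using laurent_coeff_rapid[OF G] by blast
qed

section \<open>Polynomials of diagonal operators\<close>

definition monomial_value :: "('k::finite \<Rightarrow> nat) \<Rightarrow> real^'k \<Rightarrow> complex" where
  "monomial_value m A = (\<Prod>\<mu>\<in>UNIV. of_real (A $ \<mu>) ^ m \<mu>)"

text \<open>A polynomial is written as a list of coefficients with exponents, in which monomials may be
  repeated; sums and products are then concatenation and pairwise products, and like terms are
  collected only once, at the end.\<close>

definition term_list :: "(complex \<times> ('k::finite \<Rightarrow> nat)) list \<Rightarrow> real^'k \<Rightarrow> complex" where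
  "term_list xs A = (\<Sum>(c, m)\<leftarrow>xs. c * monomial_value m A)"

lemma term_list_append: "term_list (xs @ ys) A = term_list xs A + term_list ys A"
  by (simp add: term_list_def)

lemma monomial_value_add: "monomial_value (\<lambda>\<mu>. m \<mu> + m' \<mu>) A = monomial_value m A * monomial_value m' A"
  by (simp add: monomial_value_def power_add prod.distrib)

lemma term_list_mult:
  "term_list [(fst x * fst y, \<lambda>\<mu>. snd x \<mu> + snd y \<mu>). x \<leftarrow> xs, y \<leftarrow> ys] A = term_list xs A * term_list ys A"
proof (induction xs)
  case (Cons x xs)
  have "term_list (map (\<lambda>y. (fst x * fst y, \<lambda>\<mu>. snd x \<mu> + snd y \<mu>)) ys) A
      = fst x * monomial_value (snd x) A * term_list ys A"
    by (induction ys) (auto simp: term_list_def monomial_value_add algebra_simps)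
  then show ?case
    using Cons by (simp add: term_list_append) (simp add: term_list_def case_prod_unfold algebra_simps)
qed (simp add: term_list_def)

lemma real_polynomial_term_list:
  assumes "real_polynomial_function (p :: real^'k::finite \<Rightarrow> real)"
  shows "\<exists>xs. \<forall>A. of_real (p A) = term_list xs A"
  using assms
proof (induction rule: real_polynomial_function.induct)
  case (linear f)
  interpret bounded_linear f by fact
  obtain ks :: "'k list" where "distinct ks" "set ks = UNIV"
    using finite_distinct_list[OF finite] by blast
  have mv: "monomial_value (\<lambda>j. if j = i then 1 else 0) A = of_real (A $ i)" for i and A :: "real^'k"
    by (simp add: monomial_value_def if_distrib[of "\<lambda>e. _ ^ e"] cong: if_cong)
  have "of_real (f A) = term_list (map (\<lambda>i. (of_real (f (axis i 1)), \<lambda>j. if j = i then 1 else 0)) ks) A" for A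
  proof -
    have "f A = f (\<Sum>i\<in>UNIV. (A $ i) *\<^sub>R axis i 1)"
      using basis_expansion[of A] by (simp add: scalar_mult_eq_scaleR)
    also have "\<dots> = (\<Sum>i\<in>UNIV. A $ i * f (axis i 1))" by (simp add: sum scaleR)
    also have "\<dots> = (\<Sum>i\<leftarrow>ks. A $ i * f (axis i 1))"
      using \<open>distinct ks\<close> \<open>set ks = UNIV\<close> by (simp add: sum_list_distinct_conv_sum_set)
    finally have "f A = (\<Sum>i\<leftarrow>ks. A $ i * f (axis i 1))" .
    moreover have "of_real (sum_list (map g zs)) = (\<Sum>i\<leftarrow>zs. of_real (g i) :: complex)" for g :: "'k \<Rightarrow> real" and zs
      by (induction zs) auto
    ultimately show ?thesis
      by (simp add: term_list_def mv o_def mult.commute)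
  qed
  then show ?case by blast
next
  case (const c)
  have "of_real c = term_list [(of_real c, \<lambda>_. 0)] A" for A :: "real^'k"
    by (simp add: term_list_def monomial_value_def)
  then show ?case by blast
next
  case (add f g)
  then show ?case by (metis term_list_append of_real_add)
next
  case (mult f g)
  then show ?case by (metis (no_types, lifting) term_list_mult of_real_mult)
qed

lemma term_list_coeffs:
  "\<exists>a S. finite S \<and> (\<forall>m. m \<notin> S \<longrightarrow> a m = 0) \<and> (\<forall>A. term_list xs A = (\<Sum>m\<in>S. a m * monomial_value m A))"
proof (induction xs)
  case Nil
  show ?case by (intro exI[of _ "\<lambda>_. 0"] exI[of _ "{}"]) (simp add: term_list_def)
next
  case (Cons x xs)
  then obtain a S where a: "finite S" "\<And>m. m \<notin> S \<Longrightarrow> a m = 0"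
      "\<And>A. term_list xs A = (\<Sum>m\<in>S. a m * monomial_value m A)" by blast
  obtain c m where x: "x = (c, m)" by (cases x)
  let ?a = "a(m := a m + c)"
  have "term_list (x # xs) A = (\<Sum>m\<in>insert m S. ?a m * monomial_value m A)" for A
  proof -
    have "(\<Sum>m\<in>insert m S. ?a m * monomial_value m A)
        = ?a m * monomial_value m A + (\<Sum>m'\<in>S - {m}. ?a m' * monomial_value m' A)"
      by (rule sum.insert_remove[OF a(1)])
    also have "(\<Sum>m'\<in>S - {m}. ?a m' * monomial_value m' A) = (\<Sum>m'\<in>S - {m}. a m' * monomial_value m' A)"
      by (intro sum.cong) auto
    also have "?a m * monomial_value m A + \<dots> = c * monomial_value m A + (\<Sum>m\<in>insert m S. a m * monomial_value m A)"
      by (subst sum.insert_remove[OF a(1)]) (simp add: distrib_right)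
    also have "(\<Sum>m\<in>insert m S. a m * monomial_value m A) = (\<Sum>m\<in>S. a m * monomial_value m A)"
      using a(1,2) by (intro sum.mono_neutral_right) auto
    finally show ?thesis using a(3) by (simp add: x term_list_def)
  qed
  then show ?case using a(1,2) by (intro exI[of _ ?a] exI[of _ "insert m S"]) auto
qed

definition complex_polynomial :: "(real^'k::finite \<Rightarrow> complex) \<Rightarrow> bool" where
  "complex_polynomial f \<longleftrightarrow> real_polynomial_function (\<lambda>A. Re (f A)) \<and> real_polynomial_function (\<lambda>A. Im (f A))"

lemma complex_polynomial_of_real: "real_polynomial_function p \<Longrightarrow> complex_polynomial (\<lambda>A. of_real (p A))"
  by (simp add: complex_polynomial_def real_polynomial_function.intros(2))

lemma complex_polynomial_polynomial_function: "polynomial_function M \<Longrightarrow> complex_polynomial M"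
  unfolding polynomial_function_def complex_polynomial_def
  using bounded_linear_Re bounded_linear_Im by (auto simp: o_def)

lemma complex_polynomial_cnj: "complex_polynomial M \<Longrightarrow> complex_polynomial (\<lambda>A. cnj (M A))"
  unfolding complex_polynomial_def by (simp add: real_polynomial_function_minus)

text \<open>Polynomial functions are generated by linear forms and constants, so a monomial expansion exists
  and the choice in \<open>mpoly_coeffs\<close> is a genuine one.\<close>

lemma mpoly_coeffs_spec:
  assumes "complex_polynomial f"
  shows "finite {m. mpoly_coeffs f m \<noteq> 0}"
    "f A = (\<Sum>m | mpoly_coeffs f m \<noteq> 0. mpoly_coeffs f m * (\<Prod>\<mu>\<in>UNIV. of_real (A $ \<mu>) ^ m \<mu>))"
proof -
  obtain xs where xs: "\<And>A. of_real (Re (f A)) = term_list xs A"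
    using real_polynomial_term_list assms unfolding complex_polynomial_def by blast
  obtain ys where ys: "\<And>A. of_real (Im (f A)) = term_list ys A"
    using real_polynomial_term_list assms unfolding complex_polynomial_def by blast
  have iys: "\<i> * term_list ys A = term_list (map (\<lambda>(c, m). (\<i> * c, m)) ys) A" for A
    by (induction ys) (auto simp: term_list_def algebra_simps)
  have f: "f A = term_list (xs @ map (\<lambda>(c, m). (\<i> * c, m)) ys) A" for A
    unfolding term_list_append iys[symmetric] xs[symmetric] ys[symmetric] by (rule complex_eq)
  obtain a S where a: "finite S" "\<And>m. m \<notin> S \<Longrightarrow> a m = 0"
      "\<And>A. f A = (\<Sum>m\<in>S. a m * monomial_value m A)"
    using term_list_coeffs[of "xs @ map (\<lambda>(c, m). (\<i> * c, m)) ys"] unfolding f[symmetric] by blast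
  have sub: "{m. a m \<noteq> 0} \<subseteq> S" using a(2) by auto
  have "f A = (\<Sum>m | a m \<noteq> 0. a m * (\<Prod>\<mu>\<in>UNIV. of_real (A $ \<mu>) ^ m \<mu>))" for A
    unfolding a(3) monomial_value_def using a(1) sub by (intro sum.mono_neutral_right) auto
  then have "\<exists>a. finite {m. a m \<noteq> 0} \<and>
      (\<forall>A. f A = (\<Sum>m | a m \<noteq> 0. a m * (\<Prod>\<mu>\<in>UNIV. of_real (A $ \<mu>) ^ m \<mu>)))"
    using finite_subset[OF sub a(1)] by blast
  from someI_ex[OF this]
  show "finite {m. mpoly_coeffs f m \<noteq> 0}"
    "f A = (\<Sum>m | mpoly_coeffs f m \<noteq> 0. mpoly_coeffs f m * (\<Prod>\<mu>\<in>UNIV. of_real (A $ \<mu>) ^ m \<mu>))"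
    unfolding mpoly_coeffs_def by blast+
qed

context l2_model begin

abbreviation diagonal :: "('x fn \<Rightarrow> 'x fn) \<Rightarrow> ('i \<Rightarrow> complex) \<Rightarrow> bool" where
  "diagonal T a \<equiv> weighted_shift T (\<lambda>n. n) a"

lemma diagonalI: "(\<And>u. u \<in> P \<Longrightarrow> T u \<in> P) \<Longrightarrow> (\<And>u n. u \<in> P \<Longrightarrow> N (T u) n = a n * N u n) \<Longrightarrow> diagonal T a"
  by (simp add: weighted_shift_def bij_def)

lemma diagonal_comp:
  assumes "diagonal S a" "diagonal T b"
  shows "diagonal (S \<circ> T) (\<lambda>n. a n * b n)"
  by (rule diagonalI)
     (simp_all add: weighted_shiftD(2,3)[OF assms(1)] weighted_shiftD(2,3)[OF assms(2)])

lemma diagonal_id: "diagonal id (\<lambda>n. 1)"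
  by (rule diagonalI) simp_all

lemma diagonal_funpow:
  assumes "diagonal T a"
  shows "diagonal (T ^^ k) (\<lambda>n. a n ^ k)"
  by (induction k) (simp_all add: diagonal_id[unfolded id_def] diagonal_comp[OF assms, unfolded o_def] diagonal_id diagonal_comp[OF assms])

lemma diagonal_monomial_op:
  fixes T :: "'k::finite \<Rightarrow> 'x fn \<Rightarrow> 'x fn"
  assumes "\<And>\<mu>. diagonal (T \<mu>) (a \<mu>)"
  shows "diagonal (monomial_op T m) (\<lambda>n. \<Prod>\<mu>\<in>UNIV. a \<mu> n ^ m \<mu>)"
proof -
  have foldr_step: "foldr (\<lambda>\<mu> S. (T \<mu> ^^ m \<mu>) \<circ> S) (\<mu> # xs) id
      = (T \<mu> ^^ m \<mu>) \<circ> foldr (\<lambda>\<mu> S. (T \<mu> ^^ m \<mu>) \<circ> S) xs id" for \<mu> xs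
    by simp
  have fold: "diagonal (foldr (\<lambda>\<mu> S. (T \<mu> ^^ m \<mu>) \<circ> S) xs id) (\<lambda>n. \<Prod>\<mu>\<leftarrow>xs. a \<mu> n ^ m \<mu>)" for xs
  proof (induction xs)
    case Nil
    have "foldr (\<lambda>\<mu> S. (T \<mu> ^^ m \<mu>) \<circ> S) [] id = id" by simp
    then show ?case using diagonal_id by (simp only: list.map prod_list.Nil)
  next
    case (Cons \<mu> xs)
    show ?case
      using diagonal_comp[OF diagonal_funpow[OF assms[of \<mu>], of "m \<mu>"] Cons.IH]
      unfolding list.map prod_list.Cons foldr_step .
  qed
  define xs where "xs = (SOME xs. distinct xs \<and> set xs = (UNIV :: 'k set))"
  have xs: "distinct xs" "set xs = UNIV"
    using someI_ex[OF finite_distinct_list[OF finite, of "UNIV :: 'k set"]]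
    unfolding xs_def by (simp_all only: conj_commute[of "distinct _"])
  have "(\<Prod>\<mu>\<leftarrow>xs. a \<mu> n ^ m \<mu>) = (\<Prod>\<mu>\<in>UNIV. a \<mu> n ^ m \<mu>)" for n
    using prod.distinct_set_conv_list[OF xs(1), of "\<lambda>\<mu>. a \<mu> n ^ m \<mu>"] xs(2) by simp
  then show ?thesis
    using fold[of xs] by (simp add: monomial_op_def xs_def[symmetric])
qed

text \<open>On the \<open>n\<close>-th coefficient the operators act as the numbers \<open>\<alpha> n $ \<mu>\<close>, so a polynomial of them acts
  as its value at the point \<open>\<alpha> n\<close>.\<close>

lemma diagonal_poly_op:
  fixes \<alpha> :: "'i \<Rightarrow> real^'k::finite"
  assumes T: "\<And>\<mu>. diagonal (T \<mu>) (\<lambda>n. of_real (\<alpha> n $ \<mu>))" and f: "complex_polynomial f"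
  shows "diagonal (poly_op f T) (\<lambda>n. f (\<alpha> n))"
proof (rule diagonalI)
  fix u assume u: "u \<in> P"
  note M = diagonal_monomial_op[of T "\<lambda>\<mu> n. of_real (\<alpha> n $ \<mu>)", OF T]
  note S = mpoly_coeffs_spec[OF f]
  have MP: "monomial_op T m u \<in> P" for m by (rule weighted_shiftD(2)[OF M u])
  show "poly_op f T u \<in> P"
    unfolding poly_op_def by (rule P_sum[OF S(1)]) (rule MP)
  fix n
  have "N (poly_op f T u) n = (\<Sum>m | mpoly_coeffs f m \<noteq> 0. mpoly_coeffs f m * N (monomial_op T m u) n)"
    unfolding poly_op_def using N_sum[OF S(1), of "\<lambda>m. monomial_op T m u" "mpoly_coeffs f"] MP by simp
  also have "\<dots> = f (\<alpha> n) * N u n"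
    unfolding S(2)[of "\<alpha> n"] weighted_shiftD(3)[OF M u] by (simp add: sum_distrib_right mult.assoc)
  finally show "N (poly_op f T u) n = f (\<alpha> n) * N u n" .
qed

lemma diagonal_poly_op1:
  assumes T: "diagonal T (\<lambda>n. of_real (a n))" and f: "real_polynomial_function f"
  shows "diagonal (poly_op1 f T) (\<lambda>n. of_real (f (a n)))"
proof -
  obtain b k where b: "f = (\<lambda>x. \<Sum>i\<le>k. b i * x ^ i)"
    using f real_polynomial_function_iff_sum by blast
  define q where "q = (\<Sum>i\<le>k. monom (b i) i)"
  have q: "poly q t = f t" for t by (simp add: q_def b poly_sum poly_monom)
  \<comment> \<open>a real polynomial is determined by its values\<close>
  have the: "(THE p. \<forall>t. poly p t = f t) = q"
    by (rule the_equality) (auto simp: q intro!: poly_ext)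
  show ?thesis
  proof (rule diagonalI)
    fix u assume u: "u \<in> P"
    note M = diagonal_funpow[OF T]
    have MP: "(T ^^ i) u \<in> P" for i by (rule weighted_shiftD(2)[OF M u])
    have eq: "poly_op1 f T u = (\<lambda>x. \<Sum>i\<le>degree q. of_real (coeff q i) * (T ^^ i) u x)"
      by (simp add: poly_op1_def the)
    show "poly_op1 f T u \<in> P"
      unfolding eq by (rule P_sum[OF finite_atMost]) (rule MP)
    fix n
    have "N (poly_op1 f T u) n = (\<Sum>i\<le>degree q. of_real (coeff q i) * N ((T ^^ i) u) n)"
      unfolding eq using N_sum[OF finite_atMost, of _ "\<lambda>i. (T ^^ i) u" "\<lambda>i. of_real (coeff q i)"] MP by simp
    also have "\<dots> = of_real (f (a n)) * N u n"
      unfolding q[of "a n", symmetric] weighted_shiftD(3)[OF M u] poly_altdef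
      by (simp add: sum_distrib_right mult.assoc)
    finally show "N (poly_op1 f T u) n = of_real (f (a n)) * N u n" .
  qed
qed

end

section \<open>Integration against the Gaussian weight on the strip\<close>

lemma nn_integral_count_space_has_sum:
  fixes f :: "'i \<Rightarrow> real"
  assumes "\<And>n. 0 \<le> f n" "(f has_sum s) UNIV"
  shows "(\<integral>\<^sup>+n. ennreal (f n) \<partial>count_space UNIV) = ennreal s"
proof -
  have "(\<lambda>n. norm (f n)) summable_on UNIV" using assms has_sum_imp_summable[OF assms(2)] by simp
  then have a: "Infinite_Set_Sum.abs_summable_on f UNIV" by (simp only: abs_summable_equivalent)
  have "s = infsetsum f UNIV" unfolding infsetsum_infsum[OF a] by (rule infsumI[OF assms(2), symmetric])
  moreover have "integrable (count_space UNIV) f" using a by (simp add: Infinite_Set_Sum.abs_summable_on_def)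
  ultimately show ?thesis
    using nn_integral_eq_integral[of "count_space UNIV" f] assms(1)
    by (simp add: infsetsum_def)
qed

lemma summable_on_iff_nn_integral_count_space:
  fixes f :: "'i \<Rightarrow> real"
  assumes "\<And>n. 0 \<le> f n"
  shows "f summable_on UNIV \<longleftrightarrow> (\<integral>\<^sup>+n. ennreal (f n) \<partial>count_space UNIV) < \<infinity>"
proof -
  have "f summable_on UNIV \<longleftrightarrow> (\<lambda>n. norm (f n)) summable_on UNIV" using assms by simp
  also have "\<dots> \<longleftrightarrow> Infinite_Set_Sum.abs_summable_on f UNIV" by (rule abs_summable_equivalent)
  also have "\<dots> \<longleftrightarrow> (\<integral>\<^sup>+n. ennreal (f n) \<partial>count_space UNIV) < \<infinity>"
    unfolding Infinite_Set_Sum.abs_summable_on_def using assms by (simp add: integrable_iff_bounded)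
  finally show ?thesis .
qed

lemma lborel_complex: "(lborel :: complex measure) = distr (lborel \<Otimes>\<^sub>M lborel) borel (\<lambda>(x, y). Complex x y)"
proof (rule lborel_eqI)
  have m [measurable]: "(\<lambda>(x, y). Complex x y) \<in> borel_measurable (borel \<Otimes>\<^sub>M borel)"
    unfolding borel_prod by (intro borel_measurable_continuous_onI) (auto simp: case_prod_unfold intro!: continuous_intros)
  fix l u :: complex assume le: "\<And>b. b \<in> Basis \<Longrightarrow> l \<bullet> b \<le> u \<bullet> b"
  have le': "Re l \<le> Re u" "Im l \<le> Im u" using le[of 1] le[of \<i>] by (auto simp: Basis_complex_def)
  have "(\<lambda>(x, y). Complex x y) -` box l u \<inter> space (lborel \<Otimes>\<^sub>M lborel) = {Re l<..<Re u} \<times> {Im l<..<Im u}"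
    by (auto simp: box_def Basis_complex_def space_pair_measure)
  then have "emeasure (distr (lborel \<Otimes>\<^sub>M lborel) borel (\<lambda>(x, y). Complex x y)) (box l u)
      = emeasure (lborel \<Otimes>\<^sub>M lborel) ({Re l<..<Re u} \<times> {Im l<..<Im u})"
    by (subst emeasure_distr) (auto simp: measurable_lborel1)
  also have "\<dots> = ennreal (Re u - Re l) * ennreal (Im u - Im l)"
    using le' by (subst lborel.emeasure_pair_measure_Times) auto
  also have "\<dots> = ennreal (\<Prod>b\<in>Basis. (u - l) \<bullet> b)"
    using le' by (simp add: Basis_complex_def ennreal_mult)
  finally show "emeasure (distr (lborel \<Otimes>\<^sub>M lborel) borel (\<lambda>(x, y). Complex x y)) (box l u)
      = ennreal (\<Prod>b\<in>Basis. (u - l) \<bullet> b)" .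
qed simp

lemma nn_integral_lborel_complex:
  assumes [measurable]: "f \<in> borel_measurable borel"
  shows "(\<integral>\<^sup>+z. f z \<partial>(lborel :: complex measure)) = (\<integral>\<^sup>+x. \<integral>\<^sup>+y. f (Complex x y) \<partial>lborel \<partial>lborel)"
proof -
  have m [measurable]: "(\<lambda>(x, y). Complex x y) \<in> borel_measurable (borel \<Otimes>\<^sub>M borel)"
    unfolding borel_prod by (intro borel_measurable_continuous_onI) (auto simp: case_prod_unfold intro!: continuous_intros)
  have m2 [measurable]: "(\<lambda>p. f (Complex (fst p) (snd p))) \<in> borel_measurable (lborel \<Otimes>\<^sub>M lborel)"
    using measurable_compose[OF m assms] by (simp add: case_prod_unfold cong: measurable_cong_sets)
  have "(\<integral>\<^sup>+z. f z \<partial>(lborel :: complex measure)) = (\<integral>\<^sup>+p. f (Complex (fst p) (snd p)) \<partial>(lborel \<Otimes>\<^sub>M lborel))"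
    by (subst lborel_complex, subst nn_integral_distr) (auto simp: case_prod_unfold)
  also have "\<dots> = (\<integral>\<^sup>+x. \<integral>\<^sup>+y. f (Complex x y) \<partial>lborel \<partial>lborel)"
    using lborel.nn_integral_fst[OF m2] by simp
  finally show ?thesis .
qed

text \<open>The density of the measure of \<open>L\<close> with respect to \<open>|d zbar \<and> dz|\<close> on the strip, which depends on the
  real part only.\<close>

definition gauss_weight :: "real \<Rightarrow> real \<Rightarrow> real" where
  "gauss_weight h x = exp (- (2 * x - h)\<^sup>2 / (4 * h)) / (4 * pi * sqrt (pi * h))"

lemma gauss_weight_pos: "h > 0 \<Longrightarrow> gauss_weight h x > 0"
  by (simp add: gauss_weight_def)

lemma borel_measurable_gauss_weight [measurable]: "gauss_weight h \<in> borel_measurable borel"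
  unfolding gauss_weight_def by measurable

lemma nn_integral_L_measure:
  assumes h: "h > 0" and [measurable]: "f \<in> borel_measurable borel"
  shows "(\<integral>\<^sup>+z. f z \<partial>L_measure h)
    = (\<integral>\<^sup>+x. ennreal (2 * gauss_weight h x) * (\<integral>\<^sup>+y. indicator {0..2 * pi} y * f (Complex x y) \<partial>lborel) \<partial>lborel)"
proof -
  let ?S = "{z. 0 < Im z \<and> Im z < 2 * pi}"
  have [measurable]: "?S \<in> sets borel"
    by (intro borel_open open_Collect_conj open_Collect_less continuous_intros)
  have [measurable]: "(\<lambda>z. gauss_weight h (Re z)) \<in> borel_measurable borel"
    by (rule measurable_compose[OF borel_measurable_Re borel_measurable_gauss_weight])
  have [measurable]: "(\<lambda>y. f (Complex x y)) \<in> borel_measurable borel" for x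
    by (rule measurable_compose[OF borel_measurable_continuous_onI assms(2)]) (auto intro!: continuous_intros)
  have "(\<integral>\<^sup>+z. f z \<partial>L_measure h)
      = (\<integral>\<^sup>+z. (2 * indicator ?S z) * (ennreal (gauss_weight h (Re z)) * f z) \<partial>lborel)"
    unfolding L_measure_def strip_measure_def gauss_weight_def[symmetric]
    by (subst nn_integral_density, simp, simp, subst nn_integral_density) simp_all
  also have "\<dots> = (\<integral>\<^sup>+x. \<integral>\<^sup>+y. (2 * indicator ?S (Complex x y)) * (ennreal (gauss_weight h x) * f (Complex x y)) \<partial>lborel \<partial>lborel)"
    by (subst nn_integral_lborel_complex) simp_all
  also have "\<dots> = (\<integral>\<^sup>+x. ennreal (2 * gauss_weight h x) * (\<integral>\<^sup>+y. indicator {0..2 * pi} y * f (Complex x y) \<partial>lborel) \<partial>lborel)"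
  proof (rule nn_integral_cong)
    fix x
    \<comment> \<open>the strip is open, while the integral in \<open>y\<close> extends over the closed interval\<close>
    have "AE y in lborel. y \<noteq> 0 \<and> y \<noteq> 2 * pi"
      using AE_lborel_singleton[of "0::real"] AE_lborel_singleton[of "2 * pi"] by eventually_elim simp
    then have "AE y in lborel. (2 * indicator ?S (Complex x y)) * (ennreal (gauss_weight h x) * f (Complex x y))
       = ennreal (2 * gauss_weight h x) * (indicator {0..2 * pi} y * f (Complex x y))"
      by eventually_elim (use gauss_weight_pos[OF h, of x] in \<open>auto simp: indicator_def ennreal_mult mult_ac\<close>)
    then have "(\<integral>\<^sup>+y. (2 * indicator ?S (Complex x y)) * (ennreal (gauss_weight h x) * f (Complex x y)) \<partial>lborel)
       = (\<integral>\<^sup>+y. ennreal (2 * gauss_weight h x) * (indicator {0..2 * pi} y * f (Complex x y)) \<partial>lborel)"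
      by (rule nn_integral_cong_AE)
    then show "(\<integral>\<^sup>+y. (2 * indicator ?S (Complex x y)) * (ennreal (gauss_weight h x) * f (Complex x y)) \<partial>lborel)
       = ennreal (2 * gauss_weight h x) * (\<integral>\<^sup>+y. indicator {0..2 * pi} y * f (Complex x y) \<partial>lborel)"
      by (simp add: nn_integral_cmult)
  qed
  finally show ?thesis .
qed

text \<open>Completing the square turns the integrand into a multiple of the density of the normal
  distribution with mean \<open>h/2 + \<nu>h\<close> and variance \<open>h/2\<close>.\<close>

lemma gauss_moment:
  assumes h: "h > 0"
  shows "(\<integral>\<^sup>+x. ennreal (4 * pi * gauss_weight h x * exp (2 * \<nu> * x)) \<partial>lborel) = ennreal (exp (h * (\<nu>\<^sup>2 + \<nu>)))"
proof -
  let ?m = "h / 2 + \<nu> * h" and ?s = "sqrt (h / 2)"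
  have eq: "4 * pi * gauss_weight h x * exp (2 * \<nu> * x) = exp (h * (\<nu>\<^sup>2 + \<nu>)) * normal_density ?m ?s x" for x
  proof -
    have "- (2 * x - h)\<^sup>2 / (4 * h) + 2 * \<nu> * x = h * (\<nu>\<^sup>2 + \<nu>) + (- (x - ?m)\<^sup>2 / h)"
      using h by (simp add: field_simps power2_eq_square)
    then have "exp (- (2 * x - h)\<^sup>2 / (4 * h)) * exp (2 * \<nu> * x) = exp (h * (\<nu>\<^sup>2 + \<nu>)) * exp (- (x - ?m)\<^sup>2 / h)"
      by (simp only: exp_add[symmetric])
    then show ?thesis
      using h by (simp add: gauss_weight_def normal_density_def field_simps)
  qed
  have "(\<integral>\<^sup>+x. ennreal (normal_density ?m ?s x) \<partial>lborel) = ennreal 1"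
    using h by (subst nn_integral_eq_integral) (auto intro: integrable_normal_density)
  then show ?thesis
    unfolding eq by (simp add: ennreal_mult nn_integral_cmult)
qed

lemma exp_series_cnj: "cnj (exp_series \<sigma> c \<zeta>) = exp_series \<sigma> (\<lambda>n. cnj (c n)) (cnj \<zeta>)"
  unfolding exp_series_def by (simp add: exp_cnj flip: infsum_cnj)

lemma rapid_cnj: "rapid c \<Longrightarrow> rapid (\<lambda>n. cnj (c n))"
  by (simp add: rapid_def)

text \<open>Parseval is applied in the imaginary direction on each vertical line, and then, after exchanging
  sum and integral, the Gaussian moment in the real direction for each exponent.\<close>

lemma nn_integral_exp_series:
  assumes h: "h > 0" and c: "rapid c"
  shows "(\<integral>\<^sup>+z. ennreal ((cmod (exp_series \<sigma> c (cnj z)))\<^sup>2) \<partial>L_measure h)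
    = (\<integral>\<^sup>+n. ennreal ((cmod (c n))\<^sup>2 * exp (h * ((of_int n + \<sigma>)\<^sup>2 + (of_int n + \<sigma>)))) \<partial>count_space UNIV)"
proof -
  let ?t = "\<lambda>n x. (cmod (c n))\<^sup>2 * exp (2 * (of_int n + \<sigma>) * x)"
  have cont: "continuous_on UNIV (\<lambda>z. (cmod (exp_series \<sigma> c (cnj z)))\<^sup>2)"
    by (intro continuous_intros continuous_on_compose2[OF exp_series_continuous[OF c, of UNIV]]) auto
  have meas: "(\<lambda>z. ennreal ((cmod (exp_series \<sigma> c (cnj z)))\<^sup>2)) \<in> borel_measurable borel"
    using borel_measurable_continuous_onI[OF cont] by simp
  have inner: "(\<integral>\<^sup>+y. indicator {0..2 * pi} y * ennreal ((cmod (exp_series \<sigma> c (cnj (Complex x y))))\<^sup>2) \<partial>lborel)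
      = ennreal (2 * pi) * (\<integral>\<^sup>+n. ennreal (?t n x) \<partial>count_space UNIV)" for x
  proof -
    have sq: "(cmod (c n) * exp ((of_int n + \<sigma>) * x))\<^sup>2 = ?t n x" for n
      by (simp add: power_mult_distrib exp_double[symmetric] mult.assoc)
    have cm: "cmod (exp_series \<sigma> c (cnj (Complex x y))) = cmod (exp_series \<sigma> (\<lambda>n. cnj (c n)) (Complex x y))" for y
      using arg_cong[OF exp_series_cnj[of \<sigma> c "cnj (Complex x y)"], of cmod] by simp
    obtain s where s: "((\<lambda>n. ?t n x) has_sum s) UNIV"
        "((\<lambda>y. (cmod (exp_series \<sigma> c (cnj (Complex x y))))\<^sup>2) has_integral 2 * pi * s) {0..2 * pi}"
      using exp_series_parseval[OF rapid_cnj[OF c], of \<sigma> x] unfolding complex_mod_cnj sq cm[symmetric] by blast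
    have s0: "s \<ge> 0" by (rule has_sum_nonneg[OF s(1)]) simp
    have "(\<integral>\<^sup>+y. ennreal ((cmod (exp_series \<sigma> c (cnj (Complex x y))))\<^sup>2) * indicator {0..2 * pi} y \<partial>lborel) = ennreal (2 * pi * s)"
      by (rule nn_integral_has_integral_lebesgue'[OF _ s(2)]) simp
    moreover have "(\<integral>\<^sup>+n. ennreal (?t n x) \<partial>count_space UNIV) = ennreal s"
      by (rule nn_integral_count_space_has_sum[OF _ s(1)]) simp
    ultimately show ?thesis using s0
      by (simp add: ennreal_mult mult.commute)
  qed
  have "(\<integral>\<^sup>+z. ennreal ((cmod (exp_series \<sigma> c (cnj z)))\<^sup>2) \<partial>L_measure h)
     = (\<integral>\<^sup>+x. (\<integral>\<^sup>+n. ennreal (4 * pi * gauss_weight h x) * ennreal (?t n x) \<partial>count_space UNIV) \<partial>lborel)"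
    unfolding nn_integral_L_measure[OF h meas] inner
  proof (rule nn_integral_cong)
    fix x
    have "ennreal (4 * pi * gauss_weight h x) = ennreal (2 * gauss_weight h x) * ennreal (2 * pi)"
      using gauss_weight_pos[OF h, of x] by (simp add: ennreal_mult'[symmetric] mult_ac)
    moreover have "(\<integral>\<^sup>+n. ennreal (4 * pi * gauss_weight h x) * ennreal (?t n x) \<partial>count_space UNIV)
        = ennreal (4 * pi * gauss_weight h x) * (\<integral>\<^sup>+n. ennreal (?t n x) \<partial>count_space UNIV)"
      by (rule nn_integral_cmult) simp
    ultimately show "ennreal (2 * gauss_weight h x) * (ennreal (2 * pi) * (\<integral>\<^sup>+n. ennreal (?t n x) \<partial>count_space UNIV))
        = (\<integral>\<^sup>+n. ennreal (4 * pi * gauss_weight h x) * ennreal (?t n x) \<partial>count_space UNIV)"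
      by (simp only: mult.assoc)
  qed
  also have "\<dots> = (\<integral>\<^sup>+n. (\<integral>\<^sup>+x. ennreal (4 * pi * gauss_weight h x) * ennreal (?t n x) \<partial>lborel) \<partial>count_space UNIV)"
    by (intro nn_integral_count_space_nn_integral) auto
  also have "\<dots> = (\<integral>\<^sup>+n. ennreal ((cmod (c n))\<^sup>2 * exp (h * ((of_int n + \<sigma>)\<^sup>2 + (of_int n + \<sigma>)))) \<partial>count_space UNIV)"
  proof (rule nn_integral_cong)
    fix n
    have "(\<integral>\<^sup>+x. ennreal (4 * pi * gauss_weight h x) * ennreal (?t n x) \<partial>lborel)
        = (\<integral>\<^sup>+x. ennreal ((cmod (c n))\<^sup>2) * ennreal (4 * pi * gauss_weight h x * exp (2 * (of_int n + \<sigma>) * x)) \<partial>lborel)"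
      using gauss_weight_pos[OF h]
      by (intro nn_integral_cong) (simp add: ennreal_mult'[symmetric] mult_ac less_imp_le)
    also have "\<dots> = ennreal ((cmod (c n))\<^sup>2) * ennreal (exp (h * ((of_int n + \<sigma>)\<^sup>2 + (of_int n + \<sigma>))))"
      unfolding gauss_moment[OF h, symmetric] by (rule nn_integral_cmult) simp
    finally show "(\<integral>\<^sup>+x. ennreal (4 * pi * gauss_weight h x) * ennreal (?t n x) \<partial>lborel)
        = ennreal ((cmod (c n))\<^sup>2 * exp (h * ((of_int n + \<sigma>)\<^sup>2 + (of_int n + \<sigma>))))"
      by (simp add: ennreal_mult)
  qed
  finally show ?thesis .
qed

section \<open>The space L in Fourier coefficients\<close>

lemma rapid_gauss:
  assumes a: "a > 0"
  shows "rapid (\<lambda>n. of_real (exp (- (a * (of_int n)\<^sup>2 + b * of_int n + c))))"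
proof (rule rapidI)
  fix R :: real
  define k where "k = \<bar>b\<bar> + \<bar>R\<bar>"
  have "exp (- (a * x\<^sup>2 + b * x + c)) \<le> exp (k\<^sup>2 / (4 * a) - c) * exp (- R * \<bar>x\<bar>)" for x :: real
  proof -
    have "0 \<le> a * (\<bar>x\<bar> - k / (2 * a))\<^sup>2" using a by simp
    also have "\<dots> = a * x\<^sup>2 - k * \<bar>x\<bar> + k\<^sup>2 / (4 * a)"
      using a by (simp add: power2_eq_square field_simps)
    finally have "k * \<bar>x\<bar> \<le> a * x\<^sup>2 + k\<^sup>2 / (4 * a)" by simp
    moreover have "- (b * x) \<le> \<bar>b\<bar> * \<bar>x\<bar>" by (metis abs_ge_minus_self abs_mult)
    moreover have "R * \<bar>x\<bar> \<le> \<bar>R\<bar> * \<bar>x\<bar>" by (intro mult_right_mono) auto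
    ultimately have "- (a * x\<^sup>2 + b * x + c) \<le> k\<^sup>2 / (4 * a) - c + - R * \<bar>x\<bar>"
      unfolding k_def distrib_right by linarith
    then show ?thesis by (simp only: exp_add[symmetric] exp_le_cancel_iff)
  qed
  then show "\<exists>B. \<forall>n. cmod (of_real (exp (- (a * (of_int n)\<^sup>2 + b * of_int n + c)))) \<le> B * exp (- R * real_of_int \<bar>n\<bar>)"
    by (intro exI[of _ "exp (k\<^sup>2 / (4 * a) - c)"]) simp
qed

text \<open>The multiplier is that of the antiholomorphic exponentials \<open>exp ((n + \<sigma>) cnj z)\<close>; conjugation
  accounts for the minus sign. Arbitrary growth in the real direction is allowed: this is the space \<open>P\<close> of the
  coefficient model.\<close>

definition quasi_periodic :: "real \<Rightarrow> complex fn set" where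
  "quasi_periodic \<sigma> = {u. antiholomorphic_on u UNIV \<and>
     (\<forall>z. u (z + 2 * of_real pi * \<i>) = exp (- 2 * of_real pi * \<i> * of_real \<sigma>) * u z)}"

definition anti_series :: "real \<Rightarrow> (int \<Rightarrow> complex) \<Rightarrow> complex fn" where
  "anti_series \<sigma> c = (\<lambda>z. exp_series \<sigma> c (cnj z))"

definition fourier :: "real \<Rightarrow> complex fn \<Rightarrow> int \<Rightarrow> complex" where
  "fourier \<sigma> u = (THE c. rapid c \<and> u = anti_series \<sigma> c)"

lemma anti_series_inject: "rapid c \<Longrightarrow> rapid d \<Longrightarrow> anti_series \<sigma> c = anti_series \<sigma> d \<Longrightarrow> c = d"
  by (rule exp_series_inject[of c d \<sigma>]) (auto simp: anti_series_def fun_eq_iff, metis complex_cnj_cnj)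

lemma fourier_anti_series: "rapid c \<Longrightarrow> fourier \<sigma> (anti_series \<sigma> c) = c"
  unfolding fourier_def by (rule the_equality) (auto dest: anti_series_inject)

lemma anti_series_quasi_periodic:
  assumes "rapid c" shows "anti_series \<sigma> c \<in> quasi_periodic \<sigma>"
proof -
  have eq: "cnj (anti_series \<sigma> c z) = exp_series \<sigma> (\<lambda>n. cnj (c n)) z" for z
    by (simp add: anti_series_def exp_series_cnj)
  have "antiholomorphic_on (anti_series \<sigma> c) UNIV"
    unfolding antiholomorphic_on_def eq by (rule exp_series_holomorphic[OF rapid_cnj[OF assms]])
  moreover have "anti_series \<sigma> c (z + 2 * of_real pi * \<i>) = exp (- 2 * of_real pi * \<i> * of_real \<sigma>) * anti_series \<sigma> c z" for z
  proof -
    have "cnj (anti_series \<sigma> c (z + 2 * of_real pi * \<i>)) = exp (2 * of_real pi * \<i> * of_real \<sigma>) * cnj (anti_series \<sigma> c z)"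
      unfolding eq by (rule exp_series_period)
    from arg_cong[OF this, of cnj] show ?thesis by (simp add: exp_cnj)
  qed
  ultimately show ?thesis by (simp add: quasi_periodic_def)
qed

lemma quasi_periodic_series:
  assumes "u \<in> quasi_periodic \<sigma>"
  shows "rapid (fourier \<sigma> u)" "u = anti_series \<sigma> (fourier \<sigma> u)"
proof -
  have "(\<lambda>z. cnj (u z)) holomorphic_on UNIV"
    using assms by (simp add: quasi_periodic_def antiholomorphic_on_def)
  moreover have "cnj (u (z + 2 * of_real pi * \<i>)) = exp (2 * of_real pi * \<i> * of_real \<sigma>) * cnj (u z)" for z
    using assms by (simp add: quasi_periodic_def exp_cnj)
  ultimately obtain c where c: "rapid c" "(\<lambda>z. cnj (u z)) = exp_series \<sigma> c"
    using quasi_periodic_expansion[of "\<lambda>z. cnj (u z)" \<sigma>] by blast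
  have "u z = anti_series \<sigma> (\<lambda>n. cnj (c n)) z" for z
    using arg_cong[OF fun_cong[OF c(2), of z], of cnj] by (simp add: anti_series_def exp_series_cnj)
  then have u: "u = anti_series \<sigma> (\<lambda>n. cnj (c n))" by blast
  then have "fourier \<sigma> u = (\<lambda>n. cnj (c n))" using fourier_anti_series[OF rapid_cnj[OF c(1)]] by simp
  then show "rapid (fourier \<sigma> u)" "u = anti_series \<sigma> (fourier \<sigma> u)" using u rapid_cnj[OF c(1)] by auto
qed

lemma quasi_periodic_cases:
  assumes "u \<in> quasi_periodic \<sigma>"
  obtains c where "rapid c" "u = anti_series \<sigma> c"
  using quasi_periodic_series[OF assms] by blast

lemma anti_series_add: "rapid c \<Longrightarrow> rapid d \<Longrightarrow>
    (\<lambda>z. anti_series \<sigma> c z + anti_series \<sigma> d z) = anti_series \<sigma> (\<lambda>n. c n + d n)"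
  by (simp add: anti_series_def exp_series_add)

lemma anti_series_scale: "(\<lambda>z. a * anti_series \<sigma> c z) = anti_series \<sigma> (\<lambda>n. a * c n)"
  by (simp add: anti_series_def exp_series_scale)

lemma anti_series_zero: "anti_series \<sigma> (\<lambda>n. 0) = (\<lambda>z. 0)"
  by (simp add: anti_series_def exp_series_def)

text \<open>The norm of \<open>exp (\<nu> cnj z)\<close> in \<open>L\<close>, by \<open>gauss_moment\<close>.\<close>

definition basis_norm :: "real \<Rightarrow> real \<Rightarrow> real" where
  "basis_norm h \<nu> = exp (h * (\<nu>\<^sup>2 + \<nu>) / 2)"

definition l2_coeff :: "real \<Rightarrow> real \<Rightarrow> complex fn \<Rightarrow> int \<Rightarrow> complex" where
  "l2_coeff h \<sigma> u n = fourier \<sigma> u n * of_real (basis_norm h (of_int n + \<sigma>))"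

lemma l2_coeff_anti_series: "rapid c \<Longrightarrow> l2_coeff h \<sigma> (anti_series \<sigma> c) n = c n * of_real (basis_norm h (of_int n + \<sigma>))"
  by (simp add: l2_coeff_def fourier_anti_series)

lemma basis_norm_sq: "(basis_norm h \<nu>)\<^sup>2 = exp (h * (\<nu>\<^sup>2 + \<nu>))"
  by (simp add: basis_norm_def exp_double[symmetric])

lemma basis_norm_pos: "basis_norm h \<nu> > 0"
  by (simp add: basis_norm_def)

lemma nn_integral_quasi_periodic:
  assumes h: "h > 0" and u: "u \<in> quasi_periodic \<sigma>"
  shows "(\<integral>\<^sup>+z. ennreal ((cmod (u z))\<^sup>2) \<partial>L_measure h)
    = (\<integral>\<^sup>+n. ennreal ((cmod (l2_coeff h \<sigma> u n))\<^sup>2) \<partial>count_space UNIV)"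
proof -
  obtain c where c: "rapid c" "u = anti_series \<sigma> c" using quasi_periodic_cases[OF u] .
  have "(cmod (l2_coeff h \<sigma> u n))\<^sup>2 = (cmod (c n))\<^sup>2 * exp (h * ((of_int n + \<sigma>)\<^sup>2 + (of_int n + \<sigma>)))" for n
    by (simp add: c l2_coeff_anti_series norm_mult power_mult_distrib basis_norm_sq)
  then show ?thesis using nn_integral_exp_series[OF h c(1), of \<sigma>] by (simp add: c(2) anti_series_def)
qed

lemma sets_L_measure [simp, measurable_cong]: "sets (L_measure h) = sets borel"
  by (simp add: L_measure_def strip_measure_def)

lemma quasi_periodic_continuous: "u \<in> quasi_periodic \<sigma> \<Longrightarrow> continuous_on UNIV u"
proof -
  assume "u \<in> quasi_periodic \<sigma>"
  then have "continuous_on UNIV (\<lambda>z. cnj (cnj (u z)))"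
    unfolding quasi_periodic_def antiholomorphic_on_def
    by (intro continuous_intros holomorphic_on_imp_continuous_on) auto
  then show ?thesis by simp
qed

lemma quasi_periodic_measurable: "u \<in> quasi_periodic \<sigma> \<Longrightarrow> u \<in> borel_measurable (L_measure h)"
  using borel_measurable_continuous_onI[OF quasi_periodic_continuous] by (simp cong: measurable_cong_sets)

text \<open>The norms of the exponentials grow like a Gaussian, so dividing a merely bounded family by them
  yields the coefficients of an entire function.\<close>

lemma rapid_l2:
  assumes h: "h > 0" and x: "square_summable x"
  shows "rapid (\<lambda>n. x n / of_real (basis_norm h (of_int n + \<sigma>)))"
proof -
  obtain B where B: "\<And>n. cmod (x n) \<le> B"
  proof -
    have "(cmod (x n))\<^sup>2 \<le> infsum (\<lambda>n. (cmod (x n))\<^sup>2) UNIV" for n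
      using finite_sum_le_infsum[of "\<lambda>n. (cmod (x n))\<^sup>2" UNIV "{n}"] x by (simp add: square_summable_def)
    then have "cmod (x n) \<le> sqrt (infsum (\<lambda>n. (cmod (x n))\<^sup>2) UNIV)" for n by (rule real_le_rsqrt)
    then show ?thesis by (rule that)
  qed
  show ?thesis
  proof (rule rapid_mono[OF rapid_gauss[of "h / 2" "h * \<sigma> + h / 2" "h * (\<sigma>\<^sup>2 + \<sigma>) / 2"], of _ B 0])
    fix n
    have "h * ((of_int n + \<sigma>)\<^sup>2 + (of_int n + \<sigma>)) / 2
        = h / 2 * (of_int n)\<^sup>2 + (h * \<sigma> + h / 2) * of_int n + h * (\<sigma>\<^sup>2 + \<sigma>) / 2"
      by (simp add: power2_eq_square field_simps)
    then have inv: "1 / basis_norm h (of_int n + \<sigma>)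
        = exp (- (h / 2 * (of_int n)\<^sup>2 + (h * \<sigma> + h / 2) * of_int n + h * (\<sigma>\<^sup>2 + \<sigma>) / 2))"
      unfolding basis_norm_def exp_minus by (simp add: inverse_eq_divide)
    have "cmod (x n / of_real (basis_norm h (of_int n + \<sigma>))) = cmod (x n) * (1 / basis_norm h (of_int n + \<sigma>))"
      using basis_norm_pos[of h "of_int n + \<sigma>"] by (simp add: norm_divide)
    also have "\<dots> = cmod (x n) * exp (- (h / 2 * (of_int n)\<^sup>2 + (h * \<sigma> + h / 2) * of_int n + h * (\<sigma>\<^sup>2 + \<sigma>) / 2))"
      unfolding inv ..
    also have "\<dots> \<le> B * exp (- (h / 2 * (of_int n)\<^sup>2 + (h * \<sigma> + h / 2) * of_int n + h * (\<sigma>\<^sup>2 + \<sigma>) / 2))"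
      using B by (intro mult_right_mono) auto
    finally show "cmod (x n / of_real (basis_norm h (of_int n + \<sigma>))) \<le> B * exp (0 * real_of_int \<bar>n\<bar>) *
        cmod (of_real (exp (- (h / 2 * (of_int n)\<^sup>2 + (h * \<sigma> + h / 2) * of_int n + h * (\<sigma>\<^sup>2 + \<sigma>) / 2))))"
      by simp
  qed (use h in simp)
qed

lemma L_space_iff:
  assumes h: "h > 0"
  shows "u \<in> L_space h (exp (- 2 * of_real pi * \<i> * of_real \<sigma>)) \<longleftrightarrow>
    u \<in> quasi_periodic \<sigma> \<and> square_summable (l2_coeff h \<sigma> u)"
proof -
  have "sq_integrable (L_measure h) u \<longleftrightarrow> square_summable (l2_coeff h \<sigma> u)" if u: "u \<in> quasi_periodic \<sigma>"
  proof -
    have m: "(\<lambda>z. (cmod (u z))\<^sup>2) \<in> borel_measurable (L_measure h)"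
      using quasi_periodic_measurable[OF u, of h] by measurable
    then show ?thesis
      unfolding sq_integrable_def square_summable_def integrable_iff_bounded
      using quasi_periodic_measurable[OF u, of h] nn_integral_quasi_periodic[OF h u]
        summable_on_iff_nn_integral_count_space[of "\<lambda>n. (cmod (l2_coeff h \<sigma> u n))\<^sup>2"]
      by simp
  qed
  then show ?thesis unfolding L_space_def quasi_periodic_def by auto
qed

text \<open>The assumptions of the coefficient model amount to three facts: the norm of \<open>u\<close> is the sum of the
  squares of its normalized coefficients (\<open>nn_integral_quasi_periodic\<close>), every square-summable family
  occurs (\<open>rapid_l2\<close>), and a function is determined by its coefficients.\<close>

lemma L_space_model:
  assumes h: "h > 0"
  shows "l2_model (L_measure h) (quasi_periodic \<sigma>) (L_space h (exp (- 2 * of_real pi * \<i> * of_real \<sigma>))) (l2_coeff h \<sigma>)"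
proof
  show "lin_subspace (quasi_periodic \<sigma>)"
    unfolding lin_subspace_def
  proof (intro conjI ballI allI)
    show "(\<lambda>z. 0) \<in> quasi_periodic \<sigma>"
      using anti_series_quasi_periodic[OF rapid_zero, of \<sigma>] by (simp only: anti_series_zero)
    fix u assume "u \<in> quasi_periodic \<sigma>"
    then obtain c where c: "rapid c" "u = anti_series \<sigma> c" by (rule quasi_periodic_cases)
    show "(\<lambda>z. a * u z) \<in> quasi_periodic \<sigma>" for a
      unfolding c anti_series_scale by (intro anti_series_quasi_periodic rapid_scale c)
    fix v assume "v \<in> quasi_periodic \<sigma>"
    then obtain d where d: "rapid d" "v = anti_series \<sigma> d" by (rule quasi_periodic_cases)
    show "(\<lambda>z. u z + v z) \<in> quasi_periodic \<sigma>"
      unfolding c d anti_series_add[OF c(1) d(1)] by (intro anti_series_quasi_periodic rapid_add c d)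
  qed
  show "u \<in> L_space h (exp (- 2 * of_real pi * \<i> * of_real \<sigma>)) \<longleftrightarrow>
    u \<in> quasi_periodic \<sigma> \<and> square_summable (l2_coeff h \<sigma> u)" for u
    by (rule L_space_iff[OF h])
  fix u assume u: "u \<in> quasi_periodic \<sigma>"
  then obtain c where c: "rapid c" "u = anti_series \<sigma> c" by (rule quasi_periodic_cases)
  show "l2_coeff h \<sigma> (\<lambda>x. a * u x) = (\<lambda>n. a * l2_coeff h \<sigma> u n)" for a
    unfolding c anti_series_scale by (simp add: l2_coeff_anti_series rapid_scale c fun_eq_iff)
  show "u = (\<lambda>x. 0)" if "\<And>n. l2_coeff h \<sigma> u n = 0"
  proof -
    have "c = (\<lambda>n. 0)"
      using that basis_norm_pos[of h] by (simp add: c l2_coeff_anti_series fun_eq_iff less_imp_neq[symmetric])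
    then show ?thesis by (simp add: c anti_series_zero)
  qed
  fix v assume "v \<in> quasi_periodic \<sigma>"
  then obtain d where d: "rapid d" "v = anti_series \<sigma> d" by (rule quasi_periodic_cases)
  show "l2_coeff h \<sigma> (\<lambda>x. u x + v x) = (\<lambda>n. l2_coeff h \<sigma> u n + l2_coeff h \<sigma> v n)"
    unfolding c d anti_series_add[OF c(1) d(1)]
    by (simp add: l2_coeff_anti_series rapid_add c d fun_eq_iff distrib_right)
next
  fix x :: "int \<Rightarrow> complex" assume x: "square_summable x"
  let ?c = "\<lambda>n. x n / of_real (basis_norm h (of_int n + \<sigma>))"
  have "l2_coeff h \<sigma> (anti_series \<sigma> ?c) = x"
    using basis_norm_pos[of h] by (simp add: l2_coeff_anti_series[OF rapid_l2[OF h x]] fun_eq_iff less_imp_neq[symmetric])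
  then show "\<exists>u\<in>quasi_periodic \<sigma>. l2_coeff h \<sigma> u = x"
    using anti_series_quasi_periodic[OF rapid_l2[OF h x]] by blast
next
  fix u assume u: "u \<in> L_space h (exp (- 2 * of_real pi * \<i> * of_real \<sigma>))"
  then show sq: "sq_integrable (L_measure h) u" by (simp add: L_space_def)
  have uq: "u \<in> quasi_periodic \<sigma>" and s: "square_summable (l2_coeff h \<sigma> u)"
    using u L_space_iff[OF h] by auto
  have hs: "((\<lambda>n. (cmod (l2_coeff h \<sigma> u n))\<^sup>2) has_sum infsum (\<lambda>n. (cmod (l2_coeff h \<sigma> u n))\<^sup>2) UNIV) UNIV"
    using s unfolding square_summable_def by (rule has_sum_infsum)
  have "ennreal ((nrm (L_measure h) u)\<^sup>2) = (\<integral>\<^sup>+z. ennreal ((cmod (u z))\<^sup>2) \<partial>L_measure h)"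
    unfolding nrm_sq using sq by (intro nn_integral_eq_integral[symmetric]) (auto simp: sq_integrable_def)
  also have "\<dots> = ennreal (infsum (\<lambda>n. (cmod (l2_coeff h \<sigma> u n))\<^sup>2) UNIV)"
    unfolding nn_integral_quasi_periodic[OF h uq] by (rule nn_integral_count_space_has_sum[OF _ hs]) simp
  finally have "(nrm (L_measure h) u)\<^sup>2 = infsum (\<lambda>n. (cmod (l2_coeff h \<sigma> u n))\<^sup>2) UNIV"
    by (simp add: infsum_nonneg)
  then show "((\<lambda>n. (cmod (l2_coeff h \<sigma> u n))\<^sup>2) has_sum (nrm (L_measure h) u)\<^sup>2) UNIV" using hs by simp
qed

section \<open>Exponentials of the ladder operators\<close>

lemma has_derivative_anti_series:
  assumes "rapid c"
  shows "(anti_series \<sigma> c has_derivative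
    (\<lambda>k. exp_series \<sigma> (\<lambda>n. of_real (of_int n + \<sigma>) * c n) (cnj z) * cnj k)) (at z)"
proof -
  have "(cnj has_derivative cnj) (at z)" by (rule bounded_linear_imp_has_derivative[OF bounded_linear_cnj])
  from has_derivative_compose[OF this exp_series_deriv[OF assms, of \<sigma> "cnj z", unfolded has_field_derivative_def]]
  show ?thesis unfolding anti_series_def .
qed

lemma wirtinger_bar_anti_series:
  assumes "rapid c"
  shows "wirtinger_bar (anti_series \<sigma> c) = anti_series \<sigma> (\<lambda>n. of_real (of_int n + \<sigma>) * c n)"
proof
  fix z
  show "wirtinger_bar (anti_series \<sigma> c) z = anti_series \<sigma> (\<lambda>n. of_real (of_int n + \<sigma>) * c n) z"
    unfolding wirtinger_bar_def frechet_derivative_at[OF has_derivative_anti_series[OF assms], symmetric]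
    by (simp add: anti_series_def field_simps)
qed

text \<open>In the variable \<open>\<zeta> = cnj z\<close>, this is the operator in the exponent of \<open>B\<close> for \<open>s = 1\<close> and of \<open>C\<close> for
  \<open>s = - 1\<close>.\<close>

definition ladder :: "complex \<Rightarrow> real \<Rightarrow> complex fn \<Rightarrow> complex fn" where
  "ladder s h F \<zeta> = s * (\<zeta> * F \<zeta> - of_real h * deriv F \<zeta> - of_real h / 2 * F \<zeta>)"

text \<open>The group \<open>exp (t ladder)\<close> applied to \<open>F\<close>, at the point \<open>\<zeta>\<close>: a translation followed by
  multiplication with an exponential, as the characteristics of the first-order operator dictate.\<close>

definition ladder_flow :: "complex \<Rightarrow> real \<Rightarrow> complex fn \<Rightarrow> complex \<Rightarrow> complex fn" where
  "ladder_flow s h F \<zeta> t = F (\<zeta> - s * t * of_real h) *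
     exp (s * t * \<zeta> - (s * t)\<^sup>2 * of_real h / 2 - s * t * of_real h / 2)"

lemma ladder_holomorphic: "F holomorphic_on UNIV \<Longrightarrow> ladder s h F holomorphic_on UNIV"
  unfolding ladder_def by (intro holomorphic_intros) auto

lemma ladder_flow_deriv:
  assumes F: "F holomorphic_on UNIV"
  shows "(ladder_flow s h F \<zeta> has_field_derivative ladder_flow s h (ladder s h F) \<zeta> t) (at t)"
proof -
  have D: "(F has_field_derivative deriv F x) (at x)" for x
    using holomorphic_derivI[OF F open_UNIV] by blast
  have "((\<lambda>t. F (\<zeta> - s * t * of_real h)) has_field_derivative
      deriv F (\<zeta> - s * t * of_real h) * (- (s * of_real h))) (at t)"
    by (rule DERIV_chain2[OF D]) (auto intro!: derivative_eq_intros)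
  moreover have "((\<lambda>t. exp (s * t * \<zeta> - (s * t)\<^sup>2 * of_real h / 2 - s * t * of_real h / 2)) has_field_derivative
      exp (s * t * \<zeta> - (s * t)\<^sup>2 * of_real h / 2 - s * t * of_real h / 2) *
        (s * \<zeta> - s * (s * t) * of_real h - s * of_real h / 2)) (at t)"
    by (auto intro!: derivative_eq_intros simp: power2_eq_square algebra_simps)
  ultimately have "(ladder_flow s h F \<zeta> has_field_derivative
      deriv F (\<zeta> - s * t * of_real h) * (- (s * of_real h)) * exp (s * t * \<zeta> - (s * t)\<^sup>2 * of_real h / 2 - s * t * of_real h / 2)
      + exp (s * t * \<zeta> - (s * t)\<^sup>2 * of_real h / 2 - s * t * of_real h / 2) *
        (s * \<zeta> - s * (s * t) * of_real h - s * of_real h / 2) * F (\<zeta> - s * t * of_real h)) (at t)"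
    unfolding ladder_flow_def by (rule DERIV_mult)
  then show ?thesis
    by (rule DERIV_cong) (simp add: ladder_flow_def ladder_def algebra_simps)
qed

lemma ladder_funpow_holomorphic: "F holomorphic_on UNIV \<Longrightarrow> (ladder s h ^^ n) F holomorphic_on UNIV"
  by (induction n) (auto intro: ladder_holomorphic)

text \<open>Differentiation in the time \<open>t\<close> is application of \<open>ladder\<close>, so the operator exponential is the Taylor
  series of \<open>ladder_flow\<close> at time 0, summed at time 1. It converges there because \<open>ladder_flow\<close> is an
  entire function of \<open>t\<close>.\<close>

lemma ladder_exp_sums:
  assumes F: "F holomorphic_on UNIV"
  shows "(\<lambda>n. (ladder s h ^^ n) F \<zeta> / fact n) sums ladder_flow s h F \<zeta> 1"
proof -
  have d: "(deriv ^^ n) (ladder_flow s h F \<zeta>) = ladder_flow s h ((ladder s h ^^ n) F) \<zeta>" for n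
  proof (induction n)
    case (Suc n)
    have "deriv (ladder_flow s h ((ladder s h ^^ n) F) \<zeta>) = ladder_flow s h (ladder s h ((ladder s h ^^ n) F)) \<zeta>"
      by (rule ext, rule DERIV_imp_deriv, rule ladder_flow_deriv[OF ladder_funpow_holomorphic[OF F]])
    then show ?case using Suc by simp
  qed simp
  have "ladder_flow s h F \<zeta> holomorphic_on ball 0 2"
    unfolding holomorphic_on_def field_differentiable_def
    using has_field_derivative_at_within[OF ladder_flow_deriv[OF F]] by blast
  from holomorphic_power_series[OF this, of 1]
  have "(\<lambda>n. (deriv ^^ n) (ladder_flow s h F \<zeta>) 0 / fact n * (1 - 0) ^ n) sums ladder_flow s h F \<zeta> 1" by simp
  then show ?thesis unfolding d by (simp add: ladder_flow_def)
qed

lemma exp_op_ladder: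
  assumes F: "F holomorphic_on UNIV"
    and T: "\<And>F. F holomorphic_on UNIV \<Longrightarrow> T (\<lambda>z. F (cnj z)) = (\<lambda>z. ladder s h F (cnj z))"
  shows "exp_op T (\<lambda>z. F (cnj z)) = (\<lambda>z. ladder_flow s h F (cnj z) 1)"
proof -
  have "(T ^^ n) (\<lambda>z. F (cnj z)) = (\<lambda>z. (ladder s h ^^ n) F (cnj z))" for n
    by (induction n) (simp_all add: T ladder_funpow_holomorphic[OF F])
  then show ?thesis
    unfolding exp_op_def using sums_unique[OF ladder_exp_sums[OF F]] by simp
qed

lemma wirtinger_bar_holomorphic:
  assumes "F holomorphic_on UNIV"
  shows "wirtinger_bar (\<lambda>z. F (cnj z)) z = deriv F (cnj z)"
proof -
  have "(F has_derivative (*) (deriv F (cnj z))) (at (cnj z))"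
    using holomorphic_derivI[OF assms open_UNIV] by (simp add: has_field_derivative_def)
  from has_derivative_compose[OF bounded_linear_imp_has_derivative[OF bounded_linear_cnj] this]
  have "((\<lambda>z. F (cnj z)) has_derivative (\<lambda>k. deriv F (cnj z) * cnj k)) (at z)" .
  then show ?thesis
    unfolding wirtinger_bar_def by (simp add: frechet_derivative_at[symmetric] field_simps)
qed

definition raising :: "real \<Rightarrow> complex fn \<Rightarrow> complex fn" where
  "raising h = exp_op (\<lambda>u z. cnj z * u z - of_real h * wirtinger_bar u z - of_real h / 2 * u z)"

definition lowering :: "real \<Rightarrow> complex fn \<Rightarrow> complex fn" where
  "lowering h = exp_op (\<lambda>u z. of_real h * wirtinger_bar u z - cnj z * u z + of_real h / 2 * u z)"

lemma raising_anti_series: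
  assumes c: "rapid c"
  shows "raising h (anti_series \<sigma> c) = (\<lambda>z. exp_series \<sigma> c (cnj z - of_real h) * exp (cnj z - of_real h))"
  unfolding raising_def anti_series_def
  by (subst exp_op_ladder[where s = 1 and h = h])
     (auto simp: exp_series_holomorphic[OF c] ladder_def wirtinger_bar_holomorphic ladder_flow_def)

lemma lowering_anti_series:
  assumes c: "rapid c"
  shows "lowering h (anti_series \<sigma> c) = (\<lambda>z. exp_series \<sigma> c (cnj z + of_real h) * exp (- cnj z))"
  unfolding lowering_def anti_series_def
  by (subst exp_op_ladder[where s = "-1" and h = h])
     (auto simp: exp_series_holomorphic[OF c] ladder_def wirtinger_bar_holomorphic ladder_flow_def)

lemma rapid_exp_mult:
  assumes "rapid c" shows "rapid (\<lambda>n. of_real (exp (a * (of_int n + b))) * c n)"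
proof (rule rapid_mono[OF assms, of _ "exp (a * b)" "\<bar>a\<bar>"])
  fix n
  have "a * of_int n \<le> \<bar>a\<bar> * real_of_int \<bar>n\<bar>" by (metis abs_ge_self abs_mult of_int_abs)
  then have "exp (a * (of_int n + b)) \<le> exp (a * b) * exp (\<bar>a\<bar> * real_of_int \<bar>n\<bar>)"
    by (simp add: distrib_left exp_add)
  from mult_right_mono[OF this, of "cmod (c n)"]
  show "cmod (of_real (exp (a * (of_int n + b))) * c n) \<le> exp (a * b) * exp (\<bar>a\<bar> * real_of_int \<bar>n\<bar>) * cmod (c n)"
    by (simp add: norm_mult)
qed

lemma raising_series:
  assumes c: "rapid c"
  shows "raising h (anti_series \<sigma> c) = anti_series \<sigma> (\<lambda>n. of_real (exp (- h * (of_int n + \<sigma>))) * c (n - 1))"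
proof
  fix z
  have "exp_series \<sigma> c (\<zeta> - of_real h) * exp (\<zeta> - of_real h)
      = (\<Sum>\<^sub>\<infinity>n. of_real (exp (- h * (of_int (n + 1) + \<sigma>))) * c (n + 1 - 1) * exp (of_real (of_int (n + 1) + \<sigma>) * \<zeta>))" for \<zeta>
    unfolding exp_series_def infsum_cmult_left'[symmetric]
    by (intro infsum_cong) (simp add: algebra_simps exp_add exp_diff exp_minus exp_of_real[symmetric] divide_inverse)
  also have "\<dots> \<zeta> = exp_series \<sigma> (\<lambda>n. of_real (exp (- h * (of_int n + \<sigma>))) * c (n - 1)) \<zeta>" for \<zeta>
    unfolding exp_series_def
    by (rule infsum_reindex_bij_witness[of _ "\<lambda>n. n - 1" "\<lambda>n. n + 1"]) auto
  finally show "raising h (anti_series \<sigma> c) z = anti_series \<sigma> (\<lambda>n. of_real (exp (- h * (of_int n + \<sigma>))) * c (n - 1)) z"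
    unfolding raising_anti_series[OF c] unfolding anti_series_def .
qed

lemma lowering_series:
  assumes c: "rapid c"
  shows "lowering h (anti_series \<sigma> c) = anti_series \<sigma> (\<lambda>n. of_real (exp (h * (of_int n + (1 + \<sigma>)))) * c (n + 1))"
proof
  fix z
  have "exp_series \<sigma> c (\<zeta> + of_real h) * exp (- \<zeta>)
      = (\<Sum>\<^sub>\<infinity>n. of_real (exp (h * (of_int (n - 1) + (1 + \<sigma>)))) * c (n - 1 + 1) * exp (of_real (of_int (n - 1) + \<sigma>) * \<zeta>))" for \<zeta>
    unfolding exp_series_def infsum_cmult_left'[symmetric]
    by (intro infsum_cong) (simp add: algebra_simps exp_add exp_diff exp_minus exp_of_real[symmetric] divide_inverse)
  also have "\<dots> \<zeta> = exp_series \<sigma> (\<lambda>n. of_real (exp (h * (of_int n + (1 + \<sigma>)))) * c (n + 1)) \<zeta>" for \<zeta>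
    unfolding exp_series_def
    by (rule infsum_reindex_bij_witness[of _ "\<lambda>n. n + 1" "\<lambda>n. n - 1"]) auto
  finally show "lowering h (anti_series \<sigma> c) z = anti_series \<sigma> (\<lambda>n. of_real (exp (h * (of_int n + (1 + \<sigma>)))) * c (n + 1)) z"
    unfolding lowering_anti_series[OF c] unfolding anti_series_def .
qed

section \<open>The operators A, B, C as weighted shifts\<close>

lemma basis_norm_step: "basis_norm h (\<nu> + 1) = basis_norm h \<nu> * exp (h * (\<nu> + 1))"
  unfolding basis_norm_def exp_add[symmetric]
  by (rule arg_cong[of _ _ exp]) (simp add: power2_eq_square field_simps)

lemma bij_shift: "bij (\<lambda>n::int. n + k)"
  by (rule bij_betw_byWitness[of _ "\<lambda>n. n - k"]) auto

text \<open>The joint eigenvalue of the operators \<open>A\<close> on the \<open>n\<close>-th exponential of the space twisted by \<open>\<sigma>\<close>.\<close>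

definition spectrum_point ::
  "real \<Rightarrow> (real \<Rightarrow> real^'k::finite \<Rightarrow> real^'k) \<Rightarrow> real^'k \<Rightarrow> real \<Rightarrow> int \<Rightarrow> real^'k" where
  "spectrum_point h \<gamma> a0 \<sigma> n = \<gamma> (h * (of_int n + \<sigma> + 1)) a0"

locale quasi_periodic_model =
  fixes h \<sigma> :: real assumes h: "h > 0"
begin

abbreviation Hs where "Hs \<equiv> L_space h (exp (- 2 * of_real pi * \<i> * of_real \<sigma>))"

sublocale l2_model "L_measure h" "quasi_periodic \<sigma>" Hs "l2_coeff h \<sigma>"
  by (rule L_space_model[OF h])

lemma diagonal_time:
  "diagonal (\<lambda>u z. of_real h * wirtinger_bar u z + of_real h * u z) (\<lambda>n. of_real (h * (of_int n + \<sigma> + 1)))"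
proof (rule diagonalI)
  fix u assume u: "u \<in> quasi_periodic \<sigma>"
  obtain c where c: "rapid c" "u = anti_series \<sigma> c" using quasi_periodic_cases[OF u] .
  let ?d = "\<lambda>n. of_real h * (of_real (of_int n + \<sigma>) * c n) + of_real h * c n"
  have d: "rapid ?d" by (intro rapid_add rapid_scale rapid_deriv c)
  have eq: "(\<lambda>z. of_real h * wirtinger_bar u z + of_real h * u z) = anti_series \<sigma> ?d"
    unfolding c(2) wirtinger_bar_anti_series[OF c(1)]
    by (simp only: anti_series_add[symmetric, OF rapid_scale[OF rapid_deriv[OF c(1)]] rapid_scale[OF c(1)]]
        anti_series_scale[symmetric])
  show "(\<lambda>z. of_real h * wirtinger_bar u z + of_real h * u z) \<in> quasi_periodic \<sigma>"
    unfolding eq by (rule anti_series_quasi_periodic[OF d])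
  show "l2_coeff h \<sigma> (\<lambda>z. of_real h * wirtinger_bar u z + of_real h * u z) n
      = of_real (h * (of_int n + \<sigma> + 1)) * l2_coeff h \<sigma> u n" for n
    unfolding eq l2_coeff_anti_series[OF d] unfolding c(2) l2_coeff_anti_series[OF c(1)]
    by (simp add: algebra_simps)
qed

text \<open>The factor \<open>exp (- h \<nu>)\<close> produced by the translation by \<open>h\<close> is the ratio of the norms of
  neighbouring exponentials (\<open>basis_norm_step\<close>).\<close>

lemma raising_shift: "weighted_shift (raising h) (\<lambda>n. n + 1) (\<lambda>n. 1)"
  unfolding weighted_shift_def
proof (intro conjI ballI allI bij_shift)
  fix u assume u: "u \<in> quasi_periodic \<sigma>"
  obtain c where c: "rapid c" "u = anti_series \<sigma> c" using quasi_periodic_cases[OF u] .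
  let ?d = "\<lambda>n. of_real (exp (- h * (of_int n + \<sigma>))) * c (n - 1)"
  have d: "rapid ?d" using rapid_exp_mult[OF rapid_shift[OF c(1), of "-1"], of "- h" \<sigma>] by simp
  have eq: "raising h u = anti_series \<sigma> ?d" unfolding c(2) by (rule raising_series[OF c(1)])
  show "raising h u \<in> quasi_periodic \<sigma>" unfolding eq by (rule anti_series_quasi_periodic[OF d])
  show "l2_coeff h \<sigma> (raising h u) (n + 1) = 1 * l2_coeff h \<sigma> u n" for n
  proof -
    have "basis_norm h (of_int (n + 1) + \<sigma>) = basis_norm h (of_int n + \<sigma>) * exp (h * (of_int (n + 1) + \<sigma>))"
      using basis_norm_step[of h "of_int n + \<sigma>"] by (simp add: add_ac)
    moreover have "exp (- h * y) * (b * exp (h * y)) = b" for y b :: real by (simp add: exp_minus)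
    ultimately have "exp (- h * (of_int (n + 1) + \<sigma>)) * basis_norm h (of_int (n + 1) + \<sigma>) = basis_norm h (of_int n + \<sigma>)"
      by metis
    from arg_cong[OF this, of complex_of_real] show ?thesis
      unfolding eq l2_coeff_anti_series[OF d] unfolding c(2) l2_coeff_anti_series[OF c(1)]
      by (simp add: mult_ac del: of_real_exp)
  qed
qed

lemma lowering_shift: "weighted_shift (lowering h) (\<lambda>n. n - 1) (\<lambda>n. 1)"
  unfolding weighted_shift_def
proof (intro conjI ballI allI)
  show "bij (\<lambda>n::int. n - 1)" using bij_shift[of "-1"] by simp
  fix u assume u: "u \<in> quasi_periodic \<sigma>"
  obtain c where c: "rapid c" "u = anti_series \<sigma> c" using quasi_periodic_cases[OF u] .
  let ?d = "\<lambda>n. of_real (exp (h * (of_int n + (1 + \<sigma>)))) * c (n + 1)"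
  have d: "rapid ?d" by (rule rapid_exp_mult[OF rapid_shift[OF c(1)]])
  have eq: "lowering h u = anti_series \<sigma> ?d" unfolding c(2) by (rule lowering_series[OF c(1)])
  show "lowering h u \<in> quasi_periodic \<sigma>" unfolding eq by (rule anti_series_quasi_periodic[OF d])
  show "l2_coeff h \<sigma> (lowering h u) (n - 1) = 1 * l2_coeff h \<sigma> u n" for n
  proof -
    have "exp (h * (of_int (n - 1) + (1 + \<sigma>))) * basis_norm h (of_int (n - 1) + \<sigma>) = basis_norm h (of_int n + \<sigma>)"
      using basis_norm_step[of h "of_int (n - 1) + \<sigma>"] by (simp add: algebra_simps)
    from arg_cong[OF this, of complex_of_real] show ?thesis
      unfolding eq l2_coeff_anti_series[OF d] unfolding c(2) l2_coeff_anti_series[OF c(1)]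
      by (simp add: mult_ac del: of_real_exp)
  qed
qed

context
  fixes \<gamma> :: "real \<Rightarrow> real^'k::finite \<Rightarrow> real^'k" and a0 :: "real^'k"
  assumes \<gamma>: "\<And>i. real_polynomial_function (\<lambda>t. \<gamma> t a0 $ i)"
begin

lemma A_hat_diagonal: "diagonal (A_hat h \<gamma> a0 i) (\<lambda>n. of_real (spectrum_point h \<gamma> a0 \<sigma> n $ i))"
  unfolding A_hat_def spectrum_point_def by (rule diagonal_poly_op1[OF diagonal_time \<gamma>])

lemma poly_A_hat_diagonal:
  "complex_polynomial f \<Longrightarrow> diagonal (poly_op f (A_hat h \<gamma> a0)) (\<lambda>n. f (spectrum_point h \<gamma> a0 \<sigma> n))"
  by (rule diagonal_poly_op[OF A_hat_diagonal])

lemma B_hat_shift: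
  assumes "complex_polynomial M"
  shows "weighted_shift (B_hat h \<gamma> a0 M) (\<lambda>n. n + 1) (\<lambda>n. M (spectrum_point h \<gamma> a0 \<sigma> n))"
  using weighted_shift_comp[OF raising_shift poly_A_hat_diagonal[OF assms]]
  unfolding B_hat_def[abs_def] raising_def by simp

lemma C_hat_shift:
  assumes "complex_polynomial M"
  shows "weighted_shift (C_hat h \<gamma> a0 M) (\<lambda>n. n - 1) (\<lambda>n. cnj (M (spectrum_point h \<gamma> a0 \<sigma> (n - 1))))"
  using weighted_shift_comp[OF poly_A_hat_diagonal[OF complex_polynomial_cnj[OF assms]] lowering_shift]
  unfolding C_hat_def[abs_def] lowering_def by simp

end
end

section \<open>Uniqueness for polynomial differential equations\<close>

text \<open>A bound and a Lipschitz constant on the ball are found together, because the Lipschitz constant of a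
  product involves the bounds of its factors.\<close>

lemma polynomial_lipschitz:
  fixes p :: "'a::real_normed_vector \<Rightarrow> real"
  assumes "real_polynomial_function p"
  shows "\<exists>B L. \<forall>x y. norm x \<le> R \<longrightarrow> norm y \<le> R \<longrightarrow> \<bar>p x\<bar> \<le> B \<and> \<bar>p x - p y\<bar> \<le> L * norm (x - y)"
  using assms
proof (induction rule: real_polynomial_function.induct)
  case (linear f)
  interpret bounded_linear f by fact
  obtain K where K: "\<And>x. norm (f x) \<le> norm x * K" "K \<ge> 0" using nonneg_bounded by blast
  show ?case
  proof (rule exI[of _ "R * K"], rule exI[of _ K], intro allI impI conjI)
    fix x y :: 'a assume "norm x \<le> R" "norm y \<le> R"
    then show "\<bar>f x\<bar> \<le> R * K" using K(1)[of x] mult_right_mono[of "norm x" R K] K(2) by simp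
    show "\<bar>f x - f y\<bar> \<le> K * norm (x - y)" using K(1)[of "x - y"] by (simp add: diff mult.commute)
  qed
next
  case (const c)
  show ?case by (rule exI[of _ "\<bar>c\<bar>"], rule exI[of _ 0]) simp
next
  case (add f g)
  then obtain B L B' L' where
    *: "\<And>x y. norm x \<le> R \<Longrightarrow> norm y \<le> R \<Longrightarrow> \<bar>f x\<bar> \<le> B \<and> \<bar>f x - f y\<bar> \<le> L * norm (x - y)"
       "\<And>x y. norm x \<le> R \<Longrightarrow> norm y \<le> R \<Longrightarrow> \<bar>g x\<bar> \<le> B' \<and> \<bar>g x - g y\<bar> \<le> L' * norm (x - y)" by metis
  show ?case
  proof (rule exI[of _ "B + B'"], rule exI[of _ "L + L'"], intro allI impI conjI)
    fix x y :: 'a assume xy: "norm x \<le> R" "norm y \<le> R"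
    show "\<bar>f x + g x\<bar> \<le> B + B'" using *(1)[OF xy] *(2)[OF xy] by linarith
    show "\<bar>f x + g x - (f y + g y)\<bar> \<le> (L + L') * norm (x - y)"
      using *(1)[OF xy] *(2)[OF xy] unfolding distrib_right by linarith
  qed
next
  case (mult f g)
  then obtain B L B' L' where
    *: "\<And>x y. norm x \<le> R \<Longrightarrow> norm y \<le> R \<Longrightarrow> \<bar>f x\<bar> \<le> B \<and> \<bar>f x - f y\<bar> \<le> L * norm (x - y)"
       "\<And>x y. norm x \<le> R \<Longrightarrow> norm y \<le> R \<Longrightarrow> \<bar>g x\<bar> \<le> B' \<and> \<bar>g x - g y\<bar> \<le> L' * norm (x - y)" by metis
  show ?case
  proof (rule exI[of _ "B * B'"], rule exI[of _ "B * L' + B' * L"], intro allI impI conjI)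
    fix x y :: 'a assume xy: "norm x \<le> R" "norm y \<le> R"
    note f = *(1)[OF xy] and g = *(2)[OF xy] and gy = *(2)[OF xy(2) xy(1)]
    show "\<bar>f x * g x\<bar> \<le> B * B'"
      unfolding abs_mult using f g by (intro mult_mono) (auto intro: order_trans[OF abs_ge_zero])
    have "\<bar>f x * g x - f y * g y\<bar> = \<bar>f x * (g x - g y) + g y * (f x - f y)\<bar>" by (simp add: algebra_simps)
    also have "\<dots> \<le> \<bar>f x\<bar> * \<bar>g x - g y\<bar> + \<bar>g y\<bar> * \<bar>f x - f y\<bar>"
      unfolding abs_mult[symmetric] by (rule abs_triangle_ineq)
    also have "\<dots> \<le> B * (L' * norm (x - y)) + B' * (L * norm (x - y))"
      using f g gy by (intro add_mono mult_mono) (auto intro: order_trans[OF abs_ge_zero])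
    finally show "\<bar>f x * g x - f y * g y\<bar> \<le> (B * L' + B' * L) * norm (x - y)" by (simp add: algebra_simps)
  qed
qed

lemma polynomial_field_lipschitz:
  fixes v :: "real^'k::finite \<Rightarrow> real^'k"
  assumes "polynomial_function v"
  shows "\<exists>L\<ge>0. \<forall>x y. norm x \<le> R \<longrightarrow> norm y \<le> R \<longrightarrow> norm (v x - v y) \<le> L * norm (x - y)"
proof -
  have "real_polynomial_function (\<lambda>x. v x $ i)" for i
    using assms bounded_linear_vec_nth unfolding polynomial_function_def by (auto simp: o_def)
  then have "\<exists>L. \<forall>x y. norm x \<le> R \<longrightarrow> norm y \<le> R \<longrightarrow> \<bar>v x $ i - v y $ i\<bar> \<le> L * norm (x - y)" for i
    using polynomial_lipschitz[of "\<lambda>x. v x $ i" R] by blast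
  then obtain L where L: "\<And>i x y. norm x \<le> R \<Longrightarrow> norm y \<le> R \<Longrightarrow> \<bar>v x $ i - v y $ i\<bar> \<le> L i * norm (x - y)" by metis
  have "norm (v x - v y) \<le> (\<Sum>i\<in>UNIV. \<bar>L i\<bar>) * norm (x - y)" if "norm x \<le> R" "norm y \<le> R" for x y
  proof -
    have "norm (v x - v y) \<le> (\<Sum>i\<in>UNIV. \<bar>(v x - v y) $ i\<bar>)" by (rule norm_le_l1_cart)
    also have "\<dots> \<le> (\<Sum>i\<in>UNIV. \<bar>L i\<bar> * norm (x - y))"
    proof (rule sum_mono)
      fix i
      have "\<bar>(v x - v y) $ i\<bar> \<le> L i * norm (x - y)" using L[OF that, of i] by simp
      also have "\<dots> \<le> \<bar>L i\<bar> * norm (x - y)" by (intro mult_right_mono) auto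
      finally show "\<bar>(v x - v y) $ i\<bar> \<le> \<bar>L i\<bar> * norm (x - y)" .
    qed
    finally show ?thesis by (simp add: sum_distrib_right)
  qed
  then show ?thesis by (intro exI[of _ "\<Sum>i\<in>UNIV. \<bar>L i\<bar>"]) (auto intro: sum_nonneg)
qed

text \<open>Gronwall's argument: with \<open>L\<close> a Lipschitz constant of \<open>v\<close> on a ball containing both solutions, the
  squared distance times \<open>exp (- 2 L t)\<close> is nonincreasing.\<close>

lemma ode_unique_forward:
  fixes x y :: "real \<Rightarrow> real^'k::finite"
  assumes v: "polynomial_function v"
    and x: "\<And>t. (x has_vector_derivative v (x t)) (at t)" and y: "\<And>t. (y has_vector_derivative v (y t)) (at t)"
    and init: "x 0 = y 0" and T: "T \<ge> 0"
  shows "x T = y T"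
proof -
  have cx: "continuous_on {0..T} x" and cy: "continuous_on {0..T} y"
    using x y by (auto intro!: continuous_at_imp_continuous_on has_vector_derivative_continuous)
  have "bounded (x ` {0..T} \<union> y ` {0..T})"
    using cx cy by (auto intro!: compact_imp_bounded compact_continuous_image)
  then obtain R where "\<forall>p\<in>x ` {0..T} \<union> y ` {0..T}. norm p \<le> R" using bounded_iff by blast
  then have R: "\<And>t. t \<in> {0..T} \<Longrightarrow> norm (x t) \<le> R \<and> norm (y t) \<le> R" by blast
  obtain L where L: "L \<ge> 0" "\<And>a b. norm a \<le> R \<Longrightarrow> norm b \<le> R \<Longrightarrow> norm (v a - v b) \<le> L * norm (a - b)"
    using polynomial_field_lipschitz[OF v, of R] by blast
  define d where "d = (\<lambda>t. (x t - y t) \<bullet> (x t - y t) * exp (- (2 * L) * t))"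
  have "d T \<le> d 0"
  proof (rule DERIV_nonpos_imp_nonincreasing[OF T])
    fix t assume t: "0 \<le> t" "t \<le> T"
    let ?w = "x t - y t" and ?dv = "v (x t) - v (y t)"
    have w: "((\<lambda>t. x t - y t) has_vector_derivative ?dv) (at t)"
      by (intro has_vector_derivative_diff x y)
    have "((\<lambda>t. (x t - y t) \<bullet> (x t - y t)) has_vector_derivative (?w \<bullet> ?dv + ?dv \<bullet> ?w)) (at t)"
      by (rule bounded_bilinear.has_vector_derivative[OF bounded_bilinear_inner w w])
    then have q: "((\<lambda>t. (x t - y t) \<bullet> (x t - y t)) has_real_derivative 2 * (?w \<bullet> ?dv)) (at t)"
      unfolding has_real_derivative_iff_has_vector_derivative by (simp only: inner_commute[of ?dv] mult_2)
    have e: "((\<lambda>t. exp (- (2 * L) * t)) has_real_derivative exp (- (2 * L) * t) * (- (2 * L))) (at t)"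
      by (auto intro!: derivative_eq_intros)
    have "(d has_real_derivative (2 * (?w \<bullet> ?dv) - 2 * L * (?w \<bullet> ?w)) * exp (- (2 * L) * t)) (at t)"
      unfolding d_def by (rule DERIV_cong[OF DERIV_mult[OF q e]]) algebra
    moreover have "?w \<bullet> ?dv \<le> L * (?w \<bullet> ?w)"
    proof -
      have "?w \<bullet> ?dv \<le> norm ?w * norm ?dv" by (rule norm_cauchy_schwarz)
      also have "\<dots> \<le> norm ?w * (L * norm ?w)" using R[of t] t by (intro mult_left_mono L(2)) auto
      finally show ?thesis by (simp add: power2_norm_eq_inner[symmetric] power2_eq_square mult_ac)
    qed
    ultimately show "\<exists>D. (d has_real_derivative D) (at t) \<and> D \<le> 0"
      by (intro exI[of _ "(2 * (?w \<bullet> ?dv) - 2 * L * (?w \<bullet> ?w)) * exp (- (2 * L) * t)"])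
         (simp add: mult_le_0_iff)
  qed
  then have "(x T - y T) \<bullet> (x T - y T) \<le> 0" using init by (simp add: d_def mult_le_0_iff)
  then have "(x T - y T) \<bullet> (x T - y T) = 0" using inner_ge_zero[of "x T - y T"] by linarith
  then show ?thesis by simp
qed

lemma ode_unique:
  fixes x y :: "real \<Rightarrow> real^'k::finite"
  assumes v: "polynomial_function v"
    and x: "\<And>t. (x has_vector_derivative v (x t)) (at t)" and y: "\<And>t. (y has_vector_derivative v (y t)) (at t)"
    and init: "x 0 = y 0"
  shows "x t = y t"
proof (cases "t \<ge> 0")
  case True
  then show ?thesis by (rule ode_unique_forward[OF v x y init])
next
  case False
  have v': "polynomial_function (\<lambda>a. - v a)" by (rule polynomial_function_minus[OF v])
  have rev: "((\<lambda>t. z (- t)) has_vector_derivative - v (z (- t))) (at t)"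
    if "\<And>t. (z has_vector_derivative v (z t)) (at t)" for z :: "real \<Rightarrow> real^'k" and t
  proof -
    have "((\<lambda>t. - t) has_real_derivative -1) (at t)" by (auto intro!: derivative_eq_intros)
    from vector_diff_chain_at[OF this[unfolded has_real_derivative_iff_has_vector_derivative] that]
    show ?thesis by (simp add: o_def)
  qed
  have "x (- (- t)) = y (- (- t))"
    using ode_unique_forward[OF v' rev[OF x] rev[OF y], of "- t"] init False by simp
  then show ?thesis by simp
qed

section \<open>Polynomial flows and nonperiodic trajectories\<close>

locale polynomial_flow =
  fixes v :: "real^'k::finite \<Rightarrow> real^'k" and \<gamma> :: "real \<Rightarrow> real^'k \<Rightarrow> real^'k"
  assumes v: "polynomial_function v"
    and flow: "\<And>A t. ((\<lambda>s. \<gamma> s A) has_vector_derivative v (\<gamma> t A)) (at t)"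
    and flow_0: "\<And>A. \<gamma> 0 A = A"
    and flow_poly: "polynomial_function (\<lambda>(t, A). \<gamma> t A)"
begin

lemma flow_add: "\<gamma> (s + t) A = \<gamma> s (\<gamma> t A)"
proof (rule ode_unique[OF v, of "\<lambda>s. \<gamma> (s + t) A" "\<lambda>s. \<gamma> s (\<gamma> t A)"])
  fix s
  have "((\<lambda>s. s + t) has_real_derivative 1) (at s)" by (auto intro!: derivative_eq_intros)
  from vector_diff_chain_at[OF this[unfolded has_real_derivative_iff_has_vector_derivative] flow]
  show "((\<lambda>s. \<gamma> (s + t) A) has_vector_derivative v (\<gamma> (s + t) A)) (at s)" by (simp add: o_def)
  show "((\<lambda>s. \<gamma> s (\<gamma> t A)) has_vector_derivative v (\<gamma> s (\<gamma> t A))) (at s)" by (rule flow)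
qed (simp add: flow_0)

lemma flow_comp_polynomial:
  assumes "polynomial_function f"
  shows "polynomial_function (\<lambda>x. \<gamma> (f x) a)"
proof -
  have "polynomial_function (\<lambda>x. (f x, a))"
  proof -
    have "polynomial_function (\<lambda>x. f x *\<^sub>R (1 :: real, 0 :: real^'k) + (0, a))"
      using assms by (intro polynomial_function_add polynomial_function_mult polynomial_function_const)
    moreover have "(\<lambda>x. f x *\<^sub>R (1 :: real, 0 :: real^'k) + (0, a)) = (\<lambda>x. (f x, a))"
      by (simp add: scaleR_prod_def fun_eq_iff)
    ultimately show ?thesis by simp
  qed
  from polynomial_function_compose[OF this flow_poly] show ?thesis by (simp add: o_def)
qed

lemma flow_time_polynomial: "polynomial_function (\<lambda>t. \<gamma> t a)"
  by (rule flow_comp_polynomial) simp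

lemma flow_time_component: "real_polynomial_function (\<lambda>t. \<gamma> t a $ i)"
  using flow_time_polynomial[of a] bounded_linear_vec_nth unfolding polynomial_function_def by (auto simp: o_def)

lemma flow_space_component: "real_polynomial_function (\<lambda>A. \<gamma> t A $ i)"
proof -
  have "polynomial_function (\<lambda>A :: real^'k. (t, A))"
  proof -
    have "polynomial_function (\<lambda>A :: real^'k. (t, 0) + (0, A))"
      by (intro polynomial_function_add polynomial_function_const polynomial_function_bounded_linear
          bounded_linear_Pair bounded_linear_zero bounded_linear_ident)
    then show ?thesis by simp
  qed
  from polynomial_function_compose[OF this flow_poly] have "polynomial_function (\<gamma> t)" by (simp add: o_def)
  then show ?thesis using bounded_linear_vec_nth unfolding polynomial_function_def by (auto simp: o_def)
qed

lemma invariant_along_flow: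
  assumes "real_polynomial_function f" "\<And>A. vec_apply v f A = 0"
  shows "f (\<gamma> t A) = f A"
proof -
  have "((\<lambda>t. f (\<gamma> t A)) has_real_derivative 0) (at t)" for t
  proof -
    have "f differentiable at (\<gamma> t A)"
      using assms(1) differentiable_at_polynomial_function by (simp add: real_polynomial_function_eq)
    then have D: "(f has_derivative frechet_derivative f (at (\<gamma> t A))) (at (\<gamma> t A))"
      by (simp add: frechet_derivative_works)
    have "((\<lambda>t. f (\<gamma> t A)) has_derivative (\<lambda>s. frechet_derivative f (at (\<gamma> t A)) (s *\<^sub>R v (\<gamma> t A)))) (at t)"
      by (rule has_derivative_compose[OF flow[unfolded has_vector_derivative_def] D])
    moreover have "frechet_derivative f (at (\<gamma> t A)) (s *\<^sub>R v (\<gamma> t A)) = 0" for s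
      using assms(2)[of "\<gamma> t A"] linear_scale[OF has_derivative_linear[OF D], of s "v (\<gamma> t A)"]
      by (simp add: vec_apply_def)
    moreover have "(*) 0 = (\<lambda>s :: real. 0 :: real)" by auto
    ultimately show ?thesis by (simp add: has_field_derivative_def)
  qed
  then show ?thesis using DERIV_isconst_all[of "\<lambda>t. f (\<gamma> t A)" t 0] flow_0 by simp
qed

context
  fixes a0 assumes nonper: "nonperiodic \<gamma> a0"
begin

lemma flow_inj: "\<gamma> s a0 = \<gamma> t a0 \<longleftrightarrow> s = t"
proof -
  have "\<gamma> s a0 \<noteq> \<gamma> t a0" if "s < t" for s t
  proof
    assume eq: "\<gamma> s a0 = \<gamma> t a0"
    have "\<gamma> (t - s) a0 = \<gamma> (- s) (\<gamma> t a0)" using flow_add[of "- s" t a0] by simp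
    also have "\<dots> = \<gamma> (- s) (\<gamma> s a0)" by (simp add: eq)
    also have "\<dots> = a0" using flow_add[of "- s" s a0] by (simp add: flow_0)
    finally show False using nonper that unfolding nonperiodic_def by (meson diff_gt_0_iff_gt)
  qed
  then show ?thesis by (metis linorder_neqE)
qed

lemma leaf_time_flow: "leaf_time \<gamma> a0 (\<gamma> t a0) = t"
  unfolding leaf_time_def using flow_inj by auto

text \<open>A zero of \<open>v\<close> on the trajectory would be a rest point.\<close>

lemma velocity_nonzero: "v (\<gamma> t a0) \<noteq> 0"
proof
  assume z: "v (\<gamma> t a0) = 0"
  have "\<gamma> 1 (\<gamma> t a0) = \<gamma> t a0"
    by (rule ode_unique[OF v flow]) (simp_all add: flow_0 z)
  then show False using flow_inj[of "1 + t" t] by (simp add: flow_add)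
qed

end
end

text \<open>Some coordinate of the trajectory is a nonconstant polynomial in the time, so its modulus tends to
  infinity in both directions.\<close>

lemma (in polynomial_flow) flow_norm_at_infinity:
  assumes nonper: "nonperiodic \<gamma> a0"
  shows "\<exists>R. \<forall>t. norm (\<gamma> t a0) \<le> B \<longrightarrow> \<bar>t\<bar> \<le> R"
proof -
  have "\<gamma> 1 a0 \<noteq> \<gamma> 0 a0" using flow_inj[OF nonper, of 1 0] by simp
  then obtain i where i: "\<gamma> 1 a0 $ i \<noteq> \<gamma> 0 a0 $ i" by (auto simp: vec_eq_iff)
  obtain b k where b: "(\<lambda>t. \<gamma> t a0 $ i) = (\<lambda>t. \<Sum>j\<le>k. b j * t ^ j)"
    using flow_time_component[of a0 i] unfolding real_polynomial_function_iff_sum by blast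
  define q where "q = (\<Sum>j\<le>k. monom (b j) j)"
  have q: "poly q t = \<gamma> t a0 $ i" for t
    using fun_cong[OF b, of t] by (simp add: q_def poly_sum poly_monom)
  have "degree q > 0"
  proof (rule ccontr)
    assume "\<not> degree q > 0"
    then obtain c where "q = [:c:]" by (metis degree_eq_zeroE not_gr_zero)
    then show False using i q[of 0] q[of 1] by simp
  qed
  then have "filterlim (poly q) at_infinity at_infinity" by (rule filterlim_poly_at_infinity)
  then have "\<forall>\<^sub>F t in at_infinity. \<bar>B + 1\<bar> + 1 \<le> norm (poly q t)"
    unfolding filterlim_at_infinity[OF order_refl] by (elim allE[of _ "\<bar>B + 1\<bar> + 1"]) simp
  then obtain R where "\<forall>t. R \<le> norm t \<longrightarrow> \<bar>B + 1\<bar> + 1 \<le> norm (poly q t)"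
    unfolding eventually_at_infinity by blast
  then have R: "\<And>t. R \<le> norm t \<Longrightarrow> B + 1 \<le> norm (poly q t)" by fastforce
  have "\<bar>t\<bar> \<le> R" if "norm (\<gamma> t a0) \<le> B" for t
  proof (rule ccontr)
    assume "\<not> \<bar>t\<bar> \<le> R"
    then have "B + 1 \<le> \<bar>\<gamma> t a0 $ i\<bar>" using R[of t] by (simp add: q)
    also have "\<dots> \<le> norm (\<gamma> t a0)" by (rule component_le_norm_cart)
    finally show False using that by simp
  qed
  then show ?thesis by blast
qed

lemma (in polynomial_flow) flow_continuous: "continuous_on S (\<lambda>t. \<gamma> t a0)"
  using flow by (auto intro!: continuous_at_imp_continuous_on has_vector_derivative_continuous)

text \<open>Near a given point the trajectory is the injective continuous image of a compact interval of times,
  and the inverse of such a map is continuous.\<close>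

lemma (in polynomial_flow) leaf_time_continuous:
  assumes nonper: "nonperiodic \<gamma> a0"
  shows "continuous_on (range (\<lambda>t. \<gamma> t a0)) (leaf_time \<gamma> a0)"
  unfolding continuous_on_eq_continuous_within
proof
  fix A assume A: "A \<in> range (\<lambda>t. \<gamma> t a0)"
  obtain R where R: "\<And>t. norm (\<gamma> t a0) \<le> norm A + 1 \<Longrightarrow> \<bar>t\<bar> \<le> R"
    using flow_norm_at_infinity[OF nonper] by blast
  have "continuous_on ((\<lambda>t. \<gamma> t a0) ` {-R..R}) (leaf_time \<gamma> a0)"
    by (rule continuous_on_inv[OF flow_continuous]) (auto simp: leaf_time_flow[OF nonper])
  moreover have "range (\<lambda>t. \<gamma> t a0) \<inter> ball 0 (norm A + 1) \<subseteq> (\<lambda>t. \<gamma> t a0) ` {-R..R}"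
    using R by (force simp: abs_le_iff)
  ultimately have "continuous_on (range (\<lambda>t. \<gamma> t a0) \<inter> ball 0 (norm A + 1)) (leaf_time \<gamma> a0)"
    by (rule continuous_on_subset)
  then have "continuous (at A within (range (\<lambda>t. \<gamma> t a0) \<inter> ball 0 (norm A + 1))) (leaf_time \<gamma> a0)"
    using A by (simp add: continuous_on_eq_continuous_within)
  moreover have "at A within (range (\<lambda>t. \<gamma> t a0) \<inter> ball 0 (norm A + 1)) = at A within range (\<lambda>t. \<gamma> t a0)"
    by (rule at_within_nhd[of A "ball 0 (norm A + 1)"]) auto
  ultimately show "continuous (at A within range (\<lambda>t. \<gamma> t a0)) (leaf_time \<gamma> a0)" by simp
qed

section \<open>The leaf as a punctured plane\<close>

definition mk_point :: "complex \<Rightarrow> real^'k::finite \<Rightarrow> 'k pt" where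
  "mk_point c A = (Re c, Im c, A)"

lemma mk_point [simp]: "coordC (mk_point c A) = c" "coordA (mk_point c A) = A" "coordB (mk_point c A) = cnj c"
  by (simp_all add: mk_point_def coordC_def coordA_def coordB_def)

lemma mk_point_coords: "mk_point (coordC p) (coordA p) = p"
  by (simp add: mk_point_def coordC_def coordA_def)

lemma continuous_on_coords: "continuous_on S (coordC :: 'k::finite pt \<Rightarrow> complex)" "continuous_on S (coordA :: 'k::finite pt \<Rightarrow> real^'k)"
proof -
  show "continuous_on S (coordC :: 'k pt \<Rightarrow> complex)"
    by (rule linear_continuous_on[OF bounded_linear_coordC])
  show "continuous_on S (coordA :: 'k pt \<Rightarrow> real^'k)"
    unfolding coordA_def by (intro continuous_intros)
qed

locale leaf =
  fixes \<rho> :: "real^'k::finite \<Rightarrow> real" and \<kappa> v \<gamma> K c a0 g M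
  assumes alg: "algebra_data \<rho> \<kappa> v \<gamma>" and leaf_data: "leaf_data \<rho> \<kappa> v \<gamma> K c a0 g M"
    and nonper: "nonperiodic \<gamma> a0"
begin

sublocale polynomial_flow v \<gamma>
  using alg unfolding algebra_data_def by unfold_locales auto

abbreviation X where "X \<equiv> leaf_surface \<rho> \<kappa> K c"
abbreviation w where "w \<equiv> leaf_chart \<gamma> a0 M"

lemma \<kappa>_axis: "j \<in> {1..<CARD('k)} \<Longrightarrow> \<kappa> j (\<gamma> t a0) = c j"
  using alg leaf_data invariant_along_flow[of "\<kappa> j" t a0] unfolding algebra_data_def leaf_data_def by auto

lemma M_axis: "(cmod (M (\<gamma> t a0)))\<^sup>2 = \<rho> (\<gamma> t a0) - K"
  using leaf_data unfolding leaf_data_def by metis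

lemma M_axis_nonzero: "M (\<gamma> t a0) \<noteq> 0"
proof -
  have "K < \<rho> (\<gamma> t a0)" using leaf_data \<kappa>_axis unfolding leaf_data_def by blast
  then show ?thesis using M_axis[of t] by auto
qed

lemma M_polynomial: "polynomial_function M"
  using leaf_data by (simp add: leaf_data_def)

lemma X_iff: "p \<in> X \<longleftrightarrow> \<rho> (coordA p) - (cmod (coordC p))\<^sup>2 = K \<and> (\<forall>j\<in>{1..<CARD('k)}. \<kappa> j (coordA p) = c j)"
proof -
  have "coordB p * coordC p = of_real ((cmod (coordC p))\<^sup>2)"
    unfolding coordB_def by (subst complex_norm_square) (simp add: mult.commute)
  then have "of_real (\<rho> (coordA p)) - coordB p * coordC p = of_real (\<rho> (coordA p) - (cmod (coordC p))\<^sup>2)" by simp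
  then show ?thesis unfolding leaf_surface_def by (simp only: mem_Collect_eq of_real_eq_iff)
qed

lemma X_axis: "p \<in> X \<Longrightarrow> \<exists>t. coordA p = \<gamma> t a0"
  using leaf_data unfolding leaf_data_def by blast

text \<open>The inverse of the chart. On the leaf \<open>|C| = |M(A)|\<close>, hence \<open>|w| = e\<^sup>t\<close>: the time is \<open>ln |\<zeta>|\<close>, which
  gives \<open>A\<close>, and then \<open>C\<close> is recovered from the definition of \<open>w\<close>.\<close>

definition \<psi> :: "complex \<Rightarrow> 'k pt" where
  "\<psi> \<zeta> = mk_point (\<zeta> * of_real (exp (- ln (cmod \<zeta>))) * cnj (M (\<gamma> (ln (cmod \<zeta>)) a0))) (\<gamma> (ln (cmod \<zeta>)) a0)"

lemma \<psi>_in_X: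
  assumes "\<zeta> \<noteq> 0" shows "\<psi> \<zeta> \<in> X"
proof -
  have "(cmod (coordC (\<psi> \<zeta>)))\<^sup>2 = (cmod (M (\<gamma> (ln (cmod \<zeta>)) a0)))\<^sup>2"
    using assms by (simp add: \<psi>_def norm_mult exp_minus norm_inverse)
  then show ?thesis unfolding X_iff using M_axis \<kappa>_axis by (simp add: \<psi>_def)
qed

lemma w_\<psi>:
  assumes "\<zeta> \<noteq> 0" shows "w (\<psi> \<zeta>) = \<zeta>"
  using assms M_axis_nonzero by (simp add: leaf_chart_def \<psi>_def leaf_time_flow[OF nonper] exp_minus)

lemma X_point:
  assumes "p \<in> X"
  shows "w p \<noteq> 0" "\<psi> (w p) = p"
proof -
  obtain t where t: "coordA p = \<gamma> t a0" using X_axis[OF assms] by blast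
  have lt: "leaf_time \<gamma> a0 (coordA p) = t" by (simp add: t leaf_time_flow[OF nonper])
  have C2: "(cmod (coordC p))\<^sup>2 = (cmod (M (\<gamma> t a0)))\<^sup>2" using assms M_axis[of t] by (simp add: X_iff t)
  then have C: "cmod (coordC p) = cmod (M (\<gamma> t a0))" by (simp add: power2_eq_iff_nonneg)
  have w: "w p = coordC p * of_real (exp t) / cnj (M (\<gamma> t a0))"
    unfolding leaf_chart_def lt unfolding t ..
  have norm_w: "cmod (w p) = exp t" using C M_axis_nonzero[of t] by (simp add: w norm_mult norm_divide)
  then show "w p \<noteq> 0" by auto
  have "\<psi> (w p) = mk_point (coordC p) (coordA p)"
    unfolding \<psi>_def norm_w using M_axis_nonzero[of t] by (simp add: w t exp_minus field_simps)
  then show "\<psi> (w p) = p" by (simp add: mk_point_coords)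
qed

lemma w_image: "w ` X = - {0}"
  using X_point(1) w_\<psi> \<psi>_in_X by (force simp: image_iff)

lemma w_continuous: "continuous_on X w"
proof -
  have img: "coordA ` X \<subseteq> range (\<lambda>t. \<gamma> t a0)" using X_axis by blast
  have "continuous_on X (\<lambda>p. leaf_time \<gamma> a0 (coordA p))"
    by (rule continuous_on_compose2[OF leaf_time_continuous[OF nonper] continuous_on_coords(2) img])
  moreover have "continuous_on X (\<lambda>p. M (coordA p))"
    by (rule continuous_on_compose2[OF continuous_on_polymonial_function[OF M_polynomial, of UNIV] continuous_on_coords(2)]) simp
  moreover have "cnj (M (coordA p)) \<noteq> 0" if "p \<in> X" for p
    using X_axis[OF that] M_axis_nonzero by auto
  ultimately show ?thesis
    unfolding leaf_chart_def by (intro continuous_intros continuous_on_coords) auto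
qed

text \<open>The differential of \<open>\<psi>\<close> at \<open>\<zeta>\<close>, with \<open>m'\<close> the derivative of \<open>cnj M\<close> along the trajectory. The quotient
  \<open>(sgn \<zeta> \<bullet> h) / |\<zeta>|\<close> is the differential of the time \<open>ln |\<zeta>|\<close>.\<close>

definition \<psi>_deriv :: "(real \<Rightarrow> complex) \<Rightarrow> complex \<Rightarrow> complex \<Rightarrow> 'k pt" where
  "\<psi>_deriv m' \<zeta> h = mk_point
       ((h - \<zeta> * of_real ((sgn \<zeta> \<bullet> h) / cmod \<zeta>)) * of_real (exp (- ln (cmod \<zeta>))) * cnj (M (\<gamma> (ln (cmod \<zeta>)) a0))
        + \<zeta> * of_real (exp (- ln (cmod \<zeta>))) * (of_real ((sgn \<zeta> \<bullet> h) / cmod \<zeta>) * m' (ln (cmod \<zeta>))))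
       (((sgn \<zeta> \<bullet> h) / cmod \<zeta>) *\<^sub>R v (\<gamma> (ln (cmod \<zeta>)) a0))"

lemma \<psi>_has_derivative:
  obtains m' where "continuous_on UNIV m'"
    "\<And>\<zeta>. \<zeta> \<noteq> 0 \<Longrightarrow> (\<psi> has_derivative (\<psi>_deriv m' \<zeta>)) (at \<zeta>)"
proof -
  have "polynomial_function (\<lambda>s. cnj (M (\<gamma> s a0)))"
  proof -
    have "polynomial_function (\<lambda>s. M (\<gamma> s a0))"
      using polynomial_function_compose[OF flow_time_polynomial M_polynomial] by (simp add: o_def)
    from polynomial_function_compose[OF this polynomial_function_bounded_linear[OF bounded_linear_cnj]]
    show ?thesis by (simp add: o_def)
  qed
  from has_vector_derivative_polynomial_function[OF this]
  obtain m' where m': "polynomial_function m'"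
      "\<And>s. ((\<lambda>s. cnj (M (\<gamma> s a0))) has_vector_derivative m' s) (at s)" by metis
  show ?thesis
  proof (rule that[of m'])
    show "continuous_on UNIV m'" by (rule continuous_on_polymonial_function[OF m'(1)])
    fix \<zeta> :: complex assume z: "\<zeta> \<noteq> 0"
    let ?dl = "\<lambda>h. (sgn \<zeta> \<bullet> h) / cmod \<zeta>"
    have l: "((\<lambda>\<zeta>. ln (cmod \<zeta>)) has_derivative ?dl) (at \<zeta>)"
      using z by (auto intro!: derivative_eq_intros has_derivative_norm simp: divide_inverse mult_ac inner_commute)
    have e: "((\<lambda>\<zeta>. complex_of_real (exp (- ln (cmod \<zeta>)))) has_derivative
        (\<lambda>h. of_real (- ?dl h * exp (- ln (cmod \<zeta>))))) (at \<zeta>)"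
      by (intro has_derivative_of_real, rule has_derivative_eq_rhs, rule derivative_intros, rule derivative_intros, rule l)
         (simp add: fun_eq_iff mult_ac)
    have m: "((\<lambda>\<zeta>. cnj (M (\<gamma> (ln (cmod \<zeta>)) a0))) has_derivative (\<lambda>h. ?dl h *\<^sub>R m' (ln (cmod \<zeta>)))) (at \<zeta>)"
      by (rule has_derivative_compose[OF l m'(2)[unfolded has_vector_derivative_def]])
    have a: "((\<lambda>\<zeta>. \<gamma> (ln (cmod \<zeta>)) a0) has_derivative (\<lambda>h. ?dl h *\<^sub>R v (\<gamma> (ln (cmod \<zeta>)) a0))) (at \<zeta>)"
      by (rule has_derivative_compose[OF l flow[unfolded has_vector_derivative_def]])
    have C: "((\<lambda>\<zeta>. \<zeta> * of_real (exp (- ln (cmod \<zeta>))) * cnj (M (\<gamma> (ln (cmod \<zeta>)) a0))) has_derivative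
       (\<lambda>h. (h - \<zeta> * of_real (?dl h)) * of_real (exp (- ln (cmod \<zeta>))) * cnj (M (\<gamma> (ln (cmod \<zeta>)) a0))
        + \<zeta> * of_real (exp (- ln (cmod \<zeta>))) * (of_real (?dl h) * m' (ln (cmod \<zeta>))))) (at \<zeta>)"
      by (rule has_derivative_eq_rhs[OF has_derivative_mult[OF has_derivative_mult[OF has_derivative_ident e] m]])
         (auto simp: fun_eq_iff algebra_simps scaleR_conv_of_real)
    show "(\<psi> has_derivative (\<psi>_deriv m' \<zeta>)) (at \<zeta>)"
      unfolding \<psi>_deriv_def[abs_def]
      unfolding \<psi>_def[abs_def] mk_point_def
      by (intro has_derivative_Pair bounded_linear.has_derivative[OF bounded_linear_Re]
          bounded_linear.has_derivative[OF bounded_linear_Im] C a)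
  qed
qed

lemma w_homeomorphism: "homeomorphism X (- {0}) w \<psi>"
proof -
  obtain m' where D: "\<And>\<zeta>. \<zeta> \<noteq> 0 \<Longrightarrow> (\<psi> has_derivative (\<psi>_deriv m' \<zeta>)) (at \<zeta>)"
    using \<psi>_has_derivative by blast
  have "continuous_on (- {0}) \<psi>"
    by (rule continuous_at_imp_continuous_on) (use D has_derivative_continuous in blast)
  moreover note w_continuous
  moreover have "\<psi> ` (- {0}) = X"
  proof (intro equalityI subsetI)
    fix p assume "p \<in> X"
    then show "p \<in> \<psi> ` (- {0})" using X_point[of p] by (intro image_eqI[of _ _ "w p"]) auto
  next
    fix p assume "p \<in> \<psi> ` (- {0})"
    then obtain \<zeta> where "\<zeta> \<noteq> 0" "p = \<psi> \<zeta>" by blast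
    then show "p \<in> X" using \<psi>_in_X by metis
  qed
  ultimately show ?thesis
    unfolding homeomorphism_def using w_continuous X_point(2) w_\<psi> w_image by simp
qed

text \<open>The differential of \<open>\<psi>\<close> is injective: since \<open>v\<close> does not vanish on the trajectory, its \<open>A\<close>-component
  kills only vectors tangent to the circles \<open>|\<zeta>| = const\<close>, and on these its \<open>C\<close>-component is
  multiplication by a nonzero number.\<close>

lemma w_global_chart: "global_chart X w (- {0})"
proof -
  obtain m' where cm: "continuous_on UNIV m'" and D: "\<And>\<zeta>. \<zeta> \<noteq> 0 \<Longrightarrow> (\<psi> has_derivative (\<psi>_deriv m' \<zeta>)) (at \<zeta>)"
    using \<psi>_has_derivative by blast
  have inj: "inj (frechet_derivative \<psi> (at \<zeta>))" if z: "\<zeta> \<noteq> 0" for \<zeta>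
  proof -
    have lin: "linear (frechet_derivative \<psi> (at \<zeta>))"
      using D[OF z] by (intro linear_frechet_derivative) (auto simp: differentiable_def)
    show ?thesis
      unfolding linear_injective_0[OF lin]
    proof (intro allI impI)
      fix h assume "frechet_derivative \<psi> (at \<zeta>) h = 0"
      then have 0: "\<psi>_deriv m' \<zeta> h = mk_point 0 0"
        unfolding frechet_derivative_at[OF D[OF z], symmetric] by (simp add: mk_point_def zero_prod_def)
      have dl: "(sgn \<zeta> \<bullet> h) / cmod \<zeta> = 0"
        using arg_cong[OF 0, of coordA] velocity_nonzero[OF nonper] unfolding \<psi>_deriv_def mk_point
        by (simp only: scaleR_eq_0_iff) simp
      show "h = 0"
        using arg_cong[OF 0, of coordC] M_axis_nonzero unfolding \<psi>_deriv_def mk_point dl by simp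
    qed
  qed
  have cont: "continuous_on (- {0}) (\<lambda>\<zeta>. frechet_derivative \<psi> (at \<zeta>) h)" for h
  proof (rule continuous_on_eq)
    have cl: "continuous_on (- {0}) (\<lambda>\<zeta>::complex. ln (cmod \<zeta>))" by (intro continuous_intros) auto
    have cs: "continuous_on (- {0}) (\<lambda>\<zeta>::complex. (sgn \<zeta> \<bullet> h) / cmod \<zeta>)" by (intro continuous_intros) auto
    have cg: "continuous_on (- {0}) (\<lambda>\<zeta>::complex. \<gamma> (ln (cmod \<zeta>)) a0)"
      by (rule continuous_on_compose2[OF flow_continuous[of UNIV] cl]) simp
    have cM: "continuous_on (- {0}) (\<lambda>\<zeta>::complex. M (\<gamma> (ln (cmod \<zeta>)) a0))"
      by (rule continuous_on_compose2[OF continuous_on_polymonial_function[OF M_polynomial, of UNIV] cg]) simp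
    have cv: "continuous_on (- {0}) (\<lambda>\<zeta>::complex. v (\<gamma> (ln (cmod \<zeta>)) a0))"
      by (rule continuous_on_compose2[OF continuous_on_polymonial_function[OF v, of UNIV] cg]) simp
    have cm: "continuous_on (- {0}) (\<lambda>\<zeta>::complex. m' (ln (cmod \<zeta>)))"
      by (rule continuous_on_compose2[OF cm cl]) simp
    show "continuous_on (- {0}) (\<lambda>\<zeta>. \<psi>_deriv m' \<zeta> h)"
      unfolding \<psi>_deriv_def mk_point_def
      by (intro continuous_on_Pair continuous_on_Re continuous_on_Im continuous_on_add continuous_on_mult
          continuous_on_diff continuous_on_of_real continuous_on_exp continuous_on_minus continuous_on_cnj
          continuous_on_scaleR continuous_on_const continuous_on_id cl cs cM cv cm)
  qed (simp add: frechet_derivative_at[OF D, symmetric])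
  show ?thesis
    unfolding global_chart_def
  proof (intro conjI exI[of _ \<psi>] ballI allI)
    show "\<psi> differentiable at \<zeta>" if "\<zeta> \<in> - {0}" for \<zeta> using D that by (auto simp: differentiable_def)
  qed (use w_homeomorphism inj cont in auto)
qed

lemma punctured_plane_cylinder: "(- {0} :: complex set) homeomorphic (sphere (0::complex) 1 \<times> (UNIV :: real set))"
proof (rule homeomorphicI[where f = "\<lambda>\<zeta>. (sgn \<zeta>, ln (cmod \<zeta>))" and g = "\<lambda>p. fst p * of_real (exp (snd p))"])
  have 1: "(sgn \<zeta>, ln (cmod \<zeta>)) \<in> sphere 0 1 \<times> UNIV" if "\<zeta> \<noteq> 0" for \<zeta> :: complex
    using that by (simp add: norm_sgn)
  have 2: "sgn \<zeta> * of_real (exp (ln (cmod \<zeta>))) = \<zeta>" if "\<zeta> \<noteq> 0" for \<zeta> :: complex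
    using that by (simp add: sgn_eq)
  have 3: "p \<in> sphere (0::complex) 1 \<times> (UNIV :: real set) \<Longrightarrow>
      fst p * of_real (exp (snd p)) \<noteq> 0 \<and> sgn (fst p * of_real (exp (snd p))) = fst p \<and>
      ln (cmod (fst p * of_real (exp (snd p)))) = snd p" for p
    by (auto simp: sgn_eq norm_mult)
  show "(\<lambda>\<zeta>. (sgn \<zeta>, ln (cmod \<zeta>))) ` (- {0}) = sphere (0::complex) 1 \<times> (UNIV :: real set)"
  proof (intro equalityI subsetI)
    fix p assume "p \<in> sphere (0::complex) 1 \<times> (UNIV :: real set)"
    from 3[OF this] show "p \<in> (\<lambda>\<zeta>. (sgn \<zeta>, ln (cmod \<zeta>))) ` (- {0})"
      by (intro image_eqI[of _ _ "fst p * of_real (exp (snd p))"]) (auto simp: prod_eq_iff)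
  qed (use 1 in auto)
  show "(\<lambda>p. fst p * of_real (exp (snd p))) ` (sphere (0::complex) 1 \<times> (UNIV :: real set)) = - {0}"
  proof (intro equalityI subsetI)
    fix \<zeta> :: complex assume "\<zeta> \<in> - {0}"
    then show "\<zeta> \<in> (\<lambda>p. fst p * of_real (exp (snd p))) ` (sphere (0::complex) 1 \<times> (UNIV :: real set))"
      using 1[of \<zeta>] 2[of \<zeta>] by (intro image_eqI[of _ _ "(sgn \<zeta>, ln (cmod \<zeta>))"]) auto
  qed (use 3 in auto)
  show "(sgn (fst p * of_real (exp (snd p))), ln (cmod (fst p * of_real (exp (snd p))))) = p"
    if "p \<in> sphere (0::complex) 1 \<times> (UNIV :: real set)" for p
    using 3[OF that] by (simp add: prod_eq_iff)
qed (auto intro!: continuous_intros simp: sgn_eq)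

lemma X_cylinder: "X homeomorphic (sphere (0::complex) 1 \<times> (UNIV :: real set))"
  by (rule homeomorphic_trans[OF _ punctured_plane_cylinder])
     (use w_homeomorphism in \<open>unfold homeomorphic_def, blast\<close>)

lemma X_closed: "closed X"
proof -
  have \<rho>: "continuous_on UNIV (\<lambda>p. \<rho> (coordA p))"
    using alg unfolding algebra_data_def real_polynomial_function_eq
    by (intro continuous_on_compose2[OF continuous_on_polymonial_function[of \<rho> UNIV] continuous_on_coords(2)]) auto
  have \<kappa>: "continuous_on UNIV (\<lambda>p. \<kappa> j (coordA p))" if "j \<in> {1..<CARD('k)}" for j
    using alg that unfolding algebra_data_def real_polynomial_function_eq
    by (intro continuous_on_compose2[OF continuous_on_polymonial_function[of "\<kappa> j" UNIV] continuous_on_coords(2)]) auto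
  have "X = {p. \<rho> (coordA p) - (cmod (coordC p))\<^sup>2 = K} \<inter> (\<Inter>j\<in>{1..<CARD('k)}. {p. \<kappa> j (coordA p) = c j})"
    using X_iff by auto
  moreover have "closed {p :: 'k pt. \<rho> (coordA p) - (cmod (coordC p))\<^sup>2 = K}"
    by (intro closed_Collect_eq continuous_intros \<rho> continuous_on_coords)
  moreover have "closed {p :: 'k pt. \<kappa> j (coordA p) = c j}" if "j \<in> {1..<CARD('k)}" for j
    by (intro closed_Collect_eq \<kappa>[OF that] continuous_on_const)
  ultimately show ?thesis by (simp only:) (intro closed_Int closed_INT ballI)
qed

lemma point_of_eq: "point_of X w z = \<psi> (exp z)"
proof -
  have "inj_on w X" using X_point(2) by (metis inj_onI)
  then show ?thesis
    unfolding point_of_def using inv_into_f_f[of w X "\<psi> (exp z)"] \<psi>_in_X[of "exp z"] w_\<psi>[of "exp z"] by simp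
qed

end

section \<open>Theta series and Jacobi's transformation\<close>

definition theta_series :: "real \<Rightarrow> complex \<Rightarrow> complex" where
  "theta_series h = exp_series 0 (\<lambda>n. of_real (exp (- h * (of_int n)\<^sup>2)))"

lemma rapid_theta: "h > 0 \<Longrightarrow> rapid (\<lambda>n. of_real (exp (- h * (of_int n)\<^sup>2)))"
  using rapid_gauss[of h 0 0] by simp

lemma theta_eq: "theta \<alpha> (exp (- h)) = theta_series h \<alpha>"
proof -
  have "exp (- h) powi (n\<^sup>2) = exp (- h * (of_int n)\<^sup>2)" for n
    by (simp add: exp_power_int mult.commute)
  then show ?thesis by (simp add: theta_def theta_series_def exp_series_def)
qed

lemma theta_series_holomorphic: "h > 0 \<Longrightarrow> theta_series h holomorphic_on S"
  unfolding theta_series_def by (rule exp_series_holomorphic[OF rapid_theta])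

lemma theta_series_has_sum:
  "h > 0 \<Longrightarrow> ((\<lambda>n. exp (of_int n * \<zeta> - of_real h * (of_int n)\<^sup>2)) has_sum theta_series h \<zeta>) UNIV"
proof -
  assume h: "h > 0"
  have "of_real (exp (- h * (of_int n)\<^sup>2)) * exp (of_real (of_int n + 0) * \<zeta>) = exp (of_int n * \<zeta> - of_real h * (of_int n)\<^sup>2)" for n
    unfolding exp_of_real[symmetric] exp_add[symmetric] by (rule arg_cong[of _ _ exp]) simp
  then show ?thesis
    using exp_series_has_sum[OF rapid_theta[OF h], of 0 \<zeta>] unfolding theta_series_def by (simp only:)
qed

lemma theta_series_period:
  "theta_series h (\<zeta> + 2 * of_real pi * \<i>) = theta_series h \<zeta>"
  unfolding theta_series_def exp_series_period by simp

text \<open>A shift of the summation index by one completes the square.\<close>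

lemma theta_series_quasi_period:
  assumes h: "h > 0"
  shows "theta_series h (\<zeta> + 2 * of_real h) = exp (\<zeta> + of_real h) * theta_series h \<zeta>"
proof -
  have "((\<lambda>n. exp (of_int n * \<zeta> - of_real h * (of_int n)\<^sup>2)) has_sum theta_series h \<zeta>) UNIV"
    by (rule theta_series_has_sum[OF h])
  then have "((\<lambda>n. exp (of_int (n - 1) * \<zeta> - of_real h * (of_int (n - 1))\<^sup>2)) has_sum theta_series h \<zeta>) UNIV"
    using has_sum_reindex_bij_betw[OF bij_shift[of "-1"], of "\<lambda>n. exp (of_int n * \<zeta> - of_real h * (of_int n)\<^sup>2)"] by simp
  from has_sum_cmult_right[OF this, of "exp (\<zeta> + of_real h)"]
  have 1: "((\<lambda>n. exp (\<zeta> + of_real h) * exp (of_int (n - 1) * \<zeta> - of_real h * (of_int (n - 1))\<^sup>2)) has_sum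
      exp (\<zeta> + of_real h) * theta_series h \<zeta>) UNIV" .
  have "exp (\<zeta> + of_real h) * exp (of_int (n - 1) * \<zeta> - of_real h * (of_int (n - 1))\<^sup>2)
      = exp (of_int n * (\<zeta> + 2 * of_real h) - of_real h * (of_int n)\<^sup>2)" for n
    unfolding exp_add[symmetric] by (rule arg_cong[of _ _ exp]) (simp add: power2_eq_square algebra_simps)
  then show ?thesis
    using has_sum_unique[OF theta_series_has_sum[OF h] 1[unfolded \<open>\<And>n. _ n = _ n\<close>]] by simp
qed

lemma exp_series_const_coeff:
  assumes c: "rapid c"
  shows "((\<lambda>y. exp_series 0 c (\<i> * of_real y)) has_integral 2 * of_real pi * c 0) {0..2 * pi}"
proof -
  let ?F = "finite_subsets_at_top (UNIV :: int set)"
  let ?p = "\<lambda>X y. \<Sum>n\<in>X. c n * exp (of_real (of_int n + 0) * (\<i> * of_real y))"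
  have "uniform_limit (range (\<lambda>y. \<i> * of_real y)) (\<lambda>X \<zeta>. \<Sum>n\<in>X. c n * exp (of_real (of_int n + 0) * \<zeta>)) (exp_series 0 c) ?F"
    by (rule exp_series_uniform[OF c, where R = 0]) auto
  from uniform_limit_compose'[OF this, of "\<lambda>y. \<i> * of_real y" UNIV]
  have "uniform_limit UNIV (\<lambda>X y. ?p X y) (\<lambda>y. exp_series 0 c (\<i> * of_real y)) ?F" by simp
  then have "uniform_limit {0..2*pi} ?p (\<lambda>y. exp_series 0 c (\<i> * of_real y)) ?F"
    by (rule uniform_limit_on_subset) simp
  then obtain I J where I: "\<And>X. ((\<lambda>y. ?p X y) has_integral I X) {0..2*pi}"
      and J: "((\<lambda>y. exp_series 0 c (\<i> * of_real y)) has_integral J) {0..2*pi}" and IJ: "(I \<longlongrightarrow> J) ?F"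
    by (rule uniform_limit_integral) (auto intro!: continuous_intros)
  have term1: "((\<lambda>y. c n * exp (of_real (of_int n + 0) * (\<i> * of_real y))) has_integral
      (if n = 0 then 2 * of_real pi * c 0 else 0)) {0..2*pi}" for n
  proof (cases "n = 0")
    case True
    then show ?thesis using has_integral_const_real[of "c 0" 0 "2 * pi"] by (simp add: scaleR_conv_of_real)
  next
    case False
    have "exp (of_real (of_int n + 0) * (\<i> * of_real y)) = cis (real_of_int (n - 0) * y)" for y
      by (simp add: cis_conv_exp mult_ac)
    then show ?thesis using has_integral_mult_right[OF exp_orthogonal[OF False], of "c n"] False by simp
  qed
  have "I X = 2 * of_real pi * c 0" if "finite X" "{0} \<subseteq> X" for X
  proof -
    have "(?p X has_integral (\<Sum>n\<in>X. if n = 0 then 2 * of_real pi * c 0 else 0)) {0..2*pi}"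
      by (intro has_integral_sum that(1) term1)
    then have "I X = (\<Sum>n\<in>X. if n = 0 then 2 * of_real pi * c 0 else 0)" by (rule has_integral_unique[OF I])
    then show ?thesis using that by simp
  qed
  then have "\<forall>\<^sub>F X in ?F. I X = 2 * of_real pi * c 0"
    unfolding eventually_finite_subsets_at_top by (intro exI[of _ "{0}"]) auto
  then have "(I \<longlongrightarrow> 2 * of_real pi * c 0) ?F" by (rule tendsto_eventually)
  then have "J = 2 * of_real pi * c 0" using IJ tendsto_unique[OF finite_subsets_at_top_neq_bot] by blast
  then show ?thesis using J by simp
qed

text \<open>The line is cut into translates of one period.\<close>

lemma nn_integral_unfold:
  assumes [measurable]: "f \<in> borel_measurable borel"
  shows "(\<integral>\<^sup>+x. f x \<partial>lborel)
    = (\<integral>\<^sup>+y. (\<integral>\<^sup>+m. f (y + 2 * pi * real_of_int m) \<partial>count_space UNIV) * indicator {0..2 * pi} y \<partial>lborel)"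
proof -
  let ?I = "\<lambda>m. {2 * pi * real_of_int m..<2 * pi * real_of_int m + 2 * pi}"
  have one: "(\<integral>\<^sup>+m. f x * indicator (?I m) x \<partial>count_space UNIV) = f x" for x
  proof -
    define k where "k = \<lfloor>x / (2 * pi)\<rfloor>"
    have k: "x \<in> ?I m \<longleftrightarrow> m = k" for m
    proof -
      have "m = k \<longleftrightarrow> real_of_int m \<le> x / (2 * pi) \<and> x / (2 * pi) < real_of_int m + 1"
        unfolding k_def by (simp only: eq_commute[of m] floor_eq_iff)
      also have "\<dots> \<longleftrightarrow> x \<in> ?I m" by (simp add: field_simps)
      finally show ?thesis ..
    qed
    have "(\<integral>\<^sup>+m. f x * indicator (?I m) x \<partial>count_space UNIV) = (\<integral>\<^sup>+m. f x * indicator {k} m \<partial>count_space UNIV)"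
      by (intro nn_integral_cong) (simp only: indicator_def k singleton_iff)
    also have "\<dots> = f x" by (subst nn_integral_cmult_indicator) auto
    finally show ?thesis .
  qed
  have "(\<integral>\<^sup>+x. f x \<partial>lborel) = (\<integral>\<^sup>+x. (\<integral>\<^sup>+m. f x * indicator (?I m) x \<partial>count_space UNIV) \<partial>lborel)"
    by (simp only: one)
  also have "\<dots> = (\<integral>\<^sup>+m. (\<integral>\<^sup>+x. f x * indicator (?I m) x \<partial>lborel) \<partial>count_space UNIV)"
    by (rule nn_integral_count_space_nn_integral) auto
  also have "\<dots> = (\<integral>\<^sup>+m. (\<integral>\<^sup>+y. f (y + 2 * pi * real_of_int m) * indicator {0..<2 * pi} y \<partial>lborel) \<partial>count_space UNIV)"
  proof (rule nn_integral_cong)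
    fix m
    show "(\<integral>\<^sup>+x. f x * indicator (?I m) x \<partial>lborel) = (\<integral>\<^sup>+y. f (y + 2 * pi * real_of_int m) * indicator {0..<2 * pi} y \<partial>lborel)"
      by (subst nn_integral_real_affine[where c = 1 and t = "2 * pi * real_of_int m"])
         (auto simp: add.commute indicator_def intro!: nn_integral_cong)
  qed
  also have "\<dots> = (\<integral>\<^sup>+y. (\<integral>\<^sup>+m. f (y + 2 * pi * real_of_int m) * indicator {0..<2 * pi} y \<partial>count_space UNIV) \<partial>lborel)"
    by (rule nn_integral_count_space_nn_integral[symmetric]) auto
  also have "\<dots> = (\<integral>\<^sup>+y. (\<integral>\<^sup>+m. f (y + 2 * pi * real_of_int m) \<partial>count_space UNIV) * indicator {0..2 * pi} y \<partial>lborel)"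
  proof (rule nn_integral_cong_AE)
    show "AE y in lborel. (\<integral>\<^sup>+m. f (y + 2 * pi * real_of_int m) * indicator {0..<2 * pi} y \<partial>count_space UNIV)
        = (\<integral>\<^sup>+m. f (y + 2 * pi * real_of_int m) \<partial>count_space UNIV) * indicator {0..2 * pi} y"
      using AE_lborel_singleton[of "2 * pi"]
      by eventually_elim (auto simp: nn_integral_multc indicator_def)
  qed
  finally show ?thesis .
qed

lemma nn_integral_gauss:
  assumes h: "h > 0"
  shows "(\<integral>\<^sup>+y. ennreal (exp (- y\<^sup>2 / (4 * h))) \<partial>lborel) = ennreal (sqrt (4 * pi * h))"
proof -
  have eq: "exp (- y\<^sup>2 / (4 * h)) = sqrt (4 * pi * h) * normal_density 0 (sqrt (2 * h)) y" for y
    using h by (simp add: normal_density_def mult.assoc)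
  have "(\<integral>\<^sup>+x. ennreal (normal_density 0 (sqrt (2 * h)) x) \<partial>lborel) = ennreal 1"
    using h by (subst nn_integral_eq_integral) (auto intro: integrable_normal_density)
  then show ?thesis
    unfolding eq using h by (simp add: ennreal_mult' nn_integral_cmult)
qed

text \<open>The left-hand side, as a function \<open>G\<close> of \<open>\<zeta>\<close>, is \<open>2\<pi>i\<close>-periodic and gets the same factor as \<open>theta_series h\<close>
  under translation by \<open>2h\<close>. In Fourier coefficients the second property is a first-order recursion,
  so \<open>G\<close> is a multiple of \<open>theta_series h\<close>. The constant is the mean value of \<open>G\<close> over a period of the
  imaginary axis; there \<open>G\<close> is the sum of the \<open>2\<pi>\<close>-translates of a Gaussian function, so the mean value
  unfolds to a Gaussian integral over the line.\<close>

lemma jacobi_transformation: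
  assumes h: "h > 0"
  shows "exp (\<zeta>\<^sup>2 / (4 * of_real h)) * theta_series (pi\<^sup>2 / h) (\<i> * of_real (pi / h) * \<zeta>)
    = of_real (sqrt (h / pi)) * theta_series h \<zeta>"
proof -
  define h' where "h' = pi\<^sup>2 / h"
  have h': "h' > 0" using h by (simp add: h'_def)
  define G where "G = (\<lambda>\<zeta>. exp (\<zeta>\<^sup>2 / (4 * of_real h)) * theta_series h' (\<i> * of_real (pi / h) * \<zeta>))"
  have G: "G holomorphic_on UNIV"
    unfolding G_def
    by (intro holomorphic_intros holomorphic_on_compose_gen[OF _ theta_series_holomorphic[OF h', of UNIV], unfolded o_def])
       (use h in auto)
  have hc: "complex_of_real h \<noteq> 0" using h by simp
  \<comment> \<open>periodicity comes from the quasi-period \<open>2h'\<close> of the theta series, quasi-periodicity from its period\<close>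
  have G1: "G (\<zeta> + 2 * of_real pi * \<i>) = G \<zeta>" for \<zeta>
  proof -
    have "\<i> * of_real (pi / h) * \<zeta> = \<i> * of_real (pi / h) * (\<zeta> + 2 * of_real pi * \<i>) + 2 * of_real h'"
      using hc by (simp add: h'_def power2_eq_square field_simps)
    from theta_series_quasi_period[OF h', of "\<i> * of_real (pi / h) * (\<zeta> + 2 * of_real pi * \<i>)", folded this]
    have "G \<zeta> = exp (\<zeta>\<^sup>2 / (4 * of_real h)) * (exp (\<i> * of_real (pi / h) * (\<zeta> + 2 * of_real pi * \<i>) + of_real h') *
        theta_series h' (\<i> * of_real (pi / h) * (\<zeta> + 2 * of_real pi * \<i>)))"
      by (simp add: G_def)
    also have "\<dots> = exp (\<zeta>\<^sup>2 / (4 * of_real h) + (\<i> * of_real (pi / h) * (\<zeta> + 2 * of_real pi * \<i>) + of_real h')) *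
        theta_series h' (\<i> * of_real (pi / h) * (\<zeta> + 2 * of_real pi * \<i>))"
      by (simp add: exp_add mult.assoc)
    also have "\<zeta>\<^sup>2 / (4 * of_real h) + (\<i> * of_real (pi / h) * (\<zeta> + 2 * of_real pi * \<i>) + of_real h')
        = (\<zeta> + 2 * of_real pi * \<i>)\<^sup>2 / (4 * of_real h)"
      using hc by (simp add: h'_def power2_eq_square field_simps)
    finally show ?thesis by (simp add: G_def)
  qed
  have G2: "G (\<zeta> + 2 * of_real h) = exp (\<zeta> + of_real h) * G \<zeta>" for \<zeta>
  proof -
    have "\<i> * of_real (pi / h) * (\<zeta> + 2 * of_real h) = \<i> * of_real (pi / h) * \<zeta> + 2 * of_real pi * \<i>"
      using hc by (simp add: field_simps)
    moreover have "(\<zeta> + 2 * of_real h)\<^sup>2 / (4 * of_real h) = \<zeta> + of_real h + \<zeta>\<^sup>2 / (4 * of_real h)"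
      using hc by (simp add: power2_eq_square field_simps)
    ultimately show ?thesis
      unfolding G_def by (simp only: theta_series_period exp_add) (simp only: mult.assoc)
  qed
  obtain c where c: "rapid c" "G = exp_series 0 c"
    using quasi_periodic_expansion[OF G, of 0] G1 by auto
  \<comment> \<open>the coefficients of both sides of \<open>G2\<close> are compared\<close>
  have rec: "of_real (exp (2 * h * of_int n)) * c n = of_real (exp h) * c (n - 1)" for n
  proof -
    have "exp_series 0 (\<lambda>n. of_real (exp (2 * h * (of_int n + 0))) * c n) = exp_series 0 (\<lambda>n. of_real (exp h) * c (n - 1))"
    proof
      fix \<zeta>
      have "exp_series 0 (\<lambda>n. of_real (exp (2 * h * (of_int n + 0))) * c n) \<zeta> = G (\<zeta> + 2 * of_real h)"
        unfolding c(2) exp_series_def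
        by (intro infsum_cong) (simp add: exp_add distrib_left exp_of_real[symmetric] mult_ac)
      also have "\<dots> = exp (\<zeta> + of_real h) * G \<zeta>" by (rule G2)
      also have "\<dots> = (\<Sum>\<^sub>\<infinity>n. of_real (exp h) * c (n + 1 - 1) * exp (of_real (of_int (n + 1) + 0) * \<zeta>))"
        unfolding c(2) exp_series_def infsum_cmult_right'[symmetric]
      proof (rule infsum_cong)
        fix n :: int
        have "exp (of_real (of_int (n + 1) + 0) * \<zeta>) = exp \<zeta> * exp (of_real (of_int n + 0) * \<zeta>)"
          unfolding exp_add[symmetric] by (rule arg_cong[of _ _ exp]) (simp add: algebra_simps)
        then show "exp (\<zeta> + of_real h) * (c n * exp (of_real (of_int n + 0) * \<zeta>))
            = of_real (exp h) * c (n + 1 - 1) * exp (of_real (of_int (n + 1) + 0) * \<zeta>)"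
          unfolding exp_add[of \<zeta>] exp_of_real[symmetric] by (simp only: mult_ac add_diff_cancel_right')
      qed
      also have "\<dots> = exp_series 0 (\<lambda>n. of_real (exp h) * c (n - 1)) \<zeta>"
        unfolding exp_series_def
        by (rule infsum_reindex_bij_witness[of _ "\<lambda>n. n - 1" "\<lambda>n. n + 1"]) auto
      finally show "exp_series 0 (\<lambda>n. of_real (exp (2 * h * (of_int n + 0))) * c n) \<zeta> = exp_series 0 (\<lambda>n. of_real (exp h) * c (n - 1)) \<zeta>" .
    qed
    from exp_series_inject[OF rapid_exp_mult[OF c(1)] rapid_scale[OF rapid_shift[OF c(1), of "-1", simplified]] this]
    show ?thesis by (simp add: fun_eq_iff del: of_real_exp)
  qed
  have rec': "c n = of_real (exp (h - 2 * h * of_int n)) * c (n - 1)" for n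
  proof -
    have "c n = of_real (exp (- (2 * h * of_int n)) * exp (2 * h * of_int n)) * c n" by (simp add: exp_minus)
    also have "\<dots> = of_real (exp (- (2 * h * of_int n))) * (of_real (exp h) * c (n - 1))"
      unfolding rec[symmetric] by (simp only: of_real_mult mult.assoc)
    also have "\<dots> = of_real (exp (- (2 * h * of_int n)) * exp h) * c (n - 1)" by (simp only: of_real_mult mult.assoc)
    finally show ?thesis by (simp only: exp_add[symmetric]) (simp add: algebra_simps)
  qed
  have cn: "c n = of_real (exp (- h * (of_int n)\<^sup>2)) * c 0" for n
  proof (induction n rule: int_induct[where k = 0])
    case (step1 i)
    have "c (i + 1) = of_real (exp (h - 2 * h * of_int (i + 1))) * c i" using rec'[of "i + 1"] by simp
    also have "\<dots> = of_real (exp (h - 2 * h * of_int (i + 1)) * exp (- h * (of_int i)\<^sup>2)) * c 0"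
      unfolding step1(2) by (simp only: of_real_mult mult.assoc)
    finally show ?case unfolding exp_add[symmetric] by (simp add: power2_eq_square algebra_simps)
  next
    case (step2 i)
    have "of_real (exp h) * c (i - 1) = of_real (exp (2 * h * of_int i)) * c i" using rec[of i] by simp
    also have "\<dots> = of_real (exp (2 * h * of_int i) * exp (- h * (of_int i)\<^sup>2)) * c 0"
      unfolding step2(2) by (simp only: of_real_mult mult.assoc)
    also have "exp (2 * h * of_int i) * exp (- h * (of_int i)\<^sup>2) = exp h * exp (- h * (of_int (i - 1))\<^sup>2)"
      unfolding exp_add[symmetric] by (rule arg_cong[of _ _ exp]) (simp add: power2_eq_square algebra_simps)
    finally have "of_real (exp h) * c (i - 1) = of_real (exp h) * (of_real (exp (- h * (of_int (i - 1))\<^sup>2)) * c 0)"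
      by (simp only: of_real_mult mult.assoc)
    then show ?case by (simp del: of_real_exp)
  qed simp
  have Gc: "G \<zeta> = c 0 * theta_series h \<zeta>" for \<zeta>
  proof -
    have "c = (\<lambda>n. c 0 * of_real (exp (- h * (of_int n)\<^sup>2)))" using cn by (metis mult.commute)
    then have "exp_series 0 c \<zeta> = exp_series 0 (\<lambda>n. c 0 * of_real (exp (- h * (of_int n)\<^sup>2))) \<zeta>" by (rule arg_cong)
    then show ?thesis unfolding c(2) theta_series_def exp_series_scale .
  qed
  \<comment> \<open>completing the square with the Gaussian prefactor of \<open>G\<close>\<close>
  have sumG: "((\<lambda>m. exp (- (y + 2 * pi * real_of_int m)\<^sup>2 / (4 * h))) has_sum Re (G (\<i> * of_real y))) UNIV"
    and imG: "Im (G (\<i> * of_real y)) = 0" for y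
  proof -
    have t: "exp ((\<i> * of_real y)\<^sup>2 / (4 * of_real h)) * exp (of_int m * (\<i> * of_real (pi / h) * (\<i> * of_real y)) - of_real h' * (of_int m)\<^sup>2)
        = of_real (exp (- (y + 2 * pi * real_of_int m)\<^sup>2 / (4 * h)))" for m
    proof -
      have e1: "(\<i> * of_real y)\<^sup>2 = complex_of_real (- (y\<^sup>2))" by (simp add: power_mult_distrib)
      have e2: "of_int m * (\<i> * of_real (pi / h) * (\<i> * of_real y)) = complex_of_real (- (real_of_int m * (pi / h) * y))"
        by (simp add: complex_eq_iff)
      have "- (y\<^sup>2) / (4 * h) + (- (real_of_int m * (pi / h) * y) - h' * (of_int m)\<^sup>2) = - (y + 2 * pi * real_of_int m)\<^sup>2 / (4 * h)"
      proof -
        have "(y + 2 * pi * real_of_int m)\<^sup>2 = y\<^sup>2 + 4 * (real_of_int m * pi * y) + 4 * (pi\<^sup>2 * (real_of_int m)\<^sup>2)"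
          by (simp add: power2_sum power_mult_distrib)
        then show ?thesis using h by (simp add: h'_def add_divide_distrib diff_divide_distrib)
      qed
      from arg_cong[OF this, of complex_of_real]
      have e3: "complex_of_real (- (y\<^sup>2)) / (4 * of_real h) + (complex_of_real (- (real_of_int m * (pi / h) * y)) - of_real h' * (of_int m)\<^sup>2)
          = of_real (- (y + 2 * pi * real_of_int m)\<^sup>2 / (4 * h))"
        by (simp only: of_real_add of_real_diff of_real_divide of_real_mult of_real_power of_real_of_int_eq
            of_real_numeral of_real_minus)
      show ?thesis unfolding exp_add[symmetric] exp_of_real[symmetric] e1 e2 by (rule arg_cong[OF e3])
    qed
    have "((\<lambda>m. complex_of_real (exp (- (y + 2 * pi * real_of_int m)\<^sup>2 / (4 * h)))) has_sum G (\<i> * of_real y)) UNIV"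
      using has_sum_cmult_right[OF theta_series_has_sum[OF h', of "\<i> * of_real (pi / h) * (\<i> * of_real y)"],
          of "exp ((\<i> * of_real y)\<^sup>2 / (4 * of_real h))"]
      unfolding t G_def .
    from has_sum_Re[OF this] has_sum_Im[OF this]
    have "((\<lambda>m. exp (- (y + 2 * pi * real_of_int m)\<^sup>2 / (4 * h))) has_sum Re (G (\<i> * of_real y))) UNIV"
      "((\<lambda>m::int. 0) has_sum Im (G (\<i> * of_real y))) UNIV"
      by (simp_all only: Re_complex_of_real Im_complex_of_real)
    then show "((\<lambda>m. exp (- (y + 2 * pi * real_of_int m)\<^sup>2 / (4 * h))) has_sum Re (G (\<i> * of_real y))) UNIV"
      "Im (G (\<i> * of_real y)) = 0" using has_sum_unique[OF _ has_sum_0_simp] by blast+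
  qed
  have int: "((\<lambda>y. G (\<i> * of_real y)) has_integral 2 * of_real pi * c 0) {0..2 * pi}"
    unfolding c(2) by (rule exp_series_const_coeff[OF c(1)])
  have "ennreal (sqrt (4 * pi * h)) = (\<integral>\<^sup>+y. ennreal (exp (- y\<^sup>2 / (4 * h))) \<partial>lborel)"
    by (rule nn_integral_gauss[OF h, symmetric])
  also have "\<dots> = (\<integral>\<^sup>+y. ennreal (Re (G (\<i> * of_real y))) * indicator {0..2 * pi} y \<partial>lborel)"
  proof -
    have "(\<integral>\<^sup>+m. ennreal (exp (- (y + 2 * pi * real_of_int m)\<^sup>2 / (4 * h))) \<partial>count_space UNIV) = ennreal (Re (G (\<i> * of_real y)))" for y
      by (rule nn_integral_count_space_has_sum[OF _ sumG]) simp
    then show ?thesis by (subst nn_integral_unfold) (simp, simp only:)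
  qed
  also have "\<dots> = ennreal (Re (2 * of_real pi * c 0))"
    by (rule nn_integral_has_integral_lebesgue'[OF _ has_integral_Re[OF int]])
       (rule has_sum_nonneg[OF sumG], simp)
  \<comment> \<open>\<open>ennreal\<close> sends negative numbers to 0, so a negative real part has to be excluded\<close>
  finally have "sqrt (4 * pi * h) = 2 * pi * Re (c 0)"
  proof (cases "Re (c 0) \<ge> 0")
    case False
    assume "ennreal (sqrt (4 * pi * h)) = ennreal (Re (2 * of_real pi * c 0))"
    then have "sqrt (4 * pi * h) \<le> 0" using False by (simp add: ennreal_neg mult_nonneg_nonpos ennreal_eq_0_iff)
    then show ?thesis using h pi_gt_zero by (simp add: mult_le_0_iff not_le[symmetric])
  qed (use h in \<open>simp add: ennreal_inj\<close>)
  moreover have "pi * sqrt (h / pi) = sqrt (pi * h)"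
    using real_sqrt_mult[of "pi\<^sup>2" "h / pi"] by (simp add: power2_eq_square)
  ultimately have "pi * sqrt (h / pi) = pi * Re (c 0)" using h by (simp add: real_sqrt_mult)
  then have "Re (c 0) = sqrt (h / pi)" by simp
  moreover have "Im (c 0) = 0"
    using has_integral_unique[OF has_integral_Im[OF int]] by (simp add: imG)
  ultimately have "c 0 = of_real (sqrt (h / pi))" by (simp add: complex_eq_iff)
  then show ?thesis using Gc[of \<zeta>] by (simp add: G_def h'_def)
qed

section \<open>The theta kernel and the Kaehler form\<close>

text \<open>The \<open>j\<close>-th derivative of the theta series on the real axis; for fixed \<open>y\<close>, the \<open>j\<close>-th moment of a
  positive measure on the integers.\<close>

definition theta_moment :: "real \<Rightarrow> nat \<Rightarrow> real \<Rightarrow> real" where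
  "theta_moment h j y = (\<Sum>\<^sub>\<infinity>n::int. (of_int n) ^ j * exp (of_int n * y - h * (of_int n)\<^sup>2))"

lemma rapid_moment: "h > 0 \<Longrightarrow> rapid (\<lambda>n. of_int n ^ j * of_real (exp (- h * (of_int n)\<^sup>2)))"
proof (induction j)
  case 0 then show ?case using rapid_theta by simp
next
  case (Suc j)
  from rapid_deriv[OF Suc.IH[OF Suc.prems], of 0] show ?case by (simp add: mult.assoc del: of_real_exp)
qed

lemma theta_moment_series:
  assumes h: "h > 0"
  shows "((\<lambda>n. (of_int n) ^ j * exp (of_int n * y - h * (of_int n)\<^sup>2)) has_sum theta_moment h j y) UNIV"
    "exp_series 0 (\<lambda>n. of_int n ^ j * of_real (exp (- h * (of_int n)\<^sup>2))) (of_real y) = of_real (theta_moment h j y)"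
proof -
  have t: "of_int n ^ j * of_real (exp (- h * (of_int n)\<^sup>2)) * exp (of_real (of_int n + 0) * complex_of_real y)
      = complex_of_real ((of_int n) ^ j * exp (of_int n * y - h * (of_int n)\<^sup>2))" for n
  proof -
    have "exp (of_real (of_int n + 0) * complex_of_real y) = of_real (exp (of_int n * y))"
      by (simp flip: exp_of_real)
    moreover have "exp (of_int n * y - h * (of_int n)\<^sup>2) = exp (- h * (of_int n)\<^sup>2) * exp (of_int n * y)"
      unfolding exp_add[symmetric] by simp
    ultimately show ?thesis by (simp only: of_real_mult of_real_power of_real_of_int_eq mult.assoc)
  qed
  have s: "((\<lambda>n. complex_of_real ((of_int n) ^ j * exp (of_int n * y - h * (of_int n)\<^sup>2))) has_sum
      exp_series 0 (\<lambda>n. of_int n ^ j * of_real (exp (- h * (of_int n)\<^sup>2))) (of_real y)) UNIV"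
    using exp_series_has_sum[OF rapid_moment[OF h, of j], of 0 "of_real y"] unfolding t .
  from has_sum_Re[OF s] have r: "((\<lambda>n. (of_int n) ^ j * exp (of_int n * y - h * (of_int n)\<^sup>2)) has_sum
      Re (exp_series 0 (\<lambda>n. of_int n ^ j * of_real (exp (- h * (of_int n)\<^sup>2))) (of_real y))) UNIV"
    by (simp only: Re_complex_of_real)
  then show "((\<lambda>n. (of_int n) ^ j * exp (of_int n * y - h * (of_int n)\<^sup>2)) has_sum theta_moment h j y) UNIV"
    unfolding theta_moment_def by (rule has_sum_infsum[OF has_sum_imp_summable])
  then have "((\<lambda>n. complex_of_real ((of_int n) ^ j * exp (of_int n * y - h * (of_int n)\<^sup>2))) has_sum of_real (theta_moment h j y)) UNIV"
    by (rule has_sum_of_real)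
  then show "exp_series 0 (\<lambda>n. of_int n ^ j * of_real (exp (- h * (of_int n)\<^sup>2))) (of_real y) = of_real (theta_moment h j y)"
    by (rule has_sum_unique[OF s])
qed

lemma theta_series_of_real: "h > 0 \<Longrightarrow> theta_series h (of_real y) = of_real (theta_moment h 0 y)"
  using theta_moment_series(2)[of h 0 y] by (simp add: theta_series_def)

lemma theta_moment_deriv:
  assumes h: "h > 0"
  shows "(theta_moment h j has_real_derivative theta_moment h (Suc j) y) (at y)"
proof -
  have "(exp_series 0 (\<lambda>n. of_int n ^ j * of_real (exp (- h * (of_int n)\<^sup>2))) has_field_derivative
      exp_series 0 (\<lambda>n. of_real (of_int n + 0) * (of_int n ^ j * of_real (exp (- h * (of_int n)\<^sup>2)))) (of_real y)) (at (of_real y))"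
    by (rule exp_series_deriv[OF rapid_moment[OF h]])
  also have "(\<lambda>n. of_real (of_int n + 0) * (of_int n ^ j * of_real (exp (- h * (of_int n)\<^sup>2))))
      = (\<lambda>n. of_int n ^ Suc j * complex_of_real (exp (- h * (of_int n)\<^sup>2)))" by (simp add: mult.assoc)
  finally have "((\<lambda>y. exp_series 0 (\<lambda>n. of_int n ^ j * of_real (exp (- h * (of_int n)\<^sup>2))) (of_real y)) has_vector_derivative
      exp_series 0 (\<lambda>n. of_int n ^ Suc j * complex_of_real (exp (- h * (of_int n)\<^sup>2))) (of_real y)) (at y)"
    by (rule has_vector_derivative_real_field)
  then have "((\<lambda>y. complex_of_real (theta_moment h j y)) has_vector_derivative of_real (theta_moment h (Suc j) y)) (at y)"
    unfolding theta_moment_series(2)[OF h] .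
  from bounded_linear.has_vector_derivative[OF bounded_linear_Re this] show ?thesis
    by (simp add: has_real_derivative_iff_has_vector_derivative)
qed

lemma theta_moment_pos: "h > 0 \<Longrightarrow> theta_moment h 0 y > 0"
proof -
  assume h: "h > 0"
  have "exp (of_int 0 * y - h * (of_int 0)\<^sup>2) \<le> theta_moment h 0 y"
    using finite_sum_le_has_sum[OF theta_moment_series(1)[OF h, of 0 y], of "{0}"] by simp
  then show ?thesis by simp
qed

text \<open>Divided by the square of the total mass, the expression is the variance of a probability
  distribution on the integers that is not concentrated in one point; \<open>\<mu>\<close> is its mean.\<close>

lemma theta_log_convex:
  assumes h: "h > 0"
  shows "theta_moment h 2 y * theta_moment h 0 y - (theta_moment h 1 y)\<^sup>2 > 0"
proof -
  let ?a = "\<lambda>n::int. exp (of_int n * y - h * (of_int n)\<^sup>2)"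
  define \<mu> where "\<mu> = theta_moment h 1 y / theta_moment h 0 y"
  have S0: "(?a has_sum theta_moment h 0 y) UNIV" using theta_moment_series(1)[OF h, of 0 y] by simp
  have S1: "((\<lambda>n. of_int n * ?a n) has_sum theta_moment h 1 y) UNIV" using theta_moment_series(1)[OF h, of 1 y] by simp
  note S2 = theta_moment_series(1)[OF h, of 2 y]
  have "((\<lambda>n. (of_int n) ^ 2 * ?a n + (- (2 * \<mu>)) * (of_int n * ?a n) + \<mu>\<^sup>2 * ?a n) has_sum
      theta_moment h 2 y + (- (2 * \<mu>)) * theta_moment h 1 y + \<mu>\<^sup>2 * theta_moment h 0 y) UNIV"
    by (rule has_sum_add[OF has_sum_add[OF S2 has_sum_cmult_right[OF S1]] has_sum_cmult_right[OF S0]])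
  then have S: "((\<lambda>n. (of_int n - \<mu>)\<^sup>2 * ?a n) has_sum
      theta_moment h 2 y - 2 * \<mu> * theta_moment h 1 y + \<mu>\<^sup>2 * theta_moment h 0 y) UNIV"
    by (simp add: power2_diff algebra_simps power2_eq_square)
  obtain n :: int where n: "of_int n \<noteq> \<mu>"
  proof (cases "\<mu> = 0")
    case True then show ?thesis using that[of 1] by simp
  qed (use that[of 0] in simp)
  have "(of_int n - \<mu>)\<^sup>2 * ?a n \<le> theta_moment h 2 y - 2 * \<mu> * theta_moment h 1 y + \<mu>\<^sup>2 * theta_moment h 0 y"
    using finite_sum_le_has_sum[OF S, of "{n}"] by simp
  moreover have "0 < (of_int n - \<mu>)\<^sup>2 * ?a n" using n by simp
  ultimately have "0 < (theta_moment h 2 y - 2 * \<mu> * theta_moment h 1 y + \<mu>\<^sup>2 * theta_moment h 0 y) * theta_moment h 0 y"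
    using theta_moment_pos[OF h, of y] by (intro mult_pos_pos) auto
  also have "\<dots> = theta_moment h 2 y * theta_moment h 0 y - (theta_moment h 1 y)\<^sup>2"
    using theta_moment_pos[OF h, of y] by (simp add: \<mu>_def power2_eq_square field_simps)
  finally show ?thesis .
qed

lemma theta_kernel_eq:
  assumes "h > 0"
  shows "theta_kernel h z = of_real (theta_moment h 0 (2 * Re z - h))"
proof -
  have "cnj z + z - of_real h = of_real (2 * Re z - h)" by (simp add: complex_eq_iff)
  then show ?thesis unfolding theta_kernel_def theta_eq theta_series_of_real[OF assms, symmetric] by simp
qed

text \<open>Jacobi's transformation, at the real point \<open>2 Re z - h\<close>, exhibits the theta-function of the dual
  parameter as a Gaussian function times the kernel.\<close>

lemma theta_density_eq:
  assumes h: "h > 0"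
  shows "theta_density h z = of_real (gauss_weight h (Re z) * (2 * pi * h * theta_moment h 0 (2 * Re z - h)))"
proof -
  let ?y = "2 * Re z - h"
  have "cnj z + z - of_real h = of_real ?y" by (simp add: complex_eq_iff)
  then have "theta_density h z = 1 / 2 * theta_series (pi\<^sup>2 / h) (\<i> * of_real (pi / h) * of_real ?y)"
    unfolding theta_density_def using theta_eq[of _ "pi\<^sup>2 / h"] by simp
  moreover have "complex_of_real (exp (?y\<^sup>2 / (4 * h))) * theta_series (pi\<^sup>2 / h) (\<i> * of_real (pi / h) * of_real ?y)
      = of_real (sqrt (h / pi) * theta_moment h 0 ?y)"
    using jacobi_transformation[OF h, of "of_real ?y"] unfolding theta_series_of_real[OF h]
    by (simp flip: exp_of_real)
  then have "complex_of_real (exp (- (?y\<^sup>2) / (4 * h))) * (complex_of_real (exp (?y\<^sup>2 / (4 * h))) * theta_series (pi\<^sup>2 / h) (\<i> * of_real (pi / h) * of_real ?y))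
      = of_real (exp (- (?y\<^sup>2) / (4 * h)) * (sqrt (h / pi) * theta_moment h 0 ?y))"
    by (simp only: of_real_mult)
  then have "theta_series (pi\<^sup>2 / h) (\<i> * of_real (pi / h) * of_real ?y)
      = of_real (exp (- (?y\<^sup>2) / (4 * h)) * (sqrt (h / pi) * theta_moment h 0 ?y))"
    unfolding mult.assoc[symmetric] of_real_mult[symmetric] exp_add[symmetric] by simp
  ultimately have "theta_density h z = of_real (1 / 2 * (exp (- (?y\<^sup>2) / (4 * h)) * (sqrt (h / pi) * theta_moment h 0 ?y)))"
    by simp
  also have "1 / 2 * (exp (- (?y\<^sup>2) / (4 * h)) * (sqrt (h / pi) * theta_moment h 0 ?y))
      = gauss_weight h (Re z) * (2 * pi * h * theta_moment h 0 ?y)"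
  proof -
    have "sqrt (h / pi) * sqrt (pi * h) = h"
      using h real_sqrt_mult[of "h / pi" "pi * h", symmetric] by (simp add: power2_eq_square[symmetric])
    then have "1 / 2 * sqrt (h / pi) = 1 / (4 * pi * sqrt (pi * h)) * (2 * pi * h)"
      using h by (simp add: field_simps)
    then have "exp (- (?y\<^sup>2) / (4 * h)) * theta_moment h 0 ?y * (1 / 2 * sqrt (h / pi))
        = exp (- (?y\<^sup>2) / (4 * h)) * theta_moment h 0 ?y * (1 / (4 * pi * sqrt (pi * h)) * (2 * pi * h))" by (simp only:)
    then show ?thesis unfolding gauss_weight_def by (simp add: mult_ac)
  qed
  finally show ?thesis .
qed

lemma frechet_Re:
  assumes "(g has_real_derivative g') (at (Re z))"
  shows "frechet_derivative (\<lambda>z. complex_of_real (g (Re z))) (at z) = (\<lambda>k. of_real (g' * Re k))"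
proof -
  have "((\<lambda>z. complex_of_real (g (Re z))) has_derivative (\<lambda>k. of_real (g' * Re k))) (at z)"
    by (intro has_derivative_of_real has_derivative_compose[OF bounded_linear_imp_has_derivative[OF bounded_linear_Re]
          assms[unfolded has_field_derivative_def]])
  then show ?thesis by (rule frechet_derivative_at[symmetric])
qed

lemma wirtinger_Re:
  assumes "(g has_real_derivative g') (at (Re z))"
  shows "wirtinger (\<lambda>z. of_real (g (Re z))) z = of_real (g' / 2)"
    "wirtinger_bar (\<lambda>z. of_real (g (Re z))) z = of_real (g' / 2)"
  unfolding wirtinger_def wirtinger_bar_def frechet_Re[OF assms] by simp_all

text \<open>The potential depends on \<open>Re z\<close> only, and on such functions both Wirtinger derivatives are half the
  real derivative.\<close>

lemma kaehler_form_eq: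
  assumes h: "h > 0"
  shows "\<exists>q. (\<forall>x. q x > 0) \<and> (\<forall>z \<xi> \<eta>. kaehler_potential_form h (\<lambda>z. Re (theta_kernel h z)) z \<xi> \<eta>
     = \<i> * of_real (q (Re z)) * (cnj \<xi> * \<eta> - cnj \<eta> * \<xi>))"
proof -
  let ?k = "\<lambda>j x. theta_moment h j (2 * x - h)"
  have kd: "(?k j has_real_derivative 2 * ?k (Suc j) x) (at x)" for j x
  proof -
    have "((\<lambda>x. 2 * x - h) has_real_derivative 2) (at x)" by (auto intro!: derivative_eq_intros)
    from DERIV_chain2[where f = "theta_moment h j" and g = "\<lambda>x. 2 * x - h", OF theta_moment_deriv[OF h] this]
    show ?thesis by (simp only: mult.commute)
  qed
  have d1: "((\<lambda>x. ln (?k 0 x)) has_real_derivative 2 * ?k 1 x / ?k 0 x) (at x)" for x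
    using theta_moment_pos[OF h, of "2 * x - h"]
    by (auto intro!: derivative_eq_intros kd[of 0 x, simplified])
  have d2: "((\<lambda>x. 2 * ?k 1 x / ?k 0 x / 2) has_real_derivative
       2 * ((?k 2 x * ?k 0 x - (?k 1 x)\<^sup>2) / (?k 0 x)\<^sup>2)) (at x)" for x
  proof -
    have "((\<lambda>x. ?k 1 x / ?k 0 x) has_real_derivative
       (2 * ?k 2 x * ?k 0 x - ?k 1 x * (2 * ?k 1 x)) / (?k 0 x * ?k 0 x)) (at x)"
      using DERIV_divide[OF kd[of 1 x] kd[of 0 x]] theta_moment_pos[OF h, of "2 * x - h"]
      by (simp add: numeral_2_eq_2)
    moreover have "(2 * a * b - c * (2 * c)) / (b * b) = 2 * ((a * b - c\<^sup>2) / b\<^sup>2)" for a b c :: real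
      by (simp add: power2_eq_square right_diff_distrib mult_ac)
    moreover have "2 * a / b / 2 = a / b" for a b :: real by simp
    ultimately show ?thesis by (simp only:)
  qed
  define q where "q = (\<lambda>x. h * ((?k 2 x * ?k 0 x - (?k 1 x)\<^sup>2) / (?k 0 x)\<^sup>2))"
  have "q x > 0" for x
    unfolding q_def using h theta_log_convex[OF h] theta_moment_pos[OF h]
    by (intro mult_pos_pos divide_pos_pos zero_less_power)
  moreover have "kaehler_potential_form h (\<lambda>z. Re (theta_kernel h z)) z \<xi> \<eta>
     = \<i> * of_real (q (Re z)) * (cnj \<xi> * \<eta> - cnj \<eta> * \<xi>)" for z \<xi> \<eta>
  proof -
    have w: "wirtinger (\<lambda>z. of_real (ln (Re (theta_kernel h z)))) = (\<lambda>z. of_real (2 * ?k 1 (Re z) / ?k 0 (Re z) / 2))"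
      unfolding theta_kernel_eq[OF h] Re_complex_of_real by (rule ext, rule wirtinger_Re(1)[OF d1])
    have "wirtinger_bar (wirtinger (\<lambda>z. of_real (ln (Re (theta_kernel h z))))) z
        = of_real (2 * ((?k 2 (Re z) * ?k 0 (Re z) - (?k 1 (Re z))\<^sup>2) / (?k 0 (Re z))\<^sup>2) / 2)"
      unfolding w by (rule wirtinger_Re(2)[OF d2])
    moreover have "2 * a / 2 = a" for a :: real by simp
    ultimately have "wirtinger_bar (wirtinger (\<lambda>z. of_real (ln (Re (theta_kernel h z))))) z
        = of_real ((?k 2 (Re z) * ?k 0 (Re z) - (?k 1 (Re z))\<^sup>2) / (?k 0 (Re z))\<^sup>2)"
      by (simp only:)
    then show ?thesis unfolding kaehler_potential_form_def q_def by (simp only: of_real_mult mult.assoc)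
  qed
  ultimately show ?thesis by blast
qed

lemma kaehler_theta:
  assumes h: "h > 0"
  shows "kaehler_on_cylinder (kaehler_potential_form h (\<lambda>z. Re (theta_kernel h z)))"
proof -
  obtain q where q: "\<And>x. q x > 0" "\<And>z \<xi> \<eta>. kaehler_potential_form h (\<lambda>z. Re (theta_kernel h z)) z \<xi> \<eta>
     = \<i> * of_real (q (Re z)) * (cnj \<xi> * \<eta> - cnj \<eta> * \<xi>)"
    using kaehler_form_eq[OF h] by blast
  have im: "\<i> * of_real r * (cnj \<xi> * \<eta> - cnj \<eta> * \<xi>) = of_real (- 2 * r * Im (cnj \<xi> * \<eta>))" for r \<xi> \<eta>
    by (simp add: complex_eq_iff algebra_simps)
  show ?thesis
    unfolding kaehler_on_cylinder_def q(2) im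
  proof (intro allI conjI impI)
    fix z \<xi> \<eta> :: complex assume "\<xi> \<noteq> 0"
    then have "0 < (cmod \<xi>)\<^sup>2" by simp
    then have "0 < q (Re z) * (cmod \<xi>)\<^sup>2" using q(1) by simp
    moreover have "Im (cnj (\<i> * \<xi>) * \<xi>) = - (cmod \<xi>)\<^sup>2"
      unfolding cmod_power2 by (simp add: power2_eq_square)
    ultimately show "0 < Re (complex_of_real (- 2 * q (Re z) * Im (cnj (\<i> * \<xi>) * \<xi>)))"
      unfolding Re_complex_of_real by simp
  qed (simp_all add: algebra_simps)
qed

section \<open>Sections over the leaf and the reproducing measure\<close>

lemma density_cong_AE:
  assumes "AE x in M. f x = f' x"
  shows "density M f = density M f'"
proof -
  have "(\<integral>\<^sup>+x. f x * indicator A x \<partial>M) = (\<integral>\<^sup>+x. f' x * indicator A x \<partial>M)" for A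
    by (rule nn_integral_cong_AE) (use assms in \<open>eventually_elim, simp\<close>)
  then show ?thesis unfolding density_def by simp
qed

lemma Re_Ln_exp: "Re (Ln (exp z)) = Re z"
  by (subst Re_Ln) simp_all

text \<open>A leaf together with the coefficient model of the untwisted space \<open>L\<close> (\<open>\<sigma> = 0\<close>).\<close>

locale quantized_leaf = leaf \<rho> \<kappa> v \<gamma> K c a0 g M + quasi_periodic_model h 0
  for \<rho> :: "real^'k::finite \<Rightarrow> real" and \<kappa> v \<gamma> K c a0 g M h
begin

definition plane_kernel :: "complex \<Rightarrow> real" where "plane_kernel z = Re (theta_kernel h z)"
definition leaf_kernel :: "'k pt \<Rightarrow> real" where "leaf_kernel p = plane_kernel (Ln (w p))"
definition leaf_measure :: "'k pt measure" where
  "leaf_measure = measure_on_leaf X w (\<lambda>z. Re (theta_density h z))"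
definition sections :: "'k pt fn set" where
  "sections = section_space h X w leaf_kernel leaf_measure"
definition section_mu :: "'k pt measure" where
  "section_mu = section_measure h leaf_kernel leaf_measure"
definition push :: "complex fn \<Rightarrow> 'k pt fn" where
  "push u = (\<lambda>p. if p \<in> X then u (Ln (w p)) else 0)"
definition pull :: "'k pt fn \<Rightarrow> complex fn" where
  "pull s = (\<lambda>z. s (\<psi> (exp z)))"

lemma plane_kernel_eq: "plane_kernel z = theta_moment h 0 (2 * Re z - h)"
  by (simp add: plane_kernel_def theta_kernel_eq[OF h])

lemma leaf_kernel_eq: "leaf_kernel p = theta_moment h 0 (2 * Re (Ln (w p)) - h)"
  by (simp add: leaf_kernel_def plane_kernel_eq)

lemma leaf_kernel_point: "leaf_kernel (\<psi> (exp z)) = plane_kernel z"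
  by (simp add: leaf_kernel_eq plane_kernel_eq w_\<psi> Re_Ln_exp)

lemma \<psi>_exp_in_X: "\<psi> (exp z) \<in> X"
  by (rule \<psi>_in_X) simp

lemma \<psi>_exp_measurable [measurable]: "(\<lambda>z. \<psi> (exp z)) \<in> borel_measurable borel"
proof (rule borel_measurable_continuous_onI)
  have "continuous_on (- {0}) \<psi>" using w_homeomorphism by (simp add: homeomorphism_def)
  then show "continuous_on UNIV (\<lambda>z. \<psi> (exp z))"
    by (rule continuous_on_compose2) (auto intro!: continuous_intros)
qed

lemma sets_strip_measure [simp, measurable_cong]: "sets strip_measure = sets borel"
  by (simp add: strip_measure_def)

text \<open>By \<open>theta_density_eq\<close> dividing \<open>dm\<close> by \<open>2\<pi>h\<K>\<close> leaves the Gaussian weight of \<open>L\<close>, so the norms of \<open>L\<close> and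
  of the sections agree.\<close>

lemma section_mu_eq: "section_mu = distr (L_measure h) borel (\<lambda>z. \<psi> (exp z))"
proof -
  define \<theta> where "\<theta> = (\<lambda>z::complex. ennreal (gauss_weight h (Re z) * (2 * pi * h * plane_kernel z)))"
  define k where "k = (\<lambda>p. ennreal (1 / (2 * pi * h * leaf_kernel p)))"
  \<comment> \<open>\<open>k\<close> is written with the discontinuous function \<open>Ln\<close>; on the leaf it depends on \<open>|w|\<close> only and agrees
    with \<open>k'\<close>, which is measurable because \<open>w\<close> is continuous on the closed set \<open>X\<close>\<close>
  define k' where "k' = (\<lambda>p. ennreal (indicator X p *\<^sub>R (1 / (2 * pi * h * theta_moment h 0 (2 * ln (cmod (w p)) - h)))))"
  have ctm: "continuous_on UNIV (theta_moment h 0)"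
    using theta_moment_deriv[OF h] by (intro continuous_at_imp_continuous_on ballI DERIV_isCont) blast
  have "continuous_on UNIV plane_kernel" unfolding plane_kernel_eq
    by (intro continuous_on_compose2[OF ctm] continuous_intros) auto
  then have km [measurable]: "plane_kernel \<in> borel_measurable borel" by (rule borel_measurable_continuous_onI)
  have [measurable]: "(\<lambda>z. gauss_weight h (Re z)) \<in> borel_measurable borel"
    by (rule measurable_compose[OF borel_measurable_Re borel_measurable_gauss_weight])
  have \<theta>m: "\<theta> \<in> borel_measurable borel" unfolding \<theta>_def by measurable
  have "continuous_on X (\<lambda>p. theta_moment h 0 (2 * ln (cmod (w p)) - h))"
    by (intro continuous_on_compose2[OF ctm] continuous_intros w_continuous) (use X_point in auto)
  then have "continuous_on X (\<lambda>p. 1 / (2 * pi * h * theta_moment h 0 (2 * ln (cmod (w p)) - h)))"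
    using h theta_moment_pos[OF h] by (intro continuous_intros) (auto simp: less_imp_neq[symmetric])
  from borel_measurable_continuous_on_indicator[OF borel_closed[OF X_closed] this]
  have k'm [measurable]: "k' \<in> borel_measurable borel" unfolding k'_def by measurable
  have kk': "k p = k' p" if "p \<in> X" for p
    using that X_point(1)[OF that] by (simp add: k_def k'_def leaf_kernel_eq Re_Ln)
  have dm: "leaf_measure = distr (density strip_measure \<theta>) borel (\<lambda>z. \<psi> (exp z))"
    unfolding leaf_measure_def measure_on_leaf_def point_of_eq[abs_def] \<theta>_def theta_density_eq[OF h] plane_kernel_eq
    by simp
  have pm: "(\<lambda>z. \<psi> (exp z)) \<in> measurable (density strip_measure \<theta>) borel"
    by (simp cong: measurable_cong_sets)
  have X_meas: "{p \<in> space borel. p \<in> X} \<in> sets borel" using X_closed by simp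
  have "AE p in leaf_measure. p \<in> X"
    unfolding dm by (subst AE_distr_iff[OF pm X_meas]) (simp add: \<psi>_exp_in_X)
  then have "AE p in leaf_measure. k p = k' p" by eventually_elim (rule kk')
  then have "section_mu = density leaf_measure k'"
    unfolding section_mu_def section_measure_def k_def by (rule density_cong_AE)
  also have "\<dots> = distr (density (density strip_measure \<theta>) (\<lambda>z. k' (\<psi> (exp z)))) borel (\<lambda>z. \<psi> (exp z))"
    unfolding dm by (rule density_distr) (use pm in simp_all)
  also have "density (density strip_measure \<theta>) (\<lambda>z. k' (\<psi> (exp z))) = density strip_measure (\<lambda>z. \<theta> z * k' (\<psi> (exp z)))"
    by (rule density_density_eq) (simp_all cong: measurable_cong_sets add: \<theta>m measurable_compose[OF \<psi>_exp_measurable k'm])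
  also have "(\<lambda>z. \<theta> z * k' (\<psi> (exp z))) = (\<lambda>z. ennreal (gauss_weight h (Re z)))"
  proof
    fix z
    have kp: "plane_kernel z > 0" using theta_moment_pos[OF h] by (simp add: plane_kernel_eq)
    have "k' (\<psi> (exp z)) = ennreal (1 / (2 * pi * h * plane_kernel z))"
      unfolding kk'[OF \<psi>_exp_in_X, symmetric] k_def leaf_kernel_point ..
    then have "\<theta> z * k' (\<psi> (exp z)) = ennreal (gauss_weight h (Re z) * (2 * pi * h * plane_kernel z) * (1 / (2 * pi * h * plane_kernel z)))"
      unfolding \<theta>_def by (simp only:) (rule ennreal_mult''[symmetric], use h kp in simp)
    then show "\<theta> z * k' (\<psi> (exp z)) = ennreal (gauss_weight h (Re z))" using h kp by simp
  qed
  also have "density strip_measure (\<lambda>z. ennreal (gauss_weight h (Re z))) = L_measure h"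
    unfolding L_measure_def gauss_weight_def ..
  finally show ?thesis .
qed

lemma periodic_exp:
  assumes "u \<in> L_space h 1" "exp a = exp b" shows "u a = u b"
  by (rule periodic_exp_eq[of u, OF _ assms(2)]) (use assms(1) in \<open>simp add: L_space_def\<close>)

lemma pull_push:
  assumes "u \<in> L_space h 1" shows "pull (push u) = u"
proof
  fix z
  have "pull (push u) z = u (Ln (exp z))" by (simp add: pull_def push_def \<psi>_exp_in_X w_\<psi>)
  also have "\<dots> = u z" by (rule periodic_exp[OF assms]) simp
  finally show "pull (push u) z = u z" .
qed

lemma section_L_space:
  assumes "s \<in> sections" shows "pull s \<in> L_space h 1" "push (pull s) = s"
proof -
  obtain f where f: "antiholomorphic_on f (w ` X)" "\<And>p. p \<in> X \<Longrightarrow> s p = f (w p)" "\<And>p. p \<notin> X \<Longrightarrow> s p = 0"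
      "sq_integrable section_mu s"
    using assms unfolding sections_def section_space_def section_mu_def by blast
  have ps: "pull s = (\<lambda>z. f (exp z))" using f(2)[OF \<psi>_exp_in_X] by (simp add: pull_def w_\<psi> fun_eq_iff)
  have "(\<lambda>z. cnj (f (exp z))) holomorphic_on UNIV"
    using f(1) unfolding antiholomorphic_on_def w_image
    by (intro holomorphic_on_compose_gen[of exp UNIV "\<lambda>\<zeta>. cnj (f \<zeta>)" "- {0}", unfolded o_def]) (auto intro: holomorphic_intros)
  then have "antiholomorphic_on (pull s) UNIV" by (simp add: antiholomorphic_on_def ps)
  moreover have "pull s (z + 2 * of_real pi * \<i>) = 1 * pull s z" for z by (simp add: ps exp_add)
  moreover have "sq_integrable (L_measure h) (pull s)"
  proof -
    have sm: "s \<in> borel_measurable borel" using f(4) by (simp add: sq_integrable_def section_mu_eq)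
    have pm: "(\<lambda>z. \<psi> (exp z)) \<in> measurable (L_measure h) borel" by (simp cong: measurable_cong_sets)
    have "(\<lambda>x. (cmod (s x))\<^sup>2) \<in> borel_measurable borel" using sm by measurable
    from integrable_distr_eq[OF pm this] f(4) show ?thesis
      using measurable_compose[OF pm sm] by (simp add: sq_integrable_def section_mu_eq pull_def)
  qed
  ultimately show "pull s \<in> L_space h 1" by (simp add: L_space_def)
  have "push (pull s) p = s p" for p
  proof (cases "p \<in> X")
    case True
    then show ?thesis using X_point[OF True] by (simp add: push_def pull_def exp_Ln)
  qed (simp add: push_def f(3))
  then show "push (pull s) = s" by blast
qed

lemma nrm_section:
  assumes "s \<in> sections" shows "nrm section_mu s = nrm (L_measure h) (pull s)"
proof -
  have sm: "s \<in> borel_measurable borel"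
    using assms by (auto simp: sections_def section_space_def section_mu_def[symmetric] sq_integrable_def section_mu_eq)
  have pm: "(\<lambda>z. \<psi> (exp z)) \<in> measurable (L_measure h) borel" by (simp cong: measurable_cong_sets)
  have "(\<lambda>x. (cmod (s x))\<^sup>2) \<in> borel_measurable borel" using sm by measurable
  from integral_distr[OF pm this] show ?thesis by (simp add: nrm_def section_mu_eq pull_def)
qed

lemma push_section:
  assumes u: "u \<in> L_space h 1" shows "push u \<in> sections"
proof -
  have hol: "(\<lambda>\<zeta>. cnj (u (Ln \<zeta>))) holomorphic_on - {0}"
    by (rule holomorphic_periodic_Ln[of "\<lambda>z. cnj (u z)"]) (use u in \<open>auto simp: L_space_def antiholomorphic_on_def\<close>)
  have "continuous_on (- {0}) (\<lambda>\<zeta>. cnj (cnj (u (Ln \<zeta>))))"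
    by (intro continuous_intros holomorphic_on_imp_continuous_on[OF hol])
  then have "continuous_on X (\<lambda>p. u (Ln (w p)))"
    by (intro continuous_on_compose2[of "- {0}" "\<lambda>\<zeta>. u (Ln \<zeta>)" X w] w_continuous) (use X_point in auto)
  from borel_measurable_continuous_on_indicator[OF borel_closed[OF X_closed] this]
  have "(\<lambda>p. indicator X p *\<^sub>R u (Ln (w p))) \<in> borel_measurable borel" .
  moreover have "(\<lambda>p. indicator X p *\<^sub>R u (Ln (w p))) = push u" by (auto simp: push_def indicator_def)
  ultimately have sm: "push u \<in> borel_measurable borel" by simp
  have pm: "(\<lambda>z. \<psi> (exp z)) \<in> measurable (L_measure h) borel" by (simp cong: measurable_cong_sets)
  have "(\<lambda>x. (cmod (push u x))\<^sup>2) \<in> borel_measurable borel" using sm by measurable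
  from integrable_distr_eq[OF pm this]
  have "sq_integrable section_mu (push u)"
    using sm u pull_push[OF u] by (simp add: sq_integrable_def section_mu_eq L_space_def pull_def fun_eq_iff)
  moreover have "antiholomorphic_on (\<lambda>\<zeta>. u (Ln \<zeta>)) (w ` X)" unfolding w_image antiholomorphic_on_def by (rule hol)
  ultimately show ?thesis
    unfolding sections_def section_space_def section_mu_def[symmetric] by (auto simp: push_def)
qed

lemma push_add: "push (\<lambda>z. u z + u' z) = (\<lambda>p. push u p + push u' p)"
  and push_scale: "push (\<lambda>z. a * u z) = (\<lambda>p. a * push u p)"
  by (auto simp: push_def)

lemma push_bij: "bij_betw push (L_space h 1) sections"
  by (rule bij_betw_byWitness[of _ pull]) (use pull_push push_section section_L_space in auto)

lemma push_unitary: "unitary (L_measure h) (L_space h 1) section_mu sections push"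
  unfolding unitary_def linear_on_def
  using push_add push_scale push_bij nrm_section[OF push_section] pull_push by simp

text \<open>The coefficients of a section are those of its pullback to the plane.\<close>

sublocale sec: l2_model section_mu sections sections "\<lambda>s. l2_coeff h 0 (pull s)"
proof
  have LH: "u \<in> L_space h 1 \<longleftrightarrow> u \<in> Hs" for u by simp
  show "lin_subspace sections"
    unfolding lin_subspace_def
  proof (intro conjI ballI allI)
    have "push (\<lambda>x. 0) \<in> sections" using push_section H_zero by simp
    then show "(\<lambda>x. 0) \<in> sections" by (simp add: push_def if_distrib cong: if_cong)
    fix s assume s: "s \<in> sections"
    show "(\<lambda>x. a * s x) \<in> sections" for a
      using push_section[of "\<lambda>z. a * pull s z"] H_scale[of "pull s" a] section_L_space[OF s] push_scale[of a "pull s"] by simp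
    fix t assume t: "t \<in> sections"
    show "(\<lambda>x. s x + t x) \<in> sections"
      using push_section[of "\<lambda>z. pull s z + pull t z"] H_add[of "pull s" "pull t"]
        section_L_space[OF s] section_L_space[OF t] push_add[of "pull s" "pull t"] by simp
  qed
  fix s assume s: "s \<in> sections"
  have ps: "pull s \<in> Hs" using section_L_space[OF s] by simp
  show "l2_coeff h 0 (pull (\<lambda>x. a * s x)) = (\<lambda>n. a * l2_coeff h 0 (pull s) n)" for a
    using N_scale[OF H_P[OF ps]] by (simp add: pull_def)
  show "sq_integrable section_mu s" using s by (auto simp: sections_def section_space_def section_mu_def)
  show "((\<lambda>n. (cmod (l2_coeff h 0 (pull s) n))\<^sup>2) has_sum (nrm section_mu s)\<^sup>2) UNIV"
    unfolding nrm_section[OF s] by (rule parseval[OF ps])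
  show "s = (\<lambda>x. 0)" if "\<And>n. l2_coeff h 0 (pull s) n = 0"
  proof -
    have "pull s = (\<lambda>x. 0)" using N_inj[OF H_P[OF ps]] that by blast
    then have "s = push (\<lambda>x. 0)" using section_L_space(2)[OF s] by simp
    then show ?thesis by (auto simp: push_def)
  qed
  fix t assume t: "t \<in> sections"
  have pt: "pull t \<in> Hs" using section_L_space[OF t] by simp
  show "l2_coeff h 0 (pull (\<lambda>x. s x + t x)) = (\<lambda>n. l2_coeff h 0 (pull s) n + l2_coeff h 0 (pull t) n)"
    using N_add[OF H_P[OF ps] H_P[OF pt]] by (simp add: pull_def)
next
  show "s \<in> sections \<longleftrightarrow> s \<in> sections \<and> square_summable (l2_coeff h 0 (pull s))" for s
    using section_L_space[of s] H_l2[of "pull s"] by auto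
  fix x :: "int \<Rightarrow> complex" assume "square_summable x"
  from N_onto_H[OF this] obtain u where u: "u \<in> Hs" "l2_coeff h 0 u = x" by blast
  then show "\<exists>s\<in>sections. l2_coeff h 0 (pull s) = x"
    using push_section[of u] pull_push[of u] by (intro bexI[of _ "push u"]) simp_all
qed

text \<open>The value of \<open>u\<close> at the point \<open>p\<close> with coordinate \<open>z\<close> is the sum of its coefficients times
  \<open>k\<^sub>n = exp (n cnj z) / \<parallel>e\<^sub>n\<parallel>\<close>, and \<open>|k\<^sub>n|\<^sup>2\<close> is the \<open>n\<close>-th term of the theta series for the kernel at \<open>p\<close>.\<close>

lemma reproducing: "reproducing_measure h X w (kaehler_potential_form h plane_kernel) leaf_kernel leaf_measure"
proof -
  have \<omega>: "kaehler_potential_form h plane_kernel = kaehler_potential_form h (\<lambda>z. leaf_kernel (point_of X w z))"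
    unfolding point_of_eq leaf_kernel_point ..
  have sum: "((\<lambda>u. (cmod (u p))\<^sup>2) has_sum leaf_kernel p) E"
    if E: "orthonormal_basis section_mu sections E" and p: "p \<in> X" for E p
  proof -
    define z where "z = Ln (w p)"
    have pz: "p = \<psi> (exp z)" using X_point[OF p] by (simp add: z_def exp_Ln)
    define k where "k = (\<lambda>n::int. exp (of_int n * cnj z) / complex_of_real (basis_norm h (of_int n)))"
    have k2: "(cmod (k n))\<^sup>2 = exp (of_int n * (2 * Re z - h) - h * (of_int n)\<^sup>2)" for n
    proof -
      have "(cmod (k n))\<^sup>2 = exp (2 * (of_int n * Re z)) / exp (h * ((of_int n)\<^sup>2 + of_int n))"
        using basis_norm_pos[of h "of_int n"] unfolding k_def
        by (simp add: norm_divide power_divide basis_norm_sq exp_double[symmetric])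
      also have "\<dots> = exp (of_int n * (2 * Re z - h) - h * (of_int n)\<^sup>2)"
        unfolding exp_diff[symmetric] by (rule arg_cong[of _ _ exp]) (simp add: algebra_simps)
      finally show ?thesis .
    qed
    have ks: "((\<lambda>n. (cmod (k n))\<^sup>2) has_sum leaf_kernel p) UNIV"
      unfolding k2 using theta_moment_series(1)[OF h, of 0 "2 * Re z - h"] by (simp add: leaf_kernel_eq z_def)
    have ev: "((\<lambda>n. l2_coeff h 0 (pull u) n * k n) has_sum u p) UNIV" if u: "u \<in> sections" for u
    proof -
      have "pull u \<in> quasi_periodic 0" using section_L_space(1)[OF u] H_P[of "pull u"] by simp
      then obtain c where c: "rapid c" "pull u = anti_series 0 c" by (rule quasi_periodic_cases)
      have "l2_coeff h 0 (pull u) n * k n = c n * exp (of_real (of_int n + 0) * cnj z)" for n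
        using basis_norm_pos[of h "of_int n"] by (simp add: c l2_coeff_anti_series k_def)
      moreover have "u p = exp_series 0 c (cnj z)"
        using fun_cong[OF c(2), of z] by (simp add: pz pull_def anti_series_def)
      ultimately show ?thesis using exp_series_has_sum[OF c(1), of 0 "cnj z"] by simp
    qed
    show ?thesis
      by (rule sec.reproducing_sum[OF E _ ev ks])
         (use has_sum_imp_summable[OF ks] in \<open>simp_all add: square_summable_def\<close>)
  qed
  show ?thesis
    unfolding reproducing_measure_def Let_def sections_def[symmetric] section_mu_def[symmetric]
    using \<omega> sec.hilbert sec.orthonormal_basis_exists sum by blast
qed

end

section \<open>The representation on L\<close>

context quantized_leaf begin

abbreviation \<alpha> where "\<alpha> \<equiv> spectrum_point h \<gamma> a0 0"
abbreviation A where "A \<equiv> A_hat h \<gamma> a0"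
abbreviation B where "B \<equiv> B_hat h \<gamma> a0 M"
abbreviation C where "C \<equiv> C_hat h \<gamma> a0 M"

lemma \<alpha>_eq: "\<alpha> n = \<gamma> (h * (of_int n + 1)) a0"
  by (simp add: spectrum_point_def)

lemma \<alpha>_pred: "\<alpha> (n - 1) = \<gamma> (- h) (\<alpha> n)"
  unfolding \<alpha>_eq flow_add[symmetric] by (rule arg_cong[of _ _ "\<lambda>t. \<gamma> t a0"]) (simp add: algebra_simps)

lemma \<alpha>_succ: "\<gamma> h (\<alpha> n) = \<alpha> (n + 1)"
  unfolding \<alpha>_eq flow_add[symmetric] by (rule arg_cong[of _ _ "\<lambda>t. \<gamma> t a0"]) (simp add: algebra_simps)

lemma \<alpha>_inj: "\<alpha> m = \<alpha> n \<Longrightarrow> m = n"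
  unfolding \<alpha>_eq using h by (simp add: flow_inj[OF nonper])

lemma M_complex_polynomial: "complex_polynomial M"
  by (rule complex_polynomial_polynomial_function[OF M_polynomial])

lemmas A_diag = A_hat_diagonal[of \<gamma> a0, OF flow_time_component]
lemmas poly_A_diag = poly_A_hat_diagonal[of \<gamma> a0, OF flow_time_component]
lemmas B_shift = B_hat_shift[of \<gamma> a0, OF flow_time_component M_complex_polynomial]
lemmas C_shift = C_hat_shift[of \<gamma> a0, OF flow_time_component M_complex_polynomial]

lemma CB_diag: "diagonal (\<lambda>u. C (B u)) (\<lambda>n. of_real (\<rho> (\<alpha> n) - K))"
proof -
  have "weighted_shift (\<lambda>u. C (B u)) (\<lambda>n. n + 1 - 1) (\<lambda>n. cnj (M (\<alpha> (n + 1 - 1))) * M (\<alpha> n))"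
    by (rule weighted_shift_comp[OF C_shift B_shift])
  moreover have "cnj (M (\<alpha> n)) * M (\<alpha> n) = of_real (\<rho> (\<alpha> n) - K)" for n
    unfolding \<alpha>_eq M_axis[symmetric] by (subst complex_norm_square) (simp add: mult.commute)
  ultimately show ?thesis by simp
qed

lemma BC_diag: "diagonal (\<lambda>u. B (C u)) (\<lambda>n. of_real (\<rho> (\<alpha> (n - 1)) - K))"
proof -
  have "weighted_shift (\<lambda>u. B (C u)) (\<lambda>n. n - 1 + 1) (\<lambda>n. M (\<alpha> (n - 1)) * cnj (M (\<alpha> (n - 1))))"
    by (rule weighted_shift_comp[OF B_shift C_shift])
  moreover have "M (\<alpha> n) * cnj (M (\<alpha> n)) = of_real (\<rho> (\<alpha> n) - K)" for n
    unfolding \<alpha>_eq M_axis[symmetric] by (rule complex_norm_square[symmetric])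
  ultimately show ?thesis by simp
qed

lemma \<rho>_polynomial: "real_polynomial_function \<rho>"
  using alg by (simp add: algebra_data_def)

lemma flow_vector_polynomial: "polynomial_function (\<gamma> t)"
  unfolding polynomial_function_iff_Basis_inner
  using flow_space_component[of t] by (auto simp: Basis_vec_def inner_axis)

text \<open>Both sides of each relation are weighted shifts with the same permutation, so it suffices to compare
  weights. For the first relation these are \<open>\<rho>(\<alpha>\<^sub>n) - K\<close> and its value one step earlier, for the
  second the coordinates of \<open>\<alpha>\<close> at neighbouring indices.\<close>

lemma commutation:
  assumes u: "u \<in> quasi_periodic 0"
  shows "(\<lambda>x. C (B u) x - B (C u) x) = poly_op (\<lambda>a. of_real (lambda_h h \<rho> \<gamma> a)) A u"
    "C (A i u) = poly_op (\<lambda>a. of_real (\<gamma> h a $ i)) A (C u)"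
    "A i (A j u) = A j (A i u)"
proof -
  note CB = weighted_shiftD[OF CB_diag] and BC = weighted_shiftD[OF BC_diag]
  have "real_polynomial_function (\<lambda>a. \<rho> (\<gamma> (- h) a))"
    using real_polynomial_function_compose[OF flow_vector_polynomial \<rho>_polynomial] by (simp add: o_def)
  then have "complex_polynomial (\<lambda>a. of_real (lambda_h h \<rho> \<gamma> a))"
    unfolding lambda_h_def by (intro complex_polynomial_of_real real_polynomial_function_diff \<rho>_polynomial)
  note L = weighted_shiftD[OF poly_A_diag[OF this]]
  show "(\<lambda>x. C (B u) x - B (C u) x) = poly_op (\<lambda>a. of_real (lambda_h h \<rho> \<gamma> a)) A u"
    by (rule P_eqI[OF P_diff[OF CB(2)[OF u] BC(2)[OF u]] L(2)[OF u]])
       (simp only: N_diff[OF CB(2)[OF u] BC(2)[OF u]] CB(3)[OF u] BC(3)[OF u] L(3)[OF u],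
        simp add: lambda_h_def \<alpha>_pred algebra_simps)
  have G: "complex_polynomial (\<lambda>a. of_real (\<gamma> h a $ i))"
    by (rule complex_polynomial_of_real[OF flow_space_component])
  note CA = weighted_shift_comp[OF C_shift A_diag[of i]]
  note GC = weighted_shift_comp[OF poly_A_diag[OF G] C_shift]
  show "C (A i u) = poly_op (\<lambda>a. of_real (\<gamma> h a $ i)) A (C u)"
    by (rule weighted_shift_eqI[OF CA u weighted_shiftD(2)[OF GC u]])
       (simp add: weighted_shiftD(3)[OF GC u] \<alpha>_succ)
  note AA = weighted_shift_comp[OF A_diag A_diag]
  show "A i (A j u) = A j (A i u)"
    by (rule weighted_shift_eqI[OF AA u weighted_shiftD(2)[OF AA u]])
       (simp add: weighted_shiftD(3)[OF AA u])
qed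

lemma generators_L_rep:
  "generators (L_rep h 1 \<gamma> a0 M) = (\<lambda>i. max_oper Hs (A i)) ` UNIV \<union> {max_oper Hs B, max_oper Hs C}"
  by (simp add: generators_def L_rep_def)

lemma generator_shift:
  assumes "T \<in> generators (L_rep h 1 \<gamma> a0 M)"
  obtains T' \<pi> t where "T = max_oper Hs T'" "weighted_shift T' \<pi> t"
  using assms A_diag B_shift C_shift unfolding generators_L_rep by blast

lemma star_representation: "star_representation h \<rho> \<gamma> (L_rep h 1 \<gamma> a0 M)"
proof -
  have R: "rep_measure (L_rep h 1 \<gamma> a0 M) = L_measure h" "rep_space (L_rep h 1 \<gamma> a0 M) = Hs"
    "rep_A (L_rep h 1 \<gamma> a0 M) = (\<lambda>i. max_oper Hs (A i))"
    "rep_B (L_rep h 1 \<gamma> a0 M) = max_oper Hs B" "rep_C (L_rep h 1 \<gamma> a0 M) = max_oper Hs C"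
    by (simp_all add: L_rep_def)
  have S: "snd (max_oper Hs T) = T" for T by (simp add: max_oper_def)
  have gen: "densely_defined (L_measure h) Hs T" "is_core (L_measure h) T finite_vectors"
      "snd T ` finite_vectors \<subseteq> finite_vectors"
    if T0: "T \<in> generators (L_rep h 1 \<gamma> a0 M)" for T
  proof -
    obtain T' \<pi> t where T: "T = max_oper Hs T'" "weighted_shift T' \<pi> t" by (rule generator_shift[OF T0])
    show "densely_defined (L_measure h) Hs T" unfolding T(1) by (rule weighted_shift_densely_defined[OF T(2)])
    show "is_core (L_measure h) T finite_vectors" unfolding T(1) by (rule weighted_shift_core[OF T(2)])
    show "snd T ` finite_vectors \<subseteq> finite_vectors"
      unfolding T(1) S using weighted_shift_finite_vectors[OF T(2)] by blast
  qed
  have BC: "is_adjoint (L_measure h) Hs (max_oper Hs B) (max_oper Hs C)"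
    by (rule weighted_shift_adjoint[OF B_shift C_shift]) simp_all
  have AA: "is_adjoint (L_measure h) Hs (max_oper Hs (A i)) (max_oper Hs (A i))" for i
    by (rule weighted_shift_adjoint[OF A_diag A_diag]) simp_all
  have D: "u \<in> quasi_periodic 0" if "u \<in> finite_vectors" for u using that by (simp add: finite_vectors_def)
  show ?thesis
    unfolding star_representation_def Let_def R S
    using hilbert gen BC AA finite_vectors_subspace commutation[OF D]
    by (intro conjI ballI allI exI[of _ finite_vectors]) simp_all
qed

lemma irreducible: "irreducible_rep (L_rep h 1 \<gamma> a0 M)"
proof -
  have R: "rep_measure (L_rep h 1 \<gamma> a0 M) = L_measure h" "rep_space (L_rep h 1 \<gamma> a0 M) = Hs"
    by (simp_all add: L_rep_def)
  have ne: "Hs \<noteq> {\<lambda>x. 0}"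
  proof
    assume "Hs = {\<lambda>x. 0}"
    then have "basis_vector 0 = (\<lambda>x. 0)" using basis_vector(1)[of 0] by blast
    then have "l2_coeff h 0 (\<lambda>x. 0) 0 = 1" using basis_vector(2)[of 0] by simp
    then show False using N_zero by simp
  qed
  have "V = {\<lambda>x. 0} \<or> V = Hs"
    if V: "closed_subspace (L_measure h) Hs V"
      and red: "\<And>T. T \<in> generators (L_rep h 1 \<gamma> a0 M) \<Longrightarrow> reduces (L_measure h) Hs T V" for V
  proof (rule no_reducing_subspace[OF V, where \<pi> = "\<lambda>n. n + 1" and \<pi>' = "\<lambda>n. n - 1" and A = A and B = B and C = C
        and a = "\<lambda>i n. of_real (\<alpha> n $ i)" and b = "\<lambda>n. M (\<alpha> n)" and c = "\<lambda>n. cnj (M (\<alpha> (n - 1)))"])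
    show "diagonal (A i) (\<lambda>n. of_real (\<alpha> n $ i))" for i by (rule A_diag)
    show "reduces (L_measure h) Hs (max_oper Hs (A i)) V" "reduces (L_measure h) Hs (max_oper Hs B) V"
      "reduces (L_measure h) Hs (max_oper Hs C) V" for i
      by (rule red, simp add: generators_L_rep)+
    show "m = n" if "\<And>i. complex_of_real (\<alpha> m $ i) = of_real (\<alpha> n $ i)" for m n
      using that by (intro \<alpha>_inj) (simp add: vec_eq_iff)
    show "M (\<alpha> n) \<noteq> 0" "cnj (M (\<alpha> (n - 1))) \<noteq> 0" for n
      unfolding \<alpha>_eq using M_axis_nonzero by simp_all
    show "S = {} \<or> S = UNIV" if S: "\<And>n. n \<in> S \<longleftrightarrow> n + 1 \<in> S" for S :: "int set"
    proof -
      have "n \<in> S \<longleftrightarrow> 0 \<in> S" for n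
      proof (induction n rule: int_induct[where k = 0])
        case (step2 i)
        then show ?case using S[of "i - 1"] by simp
      qed (use S in auto)
      then show ?thesis by blast
    qed
    show "weighted_shift B (\<lambda>n. n + 1) (\<lambda>n. M (\<alpha> n))" by (rule B_shift)
    show "weighted_shift C (\<lambda>n. n - 1) (\<lambda>n. cnj (M (\<alpha> (n - 1))))" by (rule C_shift)
  qed simp
  then show ?thesis unfolding irreducible_rep_def R using ne by blast
qed

lemma casimir:
  assumes u: "u \<in> L_space h 1"
  shows "j \<in> {1..<CARD('k)} \<Longrightarrow> poly_op (\<lambda>a. of_real (\<kappa> j a)) A u = (\<lambda>z. of_real (c j) * u z)"
    "(\<lambda>z. poly_op (\<lambda>a. of_real (\<rho> a)) A u z - C (B u) z) = (\<lambda>z. of_real K * u z)"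
proof -
  have uP: "u \<in> quasi_periodic 0" using u H_P[of u] by simp
  show "poly_op (\<lambda>a. of_real (\<kappa> j a)) A u = (\<lambda>z. of_real (c j) * u z)" if j: "j \<in> {1..<CARD('k)}"
  proof -
    have "complex_polynomial (\<lambda>a. of_real (\<kappa> j a))"
      using alg j by (intro complex_polynomial_of_real) (auto simp: algebra_data_def)
    note D = poly_A_diag[OF this]
    show ?thesis
      by (rule weighted_shift_eqI[OF D uP P_scale[OF uP]])
         (simp add: N_scale[OF uP] \<kappa>_axis[OF j] \<alpha>_eq)
  qed
  note R = weighted_shiftD[OF poly_A_diag[OF complex_polynomial_of_real[OF \<rho>_polynomial]]]
    and CB = weighted_shiftD[OF CB_diag]
  show "(\<lambda>z. poly_op (\<lambda>a. of_real (\<rho> a)) A u z - C (B u) z) = (\<lambda>z. of_real K * u z)"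
    by (rule P_eqI[OF P_diff[OF R(2)[OF uP] CB(2)[OF uP]] P_scale[OF uP]])
       (simp add: N_diff[OF R(2)[OF uP] CB(2)[OF uP]] N_scale[OF uP] R(3)[OF uP] CB(3)[OF uP] algebra_simps)
qed

end

section \<open>Equivalence of representations\<close>

text \<open>The recursion is solved in both directions from the value 1 at 0.\<close>

lemma int_phase_exists:
  fixes r :: "int \<Rightarrow> complex"
  assumes r: "\<And>n. cmod (r n) = 1"
  shows "\<exists>p. (\<forall>n. cmod (p n) = 1) \<and> (\<forall>n. p (n + 1) = r n * p n)"
proof -
  define a where "a = (\<lambda>k::nat. \<Prod>j<k. r (int j))"
  define b where "b = (\<lambda>k::nat. \<Prod>j<k. 1 / r (- int j - 1))"
  define p where "p = (\<lambda>n. if n \<ge> 0 then a (nat n) else b (nat (- n)))"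
  have "cmod (p n) = 1" for n
    by (simp add: p_def a_def b_def prod_norm[symmetric] norm_divide r)
  moreover have "p (n + 1) = r n * p n" for n
  proof -
    consider "n \<ge> 0" | "n = -1" | "n < -1" by linarith
    then show ?thesis
    proof cases
      case 1
      then have "nat (n + 1) = Suc (nat n)" by simp
      then show ?thesis using 1 by (simp add: p_def a_def mult.commute)
    next
      case 2
      then show ?thesis using r[of "-1"] by (auto simp: p_def a_def b_def)
    next
      case 3
      define k where "k = nat (- n) - 1"
      have k: "nat (- n) = Suc k" "nat (- (n + 1)) = k" "n = - int k - 1" using 3 by (auto simp: k_def)
      have "r n \<noteq> 0" using r[of n] by auto
      have "p (n + 1) = b k" using 3 k(2) by (simp add: p_def)
      moreover have "p n = b k * (1 / r n)" using 3 k(1,3) by (simp add: p_def b_def)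
      ultimately show ?thesis using \<open>r n \<noteq> 0\<close> by simp
    qed
  qed
  ultimately show ?thesis by blast
qed

text \<open>Since \<open>h (n - s/h + 1) + s = h (n + 1)\<close>, the twist \<open>\<sigma> = - s/h\<close> compensates the displacement of the base
  point, and both representations have the same joint spectrum \<open>\<alpha>\<close>. The squared moduli of the weights
  \<open>M(\<alpha>\<^sub>n)\<close> and \<open>M'(\<alpha>\<^sub>n)\<close> are both \<open>\<rho>(\<alpha>\<^sub>n) - K\<close>, so the weights differ by phases.\<close>

lemma twisted_equivalence:
  assumes "quantized_leaf \<rho> \<kappa> v \<gamma> K c a0 g M h" "leaf \<rho> \<kappa> v \<gamma> K c' (\<gamma> s a0) g' M'"
  shows "equivalent_reps (L_rep h 1 \<gamma> a0 M)
     (L_rep h (exp (2 * of_real pi * \<i> * of_real (s / h))) \<gamma> (\<gamma> s a0) M')"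
proof -
  interpret L: quantized_leaf \<rho> \<kappa> v \<gamma> K c a0 g M h by fact
  interpret L': leaf \<rho> \<kappa> v \<gamma> K c' "\<gamma> s a0" g' M' by fact
  interpret Q: quasi_periodic_model h "- (s / h)" by unfold_locales (rule L.h)
  have \<alpha>: "spectrum_point h \<gamma> (\<gamma> s a0) (- (s / h)) n = L.\<alpha> n" for n
    unfolding spectrum_point_def L.flow_add[symmetric]
    by (rule arg_cong[of _ _ "\<lambda>t. \<gamma> t a0"]) (use L.h in \<open>simp add: field_simps\<close>)
  have \<alpha>s: "L.\<alpha> n = \<gamma> (h * (of_int n + 1) - s) (\<gamma> s a0)" for n
    unfolding L.\<alpha>_eq L.flow_add[symmetric] by simp
  have M': "complex_polynomial M'" by (rule complex_polynomial_polynomial_function[OF L'.M_polynomial])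
  have nz: "M (L.\<alpha> n) \<noteq> 0" for n unfolding L.\<alpha>_eq by (rule L.M_axis_nonzero)
  have norm_eq: "cmod (M' (L.\<alpha> n)) = cmod (M (L.\<alpha> n))" for n
  proof -
    have "(cmod (M' (L.\<alpha> n)))\<^sup>2 = \<rho> (L.\<alpha> n) - K" unfolding \<alpha>s by (rule L'.M_axis)
    moreover have "(cmod (M (L.\<alpha> n)))\<^sup>2 = \<rho> (L.\<alpha> n) - K" unfolding L.\<alpha>_eq by (rule L.M_axis)
    ultimately have "(cmod (M' (L.\<alpha> n)))\<^sup>2 = (cmod (M (L.\<alpha> n)))\<^sup>2" by simp
    then show ?thesis by (rule power2_eq_imp_eq) simp_all
  qed
  obtain p where p: "\<And>n. cmod (p n) = 1" "\<And>n. p (n + 1) = M' (L.\<alpha> n) / M (L.\<alpha> n) * p n"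
    using int_phase_exists[of "\<lambda>n. M' (L.\<alpha> n) / M (L.\<alpha> n)"] nz by (auto simp: norm_divide norm_eq)
  interpret PR: l2_model_pair "L_measure h" "quasi_periodic 0" L.Hs "l2_coeff h 0"
      "L_measure h" "quasi_periodic (- (s / h))" Q.Hs "l2_coeff h (- (s / h))" p
    by unfold_locales (rule p)
  have Hs: "L.Hs = L_space h 1" by simp
  have Qs: "Q.Hs = L_space h (exp (2 * of_real pi * \<i> * of_real (s / h)))" by simp
  note A' = Q.A_hat_diagonal[of \<gamma> "\<gamma> s a0", OF L.flow_time_component, unfolded \<alpha>]
    and B' = Q.B_hat_shift[of \<gamma> "\<gamma> s a0", OF L.flow_time_component M', unfolded \<alpha>]
    and C' = Q.C_hat_shift[of \<gamma> "\<gamma> s a0", OF L.flow_time_component M', unfolded \<alpha>]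
  have "intertwines L.Hs PR.transport (max_oper L.Hs (L.A i)) (max_oper Q.Hs (A_hat h \<gamma> (\<gamma> s a0) i))" for i
    by (rule PR.transport_intertwines[OF L.A_diag A']) simp
  moreover have "intertwines L.Hs PR.transport (max_oper L.Hs L.B) (max_oper Q.Hs (B_hat h \<gamma> (\<gamma> s a0) M'))"
    by (rule PR.transport_intertwines[OF L.B_shift B']) (simp add: p(2) nz)
  moreover have "intertwines L.Hs PR.transport (max_oper L.Hs L.C) (max_oper Q.Hs (C_hat h \<gamma> (\<gamma> s a0) M'))"
  proof (rule PR.transport_intertwines[OF L.C_shift C'])
    fix n
    let ?a = "L.\<alpha> (n - 1)"
    have "cnj (M' ?a) * M' ?a = cnj (M ?a) * M ?a"
      using complex_norm_square[of "M' ?a"] complex_norm_square[of "M ?a"] norm_eq[of "n - 1"]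
      by (simp add: mult.commute)
    then have "cnj (M' ?a) * (M' ?a / M ?a) = cnj (M ?a)" using nz[of "n - 1"] by (simp add: field_simps)
    moreover have "p n = M' ?a / M ?a * p (n - 1)" using p(2)[of "n - 1"] by simp
    ultimately have "cnj (M' ?a) * p n = cnj (M ?a) * p (n - 1)" by (simp only: mult.assoc[symmetric])
    then show "cnj (M' ?a) * p n = p (n - 1) * cnj (M ?a)" by (simp only: mult.commute)
  qed
  ultimately show ?thesis
    unfolding equivalent_reps_def L_rep_def Hs[symmetric] Qs[symmetric]
    using PR.unitary_transport by (intro exI[of _ PR.transport]) simp
qed

text \<open>The basis vector of index 0 is a joint eigenvector of \<open>A\<close> and of \<open>C B\<close>. So is its image in the other
  representation, whose coefficients can be nonzero only at an index \<open>m\<close> with \<open>\<alpha>'\<^sub>m = \<alpha>\<^sub>0\<close>. This places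
  the two base points on the same grid of step \<open>h\<close>, and comparing the eigenvalues of \<open>C B\<close> gives \<open>K\<close>.\<close>

lemma equivalence_invariants:
  assumes "quantized_leaf \<rho> \<kappa> v \<gamma> K c a0 g M h" "quantized_leaf \<rho> \<kappa> v \<gamma> K' c' a0' g' M' h"
    and eqv: "equivalent_reps (L_rep h 1 \<gamma> a0 M) (L_rep h 1 \<gamma> a0' M')"
  shows "K' = K \<and> (\<exists>n::int. a0' = \<gamma> (of_int n * h) a0)"
proof -
  interpret L: quantized_leaf \<rho> \<kappa> v \<gamma> K c a0 g M h by fact
  interpret L': quantized_leaf \<rho> \<kappa> v \<gamma> K' c' a0' g' M' h by fact
  obtain U where U: "unitary (L_measure h) L.Hs (L_measure h) L.Hs U"
      "\<And>i. intertwines L.Hs U (max_oper L.Hs (L.A i)) (max_oper L.Hs (L'.A i))"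
      "intertwines L.Hs U (max_oper L.Hs L.B) (max_oper L.Hs L'.B)"
      "intertwines L.Hs U (max_oper L.Hs L.C) (max_oper L.Hs L'.C)"
    using eqv unfolding equivalent_reps_def L_rep_def by auto
  define \<phi> where "\<phi> = L.basis_vector 0"
  have \<phi>: "\<phi> \<in> L.Hs" "\<phi> \<in> quasi_periodic 0" "\<phi> \<in> L.finite_vectors"
    using L.basis_vector(1) L.basis_vector_finite L.H_P by (auto simp: \<phi>_def)
  have N\<phi>: "l2_coeff h 0 \<phi> n = (if n = 0 then 1 else 0)" for n
    unfolding \<phi>_def L.basis_vector(2) ..
  have U_scale: "U (\<lambda>x. a * \<phi> x) = (\<lambda>x. a * U \<phi> x)" for a
    using U(1) \<phi>(1) unfolding unitary_def linear_on_def by blast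
  have U_H: "U u \<in> L.Hs" if "u \<in> L.Hs" for u
    using U(1) that unfolding unitary_def bij_betw_def by blast
  have tw: "U (T u) = T' (U u)"
    if "intertwines L.Hs U (max_oper L.Hs T) (max_oper L.Hs T')" "u \<in> L.Hs" "T u \<in> L.Hs" for T T' u
    using that unfolding intertwines_def max_oper_def by auto
  have fin: "T u \<in> L.Hs" "T u \<in> L.finite_vectors" if "L.weighted_shift T \<pi> t" "u \<in> L.finite_vectors" for T \<pi> t u
    using L.weighted_shift_finite_vectors[OF that] L.finite_vectors_H by auto
  have v: "U \<phi> \<in> L.Hs" "U \<phi> \<in> quasi_periodic 0" using U_H[OF \<phi>(1)] L.H_P by auto
  have eigen: "T \<phi> = (\<lambda>x. t 0 * \<phi> x)" if "L.diagonal T t" for T t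
    using \<phi>(2) by (intro L.weighted_shift_eqI[OF that] L.P_scale) (auto simp: L.N_scale N\<phi>)
  obtain m where m: "l2_coeff h 0 (U \<phi>) m \<noteq> 0"
  proof -
    have "nrm (L_measure h) (U \<phi>) = nrm (L_measure h) \<phi>" using U(1) \<phi>(1) unfolding unitary_def by blast
    moreover have "\<phi> \<noteq> (\<lambda>x. 0)" using N\<phi>[of 0] L.N_zero by auto
    ultimately have "U \<phi> \<noteq> (\<lambda>x. 0)" using L.nrm_zero_iff[OF \<phi>(1)] L.nrm_zero_iff[OF v(1)] by auto
    then show ?thesis using L.N_inj[OF v(2)] that by blast
  qed
  have "L'.\<alpha> m $ i = L.\<alpha> 0 $ i" for i
  proof -
    have "L'.A i (U \<phi>) = U (L.A i \<phi>)" by (rule tw[OF U(2), OF \<phi>(1) fin(1)[OF L.A_diag \<phi>(3)], symmetric])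
    also have "\<dots> = (\<lambda>x. of_real (L.\<alpha> 0 $ i) * U \<phi> x)" unfolding eigen[OF L.A_diag] by (rule U_scale)
    finally have "of_real (L'.\<alpha> m $ i) * l2_coeff h 0 (U \<phi>) m = of_real (L.\<alpha> 0 $ i) * l2_coeff h 0 (U \<phi>) m"
      using L.weighted_shiftD(3)[OF L'.A_diag[of i] v(2), of m] L.N_scale[OF v(2)] by auto
    then show ?thesis using m by simp
  qed
  then have \<alpha>: "L'.\<alpha> m = L.\<alpha> 0" by (simp add: vec_eq_iff)
  have "K' = K"
  proof -
    have "L'.C (L'.B (U \<phi>)) = L'.C (U (L.B \<phi>))" by (simp only: tw[OF U(3), OF \<phi>(1) fin(1)[OF L.B_shift \<phi>(3)]])
    also have "\<dots> = U (L.C (L.B \<phi>))"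
      by (rule tw[OF U(4), OF fin(1)[OF L.B_shift \<phi>(3)] fin(1)[OF L.C_shift fin(2)[OF L.B_shift \<phi>(3)]], symmetric])
    also have "\<dots> = (\<lambda>x. of_real (\<rho> (L.\<alpha> 0) - K) * U \<phi> x)" unfolding eigen[OF L.CB_diag] by (rule U_scale)
    finally have "of_real (\<rho> (L'.\<alpha> m) - K') * l2_coeff h 0 (U \<phi>) m = of_real (\<rho> (L.\<alpha> 0) - K) * l2_coeff h 0 (U \<phi>) m"
      using L.weighted_shiftD(3)[OF L'.CB_diag v(2), of m] L.N_scale[OF v(2)] by auto
    then have "complex_of_real (\<rho> (L'.\<alpha> m) - K') = of_real (\<rho> (L.\<alpha> 0) - K)" using m by (simp del: of_real_diff)
    then have "\<rho> (L'.\<alpha> m) - K' = \<rho> (L.\<alpha> 0) - K" by (simp only: of_real_eq_iff)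
    then show ?thesis by (simp add: \<alpha>)
  qed
  moreover have "a0' = \<gamma> (of_int (- m) * h) a0"
  proof -
    have "a0' = \<gamma> (- (h * (of_int m + 1))) (L'.\<alpha> m)"
      unfolding L'.\<alpha>_eq L.flow_add[symmetric] by (simp add: L.flow_0)
    also have "\<dots> = \<gamma> (of_int (- m) * h) a0"
      unfolding \<alpha> L.\<alpha>_eq L.flow_add[symmetric]
      by (rule arg_cong[of _ _ "\<lambda>t. \<gamma> t a0"]) (simp add: algebra_simps)
    finally show ?thesis .
  qed
  ultimately show ?thesis by blast
qed

section \<open>The theorem\<close>

theorem theorem7p1:
  fixes hbar K :: real
    and \<rho> g :: "real^'k::finite \<Rightarrow> real"
    and \<kappa> :: "nat \<Rightarrow> real^'k \<Rightarrow> real"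
    and c :: "nat \<Rightarrow> real"
    and v :: "real^'k \<Rightarrow> real^'k"
    and \<gamma> :: "real \<Rightarrow> real^'k \<Rightarrow> real^'k"
    and a0 :: "real^'k"
    and M :: "real^'k \<Rightarrow> complex"
    and X :: "'k pt set"
    and w :: "'k pt \<Rightarrow> complex"
    and \<K> :: "complex \<Rightarrow> real"
    and \<K>X :: "'k pt \<Rightarrow> real"
    and \<omega> :: "complex \<Rightarrow> complex \<Rightarrow> complex \<Rightarrow> complex"
    and dm :: "'k pt measure"
    and J :: "complex fn \<Rightarrow> 'k pt fn"
  assumes hbar: "hbar > 0"
    and alg: "algebra_data \<rho> \<kappa> v \<gamma>"
    and leaf: "leaf_data \<rho> \<kappa> v \<gamma> K c a0 g M"
    and nonper: "nonperiodic \<gamma> a0"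
    and X_def: "X = leaf_surface \<rho> \<kappa> K c"
    and w_def: "w = leaf_chart \<gamma> a0 M"
    and K_def: "\<K> = (\<lambda>z. Re (theta_kernel hbar z))"
    and KX_def: "\<K>X = (\<lambda>p. \<K> (Ln (w p)))"
    and omega_def: "\<omega> = kaehler_potential_form hbar \<K>"
    and dm_def: "dm = measure_on_leaf X w (\<lambda>z. Re (theta_density hbar z))"
    and J_def: "J = (\<lambda>u p. if p \<in> X then u (Ln (w p)) else 0)"
  shows
    "X homeomorphic (sphere (0::complex) 1 \<times> (UNIV :: real set))

     \<comment> \<open>(a)\<close>
     \<and> star_representation hbar \<rho> \<gamma> (L_rep hbar 1 \<gamma> a0 M)
     \<and> irreducible_rep (L_rep hbar 1 \<gamma> a0 M)
     \<and> (\<forall>u\<in>L_space hbar 1.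
          (\<forall>j\<in>{1..<CARD('k)}.
             poly_op (\<lambda>A. of_real (\<kappa> j A)) (A_hat hbar \<gamma> a0) u = (\<lambda>z. of_real (c j) * u z)) \<and>
          (\<lambda>z. poly_op (\<lambda>A. of_real (\<rho> A)) (A_hat hbar \<gamma> a0) u z
               - C_hat hbar \<gamma> a0 M (B_hat hbar \<gamma> a0 M u) z) = (\<lambda>z. of_real K * u z))
     \<and> (\<forall>K' c' a0' g' M'. leaf_data \<rho> \<kappa> v \<gamma> K' c' a0' g' M' \<and> nonperiodic \<gamma> a0' \<longrightarrow>
          (equivalent_reps (L_rep hbar 1 \<gamma> a0 M) (L_rep hbar 1 \<gamma> a0' M') \<longleftrightarrow>
             K' = K \<and> (\<forall>j\<in>{1..<CARD('k)}. c' j = c j) \<and>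
             (\<exists>n::int. a0' = \<gamma> (of_int n * hbar) a0)) \<and>
          (K' = K \<and> (\<forall>j\<in>{1..<CARD('k)}. c' j = c j) \<longrightarrow>
             (\<exists>s. a0' = \<gamma> s a0 \<and>
                equivalent_reps (L_rep hbar 1 \<gamma> a0 M)
                  (L_rep hbar (exp (2 * of_real pi * \<i> * of_real (s / hbar))) \<gamma> a0' M'))))

     \<comment> \<open>(b)\<close>
     \<and> global_chart X w (- {0})
     \<and> (\<forall>z. theta_kernel hbar z \<in> \<real> \<and> 0 < \<K> z)
     \<and> kaehler_on_cylinder \<omega>
     \<and> (\<forall>u\<in>L_space hbar 1. \<forall>p\<in>X. \<forall>z. exp z = w p \<longrightarrow> J u p = u z)
     \<and> unitary (L_measure hbar) (L_space hbar 1)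
          (section_measure hbar \<K>X dm) (section_space hbar X w \<K>X dm) J

     \<comment> \<open>(c)\<close>
     \<and> (\<forall>z. theta_density hbar z \<in> \<real> \<and> 0 < Re (theta_density hbar z))
     \<and> reproducing_measure hbar X w \<omega> \<K>X dm"
proof -
  interpret L: quantized_leaf \<rho> \<kappa> v \<gamma> K c a0 g M hbar
    using hbar alg leaf nonper by unfold_locales
  have pk: "\<K> = L.plane_kernel" unfolding K_def L.plane_kernel_def[abs_def] ..
  have lk: "\<K>X = L.leaf_kernel" unfolding KX_def pk w_def L.leaf_kernel_def[abs_def] ..
  have lm: "dm = L.leaf_measure" unfolding dm_def X_def w_def L.leaf_measure_def ..
  have J: "J = L.push" unfolding J_def X_def w_def L.push_def[abs_def] ..
  have equivalence:
    "\<forall>K' c' a0' g' M'. leaf_data \<rho> \<kappa> v \<gamma> K' c' a0' g' M' \<and> nonperiodic \<gamma> a0' \<longrightarrow>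
      (equivalent_reps (L_rep hbar 1 \<gamma> a0 M) (L_rep hbar 1 \<gamma> a0' M') \<longleftrightarrow>
        K' = K \<and> (\<forall>j\<in>{1..<CARD('k)}. c' j = c j) \<and> (\<exists>n::int. a0' = \<gamma> (of_int n * hbar) a0)) \<and>
      (K' = K \<and> (\<forall>j\<in>{1..<CARD('k)}. c' j = c j) \<longrightarrow>
        (\<exists>s. a0' = \<gamma> s a0 \<and> equivalent_reps (L_rep hbar 1 \<gamma> a0 M)
           (L_rep hbar (exp (2 * of_real pi * \<i> * of_real (s / hbar))) \<gamma> a0' M')))"
  proof (intro allI impI, elim conjE)
    fix K' c' a0' g' M'
    assume leaf': "leaf_data \<rho> \<kappa> v \<gamma> K' c' a0' g' M'" and nonper': "nonperiodic \<gamma> a0'"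
    interpret L': quantized_leaf \<rho> \<kappa> v \<gamma> K' c' a0' g' M' hbar
      using hbar alg leaf' nonper' by unfold_locales
    have twisted: "equivalent_reps (L_rep hbar 1 \<gamma> a0 M)
        (L_rep hbar (exp (2 * of_real pi * \<i> * of_real (s / hbar))) \<gamma> a0' M')"
      if "K' = K" "a0' = \<gamma> s a0" for s
      using twisted_equivalence[OF L.quantized_leaf_axioms, of c' s g' M'] L'.leaf_axioms
      unfolding that[symmetric] by blast
    have "equivalent_reps (L_rep hbar 1 \<gamma> a0 M) (L_rep hbar 1 \<gamma> a0' M')"
      if K: "K' = K" and n: "a0' = \<gamma> (of_int n * hbar) a0" for n
    proof -
      \<comment> \<open>a displacement by a multiple of \<open>hbar\<close> gives the trivial twist\<close>
      have "exp (2 * of_real pi * \<i> * of_real (of_int n * hbar / hbar)) = (1 :: complex)"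
        using hbar exp_integer_2pi[of "of_int n"] by (simp add: mult_ac)
      then show ?thesis using twisted[OF K n] by simp
    qed
    moreover have "K' = K \<and> (\<forall>j\<in>{1..<CARD('k)}. c' j = c j) \<and> (\<exists>n::int. a0' = \<gamma> (of_int n * hbar) a0)"
      if eqv: "equivalent_reps (L_rep hbar 1 \<gamma> a0 M) (L_rep hbar 1 \<gamma> a0' M')"
    proof -
      obtain n :: int where K: "K' = K" and n: "a0' = \<gamma> (of_int n * hbar) a0"
        using equivalence_invariants[OF L.quantized_leaf_axioms L'.quantized_leaf_axioms eqv] by blast
      have "c' j = c j" if "j \<in> {1..<CARD('k)}" for j
        using L'.\<kappa>_axis[OF that, of 0] L.\<kappa>_axis[OF that, of "of_int n * hbar"] by (simp add: L.flow_0 n)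
      then show ?thesis using K n by blast
    qed
    moreover have "\<exists>s. a0' = \<gamma> s a0 \<and> equivalent_reps (L_rep hbar 1 \<gamma> a0 M)
           (L_rep hbar (exp (2 * of_real pi * \<i> * of_real (s / hbar))) \<gamma> a0' M')"
      if K: "K' = K" and c: "\<forall>j\<in>{1..<CARD('k)}. c' j = c j"
    proof -
      \<comment> \<open>the trajectory is the projection of the leaf, so it is determined by the Casimir values\<close>
      have "leaf_surface \<rho> \<kappa> K' c' = leaf_surface \<rho> \<kappa> K c"
        using c unfolding leaf_surface_def K by auto
      then have "range (\<lambda>t. \<gamma> t a0') = range (\<lambda>t. \<gamma> t a0)"
        using leaf leaf' unfolding leaf_data_def by metis
      moreover have "a0' = \<gamma> 0 a0'" by (simp add: L.flow_0)
      ultimately obtain s where "a0' = \<gamma> s a0" by blast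
      then show ?thesis using twisted[OF K] by blast
    qed
    ultimately show "(equivalent_reps (L_rep hbar 1 \<gamma> a0 M) (L_rep hbar 1 \<gamma> a0' M') \<longleftrightarrow>
        K' = K \<and> (\<forall>j\<in>{1..<CARD('k)}. c' j = c j) \<and> (\<exists>n::int. a0' = \<gamma> (of_int n * hbar) a0)) \<and>
      (K' = K \<and> (\<forall>j\<in>{1..<CARD('k)}. c' j = c j) \<longrightarrow>
        (\<exists>s. a0' = \<gamma> s a0 \<and> equivalent_reps (L_rep hbar 1 \<gamma> a0 M)
           (L_rep hbar (exp (2 * of_real pi * \<i> * of_real (s / hbar))) \<gamma> a0' M')))" by blast
  qed
  have kernel: "\<forall>z. theta_kernel hbar z \<in> \<real> \<and> 0 < \<K> z"
    using theta_moment_pos[OF hbar] by (simp add: K_def theta_kernel_eq[OF hbar])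
  have density: "\<forall>z. theta_density hbar z \<in> \<real> \<and> 0 < Re (theta_density hbar z)"
    using theta_moment_pos[OF hbar] gauss_weight_pos[OF hbar] hbar
    by (simp add: theta_density_eq[OF hbar] del: of_real_mult)
  have J_lift: "\<forall>u\<in>L_space hbar 1. \<forall>p\<in>X. \<forall>z. exp z = w p \<longrightarrow> J u p = u z"
  proof (intro ballI allI impI)
    fix u p z assume u: "u \<in> L_space hbar 1" and p: "p \<in> X" and z: "exp z = w p"
    have "exp (Ln (w p)) = exp z" unfolding z[symmetric] by simp
    then have "u (Ln (w p)) = u z" by (rule L.periodic_exp[OF u])
    then show "J u p = u z" using p by (simp add: J_def)
  qed
  have section_unitary: "unitary (L_measure hbar) (L_space hbar 1)
          (section_measure hbar \<K>X dm) (section_space hbar X w \<K>X dm) J"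
    using L.push_unitary unfolding J lk lm X_def w_def L.section_mu_def L.sections_def .
  have reproducing: "reproducing_measure hbar X w \<omega> \<K>X dm"
    using L.reproducing unfolding omega_def pk lk lm X_def w_def .
  have form: "kaehler_on_cylinder \<omega>"
    unfolding omega_def K_def by (rule kaehler_theta[OF hbar])
  have casimir: "\<forall>u\<in>L_space hbar 1.
          (\<forall>j\<in>{1..<CARD('k)}.
             poly_op (\<lambda>A. of_real (\<kappa> j A)) (A_hat hbar \<gamma> a0) u = (\<lambda>z. of_real (c j) * u z)) \<and>
          (\<lambda>z. poly_op (\<lambda>A. of_real (\<rho> A)) (A_hat hbar \<gamma> a0) u z
               - C_hat hbar \<gamma> a0 M (B_hat hbar \<gamma> a0 M u) z) = (\<lambda>z. of_real K * u z)"
    using L.casimir by blast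
  have cylinder: "X homeomorphic (sphere (0::complex) 1 \<times> (UNIV :: real set))"
    unfolding X_def by (rule L.X_cylinder)
  have chart: "global_chart X w (- {0})"
    unfolding X_def w_def by (rule L.w_global_chart)
  show ?thesis
    by (intro conjI) (fact cylinder L.star_representation L.irreducible casimir equivalence chart kernel form
      J_lift section_unitary density reproducing)+
qed

end
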